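(* Let $p\ge5$ be a prime and let $G$ be a group of order $p^5$ in the isoclinism family $\Phi_3$. (1) If $G$ is not isomorphic to any of $\Phi_3(311)b_r$ ($r=1,\nu$), $\Phi_3(221)a$, $\Phi_3(2111)e$, let $m$ and $m'$ denote the exponents of $C_G(G')$ and $C_G(G')/G'$, respectively. Then $$\mathbb{Q}G\cong\mathbb{Q}(G/G')\ \oplus\bigoplus_{d\mid m,\ d\nmid m'}\frac{a_d}{p}M_p(\mathbb{Q}(\zeta_d))\ \oplus\bigoplus_{d\mid m,\ d\mid m'}\frac{a_d-a_d'}{p}M_p(\mathbb{Q}(\zeta_d)),$$ where $a_d$ and $a_d'$ are the number of cyclic subgroups of order $d$ of $C_G(G')$ and of $C_G(G')/G'$, respectively. (2) If $G=\Phi_3(311)b_r$ with $r=1$ or $\nu$, then $$\mathbb{Q}G\cong\mathbb{Q}\oplus(p+1)\mathbb{Q}(\zeta_p)\oplus p\,\mathbb{Q}(\zeta_{p^2})\oplus p\,M_p(\mathbb{Q}(\zeta_p))\oplus M_p(\mathbb{Q}(\zeta_{p^3})).$$ (3) If $G\in\{\Phi_3(221)a,\Phi_3(2111)e\}$, then $$\mathbb{Q}G\cong\mathbb{Q}\oplus(p+1)\mathbb{Q}(\zeta_p)\oplus p\,\mathbb{Q}(\zeta_{p^2})\oplus 2p\,M_p(\mathbb{Q}(\zeta_p))\oplus(p-1)M_p(\mathbb{Q}(\zeta_{p^2})).$$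
   Context: $\zeta_d$ is a primitive $d$-th root of unity; $M_n(D)$ is the ring of $n\times n$ matrices over $D$; $aR$ denotes the direct sum of $a$ copies of the algebra $R$; $C_G(G')$ is the centralizer of $G'$ in $G$ (an abelian subgroup of index $p$ here); $d$ ranges over positive divisors. Two groups $G,H$ are isoclinic if there are isomorphisms $G/Z(G)\to H/Z(H)$ and $G'\to H'$ compatible with the commutator maps. $\Phi_3$ (R. James) is the isoclinism family of the order-$p^4$ group $\Phi_3(1^4)=\langle\alpha,\alpha_1,\alpha_2,\alpha_3:[\alpha_1,\alpha]=\alpha_2,[\alpha_2,\alpha]=\alpha_3,\ \alpha^p=\alpha_1^p=\alpha_2^p=\alpha_3^p=1\rangle$ (here $p\ge5$). The special groups of order $p^5$ in it are $\Phi_3(311)b_r=\langle\alpha,\alpha_1,\alpha_2,\alpha_3:[\alpha_1,\alpha]=\alpha_2,[\alpha_2,\alpha]^r=\alpha_1^{p^2}=\alpha_3,\ \alpha^p=\alpha_2^p=\alpha_3^p=1\rangle$ for $r=1,\nu$, where $\nu$ is the smallest positive integer that is a quadratic non-residue mod $p$; $\Phi_3(221)a=\langle\alpha,\alpha_1,\alpha_2,\alpha_3:[\alpha_1,\alpha]=\alpha_2,[\alpha_2,\alpha]=\alpha^p=\alpha_3,\ \alpha_1^{p^2}=\alpha_2^p=\alpha_3^p=1\rangle$; $\Phi_3(2111)e=\langle\alpha,\alpha_1,\alpha_2,\alpha_3:[\alpha_1,\alpha]=\alpha_2,[\alpha_2,\alpha]=\alpha_3,\ \alpha^p=\alpha_1^{p^2}=\alpha_2^p=\alpha_3^p=1\rangle$.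 Presentations are understood among finite $p$-groups and define groups of the stated order; $[x,y]=x^{-1}y^{-1}xy$; relations $[x,y]=1$ between generators whose commutator is not listed are omitted. *)

theory Defs
  imports
    Complex_Main
    "HOL-Library.FuncSet"
    "Jordan_Normal_Form.Matrix"
    "HOL-Algebra.Elementary_Groups"
    "HOL-Algebra.Generated_Fields"
    "HOL-Algebra.QuotRing"
    "HOL-Number_Theory.Residues"
begin

(* otherwise shadows the record field of HOL-Algebra *)
hide_const (open) Multiset.mult

section \<open>Groups\<close>

definition centralizer :: "('a, 'b) monoid_scheme \<Rightarrow> 'a set \<Rightarrow> 'a set" where
  "centralizer G S = {x \<in> carrier G. \<forall>y\<in>S. x \<otimes>\<^bsub>G\<^esub> y = y \<otimes>\<^bsub>G\<^esub> x}"

definition center :: "('a, 'b) monoid_scheme \<Rightarrow> 'a set" where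
  "center G = centralizer G (carrier G)"

abbreviation commutator_subgroup :: "('a, 'b) monoid_scheme \<Rightarrow> 'a set" where
  "commutator_subgroup G \<equiv> derived G (carrier G)"

definition gcomm :: "('a, 'b) monoid_scheme \<Rightarrow> 'a \<Rightarrow> 'a \<Rightarrow> 'a" where
  "gcomm G x y = inv\<^bsub>G\<^esub> x \<otimes>\<^bsub>G\<^esub> inv\<^bsub>G\<^esub> y \<otimes>\<^bsub>G\<^esub> x \<otimes>\<^bsub>G\<^esub> y"

definition group_exponent :: "('a, 'b) monoid_scheme \<Rightarrow> nat" where
  "group_exponent G = (LEAST n. 0 < n \<and> (\<forall>x\<in>carrier G. x [^]\<^bsub>G\<^esub> n = \<one>\<^bsub>G\<^esub>))"

definition num_cyclic_subgroups :: "('a, 'b) monoid_scheme \<Rightarrow> nat \<Rightarrow> nat" where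
  "num_cyclic_subgroups G d =
     card {H. subgroup H G \<and> cyclic_group (G\<lparr>carrier := H\<rparr>) \<and> card H = d}"

definition isoclinic :: "('a, 'b) monoid_scheme \<Rightarrow> ('c, 'd) monoid_scheme \<Rightarrow> bool" where
  "isoclinic G H \<longleftrightarrow>
     (\<exists>\<phi> \<in> iso (G Mod center G) (H Mod center H).
      \<exists>\<psi> \<in> iso (G\<lparr>carrier := commutator_subgroup G\<rparr>) (H\<lparr>carrier := commutator_subgroup H\<rparr>).
        \<forall>x\<in>carrier G. \<forall>y\<in>carrier G. \<forall>x'\<in>carrier H. \<forall>y'\<in>carrier H.
          \<phi> (center G #>\<^bsub>G\<^esub> x) = center H #>\<^bsub>H\<^esub> x' \<longrightarrow>
          \<phi> (center G #>\<^bsub>G\<^esub> y) = center H #>\<^bsub>H\<^esub> y' \<longrightarrow>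
          \<psi> (gcomm G x y) = gcomm H x' y')"


section \<open>Presentations among finite \<open>p\<close>-groups\<close>

datatype 'v gexp =
    Gen 'v
  | One
  | Mul "'v gexp" "'v gexp"
  | Inv "'v gexp"
  | Pow "'v gexp" nat

definition Comm :: "'v gexp \<Rightarrow> 'v gexp \<Rightarrow> 'v gexp" where
  "Comm x y = Mul (Mul (Mul (Inv x) (Inv y)) x) y"

primrec geval :: "('a, 'b) monoid_scheme \<Rightarrow> ('v \<Rightarrow> 'a) \<Rightarrow> 'v gexp \<Rightarrow> 'a" where
  "geval G x (Gen v) = x v"
| "geval G x One = \<one>\<^bsub>G\<^esub>"
| "geval G x (Mul s t) = geval G x s \<otimes>\<^bsub>G\<^esub> geval G x t"
| "geval G x (Inv s) = inv\<^bsub>G\<^esub> (geval G x s)"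
| "geval G x (Pow s n) = geval G x s [^]\<^bsub>G\<^esub> n"

text \<open>A set of pairs \<open>(s, t)\<close> stands for the relations \<open>s = t\<close>.\<close>

definition satisfies ::
    "('a, 'b) monoid_scheme \<Rightarrow> ('v \<Rightarrow> 'a) \<Rightarrow> ('v gexp \<times> 'v gexp) set \<Rightarrow> bool" where
  "satisfies G x R \<longleftrightarrow>
     range x \<subseteq> carrier G \<and> (\<forall>(s, t) \<in> R. geval G x s = geval G x t)"

definition finite_p_group :: "nat \<Rightarrow> ('a, 'b) monoid_scheme \<Rightarrow> bool" where
  "finite_p_group p G \<longleftrightarrow> group G \<and> finite (carrier G) \<and> (\<exists>n. order G = p ^ n)"

text \<open>
  \<open>G\<close> is the finite \<open>p\<close>-group with generators \<open>x\<close> (all values of the index type \<open>'v\<close>) and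
  defining relations \<open>R\<close>: the universal property of a presentation, with the test groups ranging
  over finite \<open>p\<close>-groups. Every finite group has an isomorphic copy with carrier in \<open>nat\<close>, so
  restricting the type of the test groups loses nothing. The notion is invariant under
  isomorphism and determines \<open>G\<close> up to isomorphism.
\<close>

definition presented_among_p_groups ::
    "nat \<Rightarrow> ('v gexp \<times> 'v gexp) set \<Rightarrow> ('a, 'b) monoid_scheme \<Rightarrow> ('v \<Rightarrow> 'a) \<Rightarrow> bool" where
  "presented_among_p_groups p R G x \<longleftrightarrow>
     finite_p_group p G \<and> satisfies G x R \<and> generate G (range x) = carrier G \<and>
     (\<forall>(H :: nat monoid) y. finite_p_group p H \<longrightarrow> satisfies H y R \<longrightarrow>
        (\<exists>h \<in> hom G H. \<forall>v. h (x v) = y v))"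

definition has_presentation ::
    "nat \<Rightarrow> ('v gexp \<times> 'v gexp) set \<Rightarrow> ('a, 'b) monoid_scheme \<Rightarrow> bool" where
  "has_presentation p R G \<longleftrightarrow> (\<exists>x. presented_among_p_groups p R G x)"


section \<open>The family \<open>\<Phi>\<^sub>3\<close>\<close>

datatype gen4 = Al | Al1 | Al2 | Al3

text \<open>
  \<open>[\<alpha>\<^sub>1, \<alpha>] = \<alpha>\<^sub>2\<close> and the commutators that the presentations leave out because they are trivial;
  only \<open>[\<alpha>\<^sub>1, \<alpha>]\<close> and \<open>[\<alpha>\<^sub>2, \<alpha>]\<close> are ever listed.
\<close>

definition Phi3_common :: "(gen4 gexp \<times> gen4 gexp) set" where
  "Phi3_common =
    {(Comm (Gen Al1) (Gen Al), Gen Al2),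
     (Comm (Gen Al3) (Gen Al), One),
     (Comm (Gen Al1) (Gen Al2), One),
     (Comm (Gen Al1) (Gen Al3), One),
     (Comm (Gen Al2) (Gen Al3), One)}"

definition Phi3_1111_rels :: "nat \<Rightarrow> (gen4 gexp \<times> gen4 gexp) set" where
  "Phi3_1111_rels p = Phi3_common \<union>
    {(Comm (Gen Al2) (Gen Al), Gen Al3),
     (Pow (Gen Al) p, One),
     (Pow (Gen Al1) p, One),
     (Pow (Gen Al2) p, One),
     (Pow (Gen Al3) p, One)}"

definition Phi3_311b_rels :: "nat \<Rightarrow> nat \<Rightarrow> (gen4 gexp \<times> gen4 gexp) set" where
  "Phi3_311b_rels p r = Phi3_common \<union>
    {(Pow (Comm (Gen Al2) (Gen Al)) r, Gen Al3),
     (Pow (Gen Al1) (p\<^sup>2), Gen Al3),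
     (Pow (Gen Al) p, One),
     (Pow (Gen Al2) p, One),
     (Pow (Gen Al3) p, One)}"

definition Phi3_221a_rels :: "nat \<Rightarrow> (gen4 gexp \<times> gen4 gexp) set" where
  "Phi3_221a_rels p = Phi3_common \<union>
    {(Comm (Gen Al2) (Gen Al), Gen Al3),
     (Pow (Gen Al) p, Gen Al3),
     (Pow (Gen Al1) (p\<^sup>2), One),
     (Pow (Gen Al2) p, One),
     (Pow (Gen Al3) p, One)}"

definition Phi3_2111e_rels :: "nat \<Rightarrow> (gen4 gexp \<times> gen4 gexp) set" where
  "Phi3_2111e_rels p = Phi3_common \<union>
    {(Comm (Gen Al2) (Gen Al), Gen Al3),
     (Pow (Gen Al) p, One),
     (Pow (Gen Al1) (p\<^sup>2), One),
     (Pow (Gen Al2) p, One),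
     (Pow (Gen Al3) p, One)}"

definition least_nonresidue :: "nat \<Rightarrow> nat" where
  "least_nonresidue p = (LEAST n. 0 < n \<and> \<not> QuadRes (int p) (int n))"

definition is_Phi3_311b :: "nat \<Rightarrow> nat \<Rightarrow> ('a, 'b) monoid_scheme \<Rightarrow> bool" where
  "is_Phi3_311b p r G \<longleftrightarrow> order G = p ^ 5 \<and> has_presentation p (Phi3_311b_rels p r) G"

definition is_Phi3_221a :: "nat \<Rightarrow> ('a, 'b) monoid_scheme \<Rightarrow> bool" where
  "is_Phi3_221a p G \<longleftrightarrow> order G = p ^ 5 \<and> has_presentation p (Phi3_221a_rels p) G"

definition is_Phi3_2111e :: "nat \<Rightarrow> ('a, 'b) monoid_scheme \<Rightarrow> bool" where
  "is_Phi3_2111e p G \<longleftrightarrow> order G = p ^ 5 \<and> has_presentation p (Phi3_2111e_rels p) G"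

definition in_Phi3 :: "nat \<Rightarrow> ('a, 'b) monoid_scheme \<Rightarrow> bool" where
  "in_Phi3 p G \<longleftrightarrow>
     (\<exists>H :: nat monoid. order H = p ^ 4 \<and> has_presentation p (Phi3_1111_rels p) H \<and> isoclinic G H)"


section \<open>Rational algebras\<close>

definition alg_iso :: "(rat, 'a) module \<Rightarrow> (rat, 'b) module \<Rightarrow> bool" (infix "\<cong>\<^sub>\<rat>" 50) where
  "A \<cong>\<^sub>\<rat> B \<longleftrightarrow>
     (\<exists>h \<in> ring_iso A B. \<forall>q. \<forall>x\<in>carrier A. h (q \<odot>\<^bsub>A\<^esub> x) = q \<odot>\<^bsub>B\<^esub> h x)"

definition group_algebra :: "('a, 'b) monoid_scheme \<Rightarrow> (rat, 'a \<Rightarrow> rat) module" where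
  "group_algebra G =
    \<lparr>carrier = {f. finite {x. f x \<noteq> 0} \<and> {x. f x \<noteq> 0} \<subseteq> carrier G},
     mult = (\<lambda>f g z. if z \<in> carrier G
               then (\<Sum>x | f x \<noteq> 0. f x * g (inv\<^bsub>G\<^esub> x \<otimes>\<^bsub>G\<^esub> z)) else 0),
     one = (\<lambda>z. if z = \<one>\<^bsub>G\<^esub> then 1 else 0),
     zero = (\<lambda>z. 0),
     add = (\<lambda>f g z. f z + g z),
     smult = (\<lambda>q f z. q * f z)\<rparr>"

definition alg_prod ::
    "(rat, 'a) module \<Rightarrow> (rat, 'b) module \<Rightarrow> (rat, 'a \<times> 'b) module" (infixr "\<oplus>\<^sub>\<rat>" 65) where
  "A \<oplus>\<^sub>\<rat> B =
    \<lparr>carrier = carrier A \<times> carrier B,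
     mult = (\<lambda>(a, b) (a', b'). (a \<otimes>\<^bsub>A\<^esub> a', b \<otimes>\<^bsub>B\<^esub> b')),
     one = (\<one>\<^bsub>A\<^esub>, \<one>\<^bsub>B\<^esub>),
     zero = (\<zero>\<^bsub>A\<^esub>, \<zero>\<^bsub>B\<^esub>),
     add = (\<lambda>(a, b) (a', b'). (a \<oplus>\<^bsub>A\<^esub> a', b \<oplus>\<^bsub>B\<^esub> b')),
     smult = (\<lambda>q (a, b). (q \<odot>\<^bsub>A\<^esub> a, q \<odot>\<^bsub>B\<^esub> b))\<rparr>"

text \<open>
  Direct sum over a finite index set; for the empty index set it is the zero algebra.
\<close>

definition alg_sum :: "'i set \<Rightarrow> ('i \<Rightarrow> (rat, 'a) module) \<Rightarrow> (rat, 'i \<Rightarrow> 'a) module" where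
  "alg_sum I A =
    \<lparr>carrier = (\<Pi>\<^sub>E i\<in>I. carrier (A i)),
     mult = (\<lambda>f g. \<lambda>i\<in>I. f i \<otimes>\<^bsub>A i\<^esub> g i),
     one = (\<lambda>i\<in>I. \<one>\<^bsub>A i\<^esub>),
     zero = (\<lambda>i\<in>I. \<zero>\<^bsub>A i\<^esub>),
     add = (\<lambda>f g. \<lambda>i\<in>I. f i \<oplus>\<^bsub>A i\<^esub> g i),
     smult = (\<lambda>q f. \<lambda>i\<in>I. q \<odot>\<^bsub>A i\<^esub> f i)\<rparr>"

definition copies :: "nat \<Rightarrow> (rat, 'a) module \<Rightarrow> (rat, nat \<Rightarrow> 'a) module" where
  "copies n A = alg_sum {..<n} (\<lambda>_. A)"

definition field_alg :: "'a::field_char_0 set \<Rightarrow> (rat, 'a) module" where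
  "field_alg K =
    \<lparr>carrier = K, mult = (*), one = 1, zero = 0, add = (+), smult = (\<lambda>q x. of_rat q * x)\<rparr>"

definition mat_alg :: "nat \<Rightarrow> 'a::field_char_0 set \<Rightarrow> (rat, 'a mat) module" where
  "mat_alg n K =
    \<lparr>carrier = {M \<in> carrier_mat n n. elements_mat M \<subseteq> K},
     mult = (*), one = 1\<^sub>m n, zero = 0\<^sub>m n n, add = (+),
     smult = (\<lambda>q M. of_rat q \<cdot>\<^sub>m M)\<rparr>"

abbreviation rat_alg :: "(rat, rat) module" where
  "rat_alg \<equiv> field_alg UNIV"

definition zeta :: "nat \<Rightarrow> complex" where
  "zeta d = cis (2 * pi / real d)"

text \<open>\<open>\<rat>(\<zeta>\<^sub>d)\<close>, as the subfield of the complex numbers generated by \<open>\<zeta>\<^sub>d\<close>.\<close>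

definition cyclotomic_field :: "nat \<Rightarrow> complex set" where
  "cyclotomic_field d = generate_field (field_alg UNIV) {zeta d}"

end

theory Submission
  imports Defs "HOL-Computational_Algebra.Polynomial_Factorial" "HOL-Computational_Algebra.Field_as_Ring" "HOL-Number_Theory.Euler_Criterion"
begin

text \<open>
  Let \<open>A\<close> be an abelian normal subgroup of \<open>G\<close> of index \<open>n\<close> and let \<open>N \<subseteq> A\<close> be normal in \<open>G\<close>. Suppose that
  no character \<open>l\<close> of \<open>A\<close> that is nontrivial on \<open>N\<close> is Galois conjugate to \<open>l\<^sup>g\<close> for some \<open>g \<notin> A\<close>. Then
  the monomial matrices induced from \<open>l\<close> map \<open>\<rat>G\<close> onto \<open>M\<^sub>n(\<rat>(\<zeta>\<^sub>d))\<close>, where \<open>d\<close> is the order of \<open>l\<close>, and by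
  Fourier inversion these maps, one for each orbit of such \<open>l\<close> under conjugation and Galois action,
  together with \<open>\<rat>G \<rightarrow> \<rat>(G/N)\<close> are an isomorphism. The number of orbits of order \<open>d\<close> is found by
  counting the elements of order \<open>d\<close> in \<open>A\<close> and \<open>A/N\<close>.

  A group in \<open>\<Phi>\<^sub>3\<close> is generated by \<open>a\<close>, \<open>b\<close>, \<open>c = [b, a]\<close>, \<open>e = [c, a]\<close> and its centre. The subgroup
  \<open>A = C\<^sub>G(G')\<close> generated by \<open>b\<close>, \<open>c\<close> and the centre satisfies the condition with \<open>N = G'\<close> if
  \<open>b\<^sup>p \<in> \<langle>e\<rangle>\<close>. Otherwise it satisfies it only with \<open>N = \<langle>e\<rangle>\<close>, which leaves \<open>G/\<langle>e\<rangle>\<close>, of order \<open>p\<^sup>4\<close>, to be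
  treated in the same way. In that case a change of the generators \<open>a\<close> and \<open>b\<close> brings the relations into
  one of the four exceptional forms, and the normal form \<open>a\<^sup>i b\<^sup>j c\<^sup>k e\<^sup>l\<close> bounds the order of every finite
  \<open>p\<close>-group with these relations by \<open>p\<^sup>5\<close>.
\<close>

section \<open>Cyclotomic fields of prime power order\<close>

text \<open>The condition on characters separates the two cases as follows. Let \<open>l\<close> be
  trivial on \<open>e\<close> but not on \<open>c\<close>. Conjugation by \<open>a\<close>
  multiplies \<open>l b\<close> by \<open>l c\<close>, a nontrivial \<open>p\<close>-th root of
  unity. If b^p lies in <e>, then \<open>l b\<close> is a \<open>p\<close>-th root of unity too, so
  a Galois automorphism fixing \<open>l c\<close> also fixes \<open>l b\<close> and cannot imitate
  the conjugation. Otherwise \<open>l b\<close> may have order p^2; then \<open>l b * l c\<close> is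
  (l b)^(1+pj) for some j, conjugation by \<open>a\<close> is a Galois conjugation, and the field of
  the induced character shrinks from Q(zeta_(p^2)) to Q(zeta_p). For these characters another
  abelian subgroup is used: the centralizer of \<open>a\<close> in the quotient by <e>, which has
  exponent p. No Galois group and no Wedderburn theory enters. An automorphism is an exponent k
  prime to p, and the arithmetic input is that a rational polynomial vanishing at zeta_(p^n) also
  vanishes at zeta_(p^n)^k. Because the pairs of a coset and an exponent permute the characters
  freely, rational group algebra elements that act as matrix units can be written down, so Schur
  indices never have to be discussed.\<close>

abbreviation of_int_poly :: "int poly \<Rightarrow> 'a::comm_ring_1 poly" where
  "of_int_poly \<equiv> map_poly of_int"

text \<open>If the constant coefficient of \<open>F\<close> is not divisible by \<open>p\<close>,
  the lowest coefficient of \<open>Q\<close> not divisible by \<open>p\<close>, at index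
  \<open>s\<close>, forces the coefficient of \<open>F * Q\<close> at \<open>s\<close> not to be
  divisible either. Below its degree \<open>P\<close> has only coefficients divisible by
  \<open>p\<close>, so \<open>s\<close> is at least the degree of \<open>P\<close> and nothing is
  left for \<open>F\<close>.\<close>

lemma eisenstein_aux:
  fixes F Q P :: "int poly"
  assumes p: "prime p" and lc: "\<not> p dvd lead_coeff P"
    and low: "\<And>i. i < degree P \<Longrightarrow> p dvd coeff P i"
    and FQ: "F * Q = smult N P" and N: "\<not> p dvd N" and F0: "\<not> p dvd coeff F 0"
  shows "degree F = 0"
proof -
  have "P \<noteq> 0" "N \<noteq> 0" using lc N by auto
  then have "F * Q \<noteq> 0" using FQ by simp
  then have deg: "degree F + degree Q = degree P"
    using degree_mult_eq[of F Q] FQ \<open>N \<noteq> 0\<close> by (metis degree_smult_eq mult_zero_left mult_zero_right)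
  have "\<exists>s. \<not> p dvd coeff Q s"
  proof (rule ccontr)
    assume "\<not> ?thesis"
    then have "p dvd coeff (F * Q) (degree P)"
      by (auto simp: coeff_mult intro!: dvd_sum)
    then show False using FQ lc N p by (auto simp: prime_dvd_mult_iff)
  qed
  define s where "s = (LEAST s. \<not> p dvd coeff Q s)"
  have s: "\<not> p dvd coeff Q s" "\<And>i. i < s \<Longrightarrow> p dvd coeff Q i"
    using LeastI_ex[OF \<open>\<exists>s. _\<close>] not_less_Least unfolding s_def by blast+
  have "coeff (F * Q) s = coeff F 0 * coeff Q s + (\<Sum>i\<in>{1..s}. coeff F i * coeff Q (s - i))"
    unfolding coeff_mult by (simp add: sum.atLeast_Suc_atMost atMost_atLeast0)
  moreover have "p dvd (\<Sum>i\<in>{1..s}. coeff F i * coeff Q (s - i))"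
    by (intro dvd_sum dvd_mult s(2)) auto
  moreover have "\<not> p dvd coeff F 0 * coeff Q s"
    using F0 s(1) p by (auto simp: prime_dvd_mult_iff)
  ultimately have "\<not> p dvd coeff (F * Q) s"
    by (simp add: dvd_add_left_iff)
  then have "\<not> p dvd coeff P s" using FQ by auto
  then have "degree P \<le> s" using low not_le by blast
  moreover have "s \<le> degree Q" using s(1) by (metis dvd_0_right le_degree)
  ultimately show ?thesis using deg by simp
qed

text \<open>\<open>N\<close> is the integer that remains after clearing denominators in a rational
  factorisation. As \<open>[:p:]\<close> is prime, a factor \<open>p\<close> of \<open>N\<close>
  divides \<open>F\<close> or \<open>Q\<close> and can be cancelled, which is the induction on the
  size of \<open>N\<close>. Once \<open>p\<close> does not divide \<open>N\<close>, the constant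
  coefficients of \<open>F\<close> and \<open>Q\<close> cannot both be divisible by
  \<open>p\<close>.\<close>

lemma eisenstein_int:
  fixes F Q P :: "int poly"
  assumes p: "prime p" and lc: "\<not> p dvd lead_coeff P"
    and low: "\<And>i. i < degree P \<Longrightarrow> p dvd coeff P i"
    and sq: "\<not> p\<^sup>2 dvd coeff P 0"
    and "F * Q = smult N P" and "N \<noteq> 0"
  shows "degree F = 0 \<or> degree Q = 0"
  using assms(5,6)
proof (induction "nat \<bar>N\<bar>" arbitrary: N F Q rule: less_induct)
  case less
  show ?case
  proof (cases "p dvd N")
    case True
    then obtain M where M: "N = p * M" by (auto elim: dvdE)
    have "[:p:] dvd F * Q" using less.prems M by (auto simp: const_poly_dvd_iff)
    moreover have "prime_elem [:p:]" using p by (intro lift_prime_elem_poly) auto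
    ultimately have "[:p:] dvd F \<or> [:p:] dvd Q" using prime_elem_dvd_mult_iff by blast
    then show ?thesis
    proof
      assume "[:p:] dvd F"
      then obtain F' where F': "F = smult p F'" by (auto elim: dvdE)
      have "p \<noteq> 0" using p by auto
      have "smult p (F' * Q) = smult p (smult M P)" using less.prems F' M by simp
      then have "F' * Q = smult M P" using \<open>p \<noteq> 0\<close> by (metis smult_cancel)
      moreover have "nat \<bar>M\<bar> < nat \<bar>N\<bar>" using M less.prems p prime_gt_1_int
        by (auto simp: abs_mult)
      ultimately show ?thesis using less.hyps[of M F' Q] less.prems M F' \<open>p \<noteq> 0\<close> by auto
    next
      assume "[:p:] dvd Q"
      then obtain Q' where Q': "Q = smult p Q'" by (auto elim: dvdE)
      have "p \<noteq> 0" using p by auto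
      have "smult p (F * Q') = smult p (smult M P)" using less.prems Q' M by simp
      then have "F * Q' = smult M P" using \<open>p \<noteq> 0\<close> by (metis smult_cancel)
      moreover have "nat \<bar>M\<bar> < nat \<bar>N\<bar>" using M less.prems p prime_gt_1_int
        by (auto simp: abs_mult)
      ultimately show ?thesis using less.hyps[of M F Q'] less.prems M Q' \<open>p \<noteq> 0\<close> by auto
    qed
  next
    case False
    have "coeff F 0 * coeff Q 0 = N * coeff P 0"
      using less.prems(1) by (metis coeff_mult_0 coeff_smult)
    then have "\<not> p\<^sup>2 dvd coeff F 0 * coeff Q 0"
      using False sq p
      by (metis coprime_commute coprime_dvd_mult_right_iff coprime_power_left_iff prime_imp_coprime)
    then have "\<not> p dvd coeff F 0 \<or> \<not> p dvd coeff Q 0"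
      by (auto simp: power2_eq_square intro: mult_dvd_mono)
    then show ?thesis
      using eisenstein_aux[OF p lc low less.prems(1) False]
        eisenstein_aux[OF p lc low _ False, of Q F] less.prems(1) by (auto simp: mult.commute)
  qed
qed

lemma rat_poly_clear_denominators:
  "\<exists>(m::int) F. m \<noteq> 0 \<and> smult (of_int m) (g :: rat poly) = of_int_poly F"
proof (induction g)
  case 0
  have "smult (of_int 1) (0 :: rat poly) = of_int_poly 0" by simp
  then show ?case using zero_neq_one by metis
next
  case (pCons a g)
  then obtain m F where m: "m \<noteq> 0" "smult (of_int m) g = of_int_poly F" by blast
  obtain n d where a: "a = of_int n / of_int d" "d \<noteq> 0"
    by (metis Fract_of_int_quotient Rat_cases less_irrefl)
  have "smult (of_int (m * d)) (pCons a g) = of_int_poly (pCons (m * n) (smult d F))"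
  proof -
    have "smult (of_int (m * d)) g = smult (of_int d) (smult (of_int m) g)"
      by (simp add: mult.commute)
    also have "\<dots> = of_int_poly (smult d F)"
      unfolding m(2) by (intro poly_eqI) (simp add: coeff_map_poly)
    finally show ?thesis using a by (simp add: map_poly_pCons)
  qed
  then show ?case using m(1) a(2) by (intro exI[of _ "m * d"]) auto
qed

lemma of_int_poly_mult_rat:
  "(of_int_poly (F * G) :: rat poly) = of_int_poly F * of_int_poly G"
  by (intro poly_eqI) (simp add: coeff_map_poly coeff_mult)

lemma eisenstein_rat:
  fixes g h :: "rat poly" and P :: "int poly"
  assumes p: "prime p" "\<not> p dvd lead_coeff P"
    "\<And>i. i < degree P \<Longrightarrow> p dvd coeff P i" "\<not> p\<^sup>2 dvd coeff P 0"
    and gh: "g * h = of_int_poly P"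
  shows "degree g = 0 \<or> degree h = 0"
proof -
  obtain m F n H where m: "m \<noteq> 0" "smult (of_int m) g = of_int_poly F"
    and n: "n \<noteq> 0" "smult (of_int n) h = of_int_poly H"
    using rat_poly_clear_denominators by meson
  have "of_int_poly (F * H) = smult (of_int (m * n)) (g * h)"
    unfolding of_int_poly_mult_rat m(2)[symmetric] n(2)[symmetric] by (simp add: mult.commute)
  also have "\<dots> = of_int_poly (smult (m * n) P)"
    unfolding gh by (intro poly_eqI) (simp add: coeff_map_poly)
  finally have "F * H = smult (m * n) P"
    by (metis (no_types, lifting) coeff_map_poly of_int_eq_iff of_int_0 poly_eqI)
  then have "degree F = 0 \<or> degree H = 0"
    using eisenstein_int[OF p, of F H "m * n"] m n by auto
  moreover have "degree F = degree g" "degree H = degree h"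
    using arg_cong[OF m(2), of degree] arg_cong[OF n(2), of degree] m(1) n(1)
    by (simp_all add: degree_map_poly)
  ultimately show ?thesis by simp
qed

text \<open>Elements of a cyclotomic field are handled as values of rational polynomials at
  \<open>zeta d\<close>. Applying a Galois automorphism then means evaluating the same polynomial at
  another power of \<open>zeta d\<close>.\<close>

definition rpoly :: "rat poly \<Rightarrow> complex \<Rightarrow> complex" where
  "rpoly f z = poly (map_poly of_rat f) z"

lemma rpoly_0 [simp]: "rpoly 0 z = 0"
  and rpoly_1 [simp]: "rpoly 1 z = 1"
  and rpoly_pCons [simp]: "rpoly (pCons a f) z = of_rat a + z * rpoly f z"
  by (simp_all add: rpoly_def map_poly_pCons map_poly_1')

lemma rpoly_add [simp]: "rpoly (f + g) z = rpoly f z + rpoly g z"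
  by (induction f g rule: poly_induct2) (simp_all add: of_rat_add algebra_simps)

lemma rpoly_smult [simp]: "rpoly (smult a f) z = of_rat a * rpoly f z"
  by (induction f) (simp_all add: of_rat_mult algebra_simps)

lemma rpoly_mult [simp]: "rpoly (f * g) z = rpoly f z * rpoly g z"
  by (induction f) (simp_all add: algebra_simps)

lemma rpoly_monom [simp]: "rpoly (monom a n) z = of_rat a * z ^ n"
  by (induction n) (simp_all add: monom_0 monom_Suc)

lemma rpoly_sum [simp]: "rpoly (\<Sum>x\<in>A. f x) z = (\<Sum>x\<in>A. rpoly (f x) z)"
  by (induction A rule: infinite_finite_induct) simp_all

lemma rpoly_bezout:
  fixes f g :: "rat poly"
  assumes "degree (gcd f g) = 0" "f \<noteq> 0 \<or> g \<noteq> 0"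
  obtains u v where "u * f + v * g = 1"
proof -
  have "gcd f g \<noteq> 0" using assms(2) by simp
  then have "is_unit (gcd f g)" using assms(1) by (subst is_unit_iff_degree)
  then have "gcd f g = 1" unfolding is_unit_gcd by (rule coprime_imp_gcd_eq_1)
  then show ?thesis by (rule that[OF trans[OF bezout_coefficients_fst_snd]])
qed

text \<open>If the gcd with \<open>P\<close> were constant, a Bezout combination equal to 1 would
  vanish at \<open>z\<close>. Irreducibility then leaves only a gcd associated to
  \<open>P\<close>.\<close>

lemma irreducible_dvd_of_common_root:
  fixes f P :: "rat poly"
  assumes irr: "\<And>g h. g * h = P \<Longrightarrow> degree g = 0 \<or> degree h = 0" and "P \<noteq> 0"
    and "rpoly P z = 0" and "rpoly f z = 0"
  shows "P dvd f"
proof -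
  define g where "g = gcd f P"
  obtain h where h: "P = g * h" unfolding g_def by (meson dvdE gcd_dvd2)
  have "degree g \<noteq> 0"
  proof
    assume "degree g = 0"
    then obtain u v where "u * f + v * P = 1" using rpoly_bezout[of f P] \<open>P \<noteq> 0\<close> g_def by blast
    then have "rpoly (u * f + v * P) z = 1" by simp
    then show False using assms by simp
  qed
  then have "degree h = 0" using irr h by metis
  then obtain c where c: "h = [:c:]" by (meson degree_eq_zeroE)
  then have "c \<noteq> 0" using h \<open>P \<noteq> 0\<close> by auto
  then have "P dvd g" using h c by (simp add: smult_dvd_iff)
  then show ?thesis unfolding g_def by (meson dvd_trans gcd_dvd1)
qed

subsection \<open>The cyclotomic polynomial of order \<open>p ^ Suc e\<close>\<close>

text \<open>Phrased as divisibility by \<open>of_nat p\<close>, so that it can be used directly for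
  integer polynomials instead of in a ring of characteristic p.\<close>

lemma freshman_dream:
  fixes a b :: "'a::comm_ring_1"
  assumes "prime p"
  shows "of_nat p dvd (a + b) ^ p - a ^ p - b ^ p"
proof -
  have p: "p > 0" using assms prime_gt_0_nat by blast
  have "(a + b) ^ p = (\<Sum>k\<le>p. of_nat (p choose k) * a ^ k * b ^ (p - k))"
    by (rule binomial_ring)
  also have "{..p} = insert 0 (insert p {1..<p})" using p by auto
  also have "(\<Sum>k\<in>\<dots>. of_nat (p choose k) * a ^ k * b ^ (p - k))
      = b ^ p + (a ^ p + (\<Sum>k\<in>{1..<p}. of_nat (p choose k) * a ^ k * b ^ (p - k)))"
    using p by simp
  finally have eq: "(a + b) ^ p - a ^ p - b ^ p
      = (\<Sum>k\<in>{1..<p}. of_nat (p choose k) * a ^ k * b ^ (p - k))" by simp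
  show ?thesis unfolding eq
  proof (intro dvd_sum)
    fix k assume k: "k \<in> {1..<p}"
    then have "p dvd (p choose k)" using assms by (intro dvd_choose_prime) auto
    then have "(of_nat p :: 'a) dvd of_nat (p choose k)" by (metis dvd_def of_nat_mult)
    then show "(of_nat p :: 'a) dvd of_nat (p choose k) * a ^ k * b ^ (p - k)"
      unfolding mult.assoc by (rule dvd_mult2)
  qed
qed

lemma diff_dvd_power_diff: "x - y dvd x ^ n - y ^ n" for x y :: "'a::comm_ring_1"
  unfolding power_diff_sumr2[of x n y] by (rule dvd_triv_left)

lemma freshman_dream_power:
  fixes a b :: "'a::comm_ring_1"
  assumes "prime p"
  shows "of_nat p dvd (a + b) ^ (p ^ e) - a ^ (p ^ e) - b ^ (p ^ e)"
proof (induction e)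
  case 0
  then show ?case by simp
next
  case (Suc e)
  let ?x = "(a + b) ^ (p ^ e)" and ?y = "a ^ (p ^ e)" and ?z = "b ^ (p ^ e)"
  have "?x - (?y + ?z) dvd ?x ^ p - (?y + ?z) ^ p"
    by (rule diff_dvd_power_diff)
  moreover have "of_nat p dvd ?x - (?y + ?z)" using Suc by (simp add: algebra_simps)
  ultimately have "of_nat p dvd ?x ^ p - (?y + ?z) ^ p" by (rule dvd_trans[rotated])
  moreover have "of_nat p dvd (?y + ?z) ^ p - ?y ^ p - ?z ^ p" by (rule freshman_dream[OF assms])
  ultimately have "of_nat p dvd (?x ^ p - (?y + ?z) ^ p) + ((?y + ?z) ^ p - ?y ^ p - ?z ^ p)"
    by (rule dvd_add)
  moreover have "x ^ (p ^ Suc e) = (x ^ (p ^ e)) ^ p" for x :: 'a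
    by (metis power_Suc2 power_mult)
  moreover have "(A - B) + (B - C - D) = A - C - D" for A B C D :: 'a by simp
  ultimately show ?case by (simp only:)
qed

lemma pcompose_power: "pcompose (f ^ n) g = pcompose f g ^ n" for f g :: "'a::comm_ring_1 poly"
  by (induction n) (simp_all add: pcompose_1 pcompose_mult)

text \<open>This is 1 + X^q + ... + X^(q(p-1)). For q = p^e it is the cyclotomic polynomial of order
  p^(e+1).\<close>

definition cyc :: "nat \<Rightarrow> nat \<Rightarrow> 'a::comm_ring_1 poly" where
  "cyc p q = (\<Sum>i<p. monom 1 q ^ i)"

text \<open>Modulo p the power z = (1+X)^q equals y + 1 with y = X^q. Multiplied by y, the geometric
  sum in y + 1 becomes (y+1)^p - 1, which is y^p modulo p. The factor y can be cancelled because the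
  constant p is a prime element of the polynomial ring and does not divide y.\<close>

lemma cyc_shift_cong:
  assumes p: "prime p"
  shows "[:int p:] dvd pcompose (cyc p (p ^ e)) [:1, 1:] - monom 1 (p ^ e * (p - 1))"
proof -
  let ?q = "p ^ e" and ?x = "[:1, 1:] :: int poly"
  define y :: "int poly" where "y = monom 1 ?q"
  define z :: "int poly" where "z = ?x ^ ?q"
  have P: "(of_nat p :: int poly) = [:int p:]" by (simp add: of_nat_poly)
  have x: "?x = monom 1 1 + 1" by (simp add: monom_altdef one_pCons)
  have zy: "[:int p:] dvd z - (y + 1)"
  proof -
    have "z = (monom 1 1 + 1) ^ ?q" "y = monom 1 1 ^ ?q"
      unfolding z_def x y_def by (simp_all add: monom_power)
    then show ?thesis
      using freshman_dream_power[OF p, of "monom 1 1 :: int poly" 1 e]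
      by (simp only: P power_one diff_diff_eq)
  qed
  have "pcompose (monom 1 ?q) ?x = z"
    unfolding z_def by (simp add: monom_altdef pcompose_power pcompose_pCons)
  then have sh: "pcompose (cyc p ?q) ?x = (\<Sum>i<p. z ^ i)"
    unfolding cyc_def by (simp add: pcompose_sum pcompose_power)
  have 1: "[:int p:] dvd (\<Sum>i<p. z ^ i) - (\<Sum>i<p. (y + 1) ^ i)"
    unfolding sum_subtractf[symmetric]
    by (intro dvd_sum) (meson diff_dvd_power_diff dvd_trans zy)
  have "y * (\<Sum>i<p. (y + 1) ^ i) = (y + 1) ^ p - 1"
    using power_diff_1_eq[of "y + 1" p] by simp
  moreover have "y * y ^ (p - 1) = y ^ p"
    using power_minus_mult[OF prime_gt_0_nat[OF p], of y] by (simp only: mult.commute)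
  ultimately have "y * ((\<Sum>i<p. (y + 1) ^ i) - y ^ (p - 1)) = (y + 1) ^ p - y ^ p - 1 ^ p"
    by (simp add: right_diff_distrib)
  then have "[:int p:] dvd y * ((\<Sum>i<p. (y + 1) ^ i) - y ^ (p - 1))"
    using freshman_dream[OF p, of y 1, unfolded P] by argo
  moreover have "prime_elem [:int p:]" using p by (intro lift_prime_elem_poly) auto
  moreover have "\<not> [:int p:] dvd y"
    unfolding y_def const_poly_dvd_iff using p by (auto dest: spec[of _ ?q])
  ultimately have "[:int p:] dvd (\<Sum>i<p. (y + 1) ^ i) - y ^ (p - 1)"
    using prime_elem_dvd_mult_iff by blast
  with 1 have "[:int p:] dvd ((\<Sum>i<p. z ^ i) - (\<Sum>i<p. (y + 1) ^ i))
      + ((\<Sum>i<p. (y + 1) ^ i) - y ^ (p - 1))"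
    by (rule dvd_add)
  moreover have "(a - b) + (b - c) = a - c" for a b c :: "int poly" by simp
  ultimately have "[:int p:] dvd (\<Sum>i<p. z ^ i) - y ^ (p - 1)"
    by (simp only:)
  then show ?thesis unfolding sh y_def monom_power by (simp only: power_one)
qed

lemma coeff_cyc_0: "coeff (cyc p q) 0 = 1" if "p > 0" "q > 0"
proof -
  have "coeff (cyc p q) 0 = (\<Sum>i<p. if i = 0 then 1 else 0)"
    using that by (auto simp: cyc_def coeff_sum monom_power intro!: sum.cong)
  also have "\<dots> = 1" using that by simp
  finally show ?thesis .
qed

lemma degree_lead_coeff_cyc:
  fixes p q :: nat
  assumes "p > 0" "q > 0"
  shows "degree (cyc p q :: 'a::{comm_ring_1} poly) = q * (p - 1)"
    and "lead_coeff (cyc p q :: 'a poly) = 1"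
proof -
  have c: "coeff (cyc p q :: 'a poly) n = (if q dvd n \<and> n div q < p then 1 else 0)" for n
  proof -
    have "coeff (cyc p q :: 'a poly) n = (\<Sum>i<p. if q * i = n then 1 else 0)"
      by (auto simp: cyc_def coeff_sum monom_power intro!: sum.cong)
    also have "\<dots> = (\<Sum>i\<in>{i \<in> {..<p}. q * i = n}. 1)"
      by (rule sum.inter_filter[symmetric]) simp
    also have "{i \<in> {..<p}. q * i = n} = (if q dvd n \<and> n div q < p then {n div q} else {})"
      using assms by auto
    finally show ?thesis by auto
  qed
  have "degree (cyc p q :: 'a poly) \<le> q * (p - 1)"
  proof (rule degree_le, intro allI impI)
    fix i assume "q * (p - 1) < i"
    then have "\<not> (q dvd i \<and> i div q < p)" using assms by auto
    then show "coeff (cyc p q :: 'a poly) i = 0" by (auto simp: c)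
  qed
  moreover have "coeff (cyc p q :: 'a poly) (q * (p - 1)) = 1" using assms by (simp add: c)
  ultimately show "degree (cyc p q :: 'a poly) = q * (p - 1)"
    by (metis le_antisym le_degree zero_neq_one)
  then show "lead_coeff (cyc p q :: 'a poly) = 1"
    using \<open>coeff (cyc p q :: 'a poly) (q * (p - 1)) = 1\<close> by simp
qed

lemma of_int_poly_pcompose:
  "(of_int_poly (pcompose f g) :: rat poly) = pcompose (of_int_poly f) (of_int_poly g)"
proof (induction f)
  case (pCons a f)
  have add: "(of_int_poly (f + g) :: rat poly) = of_int_poly f + of_int_poly g" for f g
    by (intro poly_eqI) (simp add: coeff_map_poly)
  show ?case using pCons
    by (simp add: pcompose_pCons map_poly_pCons add of_int_poly_mult_rat)
qed simp

lemma of_int_poly_cyc: "of_int_poly (cyc p q) = (cyc p q :: rat poly)"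
proof -
  have "of_int_poly (\<Sum>i<n. monom 1 q ^ i) = (\<Sum>i<n. monom 1 q ^ i :: rat poly)" for n
    by (intro poly_eqI) (auto simp: coeff_map_poly coeff_sum monom_power intro!: sum.cong)
  then show ?thesis by (simp add: cyc_def)
qed

text \<open>Eisenstein's criterion applies after the substitution X -> X + 1: the coefficients below
  the leading one are divisible by p by \<open>cyc_shift_cong\<close>, and the constant coefficient
  is the value at 1, which is p itself.\<close>

lemma cyc_irreducible:
  fixes g h :: "rat poly"
  assumes p: "prime p" and gh: "g * h = cyc p (p ^ e)"
  shows "degree g = 0 \<or> degree h = 0"
proof -
  let ?x = "[:1, 1:] :: int poly" and ?y = "[:1, 1:] :: rat poly"
  define C :: "int poly" where "C = cyc p (p ^ e)"
  define P where "P = pcompose C ?x"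
  have p0: "p > 0" "p ^ e > 0" using p prime_gt_0_nat by auto
  have deg: "degree P = p ^ e * (p - 1)"
    unfolding P_def C_def by (simp add: degree_pcompose degree_lead_coeff_cyc[OF p0])
  have lc: "lead_coeff P = 1"
  proof -
    have "lead_coeff P = lead_coeff C * lead_coeff ?x ^ degree C"
      unfolding P_def by (rule lead_coeff_comp) simp
    also have "lead_coeff C = 1" unfolding C_def by (rule degree_lead_coeff_cyc(2)[OF p0])
    finally show ?thesis by simp
  qed
  have cong: "[:int p:] dvd P - monom 1 (p ^ e * (p - 1))"
    unfolding P_def C_def by (rule cyc_shift_cong[OF p])
  have low: "int p dvd coeff P i" if "i < degree P" for i
  proof -
    have "int p dvd coeff (P - monom 1 (p ^ e * (p - 1))) i"
      using cong const_poly_dvd_iff by blast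
    then show ?thesis using that deg by simp
  qed
  have "coeff P 0 = int p"
  proof -
    have "coeff P 0 = poly P 0" by (simp add: poly_0_coeff_0)
    also have "\<dots> = poly C 1" unfolding P_def by (simp add: poly_pcompose)
    also have "\<dots> = int p" unfolding C_def cyc_def by (simp add: poly_sum poly_monom)
    finally show ?thesis .
  qed
  moreover have "\<not> (int p)\<^sup>2 dvd int p"
  proof
    assume "(int p)\<^sup>2 dvd int p"
    then have "int p * int p \<le> int p * 1"
      using p0 zdvd_imp_le by (auto simp: power2_eq_square)
    then show False using p0 prime_gt_1_nat[OF p] by simp
  qed
  ultimately have sq: "\<not> (int p)\<^sup>2 dvd coeff P 0" by simp
  have "of_int_poly P = pcompose (cyc p (p ^ e)) ?y"
    unfolding P_def of_int_poly_pcompose C_def of_int_poly_cyc by (simp add: map_poly_pCons)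
  also have "\<dots> = pcompose g ?y * pcompose h ?y"
    by (simp add: gh[symmetric] pcompose_mult)
  finally have "degree (pcompose g ?y) = 0 \<or> degree (pcompose h ?y) = 0"
    using eisenstein_rat[of "int p" P "pcompose g ?y" "pcompose h ?y"] low sq p
      prime_gt_1_nat[OF p] unfolding lc by auto
  then show ?thesis by (simp add: degree_pcompose)
qed

section \<open>Powers of roots of unity and their Galois conjugates\<close>

lemma zeta_power: "zeta d ^ k = cis (2 * pi * real k / real d)"
  unfolding zeta_def DeMoivre by (simp add: mult.commute)

lemma zeta_power_d: "d > 0 \<Longrightarrow> zeta d ^ d = 1"
  by (simp add: zeta_power)

lemma zeta_power_eq_iff:
  assumes "d > 0"
  shows "zeta d ^ i = zeta d ^ j \<longleftrightarrow> [i = j] (mod d)"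
proof -
  have *: "zeta d ^ i = zeta d ^ (i mod d)" for i
  proof -
    have "zeta d ^ i = zeta d ^ (d * (i div d) + i mod d)" by simp
    also have "\<dots> = zeta d ^ (i mod d)"
      unfolding power_add power_mult zeta_power_d[OF assms] by simp
    finally show ?thesis .
  qed
  have inj: "inj_on (\<lambda>k. cis (2 * pi * real k / real d)) {..<d}"
    using bij_betw_roots_unity[OF assms] unfolding bij_betw_def by simp
  have "zeta d ^ (i mod d) = zeta d ^ (j mod d) \<longleftrightarrow> i mod d = j mod d"
    unfolding zeta_power using inj assms by (auto simp: inj_on_def)
  then show ?thesis using * by (metis cong_def)
qed

lemma zeta_power_eq_1_iff: "d > 0 \<Longrightarrow> zeta d ^ i = 1 \<longleftrightarrow> d dvd i"
  using zeta_power_eq_iff[of d i 0] by (simp add: cong_0_iff)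

lemma root_of_unity_eq_zeta_power:
  assumes "d > 0" "z ^ d = 1"
  obtains k where "k < d" "z = zeta d ^ k"
proof -
  have "z \<in> {z. z ^ d = 1}" using assms by simp
  then have "z \<in> (\<lambda>k. cis (2 * pi * real k / real d)) ` {..<d}"
    using bij_betw_roots_unity[OF assms(1)] unfolding bij_betw_def by blast
  then show ?thesis using that by (auto simp: zeta_power)
qed

lemma rpoly_cyc_zeta:
  assumes p: "prime p" and k: "coprime k p"
  shows "rpoly (cyc p (p ^ e)) (zeta (p ^ Suc e) ^ k) = 0"
proof -
  let ?z = "zeta (p ^ Suc e) ^ k"
  have d: "p ^ Suc e > 0" using p prime_gt_0_nat by simp
  have rp: "rpoly (f ^ n) x = rpoly f x ^ n" for f n x by (induction n) simp_all
  have "rpoly (cyc p (p ^ e)) ?z = (\<Sum>i<p. (?z ^ (p ^ e)) ^ i)"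
    unfolding cyc_def rpoly_sum rp by simp
  moreover have "(?z ^ (p ^ e) - 1) * (\<Sum>i<p. (?z ^ (p ^ e)) ^ i) = (?z ^ (p ^ e)) ^ p - 1"
    by (simp add: power_diff_1_eq)
  moreover have "(?z ^ (p ^ e)) ^ p = 1"
    using zeta_power_eq_1_iff[OF d, of "k * p ^ e * p"] by (simp add: power_mult[symmetric] mult.assoc mult.commute)
  moreover have "?z ^ (p ^ e) \<noteq> 1"
  proof
    assume "?z ^ (p ^ e) = 1"
    then have "p ^ Suc e dvd k * p ^ e" using zeta_power_eq_1_iff[OF d, of "k * p ^ e"]
      by (simp add: power_mult)
    then have "p dvd k" using p prime_gt_0_nat by (simp add: dvd_mult_cancel_right)
    then show False using k p by (metis coprime_absorb_left coprime_commute not_prime_unit)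
  qed
  ultimately show ?thesis by simp
qed

text \<open>This replaces the automorphism sending zeta to zeta^k: a rational relation satisfied by
  zeta is divisible by its irreducible polynomial \<open>cyc\<close>, of which zeta^k is a root as
  well.\<close>

theorem rpoly_galois:
  assumes p: "prime p" and k: "coprime k p" and f: "rpoly f (zeta (p ^ Suc e)) = 0"
  shows "rpoly f (zeta (p ^ Suc e) ^ k) = 0"
proof -
  have p0: "p > 0" "p ^ e > 0" using p prime_gt_0_nat by auto
  have "cyc p (p ^ e) \<noteq> (0 :: rat poly)" using coeff_cyc_0[OF p0] by (metis coeff_0 zero_neq_one)
  then have "cyc p (p ^ e) dvd f"
    using irreducible_dvd_of_common_root[OF cyc_irreducible[OF p], where z = "zeta (p ^ Suc e)"]
      rpoly_cyc_zeta[OF p, of 1 e] f by auto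
  then show ?thesis using rpoly_cyc_zeta[OF p k] by (auto elim!: dvdE)
qed

section \<open>The field generated by a root of unity of prime power order\<close>

lemma field_complex: "field (field_alg (UNIV :: complex set))"
proof (rule cring.cring_fieldI)
  show "cring (field_alg (UNIV :: complex set))"
    by (intro cringI abelian_groupI comm_monoidI)
      (auto simp: field_alg_def algebra_simps intro: exI[of _ "- x" for x] add.left_inverse)
next
  show "Units (field_alg (UNIV :: complex set)) = carrier (field_alg UNIV) - {\<zero>\<^bsub>field_alg UNIV\<^esub>}"
    by (auto simp: field_alg_def Units_def) (metis left_inverse right_inverse)
qed

lemma field_alg_inv: "x \<noteq> 0 \<Longrightarrow> inv\<^bsub>field_alg (UNIV :: complex set)\<^esub> x = inverse x"
  by (rule comm_monoid.comm_inv_char[OF cring.axioms(2)[OF domain.axioms(1)[OF field.axioms(1)[OF field_complex]]]])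
    (auto simp: field_alg_def)

lemma field_alg_a_inv: "\<ominus>\<^bsub>field_alg (UNIV :: complex set)\<^esub> x = - x"
  by (rule abelian_group.minus_equality[OF ring.is_abelian_group[OF cring.axioms(1)[OF domain.axioms(1)[OF field.axioms(1)[OF field_complex]]]]])
    (auto simp: field_alg_def)

lemma of_rat_in_cyclotomic_field: "of_rat q \<in> cyclotomic_field d"
proof -
  let ?K = "field_alg (UNIV :: complex set)"
  let ?S = "cyclotomic_field d"
  have 1: "1 \<in> ?S" using generate_field.one[of ?K] by (simp add: cyclotomic_field_def field_alg_def)
  have neg: "- x \<in> ?S" if "x \<in> ?S" for x
    using generate_field.a_inv[of x ?K "{zeta d}"] that by (simp add: cyclotomic_field_def field_alg_a_inv)
  have add: "x + y \<in> ?S" if "x \<in> ?S" "y \<in> ?S" for x y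
    using generate_field.eng_add[of x ?K "{zeta d}" y] that by (simp add: cyclotomic_field_def field_alg_def)
  have mult: "x * y \<in> ?S" if "x \<in> ?S" "y \<in> ?S" for x y
    using generate_field.eng_mult[of x ?K "{zeta d}" y] that by (simp add: cyclotomic_field_def field_alg_def)
  have inv: "inverse x \<in> ?S" if "x \<in> ?S" for x
    using generate_field.m_inv[of x ?K "{zeta d}"] that
    by (cases "x = 0") (auto simp: cyclotomic_field_def field_alg_inv field_alg_def[THEN arg_cong[of _ _ zero]])
  have nat: "of_nat n \<in> ?S" for n
  proof (induction n)
    case 0
    show ?case using add[OF 1 neg[OF 1]] by simp
  qed (auto intro: add 1)
  have int: "of_int i \<in> ?S" for i
    by (cases i) (use nat neg in \<open>auto simp del: of_nat_Suc\<close>)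
  obtain a b where "q = of_int a / of_int b" "b \<noteq> 0"
    by (metis Fract_of_int_quotient Rat_cases less_irrefl)
  then have "of_rat q = (of_int a * inverse (of_int b) :: complex)"
    by (simp add: of_rat_divide)  (simp add: divide_inverse)
  then show ?thesis using mult[OF int inv[OF int]] by simp
qed

text \<open>Closure of the polynomial values under inverses is the only point that needs
  irreducibility: if f does not vanish at zeta, then f is coprime to \<open>cyc\<close>, and the
  Bezout coefficient of f, evaluated at zeta, is the inverse.\<close>

theorem cyclotomic_field_eq:
  assumes p: "prime p"
  shows "cyclotomic_field (p ^ Suc e) = range (\<lambda>f. rpoly f (zeta (p ^ Suc e)))"
proof
  let ?K = "field_alg (UNIV :: complex set)" and ?z = "zeta (p ^ Suc e)"
  have p0: "p > 0" "p ^ e > 0" using p prime_gt_0_nat by auto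
  have nz: "cyc p (p ^ e) \<noteq> (0 :: rat poly)"
    using coeff_cyc_0[OF p0] by (metis coeff_0 zero_neq_one)
  show "cyclotomic_field (p ^ Suc e) \<subseteq> range (\<lambda>f. rpoly f ?z)"
  proof
    fix x assume "x \<in> cyclotomic_field (p ^ Suc e)"
    then have "x \<in> generate_field ?K {?z}" by (simp add: cyclotomic_field_def)
    then show "x \<in> range (\<lambda>f. rpoly f ?z)"
    proof (induction rule: generate_field.induct)
      case one
      show ?case by (auto simp: field_alg_def intro!: image_eqI[of _ _ 1])
    next
      case (incl h)
      then show ?case by (auto intro!: image_eqI[of _ _ "[:0, 1:]"])
    next
      case (a_inv h)
      then obtain f where "h = rpoly f ?z" by auto
      then have "- h = rpoly (smult (-1) f) ?z" unfolding rpoly_smult by simp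
      then show ?case unfolding field_alg_a_inv by blast
    next
      case (m_inv h)
      then obtain f where f: "h = rpoly f ?z" "h \<noteq> 0" by (auto simp: field_alg_def)
      define g where "g = gcd f (cyc p (p ^ e))"
      obtain h' where h': "cyc p (p ^ e) = g * h'" unfolding g_def by (meson dvdE gcd_dvd2)
      have "degree g = 0"
      proof (rule ccontr)
        assume "degree g \<noteq> 0"
        then have "degree h' = 0" using cyc_irreducible[OF p] h' by metis
        then obtain c where c: "h' = [:c:]" by (meson degree_eq_zeroE)
        then have "c \<noteq> 0" using h' nz by auto
        then have "cyc p (p ^ e) dvd g" using h' c by (simp add: smult_dvd_iff)
        then have "cyc p (p ^ e) dvd f" unfolding g_def by (meson dvd_trans gcd_dvd1)
        then show False using rpoly_cyc_zeta[OF p, of 1 e] f by (auto elim!: dvdE)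
      qed
      then obtain u v where uv: "u * f + v * cyc p (p ^ e) = 1"
        using rpoly_bezout[of f "cyc p (p ^ e)"] nz g_def by blast
      have "rpoly u ?z * h = 1"
        using arg_cong[OF uv, of "\<lambda>f. rpoly f ?z"] rpoly_cyc_zeta[OF p, of 1 e] f by simp
      then have "inverse h = rpoly u ?z" by (metis f(2) inverse_unique mult.commute)
      then show ?case using field_alg_inv[OF f(2)] by simp
    next
      case (eng_add h1 h2)
      then show ?case by (auto simp: field_alg_def rpoly_add[symmetric] simp del: rpoly_add)
    next
      case (eng_mult h1 h2)
      then show ?case by (auto simp: field_alg_def rpoly_mult[symmetric] simp del: rpoly_mult)
    qed
  qed
  have add: "x + y \<in> cyclotomic_field d" if "x \<in> cyclotomic_field d" "y \<in> cyclotomic_field d" for x y d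
    using generate_field.eng_add[of x ?K "{zeta d}" y] that by (simp add: cyclotomic_field_def field_alg_def)
  have mult: "x * y \<in> cyclotomic_field d" if "x \<in> cyclotomic_field d" "y \<in> cyclotomic_field d" for x y d
    using generate_field.eng_mult[of x ?K "{zeta d}" y] that by (simp add: cyclotomic_field_def field_alg_def)
  have "rpoly f ?z \<in> cyclotomic_field (p ^ Suc e)" for f
  proof (induction f)
    case 0
    show ?case using of_rat_in_cyclotomic_field[of 0] by simp
  next
    case (pCons a f)
    have "?z \<in> cyclotomic_field (p ^ Suc e)"
      unfolding cyclotomic_field_def by (intro generate_field.incl) simp
    then show ?case using pCons add mult of_rat_in_cyclotomic_field by simp
  qed
  then show "range (\<lambda>f. rpoly f ?z) \<subseteq> cyclotomic_field (p ^ Suc e)" by blast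
qed

lemma sum_zeta_powers:
  assumes "d > 0"
  shows "(\<Sum>k<d. zeta d ^ (j * k)) = (if d dvd j then of_nat d else 0)"
proof (cases "d dvd j")
  case True
  then have "zeta d ^ (j * k) = 1" for k using zeta_power_eq_1_iff[OF assms] by simp
  then show ?thesis using True by simp
next
  case False
  then have "zeta d ^ j \<noteq> 1" using zeta_power_eq_1_iff[OF assms] by simp
  moreover have "(zeta d ^ j - 1) * (\<Sum>k<d. (zeta d ^ j) ^ k) = (zeta d ^ j) ^ d - 1"
    by (simp add: power_diff_1_eq)
  moreover have "(zeta d ^ j) ^ d = 1"
    using zeta_power_eq_1_iff[OF assms, of "j * d"] by (simp add: power_mult)
  ultimately show ?thesis using False by (simp add: power_mult)
qed

text \<open>The sum over all k below p^(e+1) and the part over the multiples of p are both complete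
  sums of powers of a root of unity, hence each is zero or an integer. This Ramanujan sum is what
  makes the idempotents built below rational.\<close>

lemma ramanujan_sum_rational:
  assumes p: "prime p"
  shows "(\<Sum>k | k < p ^ Suc e \<and> coprime k p. zeta (p ^ Suc e) ^ (j * k)) \<in> \<rat>"
proof -
  let ?d = "p ^ Suc e" and ?q = "p ^ e"
  have p0: "p > 0" "?q > 0" "?d > 0" using p prime_gt_0_nat by auto
  have split: "{..<?d} = {k. k < ?d \<and> coprime k p} \<union> (\<lambda>k. p * k) ` {..<?q}"
  proof (rule equalityI; rule subsetI)
    fix k assume k: "k \<in> {..<?d}"
    show "k \<in> {k. k < ?d \<and> coprime k p} \<union> (\<lambda>k. p * k) ` {..<?q}"
    proof (cases "p dvd k")
      case True
      then obtain m where "k = p * m" by (rule dvdE)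
      then have "m \<in> {..<?q}" using k p0 by simp
      then show ?thesis using \<open>k = p * m\<close> by blast
    next
      case False
      then have "coprime k p" using p by (metis coprime_commute prime_imp_coprime)
      then show ?thesis using k by simp
    qed
  next
    fix k assume "k \<in> {k. k < ?d \<and> coprime k p} \<union> (\<lambda>k. p * k) ` {..<?q}"
    then show "k \<in> {..<?d}" using p0 by (elim UnE imageE) simp_all
  qed
  have disj: "{k. k < ?d \<and> coprime k p} \<inter> (\<lambda>k. p * k) ` {..<?q} = {}"
  proof -
    have "\<not> coprime (p * m) p" for m using p by (metis coprime_def dvd_refl dvd_triv_left not_prime_unit)
    then show ?thesis by blast
  qed
  have "(\<Sum>k<?d. zeta ?d ^ (j * k)) = (\<Sum>k | k < ?d \<and> coprime k p. zeta ?d ^ (j * k))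
      + (\<Sum>k\<in>(\<lambda>k. p * k) ` {..<?q}. zeta ?d ^ (j * k))"
    unfolding split by (intro sum.union_disjoint disj) auto
  also have "(\<Sum>k\<in>(\<lambda>k. p * k) ` {..<?q}. zeta ?d ^ (j * k)) = (\<Sum>k<?q. zeta ?q ^ (j * k))"
  proof -
    have "zeta ?d ^ p = zeta ?q" using p0 by (simp add: zeta_power) (simp add: zeta_def)
    then have "zeta ?d ^ (j * (p * k)) = zeta ?q ^ (j * k)" for k
      by (metis mult.left_commute power_mult)
    then show ?thesis using p0 by (subst sum.reindex) (auto simp: inj_on_def)
  qed
  finally have eq: "(\<Sum>k | k < ?d \<and> coprime k p. zeta ?d ^ (j * k))
      = (if ?d dvd j then of_nat ?d else 0) - (if ?q dvd j then of_nat ?q else 0)"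
    unfolding sum_zeta_powers[OF p0(3)] sum_zeta_powers[OF p0(2)]
    by (rule iffD2[OF eq_diff_eq, OF sym])
  have "(if b then of_nat n else 0 :: complex) \<in> \<rat>" for b n
    by (cases b) simp_all
  then show ?thesis unfolding eq by (intro Rats_diff)
qed

section \<open>Characters of finite abelian subgroups\<close>

text \<open>Characters are extended by \<open>0\<close> outside the subgroup, the convention that makes the matrix
  entries of an induced representation a single formula.\<close>

definition chars :: "('a, 'b) monoid_scheme \<Rightarrow> 'a set \<Rightarrow> ('a \<Rightarrow> complex) set" where
  "chars G A = {l. (\<forall>x\<in>A. \<forall>y\<in>A. l (x \<otimes>\<^bsub>G\<^esub> y) = l x * l y) \<and> l \<one>\<^bsub>G\<^esub> = 1 \<and> (\<forall>x. x \<notin> A \<longrightarrow> l x = 0)}"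

definition char_order :: "'a set \<Rightarrow> ('a \<Rightarrow> complex) \<Rightarrow> nat" where
  "char_order A l = (LEAST d. d > 0 \<and> (\<forall>x\<in>A. l x ^ d = 1))"

lemma charsI:
  assumes "\<And>x y. x \<in> A \<Longrightarrow> y \<in> A \<Longrightarrow> l (x \<otimes>\<^bsub>G\<^esub> y) = l x * l y" "l \<one>\<^bsub>G\<^esub> = 1" "\<And>x. x \<notin> A \<Longrightarrow> l x = 0"
  shows "l \<in> chars G A"
  using assms by (auto simp: chars_def)

lemma chars_mult:
  assumes "l \<in> chars G A" "x \<in> A" "y \<in> A"
  shows "l (x \<otimes>\<^bsub>G\<^esub> y) = l x * l y"
  using assms(1)[unfolded chars_def, THEN CollectD, THEN conjunct1] assms(2,3) by blast

lemma chars_one: "l \<in> chars G A \<Longrightarrow> l \<one>\<^bsub>G\<^esub> = 1"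
  unfolding chars_def by blast

lemma chars_out: "l \<in> chars G A \<Longrightarrow> x \<notin> A \<Longrightarrow> l x = 0"
  by (simp add: chars_def)

locale finite_abelian_subgroup = group G for G (structure) +
  fixes A
  assumes subA: "subgroup A G" and finA: "finite A"
    and commA: "\<And>x y. x \<in> A \<Longrightarrow> y \<in> A \<Longrightarrow> x \<otimes> y = y \<otimes> x"
begin

lemma A_carrier [simp]: "x \<in> A \<Longrightarrow> x \<in> carrier G"
  by (rule subgroup.mem_carrier[OF subA])

lemma A_closed [simp]: "x \<in> A \<Longrightarrow> y \<in> A \<Longrightarrow> x \<otimes> y \<in> A"
  and A_one [simp]: "\<one> \<in> A"
  and A_inv [simp]: "x \<in> A \<Longrightarrow> inv x \<in> A"
  using subA by (auto simp: subgroup.m_closed subgroup.one_closed subgroup.m_inv_closed)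

lemma A_pow [simp]: "x \<in> A \<Longrightarrow> x [^] (n::nat) \<in> A"
  by (induction n) auto

lemma card_A_pos: "card A > 0"
  using finA A_one card_gt_0_iff by blast

lemma A_pow_card: "x \<in> A \<Longrightarrow> x [^] card A = \<one>"
proof -
  assume x: "x \<in> A"
  interpret S: group "G\<lparr>carrier := A\<rparr>" using subA subgroup_imp_group by blast
  have "x [^]\<^bsub>G\<lparr>carrier := A\<rparr>\<^esub> Coset.order (G\<lparr>carrier := A\<rparr>) = \<one>"
    using S.pow_order_eq_1[of x] x by simp
  then show ?thesis by (simp add: Coset.order_def nat_pow_consistent[symmetric])
qed

lemma subgroup_abelian: "subgroup B G \<Longrightarrow> B \<subseteq> A \<Longrightarrow> finite_abelian_subgroup G B"
  using finA commA by (intro finite_abelian_subgroup.intro finite_abelian_subgroup_axioms.intro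
      is_group) (auto intro: finite_subset)

lemma chars_pow: "l \<in> chars G A \<Longrightarrow> x \<in> A \<Longrightarrow> l (x [^] n) = l x ^ (n::nat)"
  by (induction n) (auto simp: chars_one chars_mult)

lemma chars_root: "l \<in> chars G A \<Longrightarrow> x \<in> A \<Longrightarrow> l x ^ card A = 1"
  using chars_pow[of l x "card A"] A_pow_card by (simp add: chars_one)

lemma chars_nonzero: "l \<in> chars G A \<Longrightarrow> x \<in> A \<Longrightarrow> l x \<noteq> 0"
  using chars_root[of l x] card_A_pos by (metis less_numeral_extra(3) power_0_left zero_neq_one)

lemma chars_inv: "l \<in> chars G A \<Longrightarrow> x \<in> A \<Longrightarrow> l (inv x) = inverse (l x)"
proof -
  assume l: "l \<in> chars G A" and x: "x \<in> A"
  have "l x * l (inv x) = 1" using chars_mult[OF l x, of "inv x"] x by (simp add: chars_one[OF l])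
  then show ?thesis by (metis inverse_unique)
qed

lemma finite_chars: "finite (chars G A)"
proof -
  have "inj_on (\<lambda>l. restrict l A) (chars G A)"
  proof (rule inj_onI)
    fix l m assume l: "l \<in> chars G A" and m: "m \<in> chars G A" and eq: "restrict l A = restrict m A"
    show "l = m"
    proof
      fix x show "l x = m x"
        using fun_cong[OF eq, of x] chars_out[OF l] chars_out[OF m] by (cases "x \<in> A") auto
    qed
  qed
  moreover have "(\<lambda>l. restrict l A) ` chars G A \<subseteq> (\<Pi>\<^sub>E x\<in>A. {z. z ^ card A = 1})"
    using chars_root by auto
  moreover have "finite (\<Pi>\<^sub>E x\<in>A. {z::complex. z ^ card A = 1})"
    using finA card_A_pos by (intro finite_PiE finite_roots_unity) auto
  ultimately show ?thesis by (meson finite_imageD finite_subset)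
qed

lemma chars_times: "l \<in> chars G A \<Longrightarrow> m \<in> chars G A \<Longrightarrow> (\<lambda>x. l x * m x) \<in> chars G A"
  by (auto simp: chars_def)

lemma chars_inverse: "l \<in> chars G A \<Longrightarrow> (\<lambda>x. inverse (l x)) \<in> chars G A"
  by (auto simp: chars_def)

lemma chars_trivial: "(\<lambda>x. if x \<in> A then 1 else 0) \<in> chars G A"
  by (auto simp: chars_def)

lemma sum_char_eq_0:
  assumes l: "l \<in> chars G A" and B: "subgroup B G" "B \<subseteq> A" and x: "x \<in> B" "l x \<noteq> 1"
  shows "(\<Sum>b\<in>B. l b) = 0"
proof -
  have "bij_betw (\<lambda>b. x \<otimes> b) B B"
    by (rule bij_betwI[where g = "\<lambda>b. inv x \<otimes> b"])
      (use B x in \<open>auto simp: subgroup.m_closed subgroup.m_inv_closed subgroup.mem_carrier m_assoc[symmetric]\<close>)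
  then have "(\<Sum>b\<in>B. l (x \<otimes> b)) = (\<Sum>b\<in>B. l b)"
    by (rule sum.reindex_bij_betw)
  moreover have "(\<Sum>b\<in>B. l (x \<otimes> b)) = l x * (\<Sum>b\<in>B. l b)"
    unfolding sum_distrib_left using B x by (intro sum.cong refl chars_mult[OF l]) auto
  ultimately have "l x * (\<Sum>b\<in>B. l b) = (\<Sum>b\<in>B. l b)" by simp
  then have "(l x - 1) * (\<Sum>b\<in>B. l b) = 0" by (simp add: left_diff_distrib)
  then show ?thesis using x by simp
qed

text \<open>Extends \<open>c\<close> from \<open>H\<close> to the subgroup generated by
  \<open>H\<close> and \<open>x\<close>. With \<open>n\<close> the least exponent bringing
  \<open>x\<close> into \<open>H\<close>, every n-th root \<open>r\<close> of c(x^n) may be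
  prescribed as the value at \<open>x\<close>; this freedom is what produces separating
  characters.\<close>

lemma extend_char_step:
  assumes H: "subgroup H G" "H \<subseteq> A" and c: "c \<in> chars G H" and x: "x \<in> A"
    and n: "n > 0" "x [^] n \<in> H" "\<And>m. 0 < m \<Longrightarrow> m < n \<Longrightarrow> x [^] m \<notin> H"
    and r: "r ^ n = c (x [^] n)"
  obtains K c' where "subgroup K G" "K \<subseteq> A" "H \<subseteq> K" "x \<in> K" "c' \<in> chars G K"
    "\<And>h. h \<in> H \<Longrightarrow> c' h = c h" "c' x = r"
proof -
  interpret H: finite_abelian_subgroup G H using subgroup_abelian H by blast
  have xG: "x \<in> carrier G" and hG: "\<And>h. h \<in> H \<Longrightarrow> h \<in> carrier G" using x H by auto
  define K where "K = {h \<otimes> x [^] i | h (i::nat). h \<in> H}"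
  \<comment> \<open>By minimality of \<open>n\<close>, a power of \<open>x\<close> lies in
    \<open>H\<close> only if its exponent is a multiple of \<open>n\<close>, so the single equation
    for \<open>n\<close> settles all of them.\<close>
  have xHn: "r ^ m = c (x [^] m)" if "x [^] m \<in> H" for m :: nat
  proof -
    have "x [^] m = (x [^] n) [^] (m div n) \<otimes> x [^] (m mod n)"
      using xG by (simp add: nat_pow_pow nat_pow_mult)
    then have "x [^] (m mod n) = inv ((x [^] n) [^] (m div n)) \<otimes> x [^] m"
      using xG by (simp add: m_assoc[symmetric])
    then have "x [^] (m mod n) \<in> H" using that n(2) by simp
    then have "m mod n = 0" using n(3)[of "m mod n"] n(1) by (metis mod_less_divisor neq0_conv)
    then have m: "m = n * (m div n)" by auto
    then have "r ^ m = (r ^ n) ^ (m div n)" by (metis power_mult)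
    also have "\<dots> = c ((x [^] n) [^] (m div n))" using r n(2) by (simp add: H.chars_pow[OF c])
    also have "(x [^] n) [^] (m div n) = x [^] m" using xG m by (metis nat_pow_pow)
    finally show ?thesis .
  qed
  have wd_le: "c h * r ^ i = c h' * r ^ j" if "h \<in> H" "h' \<in> H" "h \<otimes> x [^] i = h' \<otimes> x [^] j" "i \<le> j"
    for h h' and i j :: nat
  proof -
    have "h \<otimes> x [^] i = (h' \<otimes> x [^] (j - i)) \<otimes> x [^] i"
      using that xG hG by (simp add: m_assoc nat_pow_mult)
    then have h: "h = h' \<otimes> x [^] (j - i)" using that xG hG by simp
    then have "x [^] (j - i) = inv h' \<otimes> h" using that xG hG by (simp add: m_assoc[symmetric])
    then have mem: "x [^] (j - i) \<in> H" using that by simp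
    then have "c h = c h' * r ^ (j - i)" using h that by (simp add: chars_mult[OF c] xHn)
    then show ?thesis using that(4) by (simp add: power_add[symmetric])
  qed
  have wd: "c h * r ^ i = c h' * r ^ j" if "h \<in> H" "h' \<in> H" "h \<otimes> x [^] i = h' \<otimes> x [^] j"
    for h h' and i j :: nat
    using wd_le[of h h' i j] wd_le[of h' h j i] that by (cases "i \<le> j") auto
  \<comment> \<open>The value is read off from any expression h x^i; by \<open>wd\<close> the choice
    makes no difference.\<close>
  define c' where "c' y = (if y \<in> K then (SOME v. \<exists>h (i::nat). h \<in> H \<and> y = h \<otimes> x [^] i \<and> v = c h * r ^ i) else 0)" for y
  have c': "c' (h \<otimes> x [^] i) = c h * r ^ i" if "h \<in> H" for h and i :: nat
  proof -
    have "h \<otimes> x [^] i \<in> K" using that K_def by blast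
    moreover have "(SOME v. \<exists>h' (j::nat). h' \<in> H \<and> h \<otimes> x [^] i = h' \<otimes> x [^] j \<and> v = c h' * r ^ j) = c h * r ^ i"
    proof (rule some_equality)
      show "\<exists>h' j. h' \<in> H \<and> h \<otimes> x [^] i = h' \<otimes> x [^] (j::nat) \<and> c h * r ^ i = c h' * r ^ j"
        using that by (intro exI conjI) (rule that refl)+
    next
      fix v assume "\<exists>h' j. h' \<in> H \<and> h \<otimes> x [^] i = h' \<otimes> x [^] (j::nat) \<and> v = c h' * r ^ j"
      then obtain h' and j :: nat where "h' \<in> H" "h \<otimes> x [^] i = h' \<otimes> x [^] j" "v = c h' * r ^ j"
        by (elim exE conjE)
      then show "v = c h * r ^ i" using wd[OF that, of h' i j] by (simp only:)
    qed
    ultimately show ?thesis by (simp add: c'_def)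
  qed
  have mult: "(h \<otimes> x [^] i) \<otimes> (h' \<otimes> x [^] j) = (h \<otimes> h') \<otimes> x [^] (i + j)"
    if "h \<in> H" "h' \<in> H" for h h' and i j :: nat
  proof -
    have "x [^] i \<otimes> h' = h' \<otimes> x [^] i" using that x H by (intro commA) auto
    then show ?thesis using that xG hG
      by (metis (no_types, lifting) m_assoc m_closed nat_pow_closed nat_pow_mult)
  qed
  have K: "subgroup K G"
  proof (rule subgroupI)
    show "K \<subseteq> carrier G" unfolding K_def using xG hG by auto
    show "K \<noteq> {}" unfolding K_def using H.A_one by blast
    fix a assume "a \<in> K"
    then obtain h i where a: "h \<in> H" "a = h \<otimes> x [^] (i::nat)" unfolding K_def by blast
    have "a \<in> A" using a x H by auto
    \<comment> \<open>\<open>K\<close> was defined with natural exponents only, so inverses are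
      rewritten as positive powers.\<close>
    have "inv a = a [^] (card A - 1)"
    proof -
      have "a [^] (card A - 1) \<otimes> a = \<one>"
        using A_pow_card[OF \<open>a \<in> A\<close>] card_A_pos by (metis Suc_diff_1 nat_pow_Suc)
      then show ?thesis using \<open>a \<in> A\<close> by (metis A_carrier inv_equality nat_pow_closed)
    qed
    also have "\<dots> = h [^] (card A - 1) \<otimes> (x [^] i) [^] (card A - 1)"
      unfolding a(2) using a x H commA by (intro pow_mult_distrib) auto
    also have "(x [^] i) [^] (card A - 1) = x [^] (i * (card A - 1))" using xG by (simp add: nat_pow_pow)
    finally show "inv a \<in> K" unfolding K_def using a H.A_pow by blast
  next
    fix a b assume "a \<in> K" "b \<in> K"
    then show "a \<otimes> b \<in> K" unfolding K_def using mult H.A_closed by (smt (verit, best) mem_Collect_eq)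
  qed
  have "K \<subseteq> A" unfolding K_def using x H by auto
  moreover have "H \<subseteq> K"
  proof
    fix h assume h: "h \<in> H"
    then have "h = h \<otimes> x [^] (0::nat)" using hG by simp
    then show "h \<in> K" unfolding K_def using h by blast
  qed
  moreover have "x \<in> K"
  proof -
    have "x = \<one> \<otimes> x [^] (1::nat)" using xG by simp
    then show ?thesis unfolding K_def using H.A_one by blast
  qed
  moreover have ext: "c' h = c h" if "h \<in> H" for h
    using c'[OF that, of 0] that hG by simp
  moreover have "c' x = r"
    using c'[OF H.A_one, of 1] xG by (simp add: chars_one[OF c])
  moreover have "c' \<in> chars G K"
  proof (rule charsI)
    fix a b assume "a \<in> K" "b \<in> K"
    then obtain h i h' j where "h \<in> H" "a = h \<otimes> x [^] (i::nat)" "h' \<in> H" "b = h' \<otimes> x [^] (j::nat)"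
      unfolding K_def by blast
    then show "c' (a \<otimes> b) = c' a * c' b"
      by (simp add: mult c' chars_mult[OF c] power_add)
  next
    show "c' \<one> = 1" using ext[OF H.A_one] chars_one[OF c] by simp
  qed (simp add: c'_def)
  ultimately show thesis using that K by blast
qed

lemma least_power_in_subgroup:
  assumes "subgroup H G" "x \<in> A"
  shows "\<exists>n::nat. n > 0 \<and> x [^] n \<in> H \<and> (\<forall>m. 0 < m \<longrightarrow> m < n \<longrightarrow> x [^] m \<notin> H)"
proof -
  let ?P = "\<lambda>n::nat. n > 0 \<and> x [^] n \<in> H"
  have "?P (card A)" using assms A_pow_card card_A_pos subgroup.one_closed by simp
  then have "?P (LEAST n. ?P n)" by (rule LeastI)
  moreover have "\<not> ?P m" if "m < (LEAST n. ?P n)" for m using not_less_Least[OF that] .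
  ultimately show ?thesis by blast
qed

text \<open>Induction on the number of missing elements. Each step adjoins one element outside
  \<open>H\<close>; the required root always exists because the value to be extracted is a root of
  unity.\<close>

lemma extend_char:
  assumes "subgroup H G" "H \<subseteq> A" "c \<in> chars G H"
  shows "\<exists>c'\<in>chars G A. \<forall>h\<in>H. c' h = c h"
  using assms
proof (induction "card A - card H" arbitrary: H c rule: less_induct)
  case less
  interpret H: finite_abelian_subgroup G H using subgroup_abelian less.prems by blast
  show ?case
  proof (cases "H = A")
    case True
    then show ?thesis using less.prems by auto
  next
    case False
    then obtain x where x: "x \<in> A" "x \<notin> H" using less.prems by blast
    obtain n :: nat where n: "n > 0" "x [^] n \<in> H" "\<And>m. 0 < m \<Longrightarrow> m < n \<Longrightarrow> x [^] m \<notin> H"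
      using least_power_in_subgroup[OF less.prems(1) x(1)] by metis
    have "c (x [^] n) ^ card H = 1" using H.chars_root less.prems(3) n(2) by blast
    then obtain k where "c (x [^] n) = zeta (card H) ^ k"
      using root_of_unity_eq_zeta_power[OF H.card_A_pos] by metis
    moreover have "zeta (card H * n) ^ n = zeta (card H)"
      using n(1) by (simp add: zeta_power) (simp add: zeta_def)
    ultimately have "(zeta (card H * n) ^ k) ^ n = c (x [^] n)"
      by (metis power_mult mult.commute)
    then obtain K c' where K: "subgroup K G" "K \<subseteq> A" "H \<subseteq> K" "x \<in> K" "c' \<in> chars G K"
      "\<And>h. h \<in> H \<Longrightarrow> c' h = c h"
      using extend_char_step[OF less.prems(1,2,3) x(1) n] by metis
    have "card H < card K" using K x finA by (metis finite_subset psubsetI psubset_card_mono)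
    moreover have "card K \<le> card A" using K finA card_mono by blast
    ultimately have "card A - card K < card A - card H" by simp
    then show ?thesis using less.hyps[of K c'] K by (metis subsetD)
  qed
qed

text \<open>Start from the trivial subgroup. There the least exponent \<open>n\<close> is the order
  of \<open>x\<close>, and \<open>zeta n\<close> is an admissible value at \<open>x\<close>; it
  differs from 1 because \<open>n\<close> does.\<close>

lemma chars_separate:
  assumes x: "x \<in> A" "x \<noteq> \<one>"
  shows "\<exists>l\<in>chars G A. l x \<noteq> 1"
proof -
  have H: "subgroup {\<one>} G" "{\<one>} \<subseteq> A" using triv_subgroup by auto
  interpret H: finite_abelian_subgroup G "{\<one>}" using subgroup_abelian H by blast
  obtain n :: nat where n: "n > 0" "x [^] n \<in> {\<one>}" "\<And>m. 0 < m \<Longrightarrow> m < n \<Longrightarrow> x [^] m \<notin> {\<one>}"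
    using least_power_in_subgroup[OF H(1) x(1)] by metis
  have "n \<noteq> 1" using n(2) x by (auto simp: nat_pow_eone)
  define c where "c y = (if y = \<one> then 1 else 0 :: complex)" for y
  have "c \<in> chars G {\<one>}" by (auto simp: chars_def c_def)
  moreover have "zeta n ^ n = c (x [^] n)" using n zeta_power_d by (simp add: c_def)
  ultimately obtain K c' where K: "subgroup K G" "K \<subseteq> A" "x \<in> K" "c' \<in> chars G K" "c' x = zeta n"
    using extend_char_step[OF H _ x(1) n] by metis
  obtain l where "l \<in> chars G A" "l x = zeta n" using extend_char[OF K(1,2,4)] K by metis
  moreover have "zeta n \<noteq> 1" using zeta_power_eq_1_iff[OF n(1), of 1] \<open>n \<noteq> 1\<close> by simp
  ultimately show ?thesis by metis
qed

lemma sum_over_chars_ne: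
  assumes x: "x \<in> A" "x \<noteq> \<one>"
  shows "(\<Sum>l\<in>chars G A. l x) = 0"
proof -
  obtain m where m: "m \<in> chars G A" "m x \<noteq> 1" using chars_separate[OF x] by blast
  have "bij_betw (\<lambda>l y. m y * l y) (chars G A) (chars G A)"
  proof (rule bij_betwI[where g = "\<lambda>l y. inverse (m y) * l y"])
    show "(\<lambda>l y. m y * l y) \<in> chars G A \<rightarrow> chars G A" using chars_times m by blast
    show "(\<lambda>l y. inverse (m y) * l y) \<in> chars G A \<rightarrow> chars G A"
      using chars_times[OF chars_inverse[OF m(1)]] by blast
    fix l assume l: "l \<in> chars G A"
    show "(\<lambda>y. inverse (m y) * (m y * l y)) = l"
    proof
      fix y show "inverse (m y) * (m y * l y) = l y"
        using chars_nonzero[OF m(1), of y] chars_out[OF l, of y] by (cases "y \<in> A") auto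
    qed
    show "(\<lambda>y. m y * (inverse (m y) * l y)) = l"
    proof
      fix y show "m y * (inverse (m y) * l y) = l y"
        using chars_nonzero[OF m(1), of y] chars_out[OF l, of y] by (cases "y \<in> A") auto
    qed
  qed
  then have "(\<Sum>l\<in>chars G A. m x * l x) = (\<Sum>l\<in>chars G A. l x)"
    by (rule sum.reindex_bij_betw)
  then have "(m x - 1) * (\<Sum>l\<in>chars G A. l x) = 0"
    by (simp add: sum_distrib_left[symmetric] left_diff_distrib)
  then show ?thesis using m by simp
qed

text \<open>Summing l x over all x in A and all characters l in both orders gives the two
  cardinalities: only x = 1 contributes in one order, only the trivial character in the
  other.\<close>

lemma card_chars: "card (chars G A) = card A"
proof -
  let ?t = "\<lambda>x. if x \<in> A then 1 else 0 :: complex"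
  have "(\<Sum>x\<in>A. \<Sum>l\<in>chars G A. l x) = (\<Sum>x\<in>A. if x = \<one> then of_nat (card (chars G A)) else 0)"
    by (intro sum.cong) (auto simp: sum_over_chars_ne chars_one)
  also have "\<dots> = of_nat (card (chars G A))" using finA by simp
  finally have 1: "(\<Sum>x\<in>A. \<Sum>l\<in>chars G A. l x) = of_nat (card (chars G A))" .
  have "(\<Sum>x\<in>A. l x) = (if l = ?t then of_nat (card A) else 0)" if l: "l \<in> chars G A" for l
  proof (cases "l = ?t")
    case False
    then obtain x where "l x \<noteq> ?t x" by auto
    then have "x \<in> A" "l x \<noteq> 1" using chars_out[OF l] by (auto split: if_splits)
    then show ?thesis using sum_char_eq_0[OF l subA] False by simp
  qed simp
  then have "(\<Sum>l\<in>chars G A. \<Sum>x\<in>A. l x) = (\<Sum>l\<in>chars G A. if l = ?t then of_nat (card A) else 0)"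
    by (intro sum.cong) auto
  also have "\<dots> = of_nat (card A)" using finite_chars chars_trivial by simp
  finally have "of_nat (card (chars G A)) = (of_nat (card A) :: complex)"
    using 1 sum.swap[of "\<lambda>x l. l x" "chars G A" A] by simp
  then show ?thesis by simp
qed

lemma sum_over_chars: "(\<Sum>l\<in>chars G A. l x) = (if x = \<one> then of_nat (card A) else 0)"
proof (cases "x \<in> A")
  case False
  then have "(\<Sum>l\<in>chars G A. l x) = 0" by (intro sum.neutral) (simp add: chars_out)
  then show ?thesis using False by auto
qed (auto simp: sum_over_chars_ne chars_one card_chars)

text \<open>The same double count with x restricted to \<open>B\<close>: the inner sum over
  \<open>B\<close> is the order of \<open>B\<close> for characters trivial on \<open>B\<close> and
  zero for all others.\<close>

lemma card_chars_trivial_on: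
  assumes B: "subgroup B G" "B \<subseteq> A"
  shows "card {l \<in> chars G A. \<forall>b\<in>B. l b = 1} * card B = card A"
proof -
  have finB: "finite B" using B finA finite_subset by blast
  have "(\<Sum>b\<in>B. l b) = (if \<forall>b\<in>B. l b = 1 then of_nat (card B) else 0)" if "l \<in> chars G A" for l
    using sum_char_eq_0[OF that B] by auto
  then have "(\<Sum>l\<in>chars G A. \<Sum>b\<in>B. l b)
      = (\<Sum>l\<in>chars G A. if \<forall>b\<in>B. l b = 1 then of_nat (card B) else 0)"
    by (intro sum.cong) auto
  also have "\<dots> = (\<Sum>l\<in>{l \<in> chars G A. \<forall>b\<in>B. l b = 1}. of_nat (card B))"
    using finite_chars by (rule sum.inter_filter[symmetric])
  finally have "(\<Sum>l\<in>chars G A. \<Sum>b\<in>B. l b)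
      = of_nat (card {l \<in> chars G A. \<forall>b\<in>B. l b = 1} * card B)" by simp
  moreover have "(\<Sum>b\<in>B. \<Sum>l\<in>chars G A. l b) = of_nat (card A)"
    unfolding sum_over_chars using finB subgroup.one_closed[OF B(1)] by simp
  ultimately have "(of_nat (card {l \<in> chars G A. \<forall>b\<in>B. l b = 1} * card B) :: complex) = of_nat (card A)"
    using sum.swap[of "\<lambda>b l. l b" "chars G A" B] by simp
  then show ?thesis using of_nat_eq_iff by blast
qed

lemma char_order:
  assumes l: "l \<in> chars G A"
  shows "char_order A l > 0" "x \<in> A \<Longrightarrow> l x ^ char_order A l = 1"
    and "(\<forall>x\<in>A. l x ^ m = 1) \<longleftrightarrow> char_order A l dvd m"
proof -
  let ?P = "\<lambda>d. d > 0 \<and> (\<forall>x\<in>A. l x ^ d = 1)"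
  have "?P (card A)" using card_A_pos chars_root[OF l] by blast
  then have P: "?P (char_order A l)" unfolding char_order_def by (rule LeastI)
  then show "char_order A l > 0" "x \<in> A \<Longrightarrow> l x ^ char_order A l = 1" by auto
  show "(\<forall>x\<in>A. l x ^ m = 1) \<longleftrightarrow> char_order A l dvd m"
  proof
    assume *: "\<forall>x\<in>A. l x ^ m = 1"
    let ?d = "char_order A l"
    have "l x ^ (m mod ?d) = 1" if "x \<in> A" for x
    proof -
      have "l x ^ m = (l x ^ ?d) ^ (m div ?d) * l x ^ (m mod ?d)"
        by (metis mult_div_mod_eq power_add power_mult)
      then show ?thesis using * P that by simp
    qed
    moreover have "\<not> ?P (m mod ?d)"
      using not_less_Least[of "m mod ?d" ?P] P unfolding char_order_def by simp
    ultimately show "?d dvd m" by auto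
  next
    assume "char_order A l dvd m"
    then show "\<forall>x\<in>A. l x ^ m = 1" using P by (auto elim!: dvdE simp: power_mult)
  qed
qed

lemma char_value_zeta:
  assumes l: "l \<in> chars G A" and x: "x \<in> A"
  obtains k where "l x = zeta (char_order A l) ^ k"
  using root_of_unity_eq_zeta_power[OF char_order(1)[OF l] char_order(2)[OF l x]] by metis

text \<open>Some value of \<open>l\<close> has the full order p^(e+1), since otherwise p^e would
  already annihilate all values. That value is zeta^k with k prime to p, and inverting k modulo the
  order gives a power of the argument whose value is zeta itself.\<close>

lemma char_order_prime_power:
  assumes p: "prime p" and A: "card A = p ^ E" and l: "l \<in> chars G A" and nt: "\<exists>x\<in>A. l x \<noteq> 1"
  obtains e x where "char_order A l = p ^ Suc e" "x \<in> A" "l x = zeta (p ^ Suc e)"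
proof -
  have "char_order A l dvd p ^ E" using char_order(3)[OF l] chars_root[OF l] A by metis
  then obtain i where i: "char_order A l = p ^ i" using divides_primepow_nat[OF p] by blast
  have "i \<noteq> 0"
  proof
    assume "i = 0"
    then show False using nt char_order(2)[OF l] i by auto
  qed
  then obtain e where e: "i = Suc e" using not0_implies_Suc by blast
  have d0: "p ^ Suc e > 0" "p > 0" using p prime_gt_0_nat by auto
  have "\<not> p ^ Suc e dvd p ^ e" using prime_gt_1_nat[OF p] by (auto dest: dvd_imp_le)
  then obtain y where y: "y \<in> A" "l y ^ (p ^ e) \<noteq> 1" using char_order(3)[OF l, of "p ^ e"] i e by auto
  obtain k where k: "l y = zeta (p ^ Suc e) ^ k" using char_value_zeta[OF l y(1)] i e by metis
  have "\<not> p dvd k"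
  proof
    assume "p dvd k"
    then have "p ^ Suc e dvd k * p ^ e" by (simp add: mult_dvd_mono)
    then show False using y k zeta_power_eq_1_iff[OF d0(1), of "k * p ^ e"] by (simp add: power_mult)
  qed
  then have "coprime k (p ^ Suc e)" using p
    by (metis coprime_commute coprime_power_right_iff prime_imp_coprime)
  then obtain j where "[k * j = 1] (mod p ^ Suc e)" using cong_solve_coprime_nat by (metis One_nat_def)
  then have "l (y [^] j) = zeta (p ^ Suc e) ^ 1"
    unfolding chars_pow[OF l y(1)] k power_mult[symmetric] using zeta_power_eq_iff[OF d0(1)] by blast
  then show thesis using that[of e "y [^] j"] i e y by simp
qed

end

section \<open>Group algebras of finite groups\<close>

lemma group_algebra_carrier:
  "finite (carrier G) \<Longrightarrow> f \<in> carrier (group_algebra G) \<longleftrightarrow> (\<forall>x. x \<notin> carrier G \<longrightarrow> f x = 0)"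
  by (auto simp: group_algebra_def intro: finite_subset)

lemma group_algebra_mult:
  assumes "group G" and fin: "finite (carrier G)"
    and f: "f \<in> carrier (group_algebra G)" and z: "z \<in> carrier G"
  shows "(f \<otimes>\<^bsub>group_algebra G\<^esub> g) z = (\<Sum>x\<in>carrier G. f x * g (inv\<^bsub>G\<^esub> x \<otimes>\<^bsub>G\<^esub> z))"
proof -
  have "(\<Sum>x | f x \<noteq> 0. f x * g (inv\<^bsub>G\<^esub> x \<otimes>\<^bsub>G\<^esub> z)) = (\<Sum>x\<in>carrier G. f x * g (inv\<^bsub>G\<^esub> x \<otimes>\<^bsub>G\<^esub> z))"
    using f fin by (intro sum.mono_neutral_left) (auto simp: group_algebra_def)
  then show ?thesis using z by (simp add: group_algebra_def)
qed

lemma (in group) bij_left_mult: "a \<in> carrier G \<Longrightarrow> bij_betw (\<lambda>x. a \<otimes> x) (carrier G) (carrier G)"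
  by (rule bij_betwI[where g = "\<lambda>x. inv a \<otimes> x"]) (auto simp: m_assoc[symmetric])

lemma (in group) bij_right_mult: "a \<in> carrier G \<Longrightarrow> bij_betw (\<lambda>x. x \<otimes> a) (carrier G) (carrier G)"
  by (rule bij_betwI[where g = "\<lambda>x. x \<otimes> inv a"]) (auto simp: m_assoc)

text \<open>A linear functional \<open>F\<close> evaluated on a product. Both the map to a quotient
  group algebra and the matrix entries are such functionals, so this is the common source of their
  multiplicativity.\<close>

lemma sum_convolution:
  fixes F :: "'a \<Rightarrow> 'c::field_char_0"
  assumes G: "group G" and fin: "finite (carrier G)"
    and f: "f \<in> carrier (group_algebra G)"
  shows "(\<Sum>z\<in>carrier G. of_rat ((f \<otimes>\<^bsub>group_algebra G\<^esub> g) z) * F z)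
    = (\<Sum>x\<in>carrier G. \<Sum>y\<in>carrier G. of_rat (f x) * of_rat (g y) * F (x \<otimes>\<^bsub>G\<^esub> y))"
proof -
  interpret group G by fact
  have "(\<Sum>z\<in>carrier G. of_rat ((f \<otimes>\<^bsub>group_algebra G\<^esub> g) z) * F z)
      = (\<Sum>z\<in>carrier G. \<Sum>x\<in>carrier G. of_rat (f x) * of_rat (g (inv\<^bsub>G\<^esub> x \<otimes>\<^bsub>G\<^esub> z)) * F z)"
    by (intro sum.cong refl)
      (simp add: group_algebra_mult[OF G fin f] of_rat_sum of_rat_mult sum_distrib_right)
  also have "\<dots> = (\<Sum>x\<in>carrier G. \<Sum>z\<in>carrier G. of_rat (f x) * of_rat (g (inv\<^bsub>G\<^esub> x \<otimes>\<^bsub>G\<^esub> z)) * F z)"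
    by (rule sum.swap)
  also have "\<dots> = (\<Sum>x\<in>carrier G. \<Sum>y\<in>carrier G. of_rat (f x) * of_rat (g y) * F (x \<otimes>\<^bsub>G\<^esub> y))"
  proof (rule sum.cong[OF refl])
    fix x assume x: "x \<in> carrier G"
    show "(\<Sum>z\<in>carrier G. of_rat (f x) * of_rat (g (inv\<^bsub>G\<^esub> x \<otimes>\<^bsub>G\<^esub> z)) * F z)
        = (\<Sum>y\<in>carrier G. of_rat (f x) * of_rat (g y) * F (x \<otimes>\<^bsub>G\<^esub> y))"
      by (subst sum.reindex_bij_betw[OF bij_left_mult[OF x], symmetric])
        (intro sum.cong refl, simp add: x m_assoc[symmetric])
  qed
  finally show ?thesis .
qed

lemma group_algebra_mult_closed:
  "finite (carrier G) \<Longrightarrow> f \<otimes>\<^bsub>group_algebra G\<^esub> g \<in> carrier (group_algebra G)"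
  by (subst group_algebra_carrier) (simp_all add: group_algebra_def)

text \<open>The linear extension of \<open>h\<close> to group algebras: coefficients are added up
  along the fibres of \<open>h\<close>.\<close>

definition push :: "('a \<Rightarrow> 'c) \<Rightarrow> ('a, 'b) monoid_scheme \<Rightarrow> ('a \<Rightarrow> rat) \<Rightarrow> 'c \<Rightarrow> rat" where
  "push h G f y = (\<Sum>x | x \<in> carrier G \<and> h x = y. f x)"

lemma push_hom:
  assumes G: "group G" and H: "group H" and fin: "finite (carrier G)" "finite (carrier H)"
    and h: "h \<in> hom G H"
    and f: "f \<in> carrier (group_algebra G)" and g: "g \<in> carrier (group_algebra G)"
  shows "push h G f \<in> carrier (group_algebra H)"
    and "push h G (f \<otimes>\<^bsub>group_algebra G\<^esub> g)
      = push h G f \<otimes>\<^bsub>group_algebra H\<^esub> push h G g"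
    and "push h G \<one>\<^bsub>group_algebra G\<^esub> = \<one>\<^bsub>group_algebra H\<^esub>"
proof -
  interpret h: group_hom G H h using G H h by (simp add: group_hom_def group_hom_axioms_def)
  show push: "push h G f \<in> carrier (group_algebra H)" for f
    using fin(2) by (subst group_algebra_carrier) (auto simp: push_def intro!: sum.neutral)
  have p: "push h G f y = (\<Sum>x\<in>carrier G. f x * (if h x = y then 1 else 0))" for f y
    unfolding push_def using fin(1) by (subst sum.inter_filter) (auto intro!: sum.cong)
  \<comment> \<open>Change of variables: pairing the pushed element with \<open>F\<close> is the
    same as pairing the original one with the composite of \<open>F\<close> and
    \<open>h\<close>.\<close>
  have p2: "(\<Sum>y\<in>carrier H. push h G f y * F y) = (\<Sum>x\<in>carrier G. f x * F (h x))" for f F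
  proof -
    have "(\<Sum>y\<in>carrier H. push h G f y * F y)
        = (\<Sum>y\<in>carrier H. \<Sum>x\<in>carrier G. f x * (if h x = y then 1 else 0) * F y)"
      by (simp add: p sum_distrib_right)
    also have "\<dots> = (\<Sum>x\<in>carrier G. \<Sum>y\<in>carrier H. f x * (if h x = y then 1 else 0) * F y)"
      by (rule sum.swap)
    also have "\<dots> = (\<Sum>x\<in>carrier G. f x * F (h x))"
    proof (rule sum.cong[OF refl])
      fix x assume x: "x \<in> carrier G"
      have "(\<Sum>y\<in>carrier H. f x * (if h x = y then 1 else 0) * F y)
          = (\<Sum>y\<in>carrier H. if h x = y then f x * F y else 0)"
        by (intro sum.cong) auto
      also have "\<dots> = f x * F (h x)" using fin(2) x by simp
      finally show "(\<Sum>y\<in>carrier H. f x * (if h x = y then 1 else 0) * F y) = f x * F (h x)" .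
    qed
    finally show ?thesis .
  qed
  show "push h G (f \<otimes>\<^bsub>group_algebra G\<^esub> g) = push h G f \<otimes>\<^bsub>group_algebra H\<^esub> push h G g"
  proof
    fix z
    let ?r = "push h G f \<otimes>\<^bsub>group_algebra H\<^esub> push h G g"
    show "push h G (f \<otimes>\<^bsub>group_algebra G\<^esub> g) z = ?r z"
    proof (cases "z \<in> carrier H")
      case True
      have "push h G (f \<otimes>\<^bsub>group_algebra G\<^esub> g) z
          = (\<Sum>x\<in>carrier G. \<Sum>y\<in>carrier G. f x * g y * (if h (x \<otimes>\<^bsub>G\<^esub> y) = z then 1 else 0))"
        unfolding p using sum_convolution[OF G fin(1) f, where 'c = rat, simplified] .
      also have "\<dots> = (\<Sum>x\<in>carrier G. \<Sum>y\<in>carrier G. f x * g y * (if h x \<otimes>\<^bsub>H\<^esub> h y = z then 1 else 0))"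
        by (intro sum.cong) auto
      also have "\<dots> = (\<Sum>x\<in>carrier G. f x * (\<Sum>y\<in>carrier G. g y * (if h x \<otimes>\<^bsub>H\<^esub> h y = z then 1 else 0)))"
        by (simp add: sum_distrib_left mult.assoc)
      also have "\<dots> = (\<Sum>x\<in>carrier G. f x * (\<Sum>y\<in>carrier H. push h G g y * (if h x \<otimes>\<^bsub>H\<^esub> y = z then 1 else 0)))"
        by (simp only: p2[where F = "\<lambda>y. if _ \<otimes>\<^bsub>H\<^esub> y = z then 1 else 0"])
      also have "\<dots> = (\<Sum>x\<in>carrier H. push h G f x * (\<Sum>y\<in>carrier H. push h G g y * (if x \<otimes>\<^bsub>H\<^esub> y = z then 1 else 0)))"
        by (simp only: p2[where F = "\<lambda>x. \<Sum>y\<in>carrier H. push h G g y * (if x \<otimes>\<^bsub>H\<^esub> y = z then 1 else 0)"])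
      also have "\<dots> = (\<Sum>x\<in>carrier H. \<Sum>y\<in>carrier H. push h G f x * push h G g y * (if x \<otimes>\<^bsub>H\<^esub> y = z then 1 else 0))"
        by (simp add: sum_distrib_left mult.assoc)
      also have "\<dots> = (\<Sum>y\<in>carrier H. ?r y * (if y = z then 1 else 0))"
        using sum_convolution[OF H fin(2) push, where 'c = rat, simplified, symmetric] .
      also have "\<dots> = (\<Sum>y\<in>carrier H. if y = z then ?r y else 0)" by (intro sum.cong) auto
      also have "\<dots> = ?r z" using fin(2) True by simp
      finally show ?thesis .
    next
      case False
      then show ?thesis using push[of "f \<otimes>\<^bsub>group_algebra G\<^esub> g"]
          group_algebra_mult_closed[OF fin(2), of "push h G f" "push h G g"]
        by (simp add: group_algebra_carrier fin)
    qed
  qed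
  show "push h G \<one>\<^bsub>group_algebra G\<^esub> = \<one>\<^bsub>group_algebra H\<^esub>"
  proof
    fix y
    have "push h G \<one>\<^bsub>group_algebra G\<^esub> y = (\<Sum>x\<in>carrier G. if x = \<one>\<^bsub>G\<^esub> then (if h x = y then 1 else 0) else 0)"
      unfolding p by (intro sum.cong) (auto simp: group_algebra_def)
    also have "\<dots> = (if h \<one>\<^bsub>G\<^esub> = y then 1 else 0)" using fin(1) by simp
    also have "\<dots> = \<one>\<^bsub>group_algebra H\<^esub> y" by (auto simp: group_algebra_def)
    finally show "push h G \<one>\<^bsub>group_algebra G\<^esub> y = \<one>\<^bsub>group_algebra H\<^esub> y" .
  qed
qed

section \<open>Splitting off the characters nontrivial on a normal subgroup\<close>

lemma coprime_root_of_unity: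
  fixes z :: complex
  assumes "coprime a b" "z ^ a = 1" "z ^ b = 1"
  shows "z = 1"
proof (cases "a = 0")
  case True
  then show ?thesis using assms by simp
next
  case False
  obtain x y where "a * x = b * y + 1" using coprime_bezout_strong[of a b] bezout_nat[OF False, of b] assms(1)
    by (metis coprime_imp_gcd_eq_1)
  then have "z ^ (a * x) = z ^ (b * y) * z" by simp
  then show ?thesis using assms by (simp add: power_mult)
qed

text \<open>The exponents \<open>k\<close> prime to \<open>p\<close> in \<open>free\<close> play the
  role of Galois automorphisms, since all values of characters of \<open>A\<close> are roots of
  unity of \<open>p\<close>-power order. The transversal \<open>t\<close> of the left cosets of
  \<open>A\<close> is indexed by numbers below \<open>n\<close> so that it can index matrix rows and
  columns.\<close>

locale induced_characters = finite_abelian_subgroup G A for G (structure) and A +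
  fixes N :: "'a set" and p E n :: nat and t :: "nat \<Rightarrow> 'a"
  assumes finG: "finite (carrier G)"
    and normA: "\<And>g x. g \<in> carrier G \<Longrightarrow> x \<in> A \<Longrightarrow> inv g \<otimes> x \<otimes> g \<in> A"
    and N: "subgroup N G" "N \<subseteq> A"
    and normN: "\<And>g x. g \<in> carrier G \<Longrightarrow> x \<in> N \<Longrightarrow> inv g \<otimes> x \<otimes> g \<in> N"
    and p: "prime p" and cardA: "card A = p ^ E"
    and t_carrier [simp]: "\<And>i. i < n \<Longrightarrow> t i \<in> carrier G"
    and transversal: "\<And>g. g \<in> carrier G \<Longrightarrow> \<exists>!i. i < n \<and> inv (t i) \<otimes> g \<in> A"
    and free: "\<And>l g k. l \<in> chars G A \<Longrightarrow> \<exists>x\<in>N. l x \<noteq> 1 \<Longrightarrow> g \<in> carrier G \<Longrightarrow> coprime k p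
      \<Longrightarrow> (\<And>x. x \<in> A \<Longrightarrow> l (inv g \<otimes> x \<otimes> g) ^ k = l x) \<Longrightarrow> g \<in> A"
begin

definition X :: "('a \<Rightarrow> complex) set" where
  "X = {l \<in> chars G A. \<exists>x\<in>N. l x \<noteq> 1}"

text \<open>Conjugation by \<open>g\<close> combined with the Galois automorphism that raises roots
  of unity to the power \<open>k\<close>. Without the explicit 0 outside \<open>A\<close>, the
  exponent 0 would give the value 1 there.\<close>

definition act :: "'a \<Rightarrow> nat \<Rightarrow> ('a \<Rightarrow> complex) \<Rightarrow> 'a \<Rightarrow> complex" where
  "act g k l = (\<lambda>x. if x \<in> A then l (inv g \<otimes> x \<otimes> g) ^ k else 0)"

definition cls :: "('a \<Rightarrow> complex) \<Rightarrow> ('a \<Rightarrow> complex) set" where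
  "cls l = {act g k l | g k. g \<in> carrier G \<and> coprime k p}"

definition R :: "('a \<Rightarrow> complex) set" where
  "R = (\<lambda>c. SOME l. l \<in> c) ` cls ` X"

text \<open>For \<open>d\<close> a positive power of \<open>p\<close>, these exponents represent the
  Galois group of Q(zeta_d).\<close>

definition K :: "nat \<Rightarrow> nat set" where
  "K d = {k. k < d \<and> coprime k p}"

abbreviation cord :: "('a \<Rightarrow> complex) \<Rightarrow> nat" where
  "cord \<equiv> char_order A"

lemma X_chars: "l \<in> X \<Longrightarrow> l \<in> chars G A"
  by (simp add: X_def)

lemma conj_mem_iff:
  assumes "g \<in> carrier G" "x \<in> carrier G"
  shows "inv g \<otimes> x \<otimes> g \<in> A \<longleftrightarrow> x \<in> A"
proof
  assume "inv g \<otimes> x \<otimes> g \<in> A"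
  then have "inv (inv g) \<otimes> (inv g \<otimes> x \<otimes> g) \<otimes> inv g \<in> A"
    by (rule normA[OF inv_closed[OF assms(1)]])
  also have "inv (inv g) \<otimes> (inv g \<otimes> x \<otimes> g) \<otimes> inv g = x"
    using assms by (simp add: m_assoc) (simp add: m_assoc[symmetric])
  finally show "x \<in> A" .
next
  show "x \<in> A \<Longrightarrow> inv g \<otimes> x \<otimes> g \<in> A" using normA assms by blast
qed

lemma coprime_pos: "coprime k p \<Longrightarrow> k > 0"
  using p by (cases k) auto

lemma act_apply:
  assumes "l \<in> chars G A" "g \<in> carrier G" "x \<in> carrier G" "coprime k p"
  shows "act g k l x = l (inv g \<otimes> x \<otimes> g) ^ k"
  using assms conj_mem_iff[of g x] coprime_pos[of k] chars_out[OF assms(1)]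
  by (auto simp: act_def)

lemma act_chars:
  assumes l: "l \<in> chars G A" and g: "g \<in> carrier G"
  shows "act g k l \<in> chars G A"
proof (rule charsI)
  fix x y assume xy: "x \<in> A" "y \<in> A"
  have "inv g \<otimes> (x \<otimes> y) \<otimes> g = (inv g \<otimes> x \<otimes> g) \<otimes> (inv g \<otimes> y \<otimes> g)"
    using g xy by (simp add: m_assoc) (simp add: m_assoc[symmetric])
  then show "act g k l (x \<otimes> y) = act g k l x * act g k l y"
    using xy g by (simp add: act_def chars_mult[OF l] normA power_mult_distrib)
next
  show "act g k l \<one> = 1" using g by (simp add: act_def chars_one[OF l])
qed (simp add: act_def)

lemma act_X:
  assumes l: "l \<in> X" and g: "g \<in> carrier G" and k: "coprime k p"
  shows "act g k l \<in> X"
proof -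
  obtain x where x: "x \<in> N" "l x \<noteq> 1" using l by (auto simp: X_def)
  then have xA: "x \<in> A" using N by blast
  have "inv (inv g) \<otimes> x \<otimes> inv g \<in> N" using x g by (intro normN) auto
  then have y: "g \<otimes> x \<otimes> inv g \<in> N" using g by simp
  have "inv g \<otimes> (g \<otimes> x \<otimes> inv g) \<otimes> g = x"
    using g xA by (simp add: m_assoc) (simp add: m_assoc[symmetric])
  then have "act g k l (g \<otimes> x \<otimes> inv g) = l x ^ k" using y N by (auto simp: act_def)
  moreover have "l x ^ k \<noteq> 1"
  proof
    assume "l x ^ k = 1"
    moreover have "l x ^ (p ^ E) = 1" using chars_root[OF X_chars[OF l] xA] cardA by simp
    ultimately show False using coprime_root_of_unity[of k "p ^ E" "l x"] k x(2) by simp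
  qed
  ultimately have "act g k l (g \<otimes> x \<otimes> inv g) \<noteq> 1" by simp
  then show ?thesis using act_chars[OF X_chars[OF l] g] y unfolding X_def by blast
qed

lemma act_act:
  assumes l: "l \<in> chars G A" and g: "g \<in> carrier G" "h \<in> carrier G"
  shows "act g k (act h j l) = act (g \<otimes> h) (j * k) l"
proof
  fix x show "act g k (act h j l) x = act (g \<otimes> h) (j * k) l x"
  proof (cases "x \<in> A")
    case True
    then have "inv h \<otimes> (inv g \<otimes> x \<otimes> g) \<otimes> h = inv (g \<otimes> h) \<otimes> x \<otimes> (g \<otimes> h)"
      using g by (simp add: inv_mult_group m_assoc)
    then show ?thesis using True normA g by (simp add: act_def power_mult)
  qed (simp add: act_def)
qed

lemma act_cong:
  assumes l: "l \<in> chars G A" and g: "g \<in> carrier G" and "[k = j] (mod cord l)"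
  shows "act g k l = act g j l"
proof
  fix x
  have "l y ^ k = l y ^ j" if "y \<in> A" for y
  proof -
    obtain i where i: "l y = zeta (cord l) ^ i" using char_value_zeta[OF l \<open>y \<in> A\<close>] .
    have "[i * k = i * j] (mod cord l)" using assms(3) by (rule cong_scalar_left)
    then show ?thesis using zeta_power_eq_iff[OF char_order(1)[OF l]]
      by (simp add: i power_mult[symmetric])
  qed
  then show "act g k l x = act g j l x" using normA g by (simp add: act_def)
qed

lemma act_one: "l \<in> chars G A \<Longrightarrow> act \<one> 1 l = l"
  using chars_out[of l G A] by (auto simp: act_def)

lemma act_in_A:
  assumes l: "l \<in> chars G A" and g: "g \<in> carrier G" and a: "a \<in> A"
  shows "act (g \<otimes> a) k l = act g k l"
proof
  fix x
  have "inv (g \<otimes> a) \<otimes> x \<otimes> (g \<otimes> a) = inv g \<otimes> x \<otimes> g" if x: "x \<in> A"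
  proof -
    have "inv (g \<otimes> a) \<otimes> x \<otimes> (g \<otimes> a) = inv a \<otimes> ((inv g \<otimes> x \<otimes> g) \<otimes> a)"
      using g a x by (simp add: inv_mult_group m_assoc)
    also have "(inv g \<otimes> x \<otimes> g) \<otimes> a = a \<otimes> (inv g \<otimes> x \<otimes> g)" using normA[OF g x] a by (rule commA)
    finally show ?thesis using g a x by (simp add: m_assoc[symmetric])
  qed
  then show "act (g \<otimes> a) k l x = act g k l x" by (simp add: act_def)
qed

lemma ord_p_power:
  assumes "l \<in> X"
  obtains e x where "cord l = p ^ Suc e" "x \<in> A" "l x = zeta (cord l)"
proof -
  have "\<exists>x\<in>A. l x \<noteq> 1" using assms N unfolding X_def by blast
  from char_order_prime_power[OF p cardA X_chars[OF assms] this] that show thesis by metis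
qed

lemma exists_inverse_exponent:
  assumes l: "l \<in> X" and k: "coprime k p"
  obtains j where "coprime j p" "[k * j = 1] (mod cord l)"
proof -
  obtain e where e: "cord l = p ^ Suc e" using ord_p_power[OF l] by metis
  have "coprime k (cord l)" using k e by simp
  then obtain j where j: "[k * j = 1] (mod cord l)" using cong_solve_coprime_nat by (metis One_nat_def)
  then have "coprime (k * j) (cord l)" using cong_imp_coprime[OF cong_sym[OF j]] by simp
  then have "coprime j p" using e by simp
  then show thesis using that j by blast
qed

lemma act_inverse:
  assumes l: "l \<in> X" and g: "g \<in> carrier G" and j: "[k * j = 1] (mod cord l)"
  shows "act (inv g) j (act g k l) = l"
  using act_act[OF X_chars[OF l], of "inv g" g j k] act_cong[OF X_chars[OF l] _ j, of \<one>] g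
    act_one[OF X_chars[OF l]] by simp

lemma cls_refl: "l \<in> X \<Longrightarrow> l \<in> cls l"
  unfolding cls_def using act_one[OF X_chars] by (metis (mono_tags, lifting) coprime_1_left mem_Collect_eq one_closed)

lemma cls_subset_X: "l \<in> X \<Longrightarrow> cls l \<subseteq> X"
  using act_X by (auto simp: cls_def)

lemma cls_trans:
  assumes l: "l \<in> X" and m: "m \<in> cls l"
  shows "cls m \<subseteq> cls l"
proof
  obtain h j where h: "h \<in> carrier G" "coprime j p" "m = act h j l" using m by (auto simp: cls_def)
  fix q assume "q \<in> cls m"
  then obtain g k where g: "g \<in> carrier G" "coprime k p" "q = act g k m" by (auto simp: cls_def)
  then have "q = act (g \<otimes> h) (j * k) l" using h act_act[OF X_chars[OF l]] by simp
  moreover have "coprime (j * k) p" using g h by simp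
  ultimately show "q \<in> cls l" using g h unfolding cls_def by blast
qed

lemma cls_sym:
  assumes l: "l \<in> X" and m: "m \<in> cls l"
  shows "l \<in> cls m"
proof -
  obtain h k where h: "h \<in> carrier G" "coprime k p" "m = act h k l" using m by (auto simp: cls_def)
  obtain j where j: "coprime j p" "[k * j = 1] (mod cord l)"
    using exists_inverse_exponent[OF l h(2)] .
  have "l = act (inv h) j m" using act_inverse[OF l h(1) j(2)] h(3) by simp
  then show ?thesis using h j unfolding cls_def by blast
qed

lemma cls_eq: "l \<in> X \<Longrightarrow> m \<in> cls l \<Longrightarrow> cls m = cls l"
  by (rule equalityI[OF cls_trans cls_trans]) (use cls_sym cls_subset_X in blast)+

lemma some_in_cls: "l \<in> X \<Longrightarrow> (SOME m. m \<in> cls l) \<in> cls l"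
  using cls_refl by (metis someI)

lemma R_subset_X: "R \<subseteq> X"
  using some_in_cls cls_subset_X by (auto simp: R_def)

lemma R_cover:
  assumes "m \<in> X"
  obtains l where "l \<in> R" "m \<in> cls l"
proof -
  define l where "l = (SOME l. l \<in> cls m)"
  have "l \<in> R" using assms by (auto simp: R_def l_def)
  moreover have "m \<in> cls l" using cls_sym[OF assms] some_in_cls[OF assms] by (simp add: l_def)
  ultimately show thesis using that by blast
qed

lemma R_unique:
  assumes "l \<in> R" "m \<in> R" "m \<in> cls l"
  shows "l = m"
proof -
  have rep: "\<exists>a. a \<in> X \<and> l = (SOME x. x \<in> cls a)" if lR: "l \<in> R" for l
  proof -
    obtain c where c: "l = (SOME x. x \<in> c)" "c \<in> cls ` X" using lR unfolding R_def by (rule imageE)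
    obtain a where a: "c = cls a" "a \<in> X" using c(2) by (rule imageE)
    show ?thesis by (rule exI[of _ a], rule conjI[OF a(2)], rule c(1)[unfolded a(1)])
  qed
  obtain a where a: "a \<in> X" "l = (SOME x. x \<in> cls a)" using rep[OF assms(1)] by (elim exE conjE)
  obtain b where b: "b \<in> X" "m = (SOME x. x \<in> cls b)" using rep[OF assms(2)] by (elim exE conjE)
  have "cls l = cls a" unfolding a(2) by (rule cls_eq[OF a(1) some_in_cls[OF a(1)]])
  moreover have "cls m = cls b" unfolding b(2) by (rule cls_eq[OF b(1) some_in_cls[OF b(1)]])
  moreover have "cls m = cls l" by (rule cls_eq[OF subsetD[OF R_subset_X assms(1)] assms(3)])
  ultimately have "cls a = cls b" by (simp only:)
  then show ?thesis by (simp only: a(2) b(2))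
qed

lemma finite_X: "finite X"
  using finite_chars by (simp add: X_def)

lemma finite_R: "finite R"
  using finite_X R_subset_X finite_subset by blast

lemma transversal_decomp:
  assumes "g \<in> carrier G"
  obtains i a where "i < n" "a \<in> A" "g = t i \<otimes> a"
proof -
  obtain i where i: "i < n" "inv (t i) \<otimes> g \<in> A" using transversal[OF assms] by blast
  have "g = t i \<otimes> (inv (t i) \<otimes> g)" using i assms by (simp add: m_assoc[symmetric])
  then show thesis using that i by blast
qed

lemma transversal_inj: "i < n \<Longrightarrow> j < n \<Longrightarrow> inv (t i) \<otimes> t j \<in> A \<Longrightarrow> i = j"
  using transversal[of "t j"] by (metis A_one l_inv t_carrier)

text \<open>Equality of the two twists means that inv (t j) t i maps \<open>l\<close> to a Galois
  conjugate of itself, so \<open>free\<close> puts it into \<open>A\<close> and the cosets agree.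
  Elements of \<open>A\<close> act trivially on \<open>A\<close> by conjugation, hence evaluating at
  an element where \<open>l\<close> takes the value zeta compares the exponents.\<close>

lemma act_inj:
  assumes l: "l \<in> X" and ij: "i < n" "j < n" and k: "k \<in> K (cord l)" "k' \<in> K (cord l)"
    and eq: "act (t i) k l = act (t j) k' l"
  shows "i = j \<and> k = k'"
proof -
  note lc = X_chars[OF l]
  obtain e x where e: "cord l = p ^ Suc e" "x \<in> A" "l x = zeta (cord l)" using ord_p_power[OF l] .
  have cop: "coprime k p" "coprime k' p" using k by (auto simp: K_def)
  obtain q where q: "coprime q p" "[k' * q = 1] (mod cord l)" using exists_inverse_exponent[OF l cop(2)] .
  let ?g = "inv (t j) \<otimes> t i"
  have g: "?g \<in> carrier G" using ij by simp
  have "act ?g (k * q) l = l"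
    using act_inverse[OF l _ q(2), of "t j"] act_act[OF lc, of "inv (t j)" "t i" q k] ij eq by simp
  then have *: "l (inv ?g \<otimes> y \<otimes> ?g) ^ (k * q) = l y" if "y \<in> A" for y
    using that by (auto simp: act_def dest: fun_cong[of _ _ y])
  have "?g \<in> A" by (rule free[of l ?g "k * q"]) (use l g cop q * in \<open>auto simp: X_def\<close>)
  then have "j = i" using transversal_inj ij by blast
  have "inv ?g \<otimes> x \<otimes> ?g = x" using \<open>?g \<in> A\<close> e(2) commA[of x ?g] by (simp add: m_assoc) (simp add: m_assoc[symmetric])
  then have "zeta (cord l) ^ (k * q) = zeta (cord l) ^ 1" using *[OF e(2)] e(3) by simp
  then have "[k * q = k' * q] (mod cord l)"
    using zeta_power_eq_iff[OF char_order(1)[OF lc]] q(2) by (metis cong_sym cong_trans)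
  moreover have "coprime q (cord l)" using q e by simp
  ultimately have "[k = k'] (mod cord l)" by (metis cong_mult_rcancel_nat coprime_commute)
  then have "k = k'" using k by (simp add: K_def cong_less_modulus_unique_nat)
  then show ?thesis using \<open>j = i\<close> by simp
qed

lemma cls_image:
  assumes l: "l \<in> X"
  shows "cls l = (\<lambda>(i, k). act (t i) k l) ` ({..<n} \<times> K (cord l))"
proof (rule equalityI; rule subsetI)
  fix m assume "m \<in> cls l"
  then obtain g k where g: "g \<in> carrier G" "coprime k p" "m = act g k l" by (auto simp: cls_def)
  obtain i a where i: "i < n" "a \<in> A" "g = t i \<otimes> a" using transversal_decomp[OF g(1)] .
  obtain e where e: "cord l = p ^ Suc e" using ord_p_power[OF l] by metis
  have "m = act (t i) (k mod cord l) l"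
    using g i act_in_A[OF X_chars[OF l]] act_cong[OF X_chars[OF l], of "t i" "k mod cord l" k] by simp
  moreover have "coprime k (cord l)" using g(2) e by simp
  then have "coprime (k mod cord l) (cord l)"
    using char_order(1)[OF X_chars[OF l]] by (metis coprime_mod_left_iff less_numeral_extra(3))
  then have "coprime (k mod cord l) p" unfolding e power_Suc by (metis coprime_mult_right_iff)
  then have "k mod cord l \<in> K (cord l)"
    using char_order(1)[OF X_chars[OF l]] by (simp add: K_def)
  ultimately show "m \<in> (\<lambda>(i, k). act (t i) k l) ` ({..<n} \<times> K (cord l))" using i by force
next
  fix m assume "m \<in> (\<lambda>(i, k). act (t i) k l) ` ({..<n} \<times> K (cord l))"
  then show "m \<in> cls l" unfolding cls_def K_def using t_carrier by fastforce
qed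

lemma card_cls: "l \<in> X \<Longrightarrow> card (cls l) = n * card (K (cord l))"
  unfolding cls_image by (subst card_image) (auto simp: inj_on_def card_cartesian_product dest: act_inj)

lemma ord_act:
  assumes l: "l \<in> X" and m: "m \<in> cls l"
  shows "cord m = cord l"
proof -
  have *: "cord m dvd cord l" if l: "l \<in> X" and m: "m \<in> cls l" for l m
  proof -
    obtain g k where g: "g \<in> carrier G" "coprime k p" "m = act g k l" using m by (auto simp: cls_def)
    have "m x ^ cord l = 1" if "x \<in> A" for x
    proof -
      have "m x ^ cord l = (l (inv g \<otimes> x \<otimes> g) ^ cord l) ^ k"
        using g that by (simp add: act_def power_mult[symmetric] mult.commute)
      then show ?thesis using char_order(2)[OF X_chars[OF l] normA[OF g(1) that]] by simp
    qed
    moreover have "m \<in> chars G A" using m l cls_subset_X X_chars by blast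
    ultimately show ?thesis using char_order(3) by blast
  qed
  show ?thesis using *[OF l m] *[OF _ cls_sym[OF l m]] m l cls_subset_X by (meson dvd_antisym subsetD)
qed

text \<open>The orbits are disjoint, \<open>act\<close> preserves the order, and by
  \<open>act_inj\<close> every orbit of order d has exactly one element for each pair of a coset and
  an exponent in \<open>K d\<close>.\<close>

lemma card_R_order:
  "card {m \<in> X. cord m = d} = n * card (K d) * card {l \<in> R. cord l = d}"
proof -
  have "{m \<in> X. cord m = d} = (\<Union>l\<in>{l \<in> R. cord l = d}. cls l)"
  proof (rule equalityI; rule subsetI)
    fix m assume m: "m \<in> {m \<in> X. cord m = d}"
    then obtain l where l: "l \<in> R" "m \<in> cls l" using R_cover by blast
    then have "cord m = cord l" using ord_act R_subset_X by blast
    then show "m \<in> (\<Union>l\<in>{l \<in> R. cord l = d}. cls l)" using m l by auto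
  next
    fix m assume "m \<in> (\<Union>l\<in>{l \<in> R. cord l = d}. cls l)"
    then obtain l where "l \<in> R" "cord l = d" "m \<in> cls l" by blast
    then show "m \<in> {m \<in> X. cord m = d}" using ord_act cls_subset_X R_subset_X by blast
  qed
  also have "card \<dots> = (\<Sum>l\<in>{l \<in> R. cord l = d}. card (cls l))"
  proof (rule card_UN_disjoint)
    show "finite {l \<in> R. cord l = d}" using finite_R by simp
    show "\<forall>l\<in>{l \<in> R. cord l = d}. finite (cls l)"
      using cls_subset_X R_subset_X finite_X finite_subset by blast
    show "\<forall>l\<in>{l \<in> R. cord l = d}. \<forall>m\<in>{l \<in> R. cord l = d}. l \<noteq> m \<longrightarrow> cls l \<inter> cls m = {}"
    proof (intro ballI impI)
      fix l m assume lm: "l \<in> {l \<in> R. cord l = d}" "m \<in> {l \<in> R. cord l = d}" "l \<noteq> m"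
      have "l = m" if "q \<in> cls l" "q \<in> cls m" for q
      proof -
        have "cls l = cls m" using that lm R_subset_X cls_eq by blast
        then show ?thesis using R_unique[of l m] lm R_subset_X cls_refl by blast
      qed
      then show "cls l \<inter> cls m = {}" using lm by blast
    qed
  qed
  also have "\<dots> = (\<Sum>l\<in>{l \<in> R. cord l = d}. n * card (K d))"
    using R_subset_X by (intro sum.cong) (auto simp: card_cls)
  finally show ?thesis by simp
qed

end

subsection \<open>Fourier analysis\<close>

lemma (in group) mult_inv_cancel_left:
  "x \<in> carrier G \<Longrightarrow> y \<in> carrier G \<Longrightarrow> x \<otimes> (inv x \<otimes> y) = y"
  "x \<in> carrier G \<Longrightarrow> y \<in> carrier G \<Longrightarrow> inv x \<otimes> (x \<otimes> y) = y"
  by (simp_all add: m_assoc[symmetric])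

context induced_characters
begin

lemma act_in_cls: "g \<in> carrier G \<Longrightarrow> coprime k p \<Longrightarrow> act g k l \<in> cls l"
  unfolding cls_def by blast

text \<open>The entry in row \<open>u\<close> and column \<open>v\<close> of the monomial
  representation induced from \<open>l\<close>, extended linearly to the group algebra.\<close>

definition L :: "('a \<Rightarrow> complex) \<Rightarrow> nat \<Rightarrow> nat \<Rightarrow> ('a \<Rightarrow> rat) \<Rightarrow> complex" where
  "L l u v f = (\<Sum>g\<in>carrier G. of_rat (f g) * l (inv (t u) \<otimes> g \<otimes> t v))"

lemma chars_mult_left:
  assumes l: "l \<in> chars G A" and a: "a \<in> A" and y: "y \<in> carrier G"
  shows "l (a \<otimes> y) = l a * l y"
proof (cases "y \<in> A")
  case True
  then show ?thesis using chars_mult[OF l a] by simp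
next
  case False
  have "a \<otimes> y \<notin> A"
  proof
    assume "a \<otimes> y \<in> A"
    then have "inv a \<otimes> (a \<otimes> y) \<in> A" by (rule A_closed[OF A_inv[OF a]])
    then show False using False a y by (simp add: m_assoc[symmetric])
  qed
  then show ?thesis using False by (simp add: chars_out[OF l])
qed

lemma chars_mult_right:
  assumes l: "l \<in> chars G A" and a: "a \<in> A" and y: "y \<in> carrier G"
  shows "l (y \<otimes> a) = l y * l a"
proof (cases "y \<in> A")
  case True
  then show ?thesis using chars_mult[OF l True a] by simp
next
  case False
  have "y \<otimes> a \<notin> A"
  proof
    assume "y \<otimes> a \<in> A"
    then have "(y \<otimes> a) \<otimes> inv a \<in> A" by (rule A_closed[OF _ A_inv[OF a]])
    then show False using False a y by (simp add: m_assoc)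
  qed
  then show ?thesis using False by (simp add: chars_out[OF l])
qed

text \<open>Only the index \<open>k\<close> for which \<open>v\<close> lies in the coset of
  \<open>t k\<close> contributes, and for that index the two arguments differ by an element of
  \<open>A\<close>. This is matrix multiplication for monomial matrices.\<close>

lemma transversal_sum:
  assumes l: "l \<in> chars G A" and u: "u \<in> carrier G" and v: "v \<in> carrier G"
  shows "(\<Sum>k<n. l (u \<otimes> t k) * l (inv (t k) \<otimes> v)) = l (u \<otimes> v)"
proof -
  obtain i where i: "i < n" "inv (t i) \<otimes> v \<in> A" using transversal[OF v] by blast
  have z: "l (inv (t k) \<otimes> v) = 0" if "k < n" "k \<noteq> i" for k
    using transversal[OF v] i that chars_out[OF l] by metis
  have "(\<Sum>k<n. l (u \<otimes> t k) * l (inv (t k) \<otimes> v)) = (\<Sum>k\<in>{i}. l (u \<otimes> t k) * l (inv (t k) \<otimes> v))"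
    by (rule sum.mono_neutral_right) (use i z in auto)
  also have "\<dots> = l ((u \<otimes> t i) \<otimes> (inv (t i) \<otimes> v))"
    using chars_mult_right[OF l i(2), of "u \<otimes> t i"] u i by simp
  also have "(u \<otimes> t i) \<otimes> (inv (t i) \<otimes> v) = u \<otimes> v"
    using u v i by (simp add: m_assoc) (simp add: m_assoc[symmetric])
  finally show ?thesis .
qed

lemma L_mult:
  assumes l: "l \<in> chars G A" and f: "f \<in> carrier (group_algebra G)" and uv: "u < n" "v < n"
  shows "L l u v (f \<otimes>\<^bsub>group_algebra G\<^esub> g) = (\<Sum>k<n. L l u k f * L l k v g)"
proof -
  have "(\<Sum>k<n. L l u k f * L l k v g)
    = (\<Sum>k<n. \<Sum>x\<in>carrier G. \<Sum>y\<in>carrier G. of_rat (f x) * of_rat (g y) *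
        (l ((inv (t u) \<otimes> x) \<otimes> t k) * l (inv (t k) \<otimes> (y \<otimes> t v))))"
    using uv by (intro sum.cong refl) (simp add: L_def sum_product m_assoc mult_ac)
  also have "\<dots> = (\<Sum>x\<in>carrier G. \<Sum>y\<in>carrier G. \<Sum>k<n. of_rat (f x) * of_rat (g y) *
        (l ((inv (t u) \<otimes> x) \<otimes> t k) * l (inv (t k) \<otimes> (y \<otimes> t v))))"
    by (subst sum.swap) (intro sum.cong refl sum.swap)
  also have "\<dots> = (\<Sum>x\<in>carrier G. \<Sum>y\<in>carrier G. of_rat (f x) * of_rat (g y) *
        l (inv (t u) \<otimes> (x \<otimes> y) \<otimes> t v))"
  proof (intro sum.cong refl)
    fix x y assume xy: "x \<in> carrier G" "y \<in> carrier G"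
    have "(inv (t u) \<otimes> x) \<otimes> (y \<otimes> t v) = inv (t u) \<otimes> (x \<otimes> y) \<otimes> t v"
      using xy uv by (simp add: m_assoc)
    then show "(\<Sum>k<n. of_rat (f x) * of_rat (g y) *
        (l ((inv (t u) \<otimes> x) \<otimes> t k) * l (inv (t k) \<otimes> (y \<otimes> t v))))
      = of_rat (f x) * of_rat (g y) * l (inv (t u) \<otimes> (x \<otimes> y) \<otimes> t v)"
      using transversal_sum[OF l, of "inv (t u) \<otimes> x" "y \<otimes> t v"] xy uv
      by (simp only: sum_distrib_left[symmetric]) simp
  qed
  also have "\<dots> = L l u v (f \<otimes>\<^bsub>group_algebra G\<^esub> g)"
    unfolding L_def by (rule sum_convolution[OF is_group finG f, symmetric])
  finally show ?thesis by simp
qed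

lemma L_one:
  assumes l: "l \<in> chars G A" and uv: "u < n" "v < n"
  shows "L l u v \<one>\<^bsub>group_algebra G\<^esub> = (if u = v then 1 else 0)"
proof -
  have "L l u v \<one>\<^bsub>group_algebra G\<^esub> = (\<Sum>g\<in>carrier G. if g = \<one> then l (inv (t u) \<otimes> g \<otimes> t v) else 0)"
    unfolding L_def by (intro sum.cong) (auto simp: group_algebra_def)
  also have "\<dots> = l (inv (t u) \<otimes> t v)" using finG uv by simp
  also have "\<dots> = (if u = v then 1 else 0)"
    using transversal_inj[OF uv] chars_out[OF l] chars_one[OF l] uv by auto
  finally show ?thesis .
qed

lemma L_add: "L l u v (\<lambda>z. f z + g z) = L l u v f + L l u v g"
  by (simp add: L_def of_rat_add distrib_right sum.distrib)

lemma L_smult: "L l u v (\<lambda>z. q * f z) = of_rat q * L l u v f"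
  by (simp add: L_def of_rat_mult sum_distrib_left mult.assoc)

lemma L_sum: "finite I \<Longrightarrow> L l u v (\<lambda>z. \<Sum>i\<in>I. f i z) = (\<Sum>i\<in>I. L l u v (f i))"
  by (induction I rule: finite_induct) (simp_all add: L_add, simp add: L_def)

lemma L_field:
  assumes l: "l \<in> X"
  shows "L l u v f \<in> cyclotomic_field (cord l)"
proof -
  obtain e where e: "cord l = p ^ Suc e" using ord_p_power[OF l] by metis
  note lc = X_chars[OF l]
  have "\<exists>P. l y = rpoly P (zeta (cord l))" for y
  proof (cases "y \<in> A")
    case True
    then obtain k where "l y = zeta (cord l) ^ k" using char_value_zeta[OF lc] by metis
    then have "l y = rpoly (monom 1 k) (zeta (cord l))" by simp
    then show ?thesis by blast
  next
    case False
    then have "l y = rpoly 0 (zeta (cord l))" using chars_out[OF lc] by simp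
    then show ?thesis by blast
  qed
  then obtain P where P: "\<And>y. l y = rpoly (P y) (zeta (cord l))" by metis
  have "L l u v f = rpoly (\<Sum>g\<in>carrier G. smult (f g) (P (inv (t u) \<otimes> g \<otimes> t v))) (zeta (cord l))"
    by (simp add: L_def P[symmetric])
  then show ?thesis unfolding e cyclotomic_field_eq[OF p] by blast
qed

text \<open>The vanishing is spread from the chosen representatives to every character of
  \<open>A\<close> and every coset, after which Fourier inversion on \<open>A\<close> recovers each
  coefficient of \<open>f\<close>.\<close>

lemma injectivity:
  assumes f: "f \<in> carrier (group_algebra G)"
    and L0: "\<And>l u v. l \<in> R \<Longrightarrow> u < n \<Longrightarrow> v < n \<Longrightarrow> L l u v f = 0"
    and N0: "\<And>g. g \<in> carrier G \<Longrightarrow> (\<Sum>x\<in>N. f (x \<otimes> g)) = 0"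
  shows "f = (\<lambda>x. 0)"
proof -
  let ?S = "\<lambda>m a b. \<Sum>g\<in>carrier G. of_rat (f g) * m (a \<otimes> g \<otimes> b)"
  \<comment> \<open>Arbitrary elements \<open>a\<close> and \<open>b\<close> replace transversal
    elements: the factors in \<open>A\<close> split off as scalars l (inv x) and l y.\<close>
  have S1: "?S l a b = 0" if l: "l \<in> R" and ab: "a \<in> carrier G" "b \<in> carrier G" for l a b
  proof -
    have lc: "l \<in> chars G A" using l R_subset_X X_chars by blast
    obtain u x where u: "u < n" "x \<in> A" "inv a = t u \<otimes> x" using transversal_decomp[of "inv a"] ab by auto
    obtain v y where v: "v < n" "y \<in> A" "b = t v \<otimes> y" using transversal_decomp[of b] ab by auto
    have a: "a = inv x \<otimes> inv (t u)"
      using u ab by (metis A_carrier inv_inv inv_mult_group t_carrier)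
    have "l (a \<otimes> g \<otimes> b) = l (inv x) * l (inv (t u) \<otimes> g \<otimes> t v) * l y" if g: "g \<in> carrier G" for g
    proof -
      have "a \<otimes> g \<otimes> b = (inv x \<otimes> (inv (t u) \<otimes> g \<otimes> t v)) \<otimes> y"
        using a v u g by (simp add: m_assoc)
      then show ?thesis using chars_mult_right[OF lc v(2)] chars_mult_left[OF lc, of "inv x"] u v g by simp
    qed
    then have "?S l a b = (\<Sum>g\<in>carrier G. (l (inv x) * l y) * (of_rat (f g) * l (inv (t u) \<otimes> g \<otimes> t v)))"
      by (intro sum.cong) (auto simp: mult_ac)
    also have "\<dots> = (l (inv x) * l y) * L l u v f" by (simp add: L_def sum_distrib_left)
    finally show ?thesis using L0[OF l u(1) v(1)] by simp
  qed
  \<comment> \<open>The sum is a rational polynomial evaluated at zeta, so by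
    \<open>rpoly_galois\<close> it still vanishes after zeta is replaced by zeta^k.\<close>
  have S2: "(\<Sum>g\<in>carrier G. of_rat (f g) * l (a \<otimes> g \<otimes> b) ^ k) = 0"
    if l: "l \<in> R" and ab: "a \<in> carrier G" "b \<in> carrier G" and k: "coprime k p" for l a b k
  proof -
    have lX: "l \<in> X" using l R_subset_X by blast
    note lc = X_chars[OF lX]
    obtain e where e: "cord l = p ^ Suc e" using ord_p_power[OF lX] by metis
    have "\<exists>P. \<forall>k. coprime k p \<longrightarrow> l y ^ k = rpoly P (zeta (cord l) ^ k)" for y
    proof (cases "y \<in> A")
      case True
      then obtain j where j: "l y = zeta (cord l) ^ j" using char_value_zeta[OF lc] by metis
      have "l y ^ k = rpoly (monom 1 j) (zeta (cord l) ^ k)" for k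
        by (simp add: j power_mult[symmetric] mult.commute)
      then show ?thesis by blast
    next
      case False
      then have "l y ^ k = rpoly 0 (zeta (cord l) ^ k)" if "coprime k p" for k
        using chars_out[OF lc] coprime_pos[OF that] by simp
      then show ?thesis by blast
    qed
    then obtain P where P: "\<And>y k. coprime k p \<Longrightarrow> l y ^ k = rpoly (P y) (zeta (cord l) ^ k)" by metis
    define F where "F = (\<Sum>g\<in>carrier G. smult (f g) (P (a \<otimes> g \<otimes> b)))"
    have F: "rpoly F (zeta (cord l) ^ k) = (\<Sum>g\<in>carrier G. of_rat (f g) * l (a \<otimes> g \<otimes> b) ^ k)"
      if "coprime k p" for k
      unfolding F_def by (simp add: P[OF that, symmetric])
    have "rpoly F (zeta (cord l)) = 0" using F[of 1] S1[OF l ab] by simp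
    then show ?thesis using F[OF k] rpoly_galois[OF p k, of F e] e by simp
  qed
  \<comment> \<open>Every character in \<open>X\<close> is a twist of a representative; the
    conjugating element is absorbed into \<open>a\<close> and \<open>b\<close>.\<close>
  have S3: "?S m \<one> b = 0" if m: "m \<in> X" and b: "b \<in> carrier G" for m b
  proof -
    obtain l where l: "l \<in> R" "m \<in> cls l" using R_cover[OF m] .
    then obtain h k where h: "h \<in> carrier G" "coprime k p" "m = act h k l" by (auto simp: cls_def)
    have lc: "l \<in> chars G A" using l R_subset_X X_chars by blast
    have "m (\<one> \<otimes> g \<otimes> b) = l (inv h \<otimes> g \<otimes> (b \<otimes> h)) ^ k" if "g \<in> carrier G" for g
      using act_apply[OF lc h(1) _ h(2), of "g \<otimes> b"] that b h by (simp add: m_assoc)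
    then have "?S m \<one> b = (\<Sum>g\<in>carrier G. of_rat (f g) * l (inv h \<otimes> g \<otimes> (b \<otimes> h)) ^ k)"
      by (intro sum.cong) auto
    then show ?thesis using S2[OF l(1) _ _ h(2), of "inv h" "b \<otimes> h"] h b by simp
  qed
  have cN: "card N > 0"
    using finite_subset[OF N(2) finA] subgroup.one_closed[OF N(1)] by (auto simp: card_gt_0_iff)
  \<comment> \<open>A character trivial on \<open>N\<close> sees only sums of \<open>f\<close> over
    cosets of \<open>N\<close>, and these vanish by \<open>N0\<close>.\<close>
  have S4: "?S m \<one> b = 0" if m: "m \<in> chars G A" and mX: "m \<notin> X" and b: "b \<in> carrier G" for m b
  proof -
    have m1: "m x = 1" if "x \<in> N" for x using m mX that by (auto simp: X_def)
    have "of_nat (card N) * ?S m \<one> b = (\<Sum>x\<in>N. ?S m \<one> b)" by simp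
    also have "\<dots> = (\<Sum>x\<in>N. \<Sum>g\<in>carrier G. of_rat (f (x \<otimes> g)) * m (g \<otimes> b))"
    proof (rule sum.cong[OF refl])
      fix x assume x: "x \<in> N"
      then have xA: "x \<in> A" using N by blast
      have "?S m \<one> b = (\<Sum>g\<in>carrier G. of_rat (f (x \<otimes> g)) * m (\<one> \<otimes> (x \<otimes> g) \<otimes> b))"
        by (rule sum.reindex_bij_betw[OF bij_left_mult[OF A_carrier[OF xA]], symmetric])
      also have "\<dots> = (\<Sum>g\<in>carrier G. of_rat (f (x \<otimes> g)) * m (g \<otimes> b))"
        using chars_mult_left[OF m xA] m1[OF x] xA b by (intro sum.cong) (auto simp: m_assoc)
      finally show "?S m \<one> b = (\<Sum>g\<in>carrier G. of_rat (f (x \<otimes> g)) * m (g \<otimes> b))" .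
    qed
    also have "\<dots> = (\<Sum>g\<in>carrier G. \<Sum>x\<in>N. of_rat (f (x \<otimes> g)) * m (g \<otimes> b))"
      by (rule sum.swap)
    also have "\<dots> = (\<Sum>g\<in>carrier G. of_rat (\<Sum>x\<in>N. f (x \<otimes> g)) * m (g \<otimes> b))"
      by (simp add: of_rat_sum sum_distrib_right)
    also have "\<dots> = 0" using N0 by (intro sum.neutral) simp
    finally show ?thesis using cN by simp
  qed
  show ?thesis
  proof
    fix w show "f w = 0"
    proof (cases "w \<in> carrier G")
      case w: True
      \<comment> \<open>Fourier inversion: summing over all characters of \<open>A\<close> leaves
        only the term with g = w, with the factor \<open>card A\<close>.\<close>
      have "?S m \<one> (inv w) = 0" if "m \<in> chars G A" for m
        using S3[of m "inv w"] S4[OF that, of "inv w"] w by (cases "m \<in> X") simp_all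
      then have "0 = (\<Sum>m\<in>chars G A. ?S m \<one> (inv w))" by (intro sum.neutral[symmetric] ballI)
      also have "\<dots> = (\<Sum>g\<in>carrier G. \<Sum>m\<in>chars G A. of_rat (f g) * m (\<one> \<otimes> g \<otimes> inv w))"
        by (rule sum.swap)
      also have "\<dots> = (\<Sum>g\<in>carrier G. if g = w then of_rat (f g) * of_nat (card A) else 0)"
      proof (rule sum.cong[OF refl])
        fix g assume g: "g \<in> carrier G"
        have "\<one> \<otimes> g \<otimes> inv w = \<one> \<longleftrightarrow> g = w"
          using g w by (metis inv_closed inv_equality inv_inv l_one r_inv)
        then show "(\<Sum>m\<in>chars G A. of_rat (f g) * m (\<one> \<otimes> g \<otimes> inv w))
            = (if g = w then of_rat (f g) * of_nat (card A) else 0)"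
          by (simp add: sum_distrib_left[symmetric] sum_over_chars)
      qed
      also have "\<dots> = of_rat (f w) * of_nat (card A)" using finG w by simp
      finally show ?thesis using card_A_pos by simp
    qed (use f finG group_algebra_carrier in blast)
  qed
qed

text \<open>Coefficients of the idempotent of the rational group algebra of \<open>A\<close> that
  belongs to the Galois orbit of the conjugate of \<open>l\<close> by \<open>t s\<close>. The sum is
  formed in the complex numbers and \<open>THE\<close> extracts the rational number that it
  equals.\<close>

definition idem :: "('a \<Rightarrow> complex) \<Rightarrow> nat \<Rightarrow> 'a \<Rightarrow> rat" where
  "idem l s h = (if h \<in> A then THE q. of_rat q
     = (\<Sum>k\<in>K (cord l). act (t s) k l (inv h)) / of_nat (card A) else 0)"

lemma idem:
  assumes l: "l \<in> X" and s: "s < n" and h: "h \<in> A"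
  shows "of_rat (idem l s h) = (\<Sum>k\<in>K (cord l). act (t s) k l (inv h)) / of_nat (card A)"
proof -
  note lc = X_chars[OF l]
  obtain e where e: "cord l = p ^ Suc e" using ord_p_power[OF l] by metis
  have "inv (t s) \<otimes> inv h \<otimes> t s \<in> A" using h s by (intro normA) auto
  then obtain j where j: "l (inv (t s) \<otimes> inv h \<otimes> t s) = zeta (cord l) ^ j"
    using char_value_zeta[OF lc] by metis
  have "(\<Sum>k\<in>K (cord l). act (t s) k l (inv h)) = (\<Sum>k\<in>K (cord l). zeta (cord l) ^ (j * k))"
    using h by (intro sum.cong) (auto simp: act_def j power_mult)
  also have "\<dots> \<in> \<rat>" unfolding K_def e by (rule ramanujan_sum_rational[OF p])
  finally have "(\<Sum>k\<in>K (cord l). act (t s) k l (inv h)) / of_nat (card A) \<in> \<rat>"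
    by (intro Rats_divide) auto
  then obtain q where q: "(\<Sum>k\<in>K (cord l). act (t s) k l (inv h)) / of_nat (card A) = of_rat q"
    by (auto simp: Rats_def)
  then have "idem l s h = q" using h by (simp add: idem_def)
  then show ?thesis using q by simp
qed

lemma char_orthogonality:
  assumes l: "l \<in> chars G A" and m: "m \<in> chars G A"
  shows "(\<Sum>h\<in>A. l (inv h) * m h) = (if l = m then of_nat (card A) else 0)"
proof (cases "l = m")
  case True
  then have "l (inv h) * m h = 1" if "h \<in> A" for h
    using that chars_inv[OF l] chars_nonzero[OF l] by simp
  then show ?thesis using True by simp
next
  case False
  then obtain x where x: "l x \<noteq> m x" by auto
  then have xA: "x \<in> A" using chars_out[OF l] chars_out[OF m] by metis
  have "(\<Sum>h\<in>A. inverse (l h) * m h) = 0"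
    by (rule sum_char_eq_0[OF chars_times[OF chars_inverse[OF l] m] subA order_refl xA])
      (use x chars_nonzero[OF l xA] in \<open>auto simp: field_simps\<close>)
  then show ?thesis using False by (simp add: chars_inv[OF l])
qed

text \<open>Orthogonality leaves the number of exponents k for which the k-th twist by
  \<open>t s\<close> of \<open>l\<close> is the conjugate of \<open>l'\<close> by
  \<open>t u\<close>. Disjointness of orbits and \<open>act_inj\<close> allow only k = 1, and that
  only when l = l' and s = u.\<close>

lemma sum_idem_char:
  assumes l: "l \<in> R" and l': "l' \<in> R" and s: "s < n" and u: "u < n"
  shows "(\<Sum>h\<in>A. of_rat (idem l s h) * act (t u) 1 l' h) = (if l = l' \<and> s = u then 1 else 0)"
proof -
  have X: "l \<in> X" "l' \<in> X" using l l' R_subset_X by auto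
  note lc = X_chars[OF X(1)] X_chars[OF X(2)]
  let ?m = "act (t u) 1 l'"
  have m: "?m \<in> chars G A" using act_chars[OF lc(2)] u by simp
  have finK: "finite (K (cord l))" by (simp add: K_def)
  have "(\<Sum>h\<in>A. of_rat (idem l s h) * ?m h)
      = (\<Sum>h\<in>A. \<Sum>k\<in>K (cord l). act (t s) k l (inv h) * ?m h / of_nat (card A))"
    using idem[OF X(1) s] by (intro sum.cong) (auto simp: sum_distrib_right sum_divide_distrib)
  also have "\<dots> = (\<Sum>k\<in>K (cord l). \<Sum>h\<in>A. act (t s) k l (inv h) * ?m h / of_nat (card A))"
    by (rule sum.swap)
  also have "\<dots> = (\<Sum>k\<in>K (cord l). if act (t s) k l = ?m then 1 else 0)"
    using char_orthogonality[OF act_chars[OF lc(1)] m] s card_A_pos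
    by (intro sum.cong) (auto simp: sum_divide_distrib[symmetric])
  also have "\<dots> = (if l = l' \<and> s = u then 1 else 0)"
  proof (cases "l = l' \<and> s = u")
    case True
    obtain e where e: "cord l = p ^ Suc e" using ord_p_power[OF X(1)] by metis
    have "1 < p ^ Suc e" using prime_gt_1_nat[OF p] by (intro one_less_power) auto
    then have 1: "1 \<in> K (cord l)" using e by (simp add: K_def)
    have "act (t s) k l = ?m \<longleftrightarrow> k = 1" if "k \<in> K (cord l)" for k
      using act_inj[OF X(1) s u that] 1 True by auto
    then have "(\<Sum>k\<in>K (cord l). if act (t s) k l = ?m then 1 else 0)
        = (\<Sum>k\<in>K (cord l). if k = 1 then 1 else 0 :: complex)" by (intro sum.cong) auto
    also have "\<dots> = 1" using finK 1 by simp
    finally show ?thesis using True by simp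
  next
    case False
    have "act (t s) k l \<noteq> ?m" if k: "k \<in> K (cord l)" for k
    proof
      assume eq: "act (t s) k l = ?m"
      have kp: "coprime k p" using k by (simp add: K_def)
      have "?m \<in> cls l" unfolding eq[symmetric] using kp s by (intro act_in_cls) auto
      moreover have "?m \<in> cls l'" using u by (intro act_in_cls) auto
      ultimately have "cls l = cls l'" using cls_eq X by metis
      then have "l' \<in> cls l" using cls_refl[OF X(2)] by simp
      then have ll: "l = l'" using R_unique[OF l l'] by blast
      obtain e where e: "cord l = p ^ Suc e" using ord_p_power[OF X(1)] by metis
      have "1 < p ^ Suc e" using prime_gt_1_nat[OF p] by (intro one_less_power) auto
      then have "1 \<in> K (cord l)" using e by (simp add: K_def)
      then show False using act_inj[OF X(1) s u k] eq ll False by blast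
    qed
    then show ?thesis using False by (auto intro: sum.neutral)
  qed
  finally show ?thesis .
qed

text \<open>The product of the idempotent \<open>idem l s\<close> with the group element t s x inv
  (t r). In the matrix component of \<open>l\<close> it becomes l x times the matrix unit at
  position (s, r), and it is zero in the other components.\<close>

definition unit_elt :: "('a \<Rightarrow> complex) \<Rightarrow> nat \<Rightarrow> nat \<Rightarrow> 'a \<Rightarrow> 'a \<Rightarrow> rat" where
  "unit_elt l s r x g = (if g \<in> carrier G then idem l s (g \<otimes> inv (t s \<otimes> x \<otimes> inv (t r))) else 0)"

lemma sum_unit_elt:
  assumes s: "s < n" and r: "r < n" and x: "x \<in> A"
  shows "(\<Sum>g\<in>carrier G. of_rat (unit_elt l s r x g) * F g)
    = (\<Sum>h\<in>A. of_rat (idem l s h) * (F (h \<otimes> (t s \<otimes> x \<otimes> inv (t r))) :: 'c::field_char_0))"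
proof -
  let ?w = "t s \<otimes> x \<otimes> inv (t r)"
  have w: "?w \<in> carrier G" using s r x by simp
  have "(\<Sum>g\<in>carrier G. of_rat (unit_elt l s r x g) * F g)
      = (\<Sum>h\<in>carrier G. of_rat (unit_elt l s r x (h \<otimes> ?w)) * F (h \<otimes> ?w))"
    by (rule sum.reindex_bij_betw[OF bij_right_mult[OF w], symmetric])
  also have "\<dots> = (\<Sum>h\<in>carrier G. of_rat (idem l s h) * F (h \<otimes> ?w))"
  proof (intro sum.cong refl)
    fix h assume h: "h \<in> carrier G"
    have "h \<otimes> ?w \<otimes> inv ?w = h" using h w by (simp only: m_assoc inv_closed r_inv r_one)
    then show "of_rat (unit_elt l s r x (h \<otimes> ?w)) * F (h \<otimes> ?w) = of_rat (idem l s h) * F (h \<otimes> ?w)"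
      using h w unfolding unit_elt_def by simp
  qed
  also have "\<dots> = (\<Sum>h\<in>A. of_rat (idem l s h) * F (h \<otimes> ?w))"
    using finG by (intro sum.mono_neutral_right) (auto simp: idem_def)
  finally show ?thesis .
qed

lemma L_unit_elt:
  assumes l: "l \<in> R" and l': "l' \<in> R" and srx: "s < n" "r < n" "x \<in> A" and uv: "u < n" "v < n"
  shows "L l' u v (unit_elt l s r x) = (if l' = l \<and> u = s \<and> v = r then l x else 0)"
proof -
  have lc: "l' \<in> chars G A" using l' R_subset_X X_chars by blast
  let ?w = "t s \<otimes> x \<otimes> inv (t r)"
  have w: "?w \<in> carrier G" using srx by simp
  have "L l' u v (unit_elt l s r x) = (\<Sum>h\<in>A. of_rat (idem l s h) * l' (inv (t u) \<otimes> (h \<otimes> ?w) \<otimes> t v))"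
    unfolding L_def by (rule sum_unit_elt[OF srx])
  also have "\<dots> = (\<Sum>h\<in>A. of_rat (idem l s h) * act (t u) 1 l' h * l' (inv (t u) \<otimes> ?w \<otimes> t v))"
  proof (intro sum.cong refl)
    fix h assume h: "h \<in> A"
    have "inv (t u) \<otimes> (h \<otimes> ?w) \<otimes> t v = (inv (t u) \<otimes> h \<otimes> t u) \<otimes> (inv (t u) \<otimes> ?w \<otimes> t v)"
      using h w uv by (simp only: m_assoc m_closed inv_closed t_carrier A_carrier mult_inv_cancel_left)
    then show "of_rat (idem l s h) * l' (inv (t u) \<otimes> (h \<otimes> ?w) \<otimes> t v)
        = of_rat (idem l s h) * act (t u) 1 l' h * l' (inv (t u) \<otimes> ?w \<otimes> t v)"
      using chars_mult_left[OF lc normA[OF t_carrier[OF uv(1)] h], of "inv (t u) \<otimes> ?w \<otimes> t v"] h uv w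
      by (simp add: act_def)
  qed
  also have "\<dots> = (if l = l' \<and> s = u then 1 else 0) * l' (inv (t u) \<otimes> ?w \<otimes> t v)"
    by (simp only: sum_distrib_right[symmetric] sum_idem_char[OF l l' srx(1) uv(1)])
  also have "\<dots> = (if l' = l \<and> u = s \<and> v = r then l x else 0)"
  proof (cases "l' = l \<and> u = s")
    case True
    have "inv (t s) \<otimes> ?w \<otimes> t v = x \<otimes> (inv (t r) \<otimes> t v)"
      using srx uv by (simp add: m_assoc) (simp add: m_assoc[symmetric])
    then have "l' (inv (t u) \<otimes> ?w \<otimes> t v) = l' x * l' (inv (t r) \<otimes> t v)"
      using chars_mult_left[OF lc srx(3), of "inv (t r) \<otimes> t v"] True srx uv by simp
    also have "l' (inv (t r) \<otimes> t v) = (if v = r then 1 else 0)"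
      using transversal_inj[OF srx(2) uv(2)] chars_out[OF lc] chars_one[OF lc] srx by auto
    finally show ?thesis using True by auto
  qed auto
  finally show ?thesis .
qed

text \<open>Since \<open>N\<close> is normal, all twists of \<open>l\<close> remain nontrivial on
  \<open>N\<close>, so their sums over \<open>N\<close> vanish. Hence these elements disappear in
  the group algebra of the quotient by \<open>N\<close>.\<close>

lemma push_unit_elt:
  assumes l: "l \<in> R" and srx: "s < n" "r < n" "x \<in> A" and g: "g \<in> carrier G"
  shows "(\<Sum>z\<in>N. unit_elt l s r x (z \<otimes> g)) = 0"
proof -
  have lX: "l \<in> X" using l R_subset_X by blast
  note lc = X_chars[OF lX]
  let ?w = "t s \<otimes> x \<otimes> inv (t r)"
  have w: "?w \<in> carrier G" using srx by simp
  define y where "y = g \<otimes> inv ?w"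
  have y: "y \<in> carrier G" using g w by (simp add: y_def)
  have eq: "unit_elt l s r x (z \<otimes> g) = idem l s (z \<otimes> y)" if "z \<in> N" for z
    using that N g w unfolding unit_elt_def y_def by (auto simp: m_assoc)
  have finN: "finite N" using N finA finite_subset by blast
  show ?thesis
  proof (cases "y \<in> A")
    case True
    have NA: "z \<in> A" if "z \<in> N" for z using that N by blast
    have "of_rat (\<Sum>z\<in>N. idem l s (z \<otimes> y))
        = (\<Sum>z\<in>N. \<Sum>k\<in>K (cord l). act (t s) k l (inv (z \<otimes> y)) / of_nat (card A))"
      using idem[OF lX srx(1)] True NA by (simp add: of_rat_sum sum_divide_distrib)
    also have "\<dots> = (\<Sum>k\<in>K (cord l). \<Sum>z\<in>N. act (t s) k l (inv (z \<otimes> y)) / of_nat (card A))"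
      by (rule sum.swap)
    also have "\<dots> = 0"
    proof (rule sum.neutral, rule ballI)
      fix k assume k: "k \<in> K (cord l)"
      have m: "act (t s) k l \<in> X" using act_X[OF lX] k srx by (simp add: K_def)
      note mc = X_chars[OF m]
      obtain z0 where z0: "z0 \<in> N" "act (t s) k l z0 \<noteq> 1" using m by (auto simp: X_def)
      have "(\<Sum>z\<in>N. inverse (act (t s) k l z)) = 0"
        using sum_char_eq_0[OF chars_inverse[OF mc] N z0(1)] z0(2) by simp
      moreover have "(\<Sum>z\<in>N. act (t s) k l (inv (z \<otimes> y)) / of_nat (card A))
          = (\<Sum>z\<in>N. inverse (act (t s) k l z) * (inverse (act (t s) k l y) / of_nat (card A)))"
        using True NA by (intro sum.cong) (auto simp: chars_inv[OF mc] chars_mult[OF mc] inverse_mult_distrib)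
      ultimately show "(\<Sum>z\<in>N. act (t s) k l (inv (z \<otimes> y)) / of_nat (card A)) = 0"
        by (simp only: sum_distrib_right[symmetric] mult_zero_left)
    qed
    finally show ?thesis using eq by simp
  next
    case False
    have "idem l s (z \<otimes> y) = 0" if z: "z \<in> N" for z
    proof -
      have "z \<otimes> y \<notin> A"
      proof
        assume "z \<otimes> y \<in> A"
        then have "inv z \<otimes> (z \<otimes> y) \<in> A" by (rule A_closed[OF A_inv[OF subsetD[OF N(2) z]]])
        then show False using False z N y by (auto simp: m_assoc[symmetric])
      qed
      then show ?thesis by (simp add: idem_def)
    qed
    then show ?thesis using eq by simp
  qed
qed

text \<open>Each prescribed entry is a rational polynomial in zeta. The monomial zeta^j is realised
  at position (s, r) by \<open>unit_elt\<close> with an argument on which \<open>l\<close> takes the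
  value zeta^j.\<close>

lemma surjectivity_matrices:
  assumes M: "\<And>l u v. l \<in> R \<Longrightarrow> u < n \<Longrightarrow> v < n \<Longrightarrow> M l u v \<in> cyclotomic_field (cord l)"
  obtains f where "f \<in> carrier (group_algebra G)"
    "\<And>l u v. l \<in> R \<Longrightarrow> u < n \<Longrightarrow> v < n \<Longrightarrow> L l u v f = M l u v"
    "\<And>g. g \<in> carrier G \<Longrightarrow> (\<Sum>x\<in>N. f (x \<otimes> g)) = 0"
proof -
  have "\<exists>P. l \<in> R \<longrightarrow> u < n \<longrightarrow> v < n \<longrightarrow> M l u v = rpoly P (zeta (cord l))" for l u v
  proof (cases "l \<in> R \<and> u < n \<and> v < n")
    case True
    then obtain e where e: "cord l = p ^ Suc e" using ord_p_power R_subset_X by (metis subsetD)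
    show ?thesis using M[of l u v] True unfolding e cyclotomic_field_eq[OF p] by auto
  qed auto
  then obtain P where P: "\<And>l u v. l \<in> R \<Longrightarrow> u < n \<Longrightarrow> v < n \<Longrightarrow> M l u v = rpoly (P l u v) (zeta (cord l))"
    by metis
  \<comment> \<open>One element per representative with value zeta is enough, because its powers
    have the values zeta^j.\<close>
  have "\<exists>x. l \<in> R \<longrightarrow> x \<in> A \<and> l x = zeta (cord l)" for l
    using ord_p_power R_subset_X by (metis subsetD)
  then obtain x where x: "\<And>l. l \<in> R \<Longrightarrow> x l \<in> A" "\<And>l. l \<in> R \<Longrightarrow> l (x l) = zeta (cord l)" by metis
  define I where "I = (SIGMA l:R. SIGMA s:{..<n}. SIGMA r:{..<n}. {..degree (P l s r)})"
  have finI: "finite I" unfolding I_def using finite_R by (intro finite_SigmaI) auto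
  define T where "T = (\<lambda>(l, s, r, j) z. coeff (P l s r) j * unit_elt l s r (x l [^] j) z)"
  define f where "f z = (\<Sum>i\<in>I. T i z)" for z
  have "f \<in> carrier (group_algebra G)"
    unfolding group_algebra_carrier[OF finG] f_def T_def
    by (auto simp: unit_elt_def intro!: sum.neutral)
  moreover have "L l u v f = M l u v" if l: "l \<in> R" and uv: "u < n" "v < n" for l u v
  proof -
    have "L l u v f = (\<Sum>i\<in>I. L l u v (T i))" unfolding f_def by (rule L_sum[OF finI])
    also have "\<dots> = (\<Sum>(l', s, r, j)\<in>I. of_rat (coeff (P l' s r) j)
        * (if l = l' \<and> u = s \<and> v = r then zeta (cord l) ^ j else 0))"
    proof (intro sum.cong refl, clarify)
      fix l' s r j assume i: "(l', s, r, j) \<in> I"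
      then have i': "l' \<in> R" "s < n" "r < n" by (auto simp: I_def)
      have lc: "l' \<in> chars G A" using i'(1) R_subset_X X_chars by blast
      show "L l u v (T (l', s, r, j)) = of_rat (coeff (P l' s r) j)
          * (if l = l' \<and> u = s \<and> v = r then zeta (cord l) ^ j else 0)"
        using L_unit_elt[OF i'(1) l i'(2,3) A_pow[OF x(1)[OF i'(1)], of j] uv] chars_pow[OF lc x(1)[OF i'(1)], of j] x(2)[OF i'(1)]
        by (auto simp: T_def L_smult)
    qed
    also have "\<dots> = (\<Sum>(l', s, r, j)\<in>(\<lambda>j. (l, u, v, j)) ` {..degree (P l u v)}.
        of_rat (coeff (P l' s r) j) * (if l = l' \<and> u = s \<and> v = r then zeta (cord l) ^ j else 0))"
      by (rule sum.mono_neutral_right[OF finI]) (use l uv in \<open>auto simp: I_def\<close>)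
    also have "\<dots> = (\<Sum>j\<le>degree (P l u v). of_rat (coeff (P l u v) j) * zeta (cord l) ^ j)"
      by (subst sum.reindex) (auto simp: inj_on_def)
    also have "\<dots> = rpoly (P l u v) (zeta (cord l))"
    proof -
      have "rpoly (\<Sum>j\<le>degree (P l u v). monom (coeff (P l u v) j) j) (zeta (cord l))
          = (\<Sum>j\<le>degree (P l u v). of_rat (coeff (P l u v) j) * zeta (cord l) ^ j)" by simp
      then show ?thesis by (simp add: poly_as_sum_of_monoms)
    qed
    finally show ?thesis using P[OF l uv] by simp
  qed
  moreover have "(\<Sum>y\<in>N. f (y \<otimes> g)) = 0" if g: "g \<in> carrier G" for g
  proof -
    have "(\<Sum>y\<in>N. f (y \<otimes> g)) = (\<Sum>i\<in>I. \<Sum>y\<in>N. T i (y \<otimes> g))"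
      unfolding f_def by (rule sum.swap)
    also have "\<dots> = 0"
      using push_unit_elt[OF _ _ _ _ g] x
      by (intro sum.neutral[of I] ballI) (auto simp: T_def I_def sum_distrib_left[symmetric])
    finally show ?thesis .
  qed
  ultimately show thesis using that by blast
qed

end

section \<open>Isomorphisms of rational algebras\<close>

lemma alg_isoI:
  assumes "\<And>x. x \<in> carrier A \<Longrightarrow> h x \<in> carrier B" "\<And>y. y \<in> carrier B \<Longrightarrow> g y \<in> carrier A"
    and "\<And>x. x \<in> carrier A \<Longrightarrow> g (h x) = x" "\<And>y. y \<in> carrier B \<Longrightarrow> h (g y) = y"
    and "\<And>x y. x \<in> carrier A \<Longrightarrow> y \<in> carrier A \<Longrightarrow> h (x \<otimes>\<^bsub>A\<^esub> y) = h x \<otimes>\<^bsub>B\<^esub> h y"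
    and "\<And>x y. x \<in> carrier A \<Longrightarrow> y \<in> carrier A \<Longrightarrow> h (x \<oplus>\<^bsub>A\<^esub> y) = h x \<oplus>\<^bsub>B\<^esub> h y"
    and "h \<one>\<^bsub>A\<^esub> = \<one>\<^bsub>B\<^esub>"
    and "\<And>q x. x \<in> carrier A \<Longrightarrow> h (q \<odot>\<^bsub>A\<^esub> x) = q \<odot>\<^bsub>B\<^esub> h x"
  shows "A \<cong>\<^sub>\<rat> B"
proof -
  have "h \<in> ring_hom A B" using assms by (intro ring_hom_memI) auto
  moreover have "bij_betw h (carrier A) (carrier B)"
    using assms by (intro bij_betwI[where g = g]) auto
  ultimately show ?thesis unfolding alg_iso_def ring_iso_def using assms(8) by blast
qed

lemma alg_isoE:
  assumes "A \<cong>\<^sub>\<rat> B"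
  obtains h where "bij_betw h (carrier A) (carrier B)"
    "\<And>x y. x \<in> carrier A \<Longrightarrow> y \<in> carrier A \<Longrightarrow> h (x \<otimes>\<^bsub>A\<^esub> y) = h x \<otimes>\<^bsub>B\<^esub> h y"
    "\<And>x y. x \<in> carrier A \<Longrightarrow> y \<in> carrier A \<Longrightarrow> h (x \<oplus>\<^bsub>A\<^esub> y) = h x \<oplus>\<^bsub>B\<^esub> h y"
    "h \<one>\<^bsub>A\<^esub> = \<one>\<^bsub>B\<^esub>" "\<And>q x. x \<in> carrier A \<Longrightarrow> h (q \<odot>\<^bsub>A\<^esub> x) = q \<odot>\<^bsub>B\<^esub> h x"
proof -
  obtain h where h: "h \<in> ring_hom A B" "bij_betw h (carrier A) (carrier B)"
    "\<forall>q. \<forall>x\<in>carrier A. h (q \<odot>\<^bsub>A\<^esub> x) = q \<odot>\<^bsub>B\<^esub> h x"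
    using assms unfolding alg_iso_def ring_iso_def by blast
  show thesis
    using that[OF h(2) ring_hom_memE(2,3,4)[OF h(1)]] h(3) by blast
qed

lemma alg_iso_refl: "A \<cong>\<^sub>\<rat> A"
  by (rule alg_isoI[where h = "\<lambda>x. x" and g = "\<lambda>x. x"]) auto

lemma alg_iso_trans:
  assumes "A \<cong>\<^sub>\<rat> B" "B \<cong>\<^sub>\<rat> C"
  shows "A \<cong>\<^sub>\<rat> C"
proof -
  obtain h where h: "bij_betw h (carrier A) (carrier B)"
    "\<And>x y. x \<in> carrier A \<Longrightarrow> y \<in> carrier A \<Longrightarrow> h (x \<otimes>\<^bsub>A\<^esub> y) = h x \<otimes>\<^bsub>B\<^esub> h y"
    "\<And>x y. x \<in> carrier A \<Longrightarrow> y \<in> carrier A \<Longrightarrow> h (x \<oplus>\<^bsub>A\<^esub> y) = h x \<oplus>\<^bsub>B\<^esub> h y"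
    "h \<one>\<^bsub>A\<^esub> = \<one>\<^bsub>B\<^esub>" "\<And>q x. x \<in> carrier A \<Longrightarrow> h (q \<odot>\<^bsub>A\<^esub> x) = q \<odot>\<^bsub>B\<^esub> h x"
    using alg_isoE[OF assms(1)] by metis
  obtain k where k: "bij_betw k (carrier B) (carrier C)"
    "\<And>x y. x \<in> carrier B \<Longrightarrow> y \<in> carrier B \<Longrightarrow> k (x \<otimes>\<^bsub>B\<^esub> y) = k x \<otimes>\<^bsub>C\<^esub> k y"
    "\<And>x y. x \<in> carrier B \<Longrightarrow> y \<in> carrier B \<Longrightarrow> k (x \<oplus>\<^bsub>B\<^esub> y) = k x \<oplus>\<^bsub>C\<^esub> k y"
    "k \<one>\<^bsub>B\<^esub> = \<one>\<^bsub>C\<^esub>" "\<And>q x. x \<in> carrier B \<Longrightarrow> k (q \<odot>\<^bsub>B\<^esub> x) = q \<odot>\<^bsub>C\<^esub> k x"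
    using alg_isoE[OF assms(2)] by metis
  have hB: "\<And>x. x \<in> carrier A \<Longrightarrow> h x \<in> carrier B" using h(1) by (rule bij_betwE[rule_format])
  have bij: "bij_betw (k \<circ> h) (carrier A) (carrier C)" using h(1) k(1) by (rule bij_betw_trans)
  have "(k \<circ> h) \<in> ring_hom A C"
    using bij_betwE[OF bij] hB h(2-4) k(2-4) by (intro ring_hom_memI) auto
  then show ?thesis unfolding alg_iso_def ring_iso_def using bij hB h(5) k(5) by auto
qed

lemma alg_iso_inv_into:
  assumes "bij_betw h A B" "y \<in> B"
  shows "inv_into A h y \<in> A" "h (inv_into A h y) = y"
  using assms by (auto simp: bij_betw_def inv_into_into f_inv_into_f)

lemma alg_prod_simps:
  "carrier (A \<oplus>\<^sub>\<rat> B) = carrier A \<times> carrier B"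
  "x \<otimes>\<^bsub>A \<oplus>\<^sub>\<rat> B\<^esub> y = (fst x \<otimes>\<^bsub>A\<^esub> fst y, snd x \<otimes>\<^bsub>B\<^esub> snd y)"
  "x \<oplus>\<^bsub>A \<oplus>\<^sub>\<rat> B\<^esub> y = (fst x \<oplus>\<^bsub>A\<^esub> fst y, snd x \<oplus>\<^bsub>B\<^esub> snd y)"
  "\<one>\<^bsub>A \<oplus>\<^sub>\<rat> B\<^esub> = (\<one>\<^bsub>A\<^esub>, \<one>\<^bsub>B\<^esub>)"
  "q \<odot>\<^bsub>A \<oplus>\<^sub>\<rat> B\<^esub> x = (q \<odot>\<^bsub>A\<^esub> fst x, q \<odot>\<^bsub>B\<^esub> snd x)"
  by (auto simp: alg_prod_def split: prod.splits)

lemma alg_sum_simps: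
  "carrier (alg_sum I A) = (\<Pi>\<^sub>E i\<in>I. carrier (A i))"
  "f \<otimes>\<^bsub>alg_sum I A\<^esub> g = (\<lambda>i\<in>I. f i \<otimes>\<^bsub>A i\<^esub> g i)"
  "f \<oplus>\<^bsub>alg_sum I A\<^esub> g = (\<lambda>i\<in>I. f i \<oplus>\<^bsub>A i\<^esub> g i)"
  "\<one>\<^bsub>alg_sum I A\<^esub> = (\<lambda>i\<in>I. \<one>\<^bsub>A i\<^esub>)"
  "q \<odot>\<^bsub>alg_sum I A\<^esub> f = (\<lambda>i\<in>I. q \<odot>\<^bsub>A i\<^esub> f i)"
  by (auto simp: alg_sum_def)

lemma alg_prod_cong:
  assumes "A \<cong>\<^sub>\<rat> A'" "B \<cong>\<^sub>\<rat> B'"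
  shows "A \<oplus>\<^sub>\<rat> B \<cong>\<^sub>\<rat> A' \<oplus>\<^sub>\<rat> B'"
proof -
  obtain h where h: "bij_betw h (carrier A) (carrier A')"
    "\<And>x y. x \<in> carrier A \<Longrightarrow> y \<in> carrier A \<Longrightarrow> h (x \<otimes>\<^bsub>A\<^esub> y) = h x \<otimes>\<^bsub>A'\<^esub> h y"
    "\<And>x y. x \<in> carrier A \<Longrightarrow> y \<in> carrier A \<Longrightarrow> h (x \<oplus>\<^bsub>A\<^esub> y) = h x \<oplus>\<^bsub>A'\<^esub> h y"
    "h \<one>\<^bsub>A\<^esub> = \<one>\<^bsub>A'\<^esub>" "\<And>q x. x \<in> carrier A \<Longrightarrow> h (q \<odot>\<^bsub>A\<^esub> x) = q \<odot>\<^bsub>A'\<^esub> h x"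
    using alg_isoE[OF assms(1)] by metis
  obtain k where k: "bij_betw k (carrier B) (carrier B')"
    "\<And>x y. x \<in> carrier B \<Longrightarrow> y \<in> carrier B \<Longrightarrow> k (x \<otimes>\<^bsub>B\<^esub> y) = k x \<otimes>\<^bsub>B'\<^esub> k y"
    "\<And>x y. x \<in> carrier B \<Longrightarrow> y \<in> carrier B \<Longrightarrow> k (x \<oplus>\<^bsub>B\<^esub> y) = k x \<oplus>\<^bsub>B'\<^esub> k y"
    "k \<one>\<^bsub>B\<^esub> = \<one>\<^bsub>B'\<^esub>" "\<And>q x. x \<in> carrier B \<Longrightarrow> k (q \<odot>\<^bsub>B\<^esub> x) = q \<odot>\<^bsub>B'\<^esub> k x"
    using alg_isoE[OF assms(2)] by metis
  have "bij_betw (map_prod h k) (carrier A \<times> carrier B) (carrier A' \<times> carrier B')"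
    using h(1) k(1) by (rule bij_betw_map_prod)
  moreover have "map_prod h k \<in> ring_hom (A \<oplus>\<^sub>\<rat> B) (A' \<oplus>\<^sub>\<rat> B')"
  proof (rule ring_hom_memI)
    fix x assume x: "x \<in> carrier (A \<oplus>\<^sub>\<rat> B)"
    then show "map_prod h k x \<in> carrier (A' \<oplus>\<^sub>\<rat> B')"
      using bij_betwE[OF h(1)] bij_betwE[OF k(1)] by (cases x) (auto simp: alg_prod_simps)
    fix y assume y: "y \<in> carrier (A \<oplus>\<^sub>\<rat> B)"
    show "map_prod h k (x \<otimes>\<^bsub>A \<oplus>\<^sub>\<rat> B\<^esub> y) = map_prod h k x \<otimes>\<^bsub>A' \<oplus>\<^sub>\<rat> B'\<^esub> map_prod h k y"
      using x y by (cases x; cases y) (simp add: alg_prod_simps h(2) k(2))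
    show "map_prod h k (x \<oplus>\<^bsub>A \<oplus>\<^sub>\<rat> B\<^esub> y) = map_prod h k x \<oplus>\<^bsub>A' \<oplus>\<^sub>\<rat> B'\<^esub> map_prod h k y"
      using x y by (cases x; cases y) (simp add: alg_prod_simps h(3) k(3))
  qed (simp add: alg_prod_simps h(4) k(4))
  ultimately show ?thesis unfolding alg_iso_def ring_iso_def using h(5) k(5)
    by (auto simp: alg_prod_simps intro!: bexI[of _ "map_prod h k"])
qed

lemma alg_prod_assoc: "(A \<oplus>\<^sub>\<rat> B) \<oplus>\<^sub>\<rat> C \<cong>\<^sub>\<rat> A \<oplus>\<^sub>\<rat> B \<oplus>\<^sub>\<rat> C"
  by (rule alg_isoI[where h = "\<lambda>((a, b), c). (a, b, c)" and g = "\<lambda>(a, b, c). ((a, b), c)"])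
    (auto simp: alg_prod_simps)

lemma alg_sum_cong:
  assumes "\<And>i. i \<in> I \<Longrightarrow> A i \<cong>\<^sub>\<rat> B i"
  shows "alg_sum I A \<cong>\<^sub>\<rat> alg_sum I B"
proof -
  have "\<forall>i\<in>I. \<exists>h. h \<in> ring_iso (A i) (B i)
      \<and> (\<forall>q. \<forall>x\<in>carrier (A i). h (q \<odot>\<^bsub>A i\<^esub> x) = q \<odot>\<^bsub>B i\<^esub> h x)"
    using assms unfolding alg_iso_def by blast
  from bchoice[OF this] obtain h where h0: "\<And>i. i \<in> I \<Longrightarrow> h i \<in> ring_hom (A i) (B i)"
    "\<And>i. i \<in> I \<Longrightarrow> bij_betw (h i) (carrier (A i)) (carrier (B i))"
    "\<And>i q x. i \<in> I \<Longrightarrow> x \<in> carrier (A i) \<Longrightarrow> h i (q \<odot>\<^bsub>A i\<^esub> x) = q \<odot>\<^bsub>B i\<^esub> h i x"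
    unfolding ring_iso_def by blast
  note h = h0(2) ring_hom_memE(2-4)[OF h0(1)] h0(3)
  have hB: "\<And>i x. i \<in> I \<Longrightarrow> x \<in> carrier (A i) \<Longrightarrow> h i x \<in> carrier (B i)"
    using h(1) bij_betwE by blast
  show ?thesis
  proof (rule alg_isoI[where h = "\<lambda>f. \<lambda>i\<in>I. h i (f i)"
        and g = "\<lambda>f. \<lambda>i\<in>I. inv_into (carrier (A i)) (h i) (f i)"], unfold alg_sum_simps)
    fix f assume f: "f \<in> (\<Pi>\<^sub>E i\<in>I. carrier (A i))"
    show "(\<lambda>i\<in>I. h i (f i)) \<in> (\<Pi>\<^sub>E i\<in>I. carrier (B i))" using f hB by auto
    show "(\<lambda>i\<in>I. inv_into (carrier (A i)) (h i) ((\<lambda>i\<in>I. h i (f i)) i)) = f"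
    proof
      fix i show "(\<lambda>i\<in>I. inv_into (carrier (A i)) (h i) ((\<lambda>i\<in>I. h i (f i)) i)) i = f i"
      proof (cases "i \<in> I")
        case True
        then have "f i \<in> carrier (A i)" using f by auto
        then show ?thesis using h(1)[OF True] True by (simp add: bij_betw_def)
      qed (use f in auto)
    qed
    show "\<And>q. (\<lambda>i\<in>I. h i ((\<lambda>i\<in>I. q \<odot>\<^bsub>A i\<^esub> f i) i)) = (\<lambda>i\<in>I. q \<odot>\<^bsub>B i\<^esub> (\<lambda>i\<in>I. h i (f i)) i)"
      using f h(5) by (intro restrict_ext) auto
    fix g assume g: "g \<in> (\<Pi>\<^sub>E i\<in>I. carrier (A i))"
    show "(\<lambda>i\<in>I. h i ((\<lambda>i\<in>I. f i \<otimes>\<^bsub>A i\<^esub> g i) i)) = (\<lambda>i\<in>I. (\<lambda>i\<in>I. h i (f i)) i \<otimes>\<^bsub>B i\<^esub> (\<lambda>i\<in>I. h i (g i)) i)"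
      by (intro restrict_ext) (simp add: h(2) PiE_mem[OF f] PiE_mem[OF g])
    show "(\<lambda>i\<in>I. h i ((\<lambda>i\<in>I. f i \<oplus>\<^bsub>A i\<^esub> g i) i)) = (\<lambda>i\<in>I. (\<lambda>i\<in>I. h i (f i)) i \<oplus>\<^bsub>B i\<^esub> (\<lambda>i\<in>I. h i (g i)) i)"
      by (intro restrict_ext) (simp add: h(3) PiE_mem[OF f] PiE_mem[OF g])
  next
    fix f assume f: "f \<in> (\<Pi>\<^sub>E i\<in>I. carrier (B i))"
    show "(\<lambda>i\<in>I. inv_into (carrier (A i)) (h i) (f i)) \<in> (\<Pi>\<^sub>E i\<in>I. carrier (A i))"
      using f alg_iso_inv_into(1)[OF h(1)] by auto
    show "(\<lambda>i\<in>I. h i ((\<lambda>i\<in>I. inv_into (carrier (A i)) (h i) (f i)) i)) = f"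
    proof
      fix i show "(\<lambda>i\<in>I. h i ((\<lambda>i\<in>I. inv_into (carrier (A i)) (h i) (f i)) i)) i = f i"
      proof (cases "i \<in> I")
        case True
        then have "f i \<in> carrier (B i)" using f by auto
        then show ?thesis using alg_iso_inv_into(2)[OF h(1)[OF True]] True by simp
      qed (use f in auto)
    qed
  next
    show "(\<lambda>i\<in>I. h i ((\<lambda>i\<in>I. \<one>\<^bsub>A i\<^esub>) i)) = (\<lambda>i\<in>I. \<one>\<^bsub>B i\<^esub>)"
      using h(4) by (intro restrict_ext) auto
  qed
qed

text \<open>Collects isomorphic summands: the indices with label \<open>e\<close> are enumerated by
  the numbers below \<open>k e\<close>, and \<open>c\<close> records the position of an index within
  its own label class.\<close>

lemma alg_sum_group:
  assumes dD: "\<And>i. i \<in> I \<Longrightarrow> d i \<in> D" and fin: "finite I"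
    and k: "\<And>e. e \<in> D \<Longrightarrow> card {i \<in> I. d i = e} = k e"
  shows "alg_sum I (\<lambda>i. B (d i)) \<cong>\<^sub>\<rat> alg_sum D (\<lambda>e. copies (k e) (B e))"
proof -
  have "\<exists>b. bij_betw b {..<k e} {i \<in> I. d i = e}" if "e \<in> D" for e
    using ex_bij_betw_nat_finite[of "{i \<in> I. d i = e}"] fin k[OF that] by (simp add: atLeast0LessThan)
  then have "\<forall>e\<in>D. \<exists>b. bij_betw b {..<k e} {i \<in> I. d i = e}" by blast
  from bchoice[OF this] obtain b where b: "\<And>e. e \<in> D \<Longrightarrow> bij_betw (b e) {..<k e} {i \<in> I. d i = e}"
    by blast
  define c where "c i = inv_into {..<k (d i)} (b (d i)) i" for i
  have c: "c i < k (d i)" "b (d i) (c i) = i" if "i \<in> I" for i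
    using alg_iso_inv_into[OF b[OF dD[OF that]], of i] that by (auto simp: c_def)
  have bI: "b e j \<in> I" "d (b e j) = e" if "e \<in> D" "j < k e" for e j
    using bij_betwE[OF b[OF that(1)]] that(2) by auto
  have cb: "c (b e j) = j" if "e \<in> D" "j < k e" for e j
    using b[OF that(1)] bI[OF that] that unfolding c_def by (simp add: bij_betw_def)
  show ?thesis
  proof (rule alg_isoI[where h = "\<lambda>f. \<lambda>e\<in>D. \<lambda>j\<in>{..<k e}. f (b e j)"
        and g = "\<lambda>g. \<lambda>i\<in>I. g (d i) (c i)"], unfold alg_sum_simps copies_def)
    fix f assume f: "f \<in> (\<Pi>\<^sub>E i\<in>I. carrier (B (d i)))"
    show "(\<lambda>e\<in>D. \<lambda>j\<in>{..<k e}. f (b e j)) \<in> (\<Pi>\<^sub>E e\<in>D. \<Pi>\<^sub>E j\<in>{..<k e}. carrier (B e))"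
    proof (rule PiE_I)
      fix e assume e: "e \<in> D"
      have "f (b e j) \<in> carrier (B e)" if "j < k e" for j
        using f bI[OF e that] by (metis PiE_E)
      then show "(\<lambda>e\<in>D. \<lambda>j\<in>{..<k e}. f (b e j)) e \<in> (\<Pi>\<^sub>E j\<in>{..<k e}. carrier (B e))" using e by auto
    qed auto
    show "(\<lambda>i\<in>I. (\<lambda>e\<in>D. \<lambda>j\<in>{..<k e}. f (b e j)) (d i) (c i)) = f"
    proof
      fix i show "(\<lambda>i\<in>I. (\<lambda>e\<in>D. \<lambda>j\<in>{..<k e}. f (b e j)) (d i) (c i)) i = f i"
        using c[of i] dD[of i] PiE_arb[OF f, of i] by (cases "i \<in> I") auto
    qed
    fix g assume g: "g \<in> (\<Pi>\<^sub>E i\<in>I. carrier (B (d i)))"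
    show "(\<lambda>e\<in>D. \<lambda>j\<in>{..<k e}. (\<lambda>i\<in>I. f i \<otimes>\<^bsub>B (d i)\<^esub> g i) (b e j)) =
      (\<lambda>e\<in>D. \<lambda>j\<in>{..<k e}. (\<lambda>e\<in>D. \<lambda>j\<in>{..<k e}. f (b e j)) e j
         \<otimes>\<^bsub>B e\<^esub> (\<lambda>e\<in>D. \<lambda>j\<in>{..<k e}. g (b e j)) e j)"
      using bI by (intro restrict_ext) auto
    show "(\<lambda>e\<in>D. \<lambda>j\<in>{..<k e}. (\<lambda>i\<in>I. f i \<oplus>\<^bsub>B (d i)\<^esub> g i) (b e j)) =
      (\<lambda>e\<in>D. \<lambda>j\<in>{..<k e}. (\<lambda>e\<in>D. \<lambda>j\<in>{..<k e}. f (b e j)) e j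
         \<oplus>\<^bsub>B e\<^esub> (\<lambda>e\<in>D. \<lambda>j\<in>{..<k e}. g (b e j)) e j)"
      using bI by (intro restrict_ext) auto
  next
    fix f q
    show "(\<lambda>e\<in>D. \<lambda>j\<in>{..<k e}. (\<lambda>i\<in>I. q \<odot>\<^bsub>B (d i)\<^esub> f i) (b e j)) =
      (\<lambda>e\<in>D. \<lambda>j\<in>{..<k e}. q \<odot>\<^bsub>B e\<^esub> (\<lambda>e\<in>D. \<lambda>j\<in>{..<k e}. f (b e j)) e j)"
      using bI by (intro restrict_ext) auto
  next
    show "(\<lambda>e\<in>D. \<lambda>j\<in>{..<k e}. (\<lambda>i\<in>I. \<one>\<^bsub>B (d i)\<^esub>) (b e j)) = (\<lambda>e\<in>D. \<lambda>j\<in>{..<k e}. \<one>\<^bsub>B e\<^esub>)"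
      using bI by (intro restrict_ext) auto
  next
    fix g assume g: "g \<in> (\<Pi>\<^sub>E e\<in>D. \<Pi>\<^sub>E j\<in>{..<k e}. carrier (B e))"
    have ge: "g e \<in> (\<Pi>\<^sub>E j\<in>{..<k e}. carrier (B e))" if "e \<in> D" for e using g that by auto
    show "(\<lambda>i\<in>I. g (d i) (c i)) \<in> (\<Pi>\<^sub>E i\<in>I. carrier (B (d i)))"
      using c(1) PiE_mem[OF ge[OF dD]] by auto
    show "(\<lambda>e\<in>D. \<lambda>j\<in>{..<k e}. (\<lambda>i\<in>I. g (d i) (c i)) (b e j)) = g"
    proof
      fix e show "(\<lambda>e\<in>D. \<lambda>j\<in>{..<k e}. (\<lambda>i\<in>I. g (d i) (c i)) (b e j)) e = g e"
      proof (cases "e \<in> D")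
        case True
        have "(\<lambda>j\<in>{..<k e}. (\<lambda>i\<in>I. g (d i) (c i)) (b e j)) j = g e j" for j
          using bI[OF True, of j] cb[OF True, of j] PiE_arb[OF ge[OF True], of j] by (cases "j < k e") auto
        then show ?thesis using True by auto
      qed (use PiE_arb[OF g] in auto)
    qed
  qed
qed

lemma alg_sum_Un:
  assumes "S \<inter> T = {}"
  shows "alg_sum (S \<union> T) A \<cong>\<^sub>\<rat> alg_sum S A \<oplus>\<^sub>\<rat> alg_sum T A"
proof (rule alg_isoI[where h = "\<lambda>f. (restrict f S, restrict f T)"
      and g = "\<lambda>(f, g). \<lambda>i\<in>S \<union> T. if i \<in> S then f i else g i"], unfold alg_sum_simps alg_prod_simps)
  fix f assume f: "f \<in> (\<Pi>\<^sub>E i\<in>S \<union> T. carrier (A i))"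
  show "(restrict f S, restrict f T) \<in> (\<Pi>\<^sub>E i\<in>S. carrier (A i)) \<times> (\<Pi>\<^sub>E i\<in>T. carrier (A i))"
    using f by auto
  show "(case (restrict f S, restrict f T) of (f, g) \<Rightarrow> \<lambda>i\<in>S \<union> T. if i \<in> S then f i else g i) = f"
    using PiE_arb[OF f] by (intro ext) auto
next
  fix y assume y: "y \<in> (\<Pi>\<^sub>E i\<in>S. carrier (A i)) \<times> (\<Pi>\<^sub>E i\<in>T. carrier (A i))"
  obtain f g where fg: "y = (f, g)" "f \<in> (\<Pi>\<^sub>E i\<in>S. carrier (A i))" "g \<in> (\<Pi>\<^sub>E i\<in>T. carrier (A i))"
    using y by auto
  show "(case y of (f, g) \<Rightarrow> \<lambda>i\<in>S \<union> T. if i \<in> S then f i else g i) \<in> (\<Pi>\<^sub>E i\<in>S \<union> T. carrier (A i))"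
    using fg by auto
  have "restrict (\<lambda>i\<in>S \<union> T. if i \<in> S then f i else g i) S = f"
    using PiE_arb[OF fg(2)] by (intro ext) auto
  moreover have "restrict (\<lambda>i\<in>S \<union> T. if i \<in> S then f i else g i) T = g"
    using PiE_arb[OF fg(3)] assms by (intro ext) (auto simp: restrict_def)
  ultimately show "(restrict (case y of (f, g) \<Rightarrow> \<lambda>i\<in>S \<union> T. if i \<in> S then f i else g i) S,
      restrict (case y of (f, g) \<Rightarrow> \<lambda>i\<in>S \<union> T. if i \<in> S then f i else g i) T) = y"
    using fg(1) by simp
qed (auto intro!: restrict_ext)

lemma alg_sum_singleton: "alg_sum {i} A \<cong>\<^sub>\<rat> A i"
proof (rule alg_isoI[where h = "\<lambda>f. f i" and g = "\<lambda>x. \<lambda>j\<in>{i}. x"], unfold alg_sum_simps)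
  fix f assume f: "f \<in> (\<Pi>\<^sub>E j\<in>{i}. carrier (A j))"
  show "(\<lambda>j\<in>{i}. f i) = f" using PiE_arb[OF f] by (intro ext) auto
qed auto

lemma copies_1: "copies 1 A \<cong>\<^sub>\<rat> A"
proof -
  have "{..<1::nat} = {0}" by auto
  then show ?thesis unfolding copies_def using alg_sum_singleton[of 0 "\<lambda>_. A"] by simp
qed

lemma copies_add: "copies a A \<oplus>\<^sub>\<rat> copies b A \<cong>\<^sub>\<rat> copies (a + b) A"
proof (unfold copies_def, rule alg_isoI[where
      h = "\<lambda>y. \<lambda>i\<in>{..<a + b}. if i < a then fst y i else snd y (i - a)"
      and g = "\<lambda>f. (restrict f {..<a}, \<lambda>i\<in>{..<b}. f (a + i))"], unfold alg_sum_simps alg_prod_simps)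
  fix y assume y: "y \<in> (\<Pi>\<^sub>E i\<in>{..<a}. carrier A) \<times> (\<Pi>\<^sub>E i\<in>{..<b}. carrier A)"
  obtain f g where fg: "y = (f, g)" "f \<in> (\<Pi>\<^sub>E i\<in>{..<a}. carrier A)" "g \<in> (\<Pi>\<^sub>E i\<in>{..<b}. carrier A)"
    using y by auto
  show "(\<lambda>i\<in>{..<a + b}. if i < a then fst y i else snd y (i - a)) \<in> (\<Pi>\<^sub>E i\<in>{..<a + b}. carrier A)"
    using PiE_mem[OF fg(2)] PiE_mem[OF fg(3)] fg(1) by auto
  have "restrict (\<lambda>i\<in>{..<a + b}. if i < a then f i else g (i - a)) {..<a} = f"
    using PiE_arb[OF fg(2)] by (intro ext) auto
  moreover have "(\<lambda>i\<in>{..<b}. (\<lambda>i\<in>{..<a + b}. if i < a then f i else g (i - a)) (a + i)) = g"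
    using PiE_arb[OF fg(3)] by (intro ext) auto
  ultimately show "(restrict (\<lambda>i\<in>{..<a + b}. if i < a then fst y i else snd y (i - a)) {..<a},
      \<lambda>i\<in>{..<b}. (\<lambda>i\<in>{..<a + b}. if i < a then fst y i else snd y (i - a)) (a + i)) = y"
    unfolding fg(1) fst_conv snd_conv by (simp only:)
next
  fix f assume f: "f \<in> (\<Pi>\<^sub>E i\<in>{..<a + b}. carrier A)"
  show "(restrict f {..<a}, \<lambda>i\<in>{..<b}. f (a + i)) \<in> (\<Pi>\<^sub>E i\<in>{..<a}. carrier A) \<times> (\<Pi>\<^sub>E i\<in>{..<b}. carrier A)"
    using PiE_mem[OF f] by auto
  show "(\<lambda>i\<in>{..<a + b}. if i < a then fst (restrict f {..<a}, \<lambda>i\<in>{..<b}. f (a + i)) i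
      else snd (restrict f {..<a}, \<lambda>i\<in>{..<b}. f (a + i)) (i - a)) = f"
    using PiE_arb[OF f] by (intro ext) auto
next
  have *: "(\<lambda>i\<in>{..<a + b}. if i < a then (\<lambda>i\<in>{..<a}. F i) i else (\<lambda>i\<in>{..<b}. H i) (i - a))
      = (\<lambda>i\<in>{..<a + b}. if i < a then F i else H (i - a))" for F H :: "nat \<Rightarrow> 'a"
    by (intro restrict_ext) auto
  show "(\<lambda>i\<in>{..<a + b}. if i < a then fst (\<lambda>i\<in>{..<a}. \<one>\<^bsub>A\<^esub>, \<lambda>i\<in>{..<b}. \<one>\<^bsub>A\<^esub>) i
      else snd (\<lambda>i\<in>{..<a}. \<one>\<^bsub>A\<^esub>, \<lambda>i\<in>{..<b}. \<one>\<^bsub>A\<^esub>) (i - a)) = (\<lambda>i\<in>{..<a + b}. \<one>\<^bsub>A\<^esub>)"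
    unfolding fst_conv snd_conv * by (intro restrict_ext) simp
  fix x y :: "(nat \<Rightarrow> 'a) \<times> (nat \<Rightarrow> 'a)" and q
  let ?h = "\<lambda>y. \<lambda>i\<in>{..<a + b}. if i < a then fst y i else snd y (i - a)"
  show "?h (\<lambda>i\<in>{..<a}. fst x i \<otimes>\<^bsub>A\<^esub> fst y i, \<lambda>i\<in>{..<b}. snd x i \<otimes>\<^bsub>A\<^esub> snd y i)
      = (\<lambda>i\<in>{..<a + b}. ?h x i \<otimes>\<^bsub>A\<^esub> ?h y i)"
    unfolding fst_conv snd_conv * by (intro restrict_ext) simp
  show "?h (\<lambda>i\<in>{..<a}. fst x i \<oplus>\<^bsub>A\<^esub> fst y i, \<lambda>i\<in>{..<b}. snd x i \<oplus>\<^bsub>A\<^esub> snd y i)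
      = (\<lambda>i\<in>{..<a + b}. ?h x i \<oplus>\<^bsub>A\<^esub> ?h y i)"
    unfolding fst_conv snd_conv * by (intro restrict_ext) simp
  show "?h (\<lambda>i\<in>{..<a}. q \<odot>\<^bsub>A\<^esub> fst x i, \<lambda>i\<in>{..<b}. q \<odot>\<^bsub>A\<^esub> snd x i)
      = (\<lambda>i\<in>{..<a + b}. q \<odot>\<^bsub>A\<^esub> ?h x i)"
    unfolding fst_conv snd_conv * by (intro restrict_ext) simp
qed

lemma mat_alg_1: "mat_alg 1 K \<cong>\<^sub>\<rat> field_alg K"
proof (rule alg_isoI[where h = "\<lambda>M. M $$ (0, 0)" and g = "\<lambda>x. mat 1 1 (\<lambda>_. x)"])
  fix M assume M: "M \<in> carrier (mat_alg 1 K)"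
  then show "M $$ (0, 0) \<in> carrier (field_alg K)"
    by (auto simp: mat_alg_def field_alg_def intro!: subsetD[of "elements_mat M" K] elements_matI)
  have "dim_row M = 1" "dim_col M = 1" using M by (auto simp: mat_alg_def)
  then show "mat 1 1 (\<lambda>_. M $$ (0, 0)) = M" by (intro eq_matI) simp_all
  show "(q \<odot>\<^bsub>mat_alg 1 K\<^esub> M) $$ (0, 0) = q \<odot>\<^bsub>field_alg K\<^esub> (M $$ (0, 0))" for q
    using M by (auto simp: mat_alg_def field_alg_def)
  fix M' assume M': "M' \<in> carrier (mat_alg 1 K)"
  show "(M \<otimes>\<^bsub>mat_alg 1 K\<^esub> M') $$ (0, 0) = M $$ (0, 0) \<otimes>\<^bsub>field_alg K\<^esub> M' $$ (0, 0)"
    using M M' by (auto simp: mat_alg_def field_alg_def scalar_prod_def)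
  show "(M \<oplus>\<^bsub>mat_alg 1 K\<^esub> M') $$ (0, 0) = M $$ (0, 0) \<oplus>\<^bsub>field_alg K\<^esub> M' $$ (0, 0)"
    using M M' by (auto simp: mat_alg_def field_alg_def)
qed (auto simp: mat_alg_def field_alg_def)

lemma group_algebra_trivial:
  assumes "group G" "carrier G = {\<one>\<^bsub>G\<^esub>}"
  shows "group_algebra G \<cong>\<^sub>\<rat> rat_alg"
proof (rule alg_isoI[where h = "\<lambda>f. f \<one>\<^bsub>G\<^esub>" and g = "\<lambda>q z. if z = \<one>\<^bsub>G\<^esub> then q else 0"])
  interpret group G by fact
  have fin: "finite (carrier G)" using assms(2) by (metis finite.intros)
  fix f assume f: "f \<in> carrier (group_algebra G)"
  show "(\<lambda>z. if z = \<one>\<^bsub>G\<^esub> then f \<one>\<^bsub>G\<^esub> else 0) = f"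
    using f assms(2) by (auto simp: group_algebra_carrier[OF fin])
  fix g assume g: "g \<in> carrier (group_algebra G)"
  have "(f \<otimes>\<^bsub>group_algebra G\<^esub> g) \<one>\<^bsub>G\<^esub>
      = (\<Sum>x\<in>{\<one>\<^bsub>G\<^esub>}. f x * g (inv\<^bsub>G\<^esub> x \<otimes>\<^bsub>G\<^esub> \<one>\<^bsub>G\<^esub>))"
    unfolding assms(2)[symmetric] by (rule group_algebra_mult[OF assms(1) fin f]) simp
  then show "(f \<otimes>\<^bsub>group_algebra G\<^esub> g) \<one>\<^bsub>G\<^esub> = f \<one>\<^bsub>G\<^esub> \<otimes>\<^bsub>rat_alg\<^esub> g \<one>\<^bsub>G\<^esub>"
    by (simp add: field_alg_def)
next
  fix q :: rat
  have fin: "finite (carrier G)" using assms(2) by (metis finite.intros)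
  show "(\<lambda>z. if z = \<one>\<^bsub>G\<^esub> then q else 0) \<in> carrier (group_algebra G)"
    using assms(2) by (auto simp: group_algebra_carrier[OF fin])
qed (auto simp: group_algebra_def field_alg_def assms(2))

section \<open>The decomposition theorem\<close>

context induced_characters
begin

lemma normalN: "N \<lhd> G"
  unfolding normal_inv_iff
proof (intro conjI ballI N(1))
  fix x h assume xh: "x \<in> carrier G" "h \<in> N"
  show "x \<otimes> h \<otimes> inv x \<in> N" using normN[of "inv x" h] xh by simp
qed

lemma push_coset:
  assumes g: "g \<in> carrier G"
  shows "push (\<lambda>a. N #> a) G f (N #> g) = (\<Sum>x\<in>N. f (x \<otimes> g))"
proof -
  have NG: "N \<subseteq> carrier G" using N(1) subgroup.subset by blast
  have "{x. x \<in> carrier G \<and> N #> x = N #> g} = (\<lambda>x. x \<otimes> g) ` N"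
  proof (rule equalityI; rule subsetI)
    fix x assume "x \<in> {x. x \<in> carrier G \<and> N #> x = N #> g}"
    then have "x \<in> N #> g" using rcos_self[OF _ N(1)] by auto
    then show "x \<in> (\<lambda>x. x \<otimes> g) ` N" by (auto simp: r_coset_def)
  next
    fix x assume "x \<in> (\<lambda>x. x \<otimes> g) ` N"
    then have x: "x \<in> N #> g" by (auto simp: r_coset_def)
    then have "x \<in> carrier G" using r_coset_subset_G[OF NG g] by blast
    then show "x \<in> {x. x \<in> carrier G \<and> N #> x = N #> g}"
      using repr_independence[OF x g N(1)] by simp
  qed
  moreover have "inj_on (\<lambda>x. x \<otimes> g) N" using NG g by (intro inj_onI) (meson right_cancel subsetD)
  ultimately show ?thesis by (simp add: push_def sum.reindex)
qed

lemma L_diff: "L l u v (\<lambda>z. f z - g z) = L l u v f - L l u v g"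
  by (simp add: L_def of_rat_diff left_diff_distrib sum_subtractf)

text \<open>Translation by t u z inv (t u), an element of \<open>N\<close>, leaves \<open>f\<close>
  unchanged and multiplies the entry by \<open>l z\<close>. Choosing z in \<open>N\<close> with
  \<open>l z\<close> different from 1 forces the entry to be zero.\<close>

lemma L_invariant:
  assumes l: "l \<in> X" and f: "\<And>z g. z \<in> N \<Longrightarrow> g \<in> carrier G \<Longrightarrow> f (z \<otimes> g) = f g" and uv: "u < n" "v < n"
  shows "L l u v f = 0"
proof -
  note lc = X_chars[OF l]
  obtain z where z: "z \<in> N" "l z \<noteq> 1" using l by (auto simp: X_def)
  have zA: "z \<in> A" using z N by blast
  have "inv (inv (t u)) \<otimes> z \<otimes> inv (t u) \<in> N" using z uv by (intro normN) auto
  then have y: "t u \<otimes> z \<otimes> inv (t u) \<in> N" (is "?y \<in> N") using uv by simp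
  then have yG: "?y \<in> carrier G" using N by auto
  have "L l u v f = (\<Sum>g\<in>carrier G. of_rat (f (?y \<otimes> g)) * l (inv (t u) \<otimes> (?y \<otimes> g) \<otimes> t v))"
    unfolding L_def by (rule sum.reindex_bij_betw[OF bij_left_mult[OF yG], symmetric])
  also have "\<dots> = (\<Sum>g\<in>carrier G. l z * (of_rat (f g) * l (inv (t u) \<otimes> g \<otimes> t v)))"
  proof (rule sum.cong[OF refl])
    fix g assume g: "g \<in> carrier G"
    have "inv (t u) \<otimes> (?y \<otimes> g) \<otimes> t v = z \<otimes> (inv (t u) \<otimes> g \<otimes> t v)"
      using g uv zA by (simp add: m_assoc mult_inv_cancel_left)
    then show "of_rat (f (?y \<otimes> g)) * l (inv (t u) \<otimes> (?y \<otimes> g) \<otimes> t v)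
        = l z * (of_rat (f g) * l (inv (t u) \<otimes> g \<otimes> t v))"
      using chars_mult_left[OF lc zA, of "inv (t u) \<otimes> g \<otimes> t v"] g uv f[OF y g] by simp
  qed
  also have "\<dots> = l z * L l u v f" by (simp add: L_def sum_distrib_left)
  finally have "(1 - l z) * L l u v f = 0" by (simp add: left_diff_distrib)
  then show ?thesis using z by simp
qed

theorem decomposition:
  "group_algebra G \<cong>\<^sub>\<rat> group_algebra (G Mod N) \<oplus>\<^sub>\<rat> alg_sum R (\<lambda>l. mat_alg n (cyclotomic_field (cord l)))"
proof -
  interpret N: normal N G by (rule normalN)
  interpret Q: group "G Mod N" by (rule N.factorgroup_is_group)
  let ?h = "\<lambda>a. N #> a"
  have QC: "carrier (G Mod N) = ?h ` carrier G" by (auto simp: FactGroup_def RCOSETS_def)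
  have finQ: "finite (carrier (G Mod N))" unfolding QC using finG by simp
  note ph = push_hom[OF is_group Q.is_group finG finQ N.r_coset_hom_Mod]
  define \<Phi> where "\<Phi> f = (push ?h G f, \<lambda>l\<in>R. mat n n (\<lambda>(u, v). L l u v f))" for f
  have RX: "l \<in> X" "l \<in> chars G A" if "l \<in> R" for l using that R_subset_X X_chars by auto
  let ?A = "group_algebra G"
  let ?B = "group_algebra (G Mod N) \<oplus>\<^sub>\<rat> alg_sum R (\<lambda>l. mat_alg n (cyclotomic_field (cord l)))"
  have closed: "\<Phi> f \<in> carrier ?B" if "f \<in> carrier ?A" for f
    using ph(1)[OF that that] RX L_field
    by (auto simp: \<Phi>_def alg_prod_simps alg_sum_simps mat_alg_def dest!: elements_matD)
  have hom: "\<Phi> \<in> ring_hom ?A ?B"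
  proof (rule ring_hom_memI)
    fix f g assume fg: "f \<in> carrier ?A" "g \<in> carrier ?A"
    have "mat n n (\<lambda>(u, v). L l u v (f \<otimes>\<^bsub>?A\<^esub> g)) = mat n n (\<lambda>(u, v). L l u v f) * mat n n (\<lambda>(u, v). L l u v g)"
      if "l \<in> R" for l
      using L_mult[OF RX(2)[OF that] fg(1)]
      by (intro eq_matI) (auto simp: scalar_prod_def atLeast0LessThan)
    then show "\<Phi> (f \<otimes>\<^bsub>?A\<^esub> g) = \<Phi> f \<otimes>\<^bsub>?B\<^esub> \<Phi> g"
      by (auto simp: \<Phi>_def alg_prod_simps alg_sum_simps mat_alg_def ph(2)[OF fg] intro!: restrict_ext)
    have "mat n n (\<lambda>(u, v). L l u v (f \<oplus>\<^bsub>?A\<^esub> g)) = mat n n (\<lambda>(u, v). L l u v f) + mat n n (\<lambda>(u, v). L l u v g)" for l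
      by (intro eq_matI) (auto simp: group_algebra_def L_add)
    moreover have "push ?h G (f \<oplus>\<^bsub>?A\<^esub> g) = push ?h G f \<oplus>\<^bsub>group_algebra (G Mod N)\<^esub> push ?h G g"
      by (intro ext) (auto simp: group_algebra_def push_def sum.distrib)
    ultimately show "\<Phi> (f \<oplus>\<^bsub>?A\<^esub> g) = \<Phi> f \<oplus>\<^bsub>?B\<^esub> \<Phi> g"
      by (auto simp: \<Phi>_def alg_prod_simps alg_sum_simps mat_alg_def intro!: restrict_ext)
  next
    have one: "\<one>\<^bsub>?A\<^esub> \<in> carrier ?A" by (auto simp: group_algebra_carrier[OF finG]) (simp add: group_algebra_def, metis one_closed)
    have "mat n n (\<lambda>(u, v). L l u v \<one>\<^bsub>?A\<^esub>) = 1\<^sub>m n" if "l \<in> R" for l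
      using L_one[OF RX(2)[OF that]] by (intro eq_matI) auto
    then show "\<Phi> \<one>\<^bsub>?A\<^esub> = \<one>\<^bsub>?B\<^esub>"
      by (auto simp: \<Phi>_def alg_prod_simps alg_sum_simps mat_alg_def ph(3)[OF one one] intro!: restrict_ext)
  qed (rule closed)
  have smult: "\<Phi> (q \<odot>\<^bsub>?A\<^esub> f) = q \<odot>\<^bsub>?B\<^esub> \<Phi> f" for q f
  proof -
    have "mat n n (\<lambda>(u, v). L l u v (q \<odot>\<^bsub>?A\<^esub> f)) = of_rat q \<cdot>\<^sub>m mat n n (\<lambda>(u, v). L l u v f)" for l
      by (intro eq_matI) (auto simp: group_algebra_def L_smult)
    moreover have "push ?h G (q \<odot>\<^bsub>?A\<^esub> f) = q \<odot>\<^bsub>group_algebra (G Mod N)\<^esub> push ?h G f"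
      by (intro ext) (auto simp: group_algebra_def push_def sum_distrib_left)
    ultimately show ?thesis
      by (auto simp: \<Phi>_def alg_prod_simps alg_sum_simps mat_alg_def intro!: restrict_ext)
  qed
  have inj: "inj_on \<Phi> (carrier ?A)"
  proof (rule inj_onI)
    fix f g assume fg: "f \<in> carrier ?A" "g \<in> carrier ?A" and eq: "\<Phi> f = \<Phi> g"
    have Leq: "L l u v f = L l u v g" if "l \<in> R" "u < n" "v < n" for l u v
    proof -
      have "snd (\<Phi> f) l = snd (\<Phi> g) l" using eq by simp
      then have "mat n n (\<lambda>(u, v). L l u v f) = mat n n (\<lambda>(u, v). L l u v g)"
        using that by (simp add: \<Phi>_def)
      from arg_cong[OF this, of "\<lambda>M. M $$ (u, v)"] show ?thesis using that by simp
    qed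
    have peq: "push ?h G f = push ?h G g" using eq by (simp add: \<Phi>_def)
    have "(\<lambda>z. f z - g z) = (\<lambda>x. 0)"
    proof (rule injectivity)
      show "(\<lambda>z. f z - g z) \<in> carrier ?A" using fg by (simp add: group_algebra_carrier[OF finG])
      show "L l u v (\<lambda>z. f z - g z) = 0" if "l \<in> R" "u < n" "v < n" for l u v
        using Leq[OF that] by (simp add: L_diff)
      show "(\<Sum>x\<in>N. f (x \<otimes> a) - g (x \<otimes> a)) = 0" if "a \<in> carrier G" for a
        using push_coset[OF that, of f] push_coset[OF that, of g] peq by (simp add: sum_subtractf)
    qed
    then show "f = g" by (metis (no_types) eq_iff_diff_eq_0 ext)
  qed
  have surj: "\<exists>f\<in>carrier ?A. \<Phi> f = b" if b: "b \<in> carrier ?B" for b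
  proof -
    obtain y M where yM: "b = (y, M)" by (cases b)
    have y: "y \<in> carrier (group_algebra (G Mod N))" using b yM by (simp add: alg_prod_simps)
    have M: "M \<in> (\<Pi>\<^sub>E l\<in>R. carrier (mat_alg n (cyclotomic_field (cord l))))"
      using b yM by (simp add: alg_prod_simps alg_sum_simps)
    have Ml: "M l \<in> carrier_mat n n" "elements_mat (M l) \<subseteq> cyclotomic_field (cord l)" if "l \<in> R" for l
      using PiE_mem[OF M that] by (auto simp: mat_alg_def)
    obtain f1 where f1: "f1 \<in> carrier ?A"
      "\<And>l u v. l \<in> R \<Longrightarrow> u < n \<Longrightarrow> v < n \<Longrightarrow> L l u v f1 = M l $$ (u, v)"
      "\<And>g. g \<in> carrier G \<Longrightarrow> (\<Sum>x\<in>N. f1 (x \<otimes> g)) = 0"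
    proof (rule surjectivity_matrices[of "\<lambda>l u v. M l $$ (u, v)"])
      fix l u v assume "l \<in> R" "u < n" "v < n"
      then show "M l $$ (u, v) \<in> cyclotomic_field (cord l)" using Ml[of l] elements_matI by blast
    qed (rule that)
    \<comment> \<open>The lift of \<open>y\<close> that is constant on cosets of \<open>N\<close>.
      All its matrix entries vanish by \<open>L_invariant\<close>, while \<open>f1\<close> has the
      prescribed entries and maps to 0 in the quotient, so the two parts can be chosen independently
      and added.\<close>
    define f0 where "f0 z = (if z \<in> carrier G then y (N #> z) / of_nat (card N) else 0)" for z
    have NG: "z \<in> carrier G" if "z \<in> N" for z using that N by auto
    have inv: "f0 (z \<otimes> g) = f0 g" if "z \<in> N" "g \<in> carrier G" for z g
    proof -
      have "z \<otimes> g \<in> N #> g" using that by (auto simp: r_coset_def)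
      then have "N #> (z \<otimes> g) = N #> g" using repr_independence[OF _ that(2) N(1)] by simp
      then show ?thesis using that NG by (simp add: f0_def)
    qed
    have cN: "card N > 0"
      using finite_subset[OF N(2) finA] subgroup.one_closed[OF N(1)] by (metis card_gt_0_iff empty_iff)
    define f where "f z = f0 z + f1 z" for z
    have fA: "f \<in> carrier ?A" using f1(1) by (auto simp: group_algebra_carrier[OF finG] f_def f0_def)
    have Lf: "L l u v f = M l $$ (u, v)" if "l \<in> R" "u < n" "v < n" for l u v
      unfolding f_def L_add using L_invariant[OF RX(1)[OF that(1)] inv that(2,3)] f1(2)[OF that] by simp
    have "push ?h G f = y"
    proof
      fix U show "push ?h G f U = y U"
      proof (cases "U \<in> carrier (G Mod N)")
        case True
        then obtain g where g: "g \<in> carrier G" "U = N #> g" unfolding QC by blast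
        have "push ?h G f U = (\<Sum>x\<in>N. f0 (x \<otimes> g)) + (\<Sum>x\<in>N. f1 (x \<otimes> g))"
          unfolding g(2) push_coset[OF g(1)] f_def by (rule sum.distrib)
        also have "\<dots> = (\<Sum>x\<in>N. f0 g)" using f1(3)[OF g(1)] inv g(1) by simp
        also have "\<dots> = y U" using cN g by (simp add: f0_def)
        finally show ?thesis .
      next
        case False
        then show ?thesis using ph(1)[OF fA fA] y by (simp add: group_algebra_carrier[OF finQ])
      qed
    qed
    moreover have "(\<lambda>l\<in>R. mat n n (\<lambda>(u, v). L l u v f)) = M"
    proof
      fix l show "(\<lambda>l\<in>R. mat n n (\<lambda>(u, v). L l u v f)) l = M l"
      proof (cases "l \<in> R")
        case True
        then have "mat n n (\<lambda>(u, v). L l u v f) = M l"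
          using Lf[OF True] Ml(1)[OF True] by (intro eq_matI) auto
        then show ?thesis using True by simp
      qed (use PiE_arb[OF M] in simp)
    qed
    ultimately show ?thesis using fA yM by (auto simp: \<Phi>_def)
  qed
  have "bij_betw \<Phi> (carrier ?A) (carrier ?B)"
    unfolding bij_betw_def
  proof (intro conjI inj equalityI subsetI)
    fix b assume "b \<in> carrier ?B"
    from surj[OF this] show "b \<in> \<Phi> ` carrier ?A" by (elim bexE) (rule image_eqI[OF sym])
  next
    fix b assume "b \<in> \<Phi> ` carrier ?A"
    then show "b \<in> carrier ?B" by (elim imageE) (simp only: closed)
  qed
  then show ?thesis unfolding alg_iso_def ring_iso_def using hom smult by blast
qed

end

section \<open>Counting characters and cyclic subgroups\<close>

lemma card_eq_sum_fibers:
  "finite S \<Longrightarrow> card S = (\<Sum>b\<in>f ` S. card {x \<in> S. f x = b})"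
  using sum.image_gen[of S "\<lambda>_. 1::nat" f] by simp

context finite_abelian_subgroup
begin

definition trivial_chars :: "'a set \<Rightarrow> nat \<Rightarrow> ('a \<Rightarrow> complex) set" where
  "trivial_chars N d = {l \<in> chars G A. (\<forall>x\<in>A. l x ^ d = 1) \<and> (\<forall>x\<in>N. l x = 1)}"

lemma finite_trivial_chars: "finite (trivial_chars N d)"
  using finite_chars by (simp add: trivial_chars_def)

lemma A_pow_mult: "x \<in> A \<Longrightarrow> y \<in> A \<Longrightarrow> (x \<otimes> y) [^] (d::nat) = x [^] d \<otimes> y [^] d"
  using commA by (intro pow_mult_distrib) auto

lemma A_inv_pow: "x \<in> A \<Longrightarrow> inv x [^] (d::nat) = inv (x [^] d)"
  by (metis A_carrier nat_pow_inv)

text \<open>Both counts below are obtained from the image of \<open>(z, x) \<mapsto> z x\<^sup>d\<close> on \<open>N \<times> A\<close>.\<close>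

lemma card_trivial_chars:
  assumes N: "subgroup N G" "N \<subseteq> A"
  shows "card (trivial_chars N d) * card N = card {x \<in> A. x [^] d \<in> N}"
proof -
  \<comment> \<open>The characters being counted are exactly those trivial on this subgroup, the
    product of \<open>N\<close> with the d-th powers of \<open>A\<close>.\<close>
  define B where "B = (\<lambda>(z, x). z \<otimes> x [^] d) ` (N \<times> A)"
  have NA: "z \<in> A" if "z \<in> N" for z using that N by blast
  have N1: "\<one> \<in> N" using subgroup.one_closed[OF N(1)] .
  have BI: "z \<otimes> x [^] d \<in> B" if "z \<in> N" "x \<in> A" for z x using that by (auto simp: B_def)
  have comm4: "(z \<otimes> x) \<otimes> (z' \<otimes> x') = (z \<otimes> z') \<otimes> (x \<otimes> x')" if "z \<in> A" "x \<in> A" "z' \<in> A" "x' \<in> A" for z x z' x'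
  proof -
    have "x \<otimes> (z' \<otimes> x') = z' \<otimes> (x \<otimes> x')" using that commA[of x z'] by (metis A_carrier m_assoc)
    then show ?thesis using that by (simp add: m_assoc)
  qed
  have B: "subgroup B G"
  proof (rule subgroupI)
    show "B \<subseteq> carrier G" using NA by (auto simp: B_def)
    show "B \<noteq> {}" using BI[OF N1 A_one] by blast
    fix a assume "a \<in> B"
    then obtain z x where a: "z \<in> N" "x \<in> A" "a = z \<otimes> x [^] d" by (auto simp: B_def)
    have "inv a = inv z \<otimes> (inv x) [^] d"
      using a NA commA[of "inv z" "inv (x [^] d)"] by (simp add: inv_mult_group A_inv_pow)
    then show "inv a \<in> B" using BI[OF subgroup.m_inv_closed[OF N(1) a(1)] A_inv[OF a(2)]] by simp
  next
    fix a b assume "a \<in> B" "b \<in> B"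
    then obtain z x z' x' where ab: "z \<in> N" "x \<in> A" "a = z \<otimes> x [^] d" "z' \<in> N" "x' \<in> A" "b = z' \<otimes> x' [^] d"
      by (auto simp: B_def)
    have "a \<otimes> b = (z \<otimes> z') \<otimes> (x \<otimes> x') [^] d"
      using ab NA by (simp add: comm4 A_pow_mult)
    then show "a \<otimes> b \<in> B" using BI[OF subgroup.m_closed[OF N(1) ab(1,4)] A_closed[OF ab(2,5)]] by simp
  qed
  have BA: "B \<subseteq> A" using NA by (auto simp: B_def)
  have "trivial_chars N d = {l \<in> chars G A. \<forall>b\<in>B. l b = 1}"
  proof (rule equalityI; rule subsetI)
    fix l assume l: "l \<in> trivial_chars N d"
    then have lc: "l \<in> chars G A" by (simp add: trivial_chars_def)
    have "l b = 1" if bB: "b \<in> B" for b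
    proof -
      obtain z x where b: "z \<in> N" "x \<in> A" "b = z \<otimes> x [^] d" using bB by (auto simp: B_def)
      then show ?thesis using l NA by (simp add: chars_mult[OF lc] chars_pow[OF lc] trivial_chars_def)
    qed
    then show "l \<in> {l \<in> chars G A. \<forall>b\<in>B. l b = 1}" using lc by simp
  next
    fix l assume l: "l \<in> {l \<in> chars G A. \<forall>b\<in>B. l b = 1}"
    then have lc: "l \<in> chars G A" by simp
    have "l x ^ d = 1" if "x \<in> A" for x
      using l BI[OF N1 that] that chars_pow[OF lc that, of d] by simp
    moreover have "l z = 1" if "z \<in> N" for z
      using l BI[OF that A_one] NA[OF that] by simp
    ultimately show "l \<in> trivial_chars N d" using lc by (simp add: trivial_chars_def)
  qed
  then have 1: "card (trivial_chars N d) * card B = card A"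
    using card_chars_trivial_on[OF B BA] by simp
  let ?K = "{x \<in> A. x [^] d \<in> N}"
  have fiber: "card {zx \<in> N \<times> A. (case zx of (z, x) \<Rightarrow> z \<otimes> x [^] d) = b} = card ?K" if b: "b \<in> B" for b
  proof -
    obtain z0 x0 where b0: "z0 \<in> N" "x0 \<in> A" "b = z0 \<otimes> x0 [^] d" using b by (auto simp: B_def)
    \<comment> \<open>Relative to a fixed solution (z0, x0), the other solutions replace x0 by x0 y
      and compensate with the factor y^(-d), which must lie in \<open>N\<close>.\<close>
    have "bij_betw (\<lambda>y. (z0 \<otimes> inv (y [^] d), x0 \<otimes> y)) ?K {zx \<in> N \<times> A. (case zx of (z, x) \<Rightarrow> z \<otimes> x [^] d) = b}"
    proof (rule bij_betwI[where g = "\<lambda>(z, x). inv x0 \<otimes> x"])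
      show "(\<lambda>y. (z0 \<otimes> inv (y [^] d), x0 \<otimes> y)) \<in> ?K \<rightarrow> {zx \<in> N \<times> A. (case zx of (z, x) \<Rightarrow> z \<otimes> x [^] d) = b}"
      proof
        fix y assume y: "y \<in> ?K"
        have "(z0 \<otimes> inv (y [^] d)) \<otimes> (x0 [^] d \<otimes> y [^] d) = (z0 \<otimes> x0 [^] d) \<otimes> (inv (y [^] d) \<otimes> y [^] d)"
          using y b0 NA by (intro comm4) auto
        then have "(z0 \<otimes> inv (y [^] d)) \<otimes> (x0 \<otimes> y) [^] d = b"
          using y b0 NA by (simp add: A_pow_mult)
        moreover have "z0 \<otimes> inv (y [^] d) \<in> N"
          using y b0 subgroup.m_closed[OF N(1)] subgroup.m_inv_closed[OF N(1)] by simp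
        ultimately show "(z0 \<otimes> inv (y [^] d), x0 \<otimes> y) \<in> {zx \<in> N \<times> A. (case zx of (z, x) \<Rightarrow> z \<otimes> x [^] d) = b}"
          using y b0 by simp
      qed
      have key: "(inv x0 \<otimes> x) [^] d = inv z \<otimes> z0" if zx: "z \<in> N" "x \<in> A" "z \<otimes> x [^] d = b" for z x
      proof -
        have "x [^] d = inv z \<otimes> (z \<otimes> x [^] d)" using zx(1,2) NA by (simp add: mult_inv_cancel_left)
        also have "z \<otimes> x [^] d = z0 \<otimes> x0 [^] d" using zx b0 by simp
        also have "inv z \<otimes> (z0 \<otimes> x0 [^] d) = (inv z \<otimes> z0) \<otimes> x0 [^] d"
          using zx b0 NA by (simp add: m_assoc)
        finally have "x [^] d = (inv z \<otimes> z0) \<otimes> x0 [^] d" .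
        then have "x [^] d = x0 [^] d \<otimes> (inv z \<otimes> z0)"
          using commA[of "inv z \<otimes> z0" "x0 [^] d"] zx b0 NA by simp
        then show ?thesis using zx b0 NA by (simp add: A_pow_mult A_inv_pow mult_inv_cancel_left)
      qed
      show "(\<lambda>(z, x). inv x0 \<otimes> x) \<in> {zx \<in> N \<times> A. (case zx of (z, x) \<Rightarrow> z \<otimes> x [^] d) = b} \<rightarrow> ?K"
        using key b0 subgroup.m_closed[OF N(1)] subgroup.m_inv_closed[OF N(1)] by auto
      show "(case (z0 \<otimes> inv (y [^] d), x0 \<otimes> y) of (z, x) \<Rightarrow> inv x0 \<otimes> x) = y" if "y \<in> ?K" for y
        using that b0 by (simp add: mult_inv_cancel_left)
      show "(z0 \<otimes> inv ((case zx of (z, x) \<Rightarrow> inv x0 \<otimes> x) [^] d), x0 \<otimes> (case zx of (z, x) \<Rightarrow> inv x0 \<otimes> x)) = zx"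
        if zxm: "zx \<in> {zx \<in> N \<times> A. (case zx of (z, x) \<Rightarrow> z \<otimes> x [^] d) = b}" for zx
      proof -
        obtain z x where zx: "zx = (z, x)" "z \<in> N" "x \<in> A" "z \<otimes> x [^] d = b" using zxm by auto
        have "z0 \<otimes> inv (inv z \<otimes> z0) = z"
          using zx b0 NA by (simp add: inv_mult_group mult_inv_cancel_left)
        then show ?thesis using zx b0 by (simp add: key mult_inv_cancel_left)
      qed
    qed
    then show ?thesis by (simp add: bij_betw_same_card)
  qed
  have finN: "finite N" using N finA finite_subset by blast
  have "card (N \<times> A) = (\<Sum>b\<in>B. card {zx \<in> N \<times> A. (case zx of (z, x) \<Rightarrow> z \<otimes> x [^] d) = b})"
    unfolding B_def using finN finA by (intro card_eq_sum_fibers finite_cartesian_product)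
  also have "\<dots> = (\<Sum>b\<in>B. card ?K)" by (rule sum.cong[OF refl fiber])
  finally have 2: "card N * card A = card B * card ?K" by (simp add: card_cartesian_product)
  have "card B > 0" using finite_subset[OF BA finA] BI[OF N1 A_one] by (metis card_gt_0_iff empty_iff)
  moreover have "card B * (card (trivial_chars N d) * card N) = card N * (card (trivial_chars N d) * card B)"
    by (simp only: mult_ac)
  then have "card B * (card (trivial_chars N d) * card N) = card B * card ?K" by (simp only: 1 2)
  ultimately show ?thesis by (simp only: nat_mult_eq_cancel1)
qed

lemma card_trivial_chars_1:
  "card (trivial_chars {\<one>} d) = card {x \<in> A. x [^] d = \<one>}"
  using card_trivial_chars[OF triv_subgroup, of d] by simp

lemma trivial_chars_order:
  "trivial_chars N d = {l \<in> chars G A. char_order A l dvd d \<and> (\<forall>x\<in>N. l x = 1)}"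
  unfolding trivial_chars_def using char_order(3) by blast

lemma card_trivial_chars_order:
  assumes p: "prime p"
  shows "card {l \<in> chars G A. char_order A l = p ^ Suc j \<and> (\<forall>x\<in>N. l x = 1)}
    = card (trivial_chars N (p ^ Suc j)) - card (trivial_chars N (p ^ j))"
proof -
  have dv: "c dvd p ^ Suc j \<longleftrightarrow> c = p ^ Suc j \<or> c dvd p ^ j" for c
  proof
    assume "c dvd p ^ Suc j"
    then obtain i where "c = p ^ i" "i \<le> Suc j" using divides_primepow_nat[OF p] by blast
    then show "c = p ^ Suc j \<or> c dvd p ^ j" by (cases "i = Suc j") (auto simp: le_imp_power_dvd)
  qed (auto intro: dvd_mult)
  have "\<not> p ^ Suc j dvd p ^ j" using prime_gt_1_nat[OF p] prime_gt_0_nat[OF p] by (auto dest: dvd_imp_le)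
  then have "{l \<in> chars G A. char_order A l = p ^ Suc j \<and> (\<forall>x\<in>N. l x = 1)}
      = trivial_chars N (p ^ Suc j) - trivial_chars N (p ^ j)"
    unfolding trivial_chars_order dv by auto
  moreover have "trivial_chars N (p ^ j) \<subseteq> trivial_chars N (p ^ Suc j)"
    unfolding trivial_chars_order dv by auto
  ultimately show ?thesis by (simp add: card_Diff_subset finite_trivial_chars)
qed

end

context induced_characters
begin

lemma K_totient: "card (K (p ^ Suc e)) = p ^ e * (p - 1)"
proof -
  have "1 < p ^ Suc e" using prime_gt_1_nat[OF p] by (intro one_less_power) auto
  have "K (p ^ Suc e) = totatives (p ^ Suc e)"
  proof (rule equalityI; rule subsetI)
    fix k assume k: "k \<in> K (p ^ Suc e)"
    then have "k > 0" using coprime_pos by (simp add: K_def)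
    then show "k \<in> totatives (p ^ Suc e)" using k by (simp add: K_def totatives_def)
  next
    fix k assume k: "k \<in> totatives (p ^ Suc e)"
    then have c: "coprime k (p ^ Suc e)" "k \<le> p ^ Suc e" by (auto simp: totatives_def)
    then have "k \<noteq> p ^ Suc e" using \<open>1 < p ^ Suc e\<close> by (metis coprime_self nat_neq_iff nat_dvd_1_iff_1)
    then have "k < p ^ Suc e" using c(2) by simp
    moreover have "coprime k p" using c(1) unfolding power_Suc by (metis coprime_mult_right_iff)
    ultimately show "k \<in> K (p ^ Suc e)" by (simp add: K_def)
  qed
  then show ?thesis using totient_prime_power_Suc[OF p, of e] by (simp add: totient_def)
qed

lemma card_X_order_split:
  "card {l \<in> chars G A. cord l = d} = card {l \<in> X. cord l = d} + card {l \<in> chars G A. cord l = d \<and> (\<forall>x\<in>N. l x = 1)}"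
proof -
  have "{l \<in> chars G A. cord l = d} = {l \<in> X. cord l = d} \<union> {l \<in> chars G A. cord l = d \<and> (\<forall>x\<in>N. l x = 1)}"
    by (auto simp: X_def)
  moreover have "{l \<in> X. cord l = d} \<inter> {l \<in> chars G A. cord l = d \<and> (\<forall>x\<in>N. l x = 1)} = {}"
    by (auto simp: X_def)
  ultimately show ?thesis using finite_X finite_chars by (simp add: card_Un_disjoint)
qed

lemma card_X_order:
  "card {l \<in> X. cord l = p ^ Suc j}
    = (card (trivial_chars {\<one>} (p ^ Suc j)) - card (trivial_chars {\<one>} (p ^ j)))
      - (card (trivial_chars N (p ^ Suc j)) - card (trivial_chars N (p ^ j)))"
proof -
  have "{l \<in> chars G A. cord l = p ^ Suc j} = {l \<in> chars G A. cord l = p ^ Suc j \<and> (\<forall>x\<in>{\<one>}. l x = 1)}"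
    using chars_one by auto
  then show ?thesis
    using card_X_order_split[of "p ^ Suc j"] unfolding card_trivial_chars_order[OF p, symmetric] by simp
qed

theorem decomposition_counted:
  assumes D: "\<And>l. l \<in> X \<Longrightarrow> cord l \<in> D"
    and k: "\<And>d. d \<in> D \<Longrightarrow> k d = card {l \<in> R. cord l = d}"
  shows "group_algebra G \<cong>\<^sub>\<rat> group_algebra (G Mod N)
    \<oplus>\<^sub>\<rat> alg_sum D (\<lambda>d. copies (k d) (mat_alg n (cyclotomic_field d)))"
proof -
  have "alg_sum R (\<lambda>l. mat_alg n (cyclotomic_field (cord l)))
      \<cong>\<^sub>\<rat> alg_sum D (\<lambda>d. copies (k d) (mat_alg n (cyclotomic_field d)))"
    using D R_subset_X k by (intro alg_sum_group finite_R) auto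
  then show ?thesis using alg_iso_trans[OF decomposition alg_prod_cong[OF alg_iso_refl]] by blast
qed

lemma card_R_eqI:
  assumes "n * (p ^ j * (p - 1)) * r = card {l \<in> X. cord l = p ^ Suc j}" and "n > 0"
  shows "card {l \<in> R. cord l = p ^ Suc j} = r"
proof -
  have "n * (p ^ j * (p - 1)) * r = n * (p ^ j * (p - 1)) * card {l \<in> R. cord l = p ^ Suc j}"
    using assms(1) card_R_order[of "p ^ Suc j"] K_totient by simp
  moreover have "n * (p ^ j * (p - 1)) > 0" using assms(2) prime_gt_1_nat[OF p] by simp
  ultimately show ?thesis by (simp only: nat_mult_eq_cancel1)
qed

end

subsection \<open>Cyclic subgroups and elements of given order\<close>

context group
begin

text \<open>Sending an element to the subgroup it generates has fibres of size
  \<open>totient d\<close>, the number of generators of a cyclic group of order d.\<close>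

lemma card_ord_eq:
  assumes fin: "finite (carrier G)" and d: "d > 0"
  shows "card {x \<in> carrier G. ord x = d} = totient d * num_cyclic_subgroups G d"
proof -
  let ?E = "{x \<in> carrier G. ord x = d}"
  let ?C = "{H. subgroup H G \<and> cyclic_group (G\<lparr>carrier := H\<rparr>) \<and> card H = d}"
  have genC: "(\<lambda>x. generate G {x}) ` ?E = ?C"
  proof (rule equalityI; rule subsetI)
    fix H assume "H \<in> (\<lambda>x. generate G {x}) ` ?E"
    then obtain x where x: "x \<in> carrier G" "ord x = d" "H = generate G {x}" by blast
    have "subgroup_generated G {x} = G\<lparr>carrier := generate G {x}\<rparr>"
      using x(1) by (simp add: subgroup_generated_def)
    then have "cyclic_group (G\<lparr>carrier := H\<rparr>)" using cyclic_group_generated[of x] x(3) by simp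
    then show "H \<in> ?C" using x generate_is_subgroup[of "{x}"] generate_pow_card[OF x(1)] by simp
  next
    fix H assume H: "H \<in> ?C"
    then have sH: "subgroup H G" by simp
    obtain x where x: "x \<in> H" "subgroup_generated (G\<lparr>carrier := H\<rparr>) {x} = G\<lparr>carrier := H\<rparr>"
      using H by (auto simp: cyclic_group_def)
    have "H = carrier (subgroup_generated (G\<lparr>carrier := H\<rparr>) {x})" using x(2) by simp
    also have "\<dots> = generate (G\<lparr>carrier := H\<rparr>) {x}"
      using x(1) by (simp add: subgroup_generated_def)
    also have "\<dots> = generate G {x}" using generate_consistent[OF _ sH, of "{x}"] x(1) by simp
    finally have Hx: "H = generate G {x}" .
    have "x \<in> carrier G" by (rule subgroup.mem_carrier[OF sH x(1)])
    then show "H \<in> (\<lambda>x. generate G {x}) ` ?E"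
      using Hx H generate_pow_card[of x] by auto
  qed
  have fiber: "card {y \<in> ?E. generate G {y} = H} = totient d" if H: "H \<in> ?C" for H
  proof -
    obtain x where x: "x \<in> carrier G" "ord x = d" "H = generate G {x}" using H genC by blast
    have genx: "generate G {x} = {x [^] k |k. k \<in> (UNIV :: nat set)}"
      using generate_pow_nat[OF x(1)] x(2) d by simp
    have pow_mod: "x [^] k = x [^] (k mod d)" for k :: nat
    proof -
      have "x [^] k = (x [^] d) [^] (k div d) \<otimes> x [^] (k mod d)"
        using x(1) by (simp add: nat_pow_pow nat_pow_mult)
      then show ?thesis using x pow_ord_eq_1[OF x(1)] by simp
    qed
    have "{y \<in> ?E. generate G {y} = H} = (\<lambda>k. x [^] k) ` totatives d"
    proof (rule equalityI; rule subsetI)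
      fix y assume y: "y \<in> {y \<in> ?E. generate G {y} = H}"
      then have "y \<in> generate G {x}" using generate.incl[of y "{y}" G] x(3) by auto
      then obtain k :: nat where k: "y = x [^] k" using genx by blast
      show "y \<in> (\<lambda>k. x [^] k) ` totatives d"
      proof (cases "k mod d = 0")
        case True
        then have "y = \<one>" using pow_mod[of k] k by simp
        then have "d = 1" using y ord_id by auto
        then show ?thesis using \<open>y = \<one>\<close> x pow_ord_eq_1[OF x(1)] by auto
      next
        case False
        have yk: "y = x [^] (k mod d)" using pow_mod[of k] k by simp
        then have "d = d div gcd d (k mod d)" using y ord_pow_gen[OF x(1), of "k mod d"] x(2) False by auto
        then have "gcd d (k mod d) = 1" using d by (metis div_eq_dividend_iff)
        then have "coprime d (k mod d)" by (rule gcd_eq_1_imp_coprime)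
        then have "coprime (k mod d) d" by (simp only: coprime_commute)
        moreover have "0 < k mod d" "k mod d \<le> d" using False d by (simp_all add: less_imp_le)
        ultimately have "k mod d \<in> totatives d"
          unfolding totatives_def by (simp only: mem_Collect_eq greaterThanAtMost_iff simp_thms)
        then show ?thesis using yk by blast
      qed
    next
      fix y assume "y \<in> (\<lambda>k. x [^] k) ` totatives d"
      then obtain k where k: "k \<in> totatives d" "y = x [^] k" by blast
      have "coprime k d" using k(1) unfolding totatives_def by blast
      then have "coprime d k" by (simp only: coprime_commute)
      then have "gcd d k = 1" by (rule coprime_imp_gcd_eq_1)
      then have oy: "ord y = d" using ord_pow_gen[OF x(1), of k] x(2) k by (auto simp: totatives_def)
      have yG: "y \<in> carrier G" using k x by simp
      have "{y} \<subseteq> generate G {x}" using k(2) genx by blast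
      then have "generate G {y} \<subseteq> generate G {x}"
        using generate_is_subgroup[of "{x}"] x(1) by (intro generate_subgroup_incl) auto
      moreover have "card (generate G {y}) = card (generate G {x})"
        using generate_pow_card[OF yG] generate_pow_card[OF x(1)] oy x(2) by simp
      moreover have "finite (generate G {x})"
        using generate_incl[of "{x}"] x(1) fin finite_subset by blast
      ultimately have "generate G {y} = generate G {x}" using card_subset_eq by blast
      then show "y \<in> {y \<in> ?E. generate G {y} = H}" using oy yG x(3) by simp
    qed
    moreover have "inj_on (\<lambda>k. x [^] k) (totatives d)"
    proof (rule inj_onI)
      fix i j assume ij: "i \<in> totatives d" "j \<in> totatives d" "x [^] i = x [^] j"
      have *: "i = j" if "i \<le> j" "x [^] i = x [^] j" "i \<in> totatives d" "j \<in> totatives d" for i j :: nat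
      proof -
        have "x [^] (j - i) \<otimes> x [^] i = x [^] j" using that(1) x(1) by (simp add: nat_pow_mult)
        then have "x [^] (j - i) \<otimes> x [^] i = \<one> \<otimes> x [^] i" using that(2) x(1) by simp
        then have "x [^] (j - i) = \<one>" using x(1) by (meson nat_pow_closed one_closed right_cancel)
        then have "d dvd j - i" using pow_eq_id[OF x(1)] x(2) by simp
        moreover have "j - i < d" using that d by (auto simp: totatives_def)
        ultimately show ?thesis using that(1) by (auto dest: dvd_imp_le)
      qed
      show "i = j" using *[of i j] *[of j i] ij by (cases "i \<le> j") auto
    qed
    ultimately show ?thesis by (simp add: card_image totient_def)
  qed
  have "card ?E = (\<Sum>H\<in>(\<lambda>x. generate G {x}) ` ?E. card {y \<in> ?E. generate G {y} = H})"
    using fin by (intro card_eq_sum_fibers) simp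
  also have "\<dots> = (\<Sum>H\<in>?C. totient d)" unfolding genC by (rule sum.cong[OF refl fiber])
  finally show ?thesis by (simp add: num_cyclic_subgroups_def mult.commute)
qed

end

section \<open>Powers, centralizers and transversals\<close>

context group
begin

lemma centerI: "x \<in> carrier G \<Longrightarrow> (\<And>y. y \<in> carrier G \<Longrightarrow> x \<otimes> y = y \<otimes> x) \<Longrightarrow> x \<in> center G"
  by (simp add: center_def centralizer_def)

lemma center_carrier: "x \<in> center G \<Longrightarrow> x \<in> carrier G"
  and center_comm: "x \<in> center G \<Longrightarrow> y \<in> carrier G \<Longrightarrow> x \<otimes> y = y \<otimes> x"
  by (auto simp: center_def centralizer_def)

lemma subgroup_centralizer:
  assumes "S \<subseteq> carrier G"
  shows "subgroup (centralizer G S) G"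
proof (rule subgroupI)
  show "centralizer G S \<subseteq> carrier G" by (auto simp: centralizer_def)
  show "centralizer G S \<noteq> {}" using assms by (auto simp: centralizer_def intro!: exI[of _ \<one>])
next
  fix x assume x: "x \<in> centralizer G S"
  have "inv x \<otimes> y = y \<otimes> inv x" if y: "y \<in> S" for y
  proof -
    have c: "x \<in> carrier G" "y \<in> carrier G" "x \<otimes> y = y \<otimes> x" using x y assms by (auto simp: centralizer_def)
    have "inv x \<otimes> (y \<otimes> x) \<otimes> inv x = inv x \<otimes> (x \<otimes> y) \<otimes> inv x" using c by simp
    then show ?thesis using c(1,2) by (simp add: m_assoc mult_inv_cancel_left)
  qed
  then show "inv x \<in> centralizer G S" using x by (simp add: centralizer_def)
next
  fix x y assume xy: "x \<in> centralizer G S" "y \<in> centralizer G S"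
  have "(x \<otimes> y) \<otimes> z = z \<otimes> (x \<otimes> y)" if z: "z \<in> S" for z
  proof -
    have c: "x \<in> carrier G" "y \<in> carrier G" "z \<in> carrier G" "x \<otimes> z = z \<otimes> x" "y \<otimes> z = z \<otimes> y"
      using xy z assms by (auto simp: centralizer_def)
    then show ?thesis by (metis m_assoc)
  qed
  then show "x \<otimes> y \<in> centralizer G S" using xy by (simp add: centralizer_def)
qed

lemma subgroup_center: "subgroup (center G) G"
  unfolding center_def by (rule subgroup_centralizer) simp

lemma subgroup_pow: "subgroup A G \<Longrightarrow> x \<in> A \<Longrightarrow> x [^] (n::nat) \<in> A"
  by (induction n) (auto simp: subgroup.one_closed subgroup.m_closed)

lemma inv_eq_pow:
  assumes "finite (carrier G)" "x \<in> carrier G"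
  shows "inv x = x [^] (Coset.order G - 1)"
proof -
  have "Coset.order G > 0" using assms(1) by (simp add: order_gt_0_iff_finite)
  then have "x [^] (Coset.order G - 1) \<otimes> x = \<one>"
    using pow_order_eq_1[OF assms(2)] by (metis Suc_diff_1 nat_pow_Suc)
  then show ?thesis using assms by (metis inv_equality nat_pow_closed)
qed

lemma finite_subgroupI:
  assumes fin: "finite (carrier G)" and S: "S \<subseteq> carrier G" "\<one> \<in> S" "\<And>x y. x \<in> S \<Longrightarrow> y \<in> S \<Longrightarrow> x \<otimes> y \<in> S"
  shows "subgroup S G"
proof (rule subgroupI)
  fix x assume x: "x \<in> S"
  have "x [^] n \<in> S" for n :: nat by (induction n) (use S x in auto)
  then show "inv x \<in> S" using inv_eq_pow[OF fin] x S by auto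
qed (use S in auto)

lemma pow_mem_coprime:
  fixes p i :: nat
  assumes A: "subgroup A G" and t: "t \<in> carrier G" "t [^] p \<in> A" and p: "prime p"
    and i: "t [^] i \<in> A" "\<not> p dvd i"
  shows "t \<in> A"
proof -
  have i0: "i \<noteq> 0" using i(2) by (metis dvd_0_right)
  have "coprime i p" using p i(2) by (metis prime_imp_coprime coprime_commute)
  then obtain x y where xy: "i * x = p * y + 1"
    using bezout_nat[OF i0, of p] by (metis coprime_imp_gcd_eq_1)
  have "(t [^] i) [^] x = (t [^] p) [^] y \<otimes> t" using t xy by (simp add: nat_pow_pow)
  then have "t = inv ((t [^] p) [^] y) \<otimes> (t [^] i) [^] x"
    using t by (simp add: mult_inv_cancel_left)
  then show ?thesis
    using A subgroup_pow[OF A t(2)] subgroup_pow[OF A i(1)] by (metis subgroup.m_closed subgroup.m_inv_closed)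
qed

lemma pow_mod_split:
  "t \<in> carrier G \<Longrightarrow> t [^] i = t [^] (i mod p) \<otimes> (t [^] p) [^] (i div p)" for i p :: nat
  by (simp add: nat_pow_pow nat_pow_mult)

text \<open>Two powers of t in one coset of A would put a power with positive exponent below p into
  A; as t^p is in A and p is prime, t itself would then be in A.\<close>

lemma cyclic_transversal:
  fixes p :: nat
  assumes A: "subgroup A G" and t: "t \<in> carrier G" "t [^] p \<in> A" "t \<notin> A" and p: "prime p"
    and gen: "\<And>g. g \<in> carrier G \<Longrightarrow> \<exists>(i::nat) x. x \<in> A \<and> g = t [^] i \<otimes> x" and g: "g \<in> carrier G"
  shows "\<exists>!i. i < p \<and> inv (t [^] i) \<otimes> g \<in> A"
proof -
  have AG: "x \<in> carrier G" if "x \<in> A" for x using that A subgroup.mem_carrier by metis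
  obtain i x where ix: "x \<in> A" "g = t [^] (i::nat) \<otimes> x" using gen[OF g] by blast
  have "g = t [^] (i mod p) \<otimes> ((t [^] p) [^] (i div p) \<otimes> x)"
    using pow_mod_split[OF t(1), of i p] ix AG t by (simp add: m_assoc)
  then have "inv (t [^] (i mod p)) \<otimes> g = (t [^] p) [^] (i div p) \<otimes> x"
    using t ix AG by (simp add: mult_inv_cancel_left)
  then have 1: "inv (t [^] (i mod p)) \<otimes> g \<in> A"
    using subgroup_pow[OF A t(2)] ix(1) subgroup.m_closed[OF A] by simp
  have *: "j = k" if jk: "j \<le> k" "k < p" "inv (t [^] j) \<otimes> g \<in> A" "inv (t [^] k) \<otimes> g \<in> A" for j k :: nat
  proof -
    have "(inv (t [^] j) \<otimes> g) \<otimes> inv (inv (t [^] k) \<otimes> g) = inv (t [^] j) \<otimes> t [^] k"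
      using t g by (simp add: inv_mult_group m_assoc mult_inv_cancel_left)
    also have "\<dots> = inv (t [^] j) \<otimes> (t [^] j \<otimes> t [^] (k - j))" using t jk by (simp add: nat_pow_mult)
    also have "\<dots> = t [^] (k - j)" using t by (simp add: mult_inv_cancel_left)
    finally have "t [^] (k - j) \<in> A"
      using subgroup.m_closed[OF A jk(3) subgroup.m_inv_closed[OF A jk(4)]] by simp
    then have "p dvd k - j" using pow_mem_coprime[OF A t(1,2) p] t(3) by blast
    then show ?thesis using jk by (auto dest: dvd_imp_le)
  qed
  have "i mod p < p" using p prime_gt_0_nat by simp
  then show ?thesis using 1 * by (metis nat_le_linear)
qed

lemma card_transversal:
  assumes A: "subgroup A G" and t: "\<And>i. i < n \<Longrightarrow> t i \<in> carrier G"
    and tr: "\<And>g. g \<in> carrier G \<Longrightarrow> \<exists>!i. i < n \<and> inv (t i) \<otimes> g \<in> A"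
  shows "card (carrier G) = n * card A"
proof -
  have AG: "x \<in> carrier G" if "x \<in> A" for x using that A subgroup.mem_carrier by metis
  have "bij_betw (\<lambda>(i, x). t i \<otimes> x) ({..<n} \<times> A) (carrier G)"
    unfolding bij_betw_def
  proof (intro conjI inj_onI equalityI subsetI)
    fix u v assume u: "u \<in> {..<n} \<times> A" and v: "v \<in> {..<n} \<times> A"
      and eq: "(case u of (i, x) \<Rightarrow> t i \<otimes> x) = (case v of (i, x) \<Rightarrow> t i \<otimes> x)"
    obtain i x j y where uv: "u = (i, x)" "v = (j, y)" "i < n" "j < n" "x \<in> A" "y \<in> A" using u v by auto
    have g: "t i \<otimes> x \<in> carrier G" "t i \<otimes> x = t j \<otimes> y" using uv AG t eq by auto
    have "inv (t i) \<otimes> (t i \<otimes> x) \<in> A" using uv AG t by (simp add: mult_inv_cancel_left)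
    moreover have "inv (t j) \<otimes> (t i \<otimes> x) \<in> A"
      unfolding g(2) using uv AG t by (simp add: mult_inv_cancel_left)
    ultimately have "i = j" using tr[OF g(1)] uv by blast
    then have "inv (t i) \<otimes> (t i \<otimes> x) = inv (t i) \<otimes> (t i \<otimes> y)" using g(2) by simp
    then have "x = y" using uv AG t by (simp add: mult_inv_cancel_left)
    then show "u = v" using uv \<open>i = j\<close> by simp
  next
    fix g assume "g \<in> (\<lambda>(i, x). t i \<otimes> x) ` ({..<n} \<times> A)"
    then show "g \<in> carrier G" using t AG by auto
  next
    fix g assume g: "g \<in> carrier G"
    obtain i where i: "i < n" "inv (t i) \<otimes> g \<in> A" using tr[OF g] by blast
    have "g = t i \<otimes> (inv (t i) \<otimes> g)" using i t g by (simp add: mult_inv_cancel_left)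
    then show "g \<in> (\<lambda>(i, x). t i \<otimes> x) ` ({..<n} \<times> A)" using i by force
  qed
  then show ?thesis by (metis bij_betw_same_card card_cartesian_product card_lessThan)
qed

end

text \<open>z has order exactly p, so z^k = z gives k = 1 modulo p. It is used to show that a Galois
  exponent fixing one nontrivial p-th root of unity fixes all of them.\<close>

lemma prime_root_exponent:
  fixes z w :: complex
  assumes p: "prime p" and z: "z ^ p = 1" "z \<noteq> 1" "z ^ k = z" and k: "coprime k p" and w: "w ^ p = 1"
  shows "w ^ k = w"
proof -
  have "k > 0" using k p by (cases k) auto
  then have zk: "z ^ (k - 1) * z = z" using z(3) by (metis power_minus_mult)
  have "z \<noteq> 0" using z(1) p prime_gt_0_nat by (metis power_0_left less_numeral_extra(3) zero_neq_one)
  then have "z ^ (k - 1) = 1" using zk by simp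
  then have "\<not> coprime (k - 1) p" using coprime_root_of_unity z by blast
  then have "p dvd k - 1" using p by (metis coprime_commute prime_imp_coprime)
  then have "w ^ (k - 1) = 1" using w by (auto elim!: dvdE simp: power_mult)
  then show ?thesis using power_minus_mult[OF \<open>k > 0\<close>, of w] by simp
qed

section \<open>The abelian quotient\<close>

text \<open>The abelian group of type (p, p^2). Independence of the generators is not listed but
  forced: the relations allow at most p * p^2 products, which is the order.\<close>

locale abelian_p2p = group G for G (structure) +
  fixes p a b
  assumes p: "prime p" and card_G: "card (carrier G) = p ^ 3"
    and comm: "\<And>x y. x \<in> carrier G \<Longrightarrow> y \<in> carrier G \<Longrightarrow> x \<otimes> y = y \<otimes> x"
    and a [simp]: "a \<in> carrier G" and b [simp]: "b \<in> carrier G"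
    and ap: "a [^] p = \<one>" and bp: "b [^] (p\<^sup>2) = \<one>"
    and gen: "\<And>g. g \<in> carrier G \<Longrightarrow> \<exists>(i::nat) (j::nat). g = a [^] i \<otimes> b [^] j"
begin

lemma p0: "p > 0" "p > 1"
  using p prime_gt_0_nat prime_gt_1_nat by auto

lemma finite_G: "finite (carrier G)"
  using card_G p0 by (metis card.infinite power_not_zero less_numeral_extra(3))

sublocale finite_abelian_subgroup G "carrier G"
  by unfold_locales (use finite_G comm in \<open>auto simp: subgroup_self\<close>)

lemma normal_form: "bij_betw (\<lambda>(i::nat, j::nat). a [^] i \<otimes> b [^] j) ({..<p} \<times> {..<p\<^sup>2}) (carrier G)"
proof -
  let ?f = "\<lambda>(i::nat, j::nat). a [^] i \<otimes> b [^] j" and ?S = "{..<p} \<times> {..<p\<^sup>2}"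
  have "carrier G \<subseteq> ?f ` ?S"
  proof
    fix g assume "g \<in> carrier G"
    then obtain i j where g: "g = a [^] (i::nat) \<otimes> b [^] (j::nat)" using gen by blast
    have "g = a [^] (i mod p) \<otimes> b [^] (j mod p\<^sup>2)"
      unfolding g using pow_mod_split[OF a, of i p] pow_mod_split[OF b, of j "p\<^sup>2"] ap bp by simp
    then show "g \<in> ?f ` ?S" using p0 by (intro image_eqI[of _ _ "(i mod p, j mod p\<^sup>2)"]) auto
  qed
  moreover have "?f ` ?S \<subseteq> carrier G" by auto
  ultimately have im: "?f ` ?S = carrier G" by blast
  then have "card (?f ` ?S) = card ?S" by (simp add: card_G card_cartesian_product power3_eq_cube power2_eq_square)
  then have "inj_on ?f ?S" by (intro eq_card_imp_inj_on) auto
  then show ?thesis using im by (simp add: bij_betw_def)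
qed

lemma pow_p: "(a [^] (i::nat) \<otimes> b [^] (j::nat)) [^] p = b [^] (j * p)"
proof -
  have "(a [^] i) [^] p = (a [^] p) [^] i" by (simp add: nat_pow_pow mult.commute)
  then show ?thesis using ap by (simp add: A_pow_mult nat_pow_pow)
qed

lemma card_pow_p: "card {x \<in> carrier G. x [^] p = \<one>} = p\<^sup>2"
proof -
  let ?f = "\<lambda>(i::nat, j::nat). a [^] i \<otimes> b [^] j" and ?S = "{..<p} \<times> {..<p\<^sup>2}"
  have inj: "inj_on ?f ?S" and im: "?f ` ?S = carrier G" using normal_form by (auto simp: bij_betw_def)
  have b1: "b [^] (j * p) = \<one> \<longleftrightarrow> p dvd j" if "j < p\<^sup>2" for j
  proof
    assume eq: "b [^] (j * p) = \<one>"
    have "b [^] (j * p) = b [^] (j * p mod p\<^sup>2)" using pow_mod_split[OF b, of "j * p" "p\<^sup>2"] bp by simp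
    then have "?f (0, j * p mod p\<^sup>2) = ?f (0, 0)" using eq by simp
    then have "j * p mod p\<^sup>2 = 0" using inj_onD[OF inj, of "(0, j * p mod p\<^sup>2)" "(0, 0)"] p0 by auto
    then have "p * p dvd j * p" by (simp add: power2_eq_square mod_eq_0_iff_dvd)
    then show "p dvd j" using p0 by simp
  next
    assume "p dvd j"
    then obtain m where "j = p * m" by (rule dvdE)
    then have "b [^] (j * p) = (b [^] (p\<^sup>2)) [^] m" by (simp add: nat_pow_pow power2_eq_square mult_ac)
    then show "b [^] (j * p) = \<one>" using bp by simp
  qed
  have "{x \<in> carrier G. x [^] p = \<one>} = ?f ` ({..<p} \<times> (\<lambda>m. p * m) ` {..<p})"
  proof (rule equalityI; rule subsetI)
    fix x assume x: "x \<in> {x \<in> carrier G. x [^] p = \<one>}"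
    then have "x \<in> ?f ` ?S" unfolding im by simp
    then obtain i j where ij: "i < p" "j < p\<^sup>2" "x = a [^] i \<otimes> b [^] j" by auto
    then have "p dvd j" using x pow_p b1 by auto
    then obtain m where m: "j = p * m" by (rule dvdE)
    then have "m < p" using ij p0 by (simp add: power2_eq_square)
    then show "x \<in> ?f ` ({..<p} \<times> (\<lambda>m. p * m) ` {..<p})" using ij m by force
  next
    fix x assume "x \<in> ?f ` ({..<p} \<times> (\<lambda>m. p * m) ` {..<p})"
    then obtain i m where "i < p" "m < p" "x = a [^] i \<otimes> b [^] (p * m)" by auto
    then show "x \<in> {x \<in> carrier G. x [^] p = \<one>}"
      using pow_p[of i "p * m"] b1[of "p * m"] p0 by (simp add: power2_eq_square)
  qed
  moreover have "inj_on ?f ({..<p} \<times> (\<lambda>m. p * m) ` {..<p})"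
    by (rule inj_on_subset[OF inj]) (use p0 in \<open>auto simp: power2_eq_square\<close>)
  moreover have "card ({..<p} \<times> (\<lambda>m. p * m) ` {..<p}) = p\<^sup>2"
    using p0 by (simp add: card_cartesian_product card_image inj_on_def power2_eq_square)
  ultimately show ?thesis by (simp add: card_image)
qed

lemma pow_p2: "x \<in> carrier G \<Longrightarrow> x [^] (p\<^sup>2) = \<one>"
proof -
  assume "x \<in> carrier G"
  then obtain i j where x: "x = a [^] (i::nat) \<otimes> b [^] (j::nat)" using gen by blast
  have "x [^] (p\<^sup>2) = (x [^] p) [^] p" using \<open>x \<in> carrier G\<close> by (simp add: nat_pow_pow power2_eq_square)
  also have "\<dots> = (b [^] (p\<^sup>2)) [^] j" unfolding x pow_p by (simp add: nat_pow_pow power2_eq_square mult_ac)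
  finally show ?thesis using bp by simp
qed

text \<open>Here G = A = N and the transversal is the identity alone, so \<open>free\<close> has
  nothing to exclude and the quotient is the trivial group, which supplies the summand Q.\<close>

sublocale ind: induced_characters G "carrier G" "carrier G" p 3 1 "\<lambda>_. \<one>"
proof unfold_locales
  show "\<exists>!i. i < (1::nat) \<and> inv \<one> \<otimes> g \<in> carrier G" if "g \<in> carrier G" for g using that by auto
qed (use finite_G p card_G in \<open>auto simp: subgroup_self\<close>)

text \<open>Orbits are pure Galois orbits. There are p^2 - 1 characters of order p in orbits of size
  p - 1, and p^3 - p^2 of order p^2 in orbits of size p(p-1); this gives p + 1 and p fields.\<close>

theorem abelian_decomposition:
  "group_algebra G \<cong>\<^sub>\<rat> rat_alg
    \<oplus>\<^sub>\<rat> copies (p + 1) (field_alg (cyclotomic_field p))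
    \<oplus>\<^sub>\<rat> copies p (field_alg (cyclotomic_field (p\<^sup>2)))"
proof -
  define k where "k d = (if d = p then p + 1 else p)" for d :: nat
  have triv: "trivial_chars (carrier G) d = {\<lambda>x. if x \<in> carrier G then 1 else 0}" for d
    using chars_trivial chars_out by (auto simp: trivial_chars_def fun_eq_iff)
  have c0: "card (trivial_chars {\<one>} (p ^ 0)) = 1"
  proof -
    have "{x \<in> carrier G. x [^] (1::nat) = \<one>} = {\<one>}" by auto
    then show ?thesis using card_trivial_chars_1[of 1] by simp
  qed
  have c1: "card (trivial_chars {\<one>} p) = p\<^sup>2" using card_trivial_chars_1[of p] card_pow_p by simp
  have "{x \<in> carrier G. x [^] (p\<^sup>2) = \<one>} = carrier G" using pow_p2 by auto
  then have c2: "card (trivial_chars {\<one>} (p\<^sup>2)) = p ^ 3"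
    using card_trivial_chars_1[of "p\<^sup>2"] card_G by simp
  have R1: "card {l \<in> ind.R. ind.cord l = p ^ Suc 0} = p + 1"
  proof (rule ind.card_R_eqI)
    have "(p - 1) * (p + 1) = p\<^sup>2 - 1" using p0 by (simp add: power2_eq_square algebra_simps)
    then show "1 * (p ^ 0 * (p - 1)) * (p + 1) = card {l \<in> ind.X. ind.cord l = p ^ Suc 0}"
      unfolding ind.card_X_order using c0 c1 by (simp add: triv)
  qed simp
  have R2: "card {l \<in> ind.R. ind.cord l = p ^ Suc 1} = p"
  proof (rule ind.card_R_eqI)
    have "p * (p - 1) * p = p ^ 3 - p\<^sup>2" by (simp add: power3_eq_cube power2_eq_square algebra_simps)
    then show "1 * (p ^ 1 * (p - 1)) * p = card {l \<in> ind.X. ind.cord l = p ^ Suc 1}"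
      unfolding ind.card_X_order using c1 c2 by (simp add: triv power2_eq_square)
  qed simp
  have D: "ind.cord l \<in> {p, p\<^sup>2}" if lX: "l \<in> ind.X" for l
  proof -
    obtain e where e: "ind.cord l = p ^ Suc e" using ind.ord_p_power[OF lX] by metis
    have lc: "l \<in> chars G (carrier G)" using ind.X_chars[OF lX] .
    have "l x ^ p\<^sup>2 = 1" if "x \<in> carrier G" for x
      using chars_pow[OF lc that, of "p\<^sup>2"] pow_p2[OF that] chars_one[OF lc] by simp
    then have "p ^ Suc e dvd p\<^sup>2" using char_order(3)[OF lc] e by metis
    then have "Suc e \<le> 2" by (rule power_dvd_imp_le) (rule p0(2))
    then show ?thesis using e by (cases e) (auto simp: power2_eq_square)
  qed
  have neq: "p \<noteq> p\<^sup>2" using p0 by (simp add: power2_eq_square)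
  have "group_algebra G \<cong>\<^sub>\<rat> group_algebra (G Mod carrier G)
    \<oplus>\<^sub>\<rat> alg_sum {p, p\<^sup>2} (\<lambda>d. copies (k d) (mat_alg 1 (cyclotomic_field d)))"
  proof (rule ind.decomposition_counted[OF D])
    show "k d = card {l \<in> ind.R. ind.cord l = d}" if "d \<in> {p, p\<^sup>2}" for d
      using that R1 R2 neq by (auto simp: k_def power2_eq_square)
  qed
  moreover have "group_algebra (G Mod carrier G) \<cong>\<^sub>\<rat> rat_alg"
  proof (rule group_algebra_trivial)
    show "group (G Mod carrier G)" by (rule normal.factorgroup_is_group[OF ind.normalN])
    have "carrier G #> g = carrier G" if "g \<in> carrier G" for g
      using coset_join2[OF that subgroup_self that] .
    then show "carrier (G Mod carrier G) = {\<one>\<^bsub>G Mod carrier G\<^esub>}"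
      by (auto simp: FactGroup_def RCOSETS_def intro!: bexI[of _ \<one>])
  qed
  moreover have "alg_sum {p, p\<^sup>2} (\<lambda>d. copies (k d) (mat_alg 1 (cyclotomic_field d)))
    \<cong>\<^sub>\<rat> copies (p + 1) (field_alg (cyclotomic_field p)) \<oplus>\<^sub>\<rat> copies p (field_alg (cyclotomic_field (p\<^sup>2)))"
  proof -
    have f: "copies (k d) (mat_alg 1 (cyclotomic_field d)) \<cong>\<^sub>\<rat> copies (k d) (field_alg (cyclotomic_field d))" for d
      unfolding copies_def by (intro alg_sum_cong mat_alg_1)
    have "alg_sum ({p} \<union> {p\<^sup>2}) (\<lambda>d. copies (k d) (mat_alg 1 (cyclotomic_field d)))
        \<cong>\<^sub>\<rat> alg_sum {p} (\<lambda>d. copies (k d) (mat_alg 1 (cyclotomic_field d)))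
          \<oplus>\<^sub>\<rat> alg_sum {p\<^sup>2} (\<lambda>d. copies (k d) (mat_alg 1 (cyclotomic_field d)))"
      using neq by (intro alg_sum_Un) auto
    moreover have "\<dots> \<cong>\<^sub>\<rat> copies (k p) (field_alg (cyclotomic_field p))
        \<oplus>\<^sub>\<rat> copies (k (p\<^sup>2)) (field_alg (cyclotomic_field (p\<^sup>2)))"
    proof (rule alg_prod_cong)
      show "alg_sum {d} (\<lambda>d. copies (k d) (mat_alg 1 (cyclotomic_field d)))
          \<cong>\<^sub>\<rat> copies (k d) (field_alg (cyclotomic_field d))" for d
        by (rule alg_iso_trans[OF alg_sum_singleton[of d "\<lambda>d. copies (k d) (mat_alg 1 (cyclotomic_field d))"] f])
      then show "alg_sum {p\<^sup>2} (\<lambda>d. copies (k d) (mat_alg 1 (cyclotomic_field d)))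
          \<cong>\<^sub>\<rat> copies (k (p\<^sup>2)) (field_alg (cyclotomic_field (p\<^sup>2)))" .
    qed
    ultimately show ?thesis using alg_iso_trans neq by (auto simp: k_def insert_is_Un[of p "{p\<^sup>2}"] simp del: Un_insert_left)
  qed
  ultimately show ?thesis by (meson alg_iso_trans alg_prod_cong)
qed

end

context group
begin

lemma comm_pow_pow:
  assumes "x \<in> carrier G" "y \<in> carrier G" "x \<otimes> y = y \<otimes> x"
  shows "x [^] (i::nat) \<otimes> y [^] (j::nat) = y [^] j \<otimes> x [^] i"
  using group_commutes_pow[of "x [^] i" y j] group_commutes_pow[of x y i] assms
  by (metis group_commutes_pow nat_pow_closed)

lemma pow_mult_left:
  "x \<in> carrier G \<Longrightarrow> y \<in> carrier G \<Longrightarrow> x [^] i \<otimes> (x [^] j \<otimes> y) = x [^] (i + j) \<otimes> y" for i j :: nat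
  by (simp add: m_assoc[symmetric] nat_pow_mult)

lemma pow_eq_one_coprime:
  fixes p i :: nat
  assumes "x \<in> carrier G" "x [^] p = \<one>" "prime p" "x [^] i = \<one>" "x \<noteq> \<one>"
  shows "p dvd i"
  using pow_mem_coprime[OF triv_subgroup assms(1) _ assms(3), of i] assms by blast

lemma conj_pow:
  assumes "g \<in> carrier G" "x \<in> carrier G"
  shows "inv g \<otimes> x [^] i \<otimes> g = (inv g \<otimes> x \<otimes> g) [^] (i::nat)"
proof (induction i)
  case (Suc i)
  have "inv g \<otimes> x [^] Suc i \<otimes> g = (inv g \<otimes> x [^] i \<otimes> g) \<otimes> (inv g \<otimes> x \<otimes> g)"
    using assms by (simp add: m_assoc mult_inv_cancel_left)
  then show ?case using Suc.IH by simp
qed (use assms in simp)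

lemma subgroup_powers:
  assumes "finite (carrier G)" "x \<in> carrier G"
  shows "subgroup (range (\<lambda>k::nat. x [^] k)) G"
proof (rule finite_subgroupI[OF assms(1)])
  show "\<one> \<in> range (\<lambda>k::nat. x [^] k)" by (rule range_eqI[of _ _ 0]) simp
qed (use assms(2) nat_pow_mult in auto)

lemma range_pow_order:
  fixes p :: nat
  assumes "x \<in> carrier G" "x [^] p = \<one>" "p > 0"
  shows "range (\<lambda>k::nat. x [^] k) = (\<lambda>k. x [^] k) ` {..<p}"
proof (rule equalityI; rule subsetI)
  fix y assume "y \<in> range (\<lambda>k::nat. x [^] k)"
  then obtain k :: nat where "y = x [^] k" by blast
  then have "y = x [^] (k mod p)" using pow_mod_split[OF assms(1), of k p] assms by simp
  then show "y \<in> (\<lambda>k. x [^] k) ` {..<p}" using assms(3) by simp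
qed auto

lemma card_powers:
  fixes p :: nat
  assumes x: "x \<in> carrier G" "x [^] p = \<one>" "x \<noteq> \<one>" and p: "prime p"
  shows "card (range (\<lambda>k::nat. x [^] k)) = p"
proof -
  have p0: "p > 0" using p prime_gt_0_nat by blast
  have *: "i = j" if ij: "i \<le> j" "j < p" "x [^] i = x [^] j" for i j :: nat
  proof -
    have "x [^] (j - i) \<otimes> x [^] i = x [^] j" using ij(1) x(1) by (simp add: nat_pow_mult)
    then have "x [^] (j - i) \<otimes> x [^] i = \<one> \<otimes> x [^] i" using ij(3) x(1) by simp
    then have "x [^] (j - i) = \<one>" using x by (meson nat_pow_closed one_closed right_cancel)
    then have "p dvd j - i" using pow_eq_one_coprime[OF x(1,2) p _ x(3)] by blast
    then show ?thesis using ij by (auto dest: dvd_imp_le)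
  qed
  have "inj_on (\<lambda>k. x [^] k) {..<p}"
    unfolding inj_on_def using * by (metis lessThan_iff nat_le_linear)
  then show ?thesis unfolding range_pow_order[OF x(1,2) p0] by (simp add: card_image)
qed

end

section \<open>The quotient of order \<open>p ^ 4\<close>\<close>

locale heisenberg_p4 = group G for G (structure) +
  fixes p a b c
  assumes p: "prime p" and card_G: "card (carrier G) = p ^ 4"
    and a [simp]: "a \<in> carrier G" and b [simp]: "b \<in> carrier G" and c [simp]: "c \<in> carrier G"
    and ba: "b \<otimes> a = a \<otimes> (b \<otimes> c)" and ca: "c \<otimes> a = a \<otimes> c" and cb: "c \<otimes> b = b \<otimes> c"
    and ap: "a [^] p = \<one>" and bp: "b [^] (p\<^sup>2) = \<one>" and cp: "c [^] p = \<one>"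
    and gen: "\<And>g. g \<in> carrier G \<Longrightarrow> \<exists>(i::nat) (j::nat) (k::nat). g = a [^] i \<otimes> (b [^] j \<otimes> c [^] k)"
begin

lemma p0: "p > 0" "p > 1"
  using p prime_gt_0_nat prime_gt_1_nat by auto

lemma finite_G: "finite (carrier G)"
  using card_G p0 by (metis card.infinite power_not_zero less_numeral_extra(3))

text \<open>Without \<open>c\<close> the normal forms would number at most p^3, too few for a group
  of order p^4.\<close>

lemma c_ne_1: "c \<noteq> \<one>"
proof
  assume c1: "c = \<one>"
  let ?f = "\<lambda>(i::nat, j::nat). a [^] i \<otimes> b [^] j" and ?S = "{..<p} \<times> {..<p\<^sup>2}"
  have "carrier G \<subseteq> ?f ` ?S"
  proof
    fix g assume "g \<in> carrier G"
    then obtain i j k where g: "g = a [^] (i::nat) \<otimes> (b [^] (j::nat) \<otimes> c [^] (k::nat))" using gen by blast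
    have "g = a [^] (i mod p) \<otimes> b [^] (j mod p\<^sup>2)"
      unfolding g using pow_mod_split[OF a, of i p] pow_mod_split[OF b, of j "p\<^sup>2"] ap bp c1 by simp
    then show "g \<in> ?f ` ?S" using p0 by (intro image_eqI[of _ _ "(i mod p, j mod p\<^sup>2)"]) auto
  qed
  then have "card (carrier G) \<le> card ?S" by (intro surj_card_le) auto
  then have "p ^ 4 \<le> p ^ 3" using card_G by (simp add: card_cartesian_product power3_eq_cube power2_eq_square mult.assoc)
  then show False using p0 by (simp add: power_increasing_iff)
qed

lemma c_center: "c \<in> center G"
proof (rule centerI)
  fix y assume "y \<in> carrier G"
  then obtain i j k where y: "y = a [^] (i::nat) \<otimes> (b [^] (j::nat) \<otimes> c [^] (k::nat))" using gen by blast
  have "c \<in> centralizer G {a, b, c}" using ca cb by (simp add: centralizer_def)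
  have "{a, b, c} \<subseteq> centralizer G {c}" using ca cb by (simp add: centralizer_def)
  moreover have S: "subgroup (centralizer G {c}) G" by (rule subgroup_centralizer) simp
  ultimately have "y \<in> centralizer G {c}"
    unfolding y by (intro subgroup.m_closed[OF S] subgroup_pow[OF S]) auto
  then show "c \<otimes> y = y \<otimes> c" by (simp add: centralizer_def)
qed simp

lemma cpow_comm: "y \<in> carrier G \<Longrightarrow> c [^] (k::nat) \<otimes> y = y \<otimes> c [^] k"
  using center_comm[OF subgroup_pow[OF subgroup_center c_center]] .

lemma bj_a: "b [^] (j::nat) \<otimes> a = a \<otimes> (b [^] j \<otimes> c [^] j)"
proof (induction j)
  case (Suc j)
  have "b [^] Suc j \<otimes> a = b [^] j \<otimes> (a \<otimes> (b \<otimes> c))" by (simp add: m_assoc ba)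
  also have "\<dots> = (b [^] j \<otimes> a) \<otimes> (b \<otimes> c)" by (simp add: m_assoc)
  also have "\<dots> = a \<otimes> (b [^] j \<otimes> ((c [^] j \<otimes> b) \<otimes> c))" unfolding Suc.IH by (simp add: m_assoc)
  also have "c [^] j \<otimes> b = b \<otimes> c [^] j" by (rule cpow_comm) simp
  finally show ?case by (simp add: m_assoc)
qed simp

text \<open>The subgroup generated by b and c would be abelian of index p too, but there conjugation
  by \<open>a\<close> can coincide with a Galois conjugation of characters of order p^2. The
  centralizer of \<open>a\<close> has exponent p, which excludes this.\<close>

definition A where "A = centralizer G {a}"

lemma subA: "subgroup A G"
  unfolding A_def by (rule subgroup_centralizer) simp

lemma ga:
  assumes g: "g = a [^] (i::nat) \<otimes> (b [^] (j::nat) \<otimes> c [^] (k::nat))"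
  shows "g \<otimes> a = a \<otimes> (g \<otimes> c [^] j)"
proof -
  have "g \<otimes> a = a [^] i \<otimes> (b [^] j \<otimes> (c [^] k \<otimes> a))" unfolding g by (simp add: m_assoc)
  also have "c [^] k \<otimes> a = a \<otimes> c [^] k" by (rule cpow_comm) simp
  also have "a [^] i \<otimes> (b [^] j \<otimes> (a \<otimes> c [^] k)) = a [^] i \<otimes> ((b [^] j \<otimes> a) \<otimes> c [^] k)" by (simp add: m_assoc)
  also have "\<dots> = (a [^] i \<otimes> a) \<otimes> (b [^] j \<otimes> (c [^] j \<otimes> c [^] k))" unfolding bj_a by (simp add: m_assoc)
  also have "a [^] i \<otimes> a = a \<otimes> a [^] i" using group_commutes_pow[of a a i] by simp
  also have "c [^] j \<otimes> c [^] k = c [^] k \<otimes> c [^] j" by (rule cpow_comm) simp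
  finally show ?thesis unfolding g by (simp add: m_assoc)
qed

lemma conj_a:
  assumes "g \<in> carrier G"
  obtains j :: nat where "inv g \<otimes> a \<otimes> g = a \<otimes> inv (c [^] j)" "g \<in> A \<longleftrightarrow> p dvd j"
proof -
  obtain i j k where g: "g = a [^] (i::nat) \<otimes> (b [^] (j::nat) \<otimes> c [^] (k::nat))" using gen[OF assms] by blast
  have eq: "g \<otimes> a = a \<otimes> (g \<otimes> c [^] j)" by (rule ga[OF g])
  have "inv g \<otimes> (g \<otimes> a) = inv g \<otimes> (a \<otimes> (g \<otimes> c [^] j))" unfolding eq ..
  then have "a = (inv g \<otimes> a \<otimes> g) \<otimes> c [^] j" using assms by (simp add: m_assoc mult_inv_cancel_left)
  then have "a \<otimes> inv (c [^] j) = ((inv g \<otimes> a \<otimes> g) \<otimes> c [^] j) \<otimes> inv (c [^] j)" by simp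
  also have "\<dots> = inv g \<otimes> a \<otimes> g" using assms by (simp add: m_assoc)
  finally have 1: "inv g \<otimes> a \<otimes> g = a \<otimes> inv (c [^] j)" ..
  have "g \<in> A \<longleftrightarrow> a \<otimes> (g \<otimes> c [^] j) = a \<otimes> (g \<otimes> \<one>)"
    using assms eq by (auto simp: A_def centralizer_def)
  also have "\<dots> \<longleftrightarrow> c [^] j = \<one>" using assms by simp
  also have "\<dots> \<longleftrightarrow> p dvd j"
  proof
    assume "c [^] j = \<one>"
    then show "p dvd j" using pow_eq_one_coprime[OF c cp p _ c_ne_1] by blast
  next
    assume "p dvd j"
    then obtain m where "j = p * m" by (rule dvdE)
    then show "c [^] j = \<one>" using cp by (simp add: nat_pow_pow[symmetric])
  qed
  finally show thesis using that 1 by blast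
qed

lemma bp_center: "b [^] p \<in> center G"
proof -
  have S: "subgroup (centralizer G {b [^] p}) G" by (rule subgroup_centralizer) simp
  have "b [^] p \<otimes> a = a \<otimes> b [^] p" using bj_a[of p] cp by simp
  then have "{a, b, c} \<subseteq> centralizer G {b [^] p}"
    using group_commutes_pow[of b b p] center_comm[OF c_center, of "b [^] p"]
    by (simp add: centralizer_def)
  then have "y \<in> centralizer G {b [^] p}" if "y \<in> carrier G" for y
    using gen[OF that] by (elim exE) (simp, intro subgroup.m_closed[OF S] subgroup_pow[OF S], auto)
  then show ?thesis by (intro centerI) (auto simp: centralizer_def)
qed

text \<open>Commuting with \<open>a\<close> kills c^j, so p divides the exponent j of
  \<open>b\<close>. Then b^j is a power of the central element b^p, and its p-th power is 1 because
  b^(p^2) is.\<close>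

lemma A_form:
  assumes "g \<in> A"
  obtains i :: nat and w where "w \<in> center G" "w [^] p = \<one>" "g = a [^] i \<otimes> w"
proof -
  have gG: "g \<in> carrier G" using assms subA subgroup.mem_carrier by metis
  obtain i j k where g: "g = a [^] (i::nat) \<otimes> (b [^] (j::nat) \<otimes> c [^] (k::nat))" using gen[OF gG] by blast
  have "a \<otimes> (g \<otimes> c [^] j) = a \<otimes> (g \<otimes> \<one>)" using ga[OF g] assms gG by (auto simp: A_def centralizer_def)
  then have "c [^] j = \<one>" using gG by simp
  then have "p dvd j" using pow_eq_one_coprime[OF c cp p _ c_ne_1] by blast
  then obtain m where m: "j = p * m" by (rule dvdE)
  have bj: "b [^] j = (b [^] p) [^] m" unfolding m by (simp add: nat_pow_pow)
  have w: "b [^] j \<in> center G" "c [^] k \<in> center G"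
    unfolding bj using subgroup_pow[OF subgroup_center] bp_center c_center by auto
  have "(b [^] j \<otimes> c [^] k) [^] p = (b [^] j) [^] p \<otimes> (c [^] k) [^] p"
    using center_comm[OF w(1), of "c [^] k"] by (intro pow_mult_distrib) auto
  also have "(c [^] k) [^] p = (c [^] p) [^] k" by (simp add: nat_pow_pow mult.commute)
  also have "(b [^] j) [^] p = (b [^] (p\<^sup>2)) [^] m" unfolding m by (simp add: nat_pow_pow power2_eq_square mult_ac)
  finally have "(b [^] j \<otimes> c [^] k) [^] p = \<one>" using bp cp by simp
  then show thesis using that[of "b [^] j \<otimes> c [^] k" i] w g subgroup.m_closed[OF subgroup_center] by blast
qed

lemma center_A: "w \<in> center G \<Longrightarrow> w \<in> A"
  using center_comm center_carrier by (auto simp: A_def centralizer_def)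

lemma a_A: "a \<in> A"
  by (simp add: A_def centralizer_def)

lemma A_comm:
  assumes "x \<in> A" "y \<in> A"
  shows "x \<otimes> y = y \<otimes> x"
proof -
  obtain i :: nat and w where x: "w \<in> center G" "x = a [^] i \<otimes> w" using A_form[OF assms(1)] by metis
  have yG: "y \<in> carrier G" using assms(2) subA subgroup.mem_carrier by metis
  have "a [^] i \<otimes> y = y \<otimes> a [^] i" using assms(2) yG by (intro group_commutes_pow) (auto simp: A_def centralizer_def)
  then show ?thesis using x yG center_comm[OF x(1) yG] center_carrier[OF x(1)]
    by (metis (no_types, lifting) a m_assoc nat_pow_closed)
qed

lemma A_exp: "x \<in> A \<Longrightarrow> x [^] p = \<one>"
proof -
  assume "x \<in> A"
  then obtain i :: nat and w where x: "w \<in> center G" "w [^] p = \<one>" "x = a [^] i \<otimes> w" using A_form by metis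
  have "x [^] p = (a [^] i) [^] p \<otimes> w [^] p"
    unfolding x(3) using center_comm[OF x(1), of "a [^] i"] center_carrier[OF x(1)] by (intro pow_mult_distrib) auto
  also have "(a [^] i) [^] p = (a [^] p) [^] i" by (simp add: nat_pow_pow mult.commute)
  finally show ?thesis using ap x by simp
qed

lemma normA:
  assumes g: "g \<in> carrier G" and x: "x \<in> A"
  shows "inv g \<otimes> x \<otimes> g \<in> A"
proof -
  obtain i :: nat and w where x: "w \<in> center G" "x = a [^] i \<otimes> w" using A_form[OF x] by metis
  obtain j :: nat where j: "inv g \<otimes> a \<otimes> g = a \<otimes> inv (c [^] j)" using conj_a[OF g] by metis
  have wG: "w \<in> carrier G" using center_carrier x by blast
  have "inv g \<otimes> x \<otimes> g = (inv g \<otimes> a [^] i \<otimes> g) \<otimes> w"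
    unfolding x(2) using g center_comm[OF x(1) g] wG by (simp add: m_assoc)
  also have "\<dots> = (a \<otimes> inv (c [^] j)) [^] i \<otimes> w" unfolding conj_pow[OF g a] j ..
  also have "\<dots> \<in> A"
    using a_A center_A[OF x(1)] center_A[OF c_center]
    by (intro subgroup.m_closed[OF subA] subgroup_pow[OF subA] subgroup.m_inv_closed[OF subA])
  finally show ?thesis .
qed

definition N where "N = range (\<lambda>k::nat. c [^] k)"

lemma N_center: "x \<in> N \<Longrightarrow> x \<in> center G"
  unfolding N_def using subgroup_pow[OF subgroup_center c_center] by auto

lemma transversal_b: "g \<in> carrier G \<Longrightarrow> \<exists>!i. i < p \<and> inv (b [^] i) \<otimes> g \<in> A"
proof (rule cyclic_transversal[OF subA b _ _ p])
  show "b [^] p \<in> A" by (rule center_A[OF bp_center])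
  show "b \<notin> A"
  proof
    assume "b \<in> A"
    then have "a \<otimes> (b \<otimes> c) = a \<otimes> (b \<otimes> \<one>)" using ba by (simp add: A_def centralizer_def)
    then show False using c_ne_1 by simp
  qed
  fix g assume "g \<in> carrier G"
  then obtain i j k where g: "g = a [^] (i::nat) \<otimes> (b [^] (j::nat) \<otimes> c [^] (k::nat))" using gen by blast
  have "g = b [^] j \<otimes> ((inv (b [^] j) \<otimes> a [^] i \<otimes> b [^] j) \<otimes> c [^] k)"
    unfolding g by (simp add: m_assoc mult_inv_cancel_left)
  moreover have "(inv (b [^] j) \<otimes> a [^] i \<otimes> b [^] j) \<otimes> c [^] k \<in> A"
    using a_A center_A[OF c_center] by (intro subgroup.m_closed[OF subA] normA subgroup_pow[OF subA]) auto
  ultimately show "\<exists>(i::nat) x. x \<in> A \<and> g = b [^] i \<otimes> x" by blast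
qed

lemma card_A: "card A = p ^ 3"
proof -
  have "card (carrier G) = p * card A" by (rule card_transversal[OF subA _ transversal_b]) auto
  then have "p * card A = p * p ^ 3" using card_G by (simp add: power_Suc[symmetric] del: power_Suc)
  then show ?thesis using p0 by simp
qed

sublocale ind: induced_characters G A N p 3 p "\<lambda>i. b [^] i"
proof (intro induced_characters.intro induced_characters_axioms.intro
    finite_abelian_subgroup.intro finite_abelian_subgroup_axioms.intro is_group)
  show "subgroup A G" by (rule subA)
  show "finite A" using subA finite_G finite_subset subgroup.subset by metis
  show "subgroup N G" unfolding N_def by (rule subgroup_powers[OF finite_G c])
  show "N \<subseteq> A" using center_A N_center by blast
  show "inv g \<otimes> x \<otimes> g \<in> N" if "g \<in> carrier G" "x \<in> N" for g x
    using that center_comm[OF N_center[OF that(2)] that(1)] center_carrier[OF N_center[OF that(2)]]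
    by (simp add: m_assoc mult_inv_cancel_left)
  show "g \<in> A" if l: "l \<in> chars G A" "\<exists>x\<in>N. l x \<noteq> 1" and g: "g \<in> carrier G" and k: "coprime k p"
    and eq: "\<And>x. x \<in> A \<Longrightarrow> l (inv g \<otimes> x \<otimes> g) ^ k = l x" for l g k
  proof -
    interpret fa: finite_abelian_subgroup G A
      using subA finite_subset[OF subgroup.subset[OF subA] finite_G] A_comm
      by (intro finite_abelian_subgroup.intro finite_abelian_subgroup_axioms.intro is_group)
    have lp: "l x ^ p = 1" if "x \<in> A" for x
      using fa.chars_pow[OF l(1) that, of p] A_exp[OF that] chars_one[OF l(1)] by simp
    obtain x where x: "x \<in> N" "l x \<noteq> 1" using l(2) by blast
    have xA: "x \<in> A" using center_A N_center x by blast
    have "inv g \<otimes> x \<otimes> g = x"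
      using center_comm[OF N_center[OF x(1)] g] g center_carrier[OF N_center[OF x(1)]]
      by (simp add: m_assoc mult_inv_cancel_left)
    then have xk: "l x ^ k = l x" using eq[OF xA] by simp
    obtain j :: nat where j: "inv g \<otimes> a \<otimes> g = a \<otimes> inv (c [^] j)" "g \<in> A \<longleftrightarrow> p dvd j" using conj_a[OF g] .
    have cj: "c [^] j \<in> A" using center_A[OF subgroup_pow[OF subgroup_center c_center]] .
    \<comment> \<open>\<open>k\<close> fixes the nontrivial value at the central element
      \<open>x\<close>, hence all p-th roots of unity. The assumed relation for \<open>a\<close>
      thus loses its exponent and says that l(c)^j = 1.\<close>
    have "l (inv g \<otimes> a \<otimes> g) ^ k = l (inv g \<otimes> a \<otimes> g)"
      using prime_root_exponent[OF p lp[OF xA] x(2) xk k] lp normA[OF g a_A] by blast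
    then have "l a * inverse (l (c [^] j)) = l a"
      using eq[OF a_A] j(1) cj a_A by (simp add: chars_mult[OF l(1)] fa.chars_inv[OF l(1)])
    then have lcj: "l c ^ j = 1"
      using fa.chars_nonzero[OF l(1) a_A] fa.chars_nonzero[OF l(1) cj] fa.chars_pow[OF l(1) center_A[OF c_center], of j]
      by (simp add: field_simps)
    have "l c \<noteq> 1"
    proof
      assume "l c = 1"
      moreover obtain m :: nat where "x = c [^] m" using x(1) by (auto simp: N_def)
      ultimately show False using x(2) fa.chars_pow[OF l(1) center_A[OF c_center], of m] by simp
    qed
    then have "\<not> coprime j p" using coprime_root_of_unity[OF _ lcj lp[OF center_A[OF c_center]]] by blast
    then have "p dvd j" using p by (metis coprime_commute prime_imp_coprime)
    then show ?thesis using j(2) by simp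
  qed
qed (use finite_G p card_A normA A_comm transversal_b in auto)

lemma quotient_abelian_p2p: "abelian_p2p (G Mod N) p (N #> a) (N #> b)"
proof -
  interpret N: normal N G by (rule ind.normalN)
  interpret Q: group "G Mod N" by (rule N.factorgroup_is_group)
  interpret h: group_hom G "G Mod N" "\<lambda>x. N #> x"
    using N.r_coset_hom_Mod by (simp add: group_hom_def group_hom_axioms_def is_group Q.is_group)
  have carr: "carrier (G Mod N) = (\<lambda>x. N #> x) ` carrier G" by (auto simp: FactGroup_def RCOSETS_def)
  have hc: "N #> c [^] k = \<one>\<^bsub>G Mod N\<^esub>" for k :: nat
    using coset_join2[OF _ N.subgroup_axioms, of "c [^] k"] by (simp add: N_def FactGroup_def)
  have form: "\<exists>(i::nat) (j::nat). U = (N #> a) [^]\<^bsub>G Mod N\<^esub> i \<otimes>\<^bsub>G Mod N\<^esub> (N #> b) [^]\<^bsub>G Mod N\<^esub> j"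
    if U: "U \<in> carrier (G Mod N)" for U
  proof -
    obtain g where g: "g \<in> carrier G" "U = N #> g" using U carr by blast
    obtain i j k where gg: "g = a [^] (i::nat) \<otimes> (b [^] (j::nat) \<otimes> c [^] (k::nat))" using gen[OF g(1)] by blast
    have "U = (N #> a [^] i) \<otimes>\<^bsub>G Mod N\<^esub> ((N #> b [^] j) \<otimes>\<^bsub>G Mod N\<^esub> (N #> c [^] k))"
      unfolding g(2) gg by (simp only: h.hom_mult a b c nat_pow_closed m_closed)
    then have "U = (N #> a) [^]\<^bsub>G Mod N\<^esub> i \<otimes>\<^bsub>G Mod N\<^esub> (N #> b) [^]\<^bsub>G Mod N\<^esub> j"
      unfolding hc by (simp only: h.hom_nat_pow h.hom_closed Q.r_one Q.nat_pow_closed a b)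
    then show ?thesis by blast
  qed
  have ab: "(N #> b) \<otimes>\<^bsub>G Mod N\<^esub> (N #> a) = (N #> a) \<otimes>\<^bsub>G Mod N\<^esub> (N #> b)"
  proof -
    have "(N #> b) \<otimes>\<^bsub>G Mod N\<^esub> (N #> a) = N #> (a \<otimes> (b \<otimes> c))" by (simp only: h.hom_mult[symmetric] a b ba)
    also have "\<dots> = (N #> a) \<otimes>\<^bsub>G Mod N\<^esub> ((N #> b) \<otimes>\<^bsub>G Mod N\<^esub> (N #> c [^] (1::nat)))"
      by (simp only: h.hom_mult a b c m_closed nat_pow_eone)
    finally show ?thesis unfolding hc by (simp only: Q.r_one h.hom_closed a b)
  qed
  show ?thesis
  proof unfold_locales
    have "card (rcosets N) * card N = Coset.order G" by (rule lagrange[OF N.subgroup_axioms])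
    then have "card (carrier (G Mod N)) * p = p ^ 4"
      using card_powers[OF c cp c_ne_1 p] card_G by (simp add: FactGroup_def Coset.order_def N_def)
    then have "card (carrier (G Mod N)) * p = p ^ 3 * p" by (simp add: power_Suc2[symmetric] del: power_Suc)
    then show "card (carrier (G Mod N)) = p ^ 3" using p0 by simp
    show "(N #> a) [^]\<^bsub>G Mod N\<^esub> p = \<one>\<^bsub>G Mod N\<^esub>" using h.hom_nat_pow[of a p] ap h.hom_one by simp
    show "(N #> b) [^]\<^bsub>G Mod N\<^esub> p\<^sup>2 = \<one>\<^bsub>G Mod N\<^esub>" using h.hom_nat_pow[of b "p\<^sup>2"] bp h.hom_one by simp
    fix U V assume UV: "U \<in> carrier (G Mod N)" "V \<in> carrier (G Mod N)"
    have S: "subgroup (centralizer (G Mod N) {N #> a, N #> b}) (G Mod N)"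
      by (rule Q.subgroup_centralizer) simp
    have "N #> a \<in> centralizer (G Mod N) {N #> a, N #> b}" "N #> b \<in> centralizer (G Mod N) {N #> a, N #> b}"
      using ab by (auto simp: centralizer_def)
    then have VS: "V \<in> centralizer (G Mod N) {N #> a, N #> b}"
      using form[OF UV(2)] subgroup.m_closed[OF S] Q.subgroup_pow[OF S] by blast
    have S': "subgroup (centralizer (G Mod N) {V}) (G Mod N)"
      by (rule Q.subgroup_centralizer) (use UV in simp)
    have "N #> a \<in> centralizer (G Mod N) {V}" "N #> b \<in> centralizer (G Mod N) {V}"
      using VS by (auto simp: centralizer_def)
    then have "U \<in> centralizer (G Mod N) {V}"
      using form[OF UV(1)] subgroup.m_closed[OF S'] Q.subgroup_pow[OF S'] by blast
    then show "U \<otimes>\<^bsub>G Mod N\<^esub> V = V \<otimes>\<^bsub>G Mod N\<^esub> U" by (simp add: centralizer_def)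
  qed (use p form in auto)
qed

text \<open>\<open>A\<close> has exponent p and order p^3, and p^2 of its characters are trivial on
  \<open>N\<close>. The remaining p^3 - p^2 all have order p and fall into orbits of size p(p-1),
  hence p matrix summands besides the abelian quotient.\<close>

theorem heisenberg_decomposition:
  "group_algebra G \<cong>\<^sub>\<rat> rat_alg
    \<oplus>\<^sub>\<rat> copies (p + 1) (field_alg (cyclotomic_field p))
    \<oplus>\<^sub>\<rat> copies p (field_alg (cyclotomic_field (p\<^sup>2)))
    \<oplus>\<^sub>\<rat> copies p (mat_alg p (cyclotomic_field p))"
proof -
  interpret q: abelian_p2p "G Mod N" p "N #> a" "N #> b" by (rule quotient_abelian_p2p)
  have cN: "card N = p" unfolding N_def by (rule card_powers[OF c cp c_ne_1 p])
  have subN: "subgroup N G" "N \<subseteq> A" using ind.N by auto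
  have Aall: "{x \<in> A. x [^] p = \<one>} = A" "{x \<in> A. x [^] p \<in> N} = A"
    using A_exp subgroup.one_closed[OF subN(1)] by auto
  have T1: "card (ind.trivial_chars {\<one>} p) = p ^ 3" using ind.card_trivial_chars_1[of p] Aall card_A by simp
  have "card (ind.trivial_chars N p) * p = p\<^sup>2 * p"
    using ind.card_trivial_chars[OF subN, of p] Aall card_A cN by (simp add: power3_eq_cube power2_eq_square)
  then have T2: "card (ind.trivial_chars N p) = p\<^sup>2" using p0 by simp
  have z1: "{x \<in> A. x [^] (1::nat) = \<one>} = {\<one>}" using subgroup.one_closed[OF subA] subgroup.mem_carrier[OF subA] by auto
  have z2: "{x \<in> A. x [^] (1::nat) \<in> N} = N" using subN subgroup.mem_carrier[OF subA] by auto
  have T3: "card (ind.trivial_chars {\<one>} 1) = 1" using ind.card_trivial_chars_1[of 1] z1 by simp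
  have T4: "card (ind.trivial_chars N 1) = 1" using ind.card_trivial_chars[OF subN, of 1] z2 cN p0 by simp
  have R1: "card {l \<in> ind.R. ind.cord l = p ^ Suc 0} = p"
  proof (rule ind.card_R_eqI)
    have "p * (p - 1) * p = p ^ 3 - p\<^sup>2" by (simp add: power3_eq_cube power2_eq_square algebra_simps)
    also have "\<dots> = (p ^ 3 - 1) - (p\<^sup>2 - 1)" using p0 by simp
    finally show "p * (p ^ 0 * (p - 1)) * p = card {l \<in> ind.X. ind.cord l = p ^ Suc 0}"
      unfolding ind.card_X_order using T1 T2 T3 T4 by simp
  qed (rule p0(1))
  have D: "ind.cord l \<in> {p}" if lX: "l \<in> ind.X" for l
  proof -
    obtain e where e: "ind.cord l = p ^ Suc e" using ind.ord_p_power[OF lX] by metis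
    have lc: "l \<in> chars G A" using ind.X_chars[OF lX] .
    have "l x ^ p = 1" if "x \<in> A" for x
      using ind.chars_pow[OF lc that, of p] A_exp[OF that] chars_one[OF lc] by simp
    then have "p ^ Suc e dvd p ^ 1" using ind.char_order(3)[OF lc] e by (metis power_one_right)
    then have "Suc e \<le> 1" by (rule power_dvd_imp_le) (rule p0(2))
    then show ?thesis using e by simp
  qed
  have "group_algebra G \<cong>\<^sub>\<rat> group_algebra (G Mod N)
    \<oplus>\<^sub>\<rat> alg_sum {p} (\<lambda>d. copies p (mat_alg p (cyclotomic_field d)))"
    by (rule ind.decomposition_counted[OF D]) (use R1 in auto)
  then have "group_algebra G \<cong>\<^sub>\<rat> (rat_alg
      \<oplus>\<^sub>\<rat> copies (p + 1) (field_alg (cyclotomic_field p)) \<oplus>\<^sub>\<rat> copies p (field_alg (cyclotomic_field (p\<^sup>2))))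
      \<oplus>\<^sub>\<rat> copies p (mat_alg p (cyclotomic_field p))"
    using alg_iso_trans alg_prod_cong[OF q.abelian_decomposition alg_sum_singleton[of p "\<lambda>d. copies p (mat_alg p (cyclotomic_field d))"]]
    by blast
  then show ?thesis
    using alg_iso_trans[OF _ alg_iso_trans[OF alg_prod_assoc alg_prod_cong[OF alg_iso_refl alg_prod_assoc]]] by blast
qed

end

section \<open>Multiplicities in terms of cyclic subgroups\<close>

context group
begin

lemma group_exponent:
  assumes "finite (carrier G)"
  shows "group_exponent G > 0" "x \<in> carrier G \<Longrightarrow> x [^] group_exponent G = \<one>"
    and "(\<And>x. x \<in> carrier G \<Longrightarrow> x [^] n = \<one>) \<Longrightarrow> group_exponent G dvd n"
proof -
  let ?P = "\<lambda>n. 0 < n \<and> (\<forall>x\<in>carrier G. x [^] n = \<one>)"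
  have "?P (Coset.order G)" using assms pow_order_eq_1 by (simp add: order_gt_0_iff_finite)
  then have P: "?P (group_exponent G)" unfolding group_exponent_def by (rule LeastI)
  then show "group_exponent G > 0" "x \<in> carrier G \<Longrightarrow> x [^] group_exponent G = \<one>" by auto
  assume n: "\<And>x. x \<in> carrier G \<Longrightarrow> x [^] n = \<one>"
  let ?m = "group_exponent G"
  have "x [^] (n mod ?m) = \<one>" if "x \<in> carrier G" for x
    using pow_mod_split[OF that, of n ?m] n[OF that] P that by simp
  moreover have "\<not> ?P (n mod ?m)"
    using not_less_Least[of "n mod ?m" ?P] P unfolding group_exponent_def by simp
  ultimately show "?m dvd n" by auto
qed

lemma card_ord_prime_power:
  assumes fin: "finite (carrier G)" and p: "prime p"
  shows "card {x \<in> carrier G. ord x = p ^ Suc j}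
    = card {x \<in> carrier G. x [^] (p ^ Suc j) = \<one>} - card {x \<in> carrier G. x [^] (p ^ j) = \<one>}"
proof -
  have dv: "q dvd p ^ Suc j \<longleftrightarrow> q = p ^ Suc j \<or> q dvd p ^ j" for q
  proof
    assume "q dvd p ^ Suc j"
    then obtain i where "q = p ^ i" "i \<le> Suc j" using divides_primepow_nat[OF p] by blast
    then show "q = p ^ Suc j \<or> q dvd p ^ j" by (cases "i = Suc j") (auto simp: le_imp_power_dvd)
  qed (auto intro: dvd_mult)
  have "\<not> p ^ Suc j dvd p ^ j" using prime_gt_1_nat[OF p] prime_gt_0_nat[OF p] by (auto dest: dvd_imp_le)
  then have "{x \<in> carrier G. ord x = p ^ Suc j}
      = {x \<in> carrier G. x [^] (p ^ Suc j) = \<one>} - {x \<in> carrier G. x [^] (p ^ j) = \<one>}"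
    using dv pow_eq_id by auto
  moreover have "{x \<in> carrier G. x [^] (p ^ j) = \<one>} \<subseteq> {x \<in> carrier G. x [^] (p ^ Suc j) = \<one>}"
    using dv pow_eq_id by auto
  ultimately show ?thesis using fin by (simp add: card_Diff_subset)
qed

lemma card_quotient_pow:
  assumes fin: "finite (carrier G)" and N: "N \<lhd> G"
  shows "card {U \<in> carrier (G Mod N). U [^]\<^bsub>G Mod N\<^esub> (d::nat) = \<one>\<^bsub>G Mod N\<^esub>} * card N
    = card {x \<in> carrier G. x [^] d \<in> N}"
proof -
  interpret N: normal N G by fact
  interpret Q: group "G Mod N" by (rule N.factorgroup_is_group)
  interpret h: group_hom G "G Mod N" "\<lambda>x. N #> x"
    using N.r_coset_hom_Mod by (simp add: group_hom_def group_hom_axioms_def is_group Q.is_group)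
  have carr: "carrier (G Mod N) = (\<lambda>x. N #> x) ` carrier G" by (auto simp: FactGroup_def RCOSETS_def)
  have mem: "N #> x = \<one>\<^bsub>G Mod N\<^esub> \<longleftrightarrow> x \<in> N" if "x \<in> carrier G" for x
    using that coset_join1[OF _ that N.subgroup_axioms] coset_join2[OF that N.subgroup_axioms]
    by (auto simp: FactGroup_def)
  let ?S = "{x \<in> carrier G. x [^] d \<in> N}"
  let ?U = "{U \<in> carrier (G Mod N). U [^]\<^bsub>G Mod N\<^esub> d = \<one>\<^bsub>G Mod N\<^esub>}"
  have iff: "(N #> x) [^]\<^bsub>G Mod N\<^esub> d = \<one>\<^bsub>G Mod N\<^esub> \<longleftrightarrow> x [^] d \<in> N" if "x \<in> carrier G" for x
    using h.hom_nat_pow[OF that, of d] mem[of "x [^] d"] that by simp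
  have im: "(\<lambda>x. N #> x) ` ?S = ?U"
    unfolding carr using iff by auto
  have "card ?S = (\<Sum>U\<in>(\<lambda>x. N #> x) ` ?S. card {x \<in> ?S. N #> x = U})"
    by (rule card_eq_sum_fibers) (use fin in simp)
  also have "\<dots> = (\<Sum>U\<in>?U. card N)"
    unfolding im
  proof (rule sum.cong[OF refl])
    fix U assume U: "U \<in> ?U"
    then obtain g where g: "g \<in> carrier G" "U = N #> g" using carr by auto
    have "{x \<in> ?S. N #> x = U} = U"
    proof (rule equalityI; rule subsetI)
      fix x assume "x \<in> {x \<in> ?S. N #> x = U}"
      then show "x \<in> U" using rcos_self[OF _ N.subgroup_axioms] by auto
    next
      fix x assume x: "x \<in> U"
      then have xG: "x \<in> carrier G" using g r_coset_subset_G[OF N.subset g(1)] by blast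
      have xU: "N #> x = U" using repr_independence[OF _ g(1) N.subgroup_axioms] x g(2) by simp
      then have "x [^] d \<in> N" using iff[OF xG] U by simp
      then show "x \<in> {x \<in> ?S. N #> x = U}" using xG xU by simp
    qed
    moreover have "card U = card N"
      using card_rcosets_equal[of U N] U N.subset by (simp add: FactGroup_def)
    ultimately show "card {x \<in> ?S. N #> x = U} = card N" by simp
  qed
  finally show ?thesis by simp
qed

lemma num_cyclic_subgroups_1:
  "num_cyclic_subgroups G 1 = 1"
proof -
  have "{H. subgroup H G \<and> cyclic_group (G\<lparr>carrier := H\<rparr>) \<and> card H = 1} = {{\<one>}}"
  proof (rule equalityI; rule subsetI)
    fix H assume H: "H \<in> {H. subgroup H G \<and> cyclic_group (G\<lparr>carrier := H\<rparr>) \<and> card H = 1}"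
    then obtain x where "H = {x}" by (auto simp: card_1_singleton_iff)
    moreover have "\<one> \<in> H" using H subgroup.one_closed by blast
    ultimately show "H \<in> {{\<one>}}" by simp
  next
    fix H assume H: "H \<in> {{\<one>}}"
    have "subgroup_generated G {\<one>} = G\<lparr>carrier := {\<one>}\<rparr>"
      by (simp add: subgroup_generated_def generate_one)
    then have "cyclic_group (G\<lparr>carrier := {\<one>}\<rparr>)" using cyclic_group_generated[of "\<one>"] by simp
    then show "H \<in> {H. subgroup H G \<and> cyclic_group (G\<lparr>carrier := H\<rparr>) \<and> card H = 1}"
      using H triv_subgroup by simp
  qed
  then show ?thesis by (simp add: num_cyclic_subgroups_def)
qed

lemma num_cyclic_subgroups_eq_0:
  assumes fin: "finite (carrier G)" and d: "\<not> d dvd group_exponent G"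
  shows "num_cyclic_subgroups G d = 0"
proof (cases "d = 0")
  case True
  have "card H \<noteq> 0" if "subgroup H G" for H
    using fin subgroup.subset[OF that] subgroup.one_closed[OF that] by (metis card_0_eq empty_iff finite_subset)
  then have "{H. subgroup H G \<and> cyclic_group (G\<lparr>carrier := H\<rparr>) \<and> card H = d} = {}"
    using True by auto
  then show ?thesis by (simp only: num_cyclic_subgroups_def card.empty)
next
  case False
  have "{x \<in> carrier G. ord x = d} = {}"
    using d pow_eq_id group_exponent(2)[OF fin] by blast
  then have "card {x \<in> carrier G. ord x = d} = 0" by (simp only: card.empty)
  then have "totient d * num_cyclic_subgroups G d = 0" using card_ord_eq[OF fin, of d] False by simp
  then show ?thesis using False by simp
qed

end

context induced_characters
begin

abbreviation C where "C \<equiv> G\<lparr>carrier := A\<rparr>"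

lemma group_C: "group C"
  using subA by (rule subgroup_imp_group)

lemma normal_N_C: "N \<lhd> C"
proof -
  interpret C: group C by (rule group_C)
  show ?thesis unfolding C.normal_inv_iff
  proof (intro conjI ballI)
    show "subgroup N C" using N subA by (simp add: subgroup_incl)
    fix x h assume xh: "x \<in> carrier C" "h \<in> N"
    then have "inv\<^bsub>C\<^esub> x = inv x" using subA by (simp add: m_inv_consistent)
    then have "x \<otimes>\<^bsub>C\<^esub> h \<otimes>\<^bsub>C\<^esub> inv\<^bsub>C\<^esub> x = h"
      using xh N commA[of x h] by (auto simp: m_assoc)
    then show "x \<otimes>\<^bsub>C\<^esub> h \<otimes>\<^bsub>C\<^esub> inv\<^bsub>C\<^esub> x \<in> N" using xh by simp
  qed
qed

text \<open>By duality \<open>A\<close> has as many characters of order d as elements of order d,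
  and the characters trivial on \<open>N\<close> correspond in the same way to A/N. The rest form
  orbits of size n * totient d, so dividing by \<open>totient d\<close> turns counts of elements
  into counts of cyclic subgroups. For d = 1 no character in \<open>X\<close> occurs.\<close>

lemma num_cyclic_subgroups_split:
  assumes "d dvd p ^ E"
  shows "num_cyclic_subgroups C d = num_cyclic_subgroups (C Mod N) d + n * card {l \<in> R. cord l = d}"
proof -
  interpret C: group C by (rule group_C)
  interpret Q: group "C Mod N" by (rule normal.factorgroup_is_group[OF normal_N_C])
  obtain i where i: "d = p ^ i" using assms divides_primepow_nat[OF p] by blast
  have finQ: "finite (carrier (C Mod N))" using finA by (simp add: FactGroup_def RCOSETS_def)
  show ?thesis
  proof (cases i)
    case 0
    have "{l \<in> R. cord l = 1} = {}"
    proof -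
      have "cord l \<noteq> 1" if lR: "l \<in> R" for l
      proof -
        obtain e where "cord l = p ^ Suc e" using ord_p_power lR R_subset_X by (metis subsetD)
        then show ?thesis using prime_gt_1_nat[OF p] by simp
      qed
      then show ?thesis by blast
    qed
    then have "card {l \<in> R. cord l = 1} = 0" by (simp only: card.empty)
    then show ?thesis using 0 i C.num_cyclic_subgroups_1 Q.num_cyclic_subgroups_1
      by (simp del: One_nat_def)
  next
    case (Suc j)
    then have d: "d = p ^ Suc j" using i by simp
    have t: "totient d = p ^ j * (p - 1)" unfolding d by (rule totient_prime_power_Suc[OF p])
    have t0: "totient d > 0" unfolding t using prime_gt_1_nat[OF p] by simp
    have d0: "d > 0" using d prime_gt_0_nat[OF p] by simp
    have cN: "card N > 0"
      using finite_subset[OF N(2) finA] subgroup.one_closed[OF N(1)] by (metis card_gt_0_iff empty_iff)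
    have T1: "card (trivial_chars {\<one>} k) = card {x \<in> carrier C. x [^]\<^bsub>C\<^esub> k = \<one>\<^bsub>C\<^esub>}" for k
      using card_trivial_chars_1[of k] by (simp add: nat_pow_consistent[symmetric])
    have TN: "card (trivial_chars N k) = card {U \<in> carrier (C Mod N). U [^]\<^bsub>C Mod N\<^esub> k = \<one>\<^bsub>C Mod N\<^esub>}" for k
    proof -
      have "card (trivial_chars N k) * card N = card {x \<in> carrier C. x [^]\<^bsub>C\<^esub> k \<in> N}"
        using card_trivial_chars[OF N, of k] by (simp add: nat_pow_consistent[symmetric])
      also have "\<dots> = card {U \<in> carrier (C Mod N). U [^]\<^bsub>C Mod N\<^esub> k = \<one>\<^bsub>C Mod N\<^esub>} * card N"
        by (rule C.card_quotient_pow[OF _ normal_N_C, symmetric]) (simp add: finA)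
      finally show ?thesis using cN by (simp only: mult.commute[of _ "card N"] nat_mult_eq_cancel1)
    qed
    have "card {l \<in> chars G A. cord l = d} = totient d * num_cyclic_subgroups C d"
    proof -
      have "{l \<in> chars G A. cord l = d} = {l \<in> chars G A. cord l = d \<and> (\<forall>x\<in>{\<one>}. l x = 1)}"
        using chars_one by auto
      then show ?thesis
        using card_trivial_chars_order[OF p, of j "{\<one>}"] C.card_ord_prime_power[OF _ p, of j] C.card_ord_eq[OF _ d0] finA
        unfolding T1 d by simp
    qed
    moreover have "card {l \<in> chars G A. cord l = d \<and> (\<forall>x\<in>N. l x = 1)} = totient d * num_cyclic_subgroups (C Mod N) d"
      using card_trivial_chars_order[OF p, of j N] Q.card_ord_prime_power[OF finQ p, of j] Q.card_ord_eq[OF finQ d0]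
      unfolding TN d by simp
    moreover have "card {l \<in> X. cord l = d} = totient d * (n * card {l \<in> R. cord l = d})"
      using card_R_order[of d] K_totient[of j] t d by simp
    ultimately have "totient d * num_cyclic_subgroups C d
        = totient d * (num_cyclic_subgroups (C Mod N) d + n * card {l \<in> R. cord l = d})"
      using card_X_order_split[of d] by (simp add: distrib_left)
    then show ?thesis using t0 by (simp only: nat_mult_eq_cancel1)
  qed
qed

text \<open>The multiplicity of order d is the number k d of representatives, and a d = a' d + n * k
  d. The divisibility claims and the truncated subtraction are therefore harmless consequences of
  the same identity.\<close>

theorem decomposition_cyclic_subgroups:
  assumes "n > 0"
  shows "let m = group_exponent C; m' = group_exponent (C Mod N);
      a = num_cyclic_subgroups C; a' = num_cyclic_subgroups (C Mod N)
    in (\<forall>d. d dvd m \<and> \<not> d dvd m' \<longrightarrow> n dvd a d) \<and>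
       (\<forall>d. d dvd m \<and> d dvd m' \<longrightarrow> a' d \<le> a d \<and> n dvd (a d - a' d)) \<and>
       group_algebra G \<cong>\<^sub>\<rat> group_algebra (G Mod N)
         \<oplus>\<^sub>\<rat> alg_sum {d. d dvd m \<and> \<not> d dvd m'}
               (\<lambda>d. copies (a d div n) (mat_alg n (cyclotomic_field d)))
         \<oplus>\<^sub>\<rat> alg_sum {d. d dvd m \<and> d dvd m'}
               (\<lambda>d. copies ((a d - a' d) div n) (mat_alg n (cyclotomic_field d)))"
proof -
  interpret C: group C by (rule group_C)
  interpret Q: group "C Mod N" by (rule normal.factorgroup_is_group[OF normal_N_C])
  have finC: "finite (carrier C)" using finA by simp
  have finQ: "finite (carrier (C Mod N))" using finA by (simp add: FactGroup_def RCOSETS_def)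
  define m where "m = group_exponent C"
  define m' where "m' = group_exponent (C Mod N)"
  define a where "a = num_cyclic_subgroups C"
  define a' where "a' = num_cyclic_subgroups (C Mod N)"
  define k where "k d = card {l \<in> R. cord l = d}" for d
  have "m dvd p ^ E" unfolding m_def
    using A_pow_card cardA by (intro C.group_exponent(3)[OF finC]) (simp add: nat_pow_consistent[symmetric])
  then have split: "a d = a' d + n * k d" if "d dvd m" for d
    unfolding a_def a'_def k_def using num_cyclic_subgroups_split dvd_trans[OF that] by blast
  \<comment> \<open>For d not dividing the exponent of the quotient the identity reads a d = n * k
    d; this is why the first sum has no subtracted term.\<close>
  have zero: "a' d = 0" if "\<not> d dvd m'" for d
    using Q.num_cyclic_subgroups_eq_0[OF finQ] that by (simp add: a'_def m'_def)
  have D: "cord l \<in> {d. d dvd m}" if "l \<in> X" for l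
  proof -
    have lc: "l \<in> chars G A" using X_chars[OF that] .
    have "l x ^ m = 1" if "x \<in> A" for x
    proof -
      have "x [^]\<^bsub>C\<^esub> m = \<one>\<^bsub>C\<^esub>" unfolding m_def using that by (intro C.group_exponent(2)[OF finC]) simp
      then have "x [^] m = \<one>" by (simp add: nat_pow_consistent[symmetric])
      then show ?thesis using chars_pow[OF lc that, of m] chars_one[OF lc] by simp
    qed
    then show ?thesis using char_order(3)[OF lc, of m] by blast
  qed
  let ?S1 = "{d. d dvd m \<and> \<not> d dvd m'}" and ?S2 = "{d. d dvd m \<and> d dvd m'}"
  let ?M = "\<lambda>d. mat_alg n (cyclotomic_field d)"
  have 1: "group_algebra G \<cong>\<^sub>\<rat> group_algebra (G Mod N) \<oplus>\<^sub>\<rat> alg_sum (?S1 \<union> ?S2) (\<lambda>d. copies (k d) (?M d))"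
    using D by (intro decomposition_counted) (auto simp: k_def)
  have 2: "alg_sum (?S1 \<union> ?S2) (\<lambda>d. copies (k d) (?M d))
      \<cong>\<^sub>\<rat> alg_sum ?S1 (\<lambda>d. copies (k d) (?M d)) \<oplus>\<^sub>\<rat> alg_sum ?S2 (\<lambda>d. copies (k d) (?M d))"
    by (rule alg_sum_Un) auto
  have 3: "alg_sum ?S1 (\<lambda>d. copies (k d) (?M d)) \<cong>\<^sub>\<rat> alg_sum ?S1 (\<lambda>d. copies (a d div n) (?M d))"
    using split zero assms by (intro alg_sum_cong) (simp add: alg_iso_refl)
  have 4: "alg_sum ?S2 (\<lambda>d. copies (k d) (?M d)) \<cong>\<^sub>\<rat> alg_sum ?S2 (\<lambda>d. copies ((a d - a' d) div n) (?M d))"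
    using split assms by (intro alg_sum_cong) (simp add: alg_iso_refl)
  note alg_iso_trans[OF 1 alg_prod_cong[OF alg_iso_refl alg_iso_trans[OF 2 alg_prod_cong[OF 3 4]]]]
  then show ?thesis
    unfolding Let_def m_def[symmetric] m'_def[symmetric] a_def[symmetric] a'_def[symmetric]
    using split zero by auto
qed

end

section \<open>Groups of order \<open>p ^ 5\<close> in the family\<close>

text \<open>Relations only, with no order, finiteness or nontriviality, so that the computations
  serve both the groups of order p^5 and arbitrary groups satisfying the presentations. The form b a
  = a (b c) of [b, a] = c is the one used for collecting \<open>a\<close> to the left.\<close>

locale phi3_base = group G for G (structure) +
  fixes a b c e
  assumes a [simp]: "a \<in> carrier G" and b [simp]: "b \<in> carrier G" and c [simp]: "c \<in> carrier G"
    and ba: "b \<otimes> a = a \<otimes> (b \<otimes> c)" and ca: "c \<otimes> a = a \<otimes> (c \<otimes> e)" and cb: "c \<otimes> b = b \<otimes> c"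
    and e_center: "e \<in> center G"
begin

lemma e [simp]: "e \<in> carrier G"
  using e_center center_carrier by blast

lemma center_left: "z \<in> center G \<Longrightarrow> x \<in> carrier G \<Longrightarrow> w \<in> carrier G \<Longrightarrow> z \<otimes> (x \<otimes> w) = x \<otimes> (z \<otimes> w)"
  by (metis center_carrier center_comm m_assoc)

lemma epow_center: "e [^] (k::nat) \<in> center G"
  by (rule subgroup_pow[OF subgroup_center e_center])

lemma bc_pow: "c [^] (k::nat) \<otimes> b [^] (j::nat) = b [^] j \<otimes> c [^] k"
  by (rule comm_pow_pow[OF c b cb])

lemma bj_a: "b [^] (j::nat) \<otimes> a = a \<otimes> (b [^] j \<otimes> c [^] j)"
proof (induction j)
  case (Suc j)
  have "b [^] Suc j \<otimes> a = (b [^] j \<otimes> a) \<otimes> (b \<otimes> c)" by (simp add: m_assoc ba)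
  also have "\<dots> = a \<otimes> (b [^] j \<otimes> ((c [^] j \<otimes> b [^] (1::nat)) \<otimes> c))" unfolding Suc.IH by (simp add: m_assoc)
  also have "c [^] j \<otimes> b [^] (1::nat) = b [^] (1::nat) \<otimes> c [^] j" by (rule bc_pow)
  finally show ?case by (simp add: m_assoc)
qed simp

lemma ck_a: "c [^] (k::nat) \<otimes> a = a \<otimes> (c [^] k \<otimes> e [^] k)"
proof (induction k)
  case (Suc k)
  have "c [^] Suc k \<otimes> a = (c [^] k \<otimes> a) \<otimes> (c \<otimes> e)" by (simp add: m_assoc ca)
  also have "\<dots> = a \<otimes> (c [^] k \<otimes> (e [^] k \<otimes> (c \<otimes> e)))" unfolding Suc.IH by (simp add: m_assoc)
  also have "e [^] k \<otimes> (c \<otimes> e) = c \<otimes> (e [^] k \<otimes> e)" by (rule center_left[OF epow_center]) auto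
  finally show ?case by (simp add: m_assoc)
qed simp

end

text \<open>What isoclinism provides: generators are known only modulo the centre. Hence p-th powers
  of \<open>a\<close> and \<open>b\<close> are merely central, and \<open>gen\<close> allows an
  arbitrary central factor.\<close>

locale phi3 = phi3_base G a b c e for G (structure) and p :: nat and a b c e +
  assumes p: "prime p" and p2: "p > 2" and card_G: "card (carrier G) = p ^ 5"
    and e_ne: "e \<noteq> \<one>" and cp: "c [^] p = \<one>" and ep: "e [^] p = \<one>"
    and ap_center: "a [^] p \<in> center G" and bp_center: "b [^] p \<in> center G"
    and gen: "\<And>g. g \<in> carrier G \<Longrightarrow> \<exists>(i::nat) (j::nat) (k::nat) z. z \<in> center G
      \<and> g = a [^] i \<otimes> (b [^] j \<otimes> (c [^] k \<otimes> z))"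
begin

lemma p0: "p > 0" "p > 1"
  using p2 by auto

lemma finite_G: "finite (carrier G)"
  using card_G p0 by (metis card.infinite power_not_zero less_numeral_extra(3))

text \<open>The subgroup generated by b, c and the centre; \<open>centralizer_Gp\<close> identifies
  it with the centralizer of the commutator subgroup.\<close>

definition CC where "CC = {b [^] (j::nat) \<otimes> (c [^] (k::nat) \<otimes> z) | j k z. z \<in> center G}"

lemma CC_I: "z \<in> center G \<Longrightarrow> b [^] (j::nat) \<otimes> (c [^] (k::nat) \<otimes> z) \<in> CC"
  unfolding CC_def by blast

lemma CC_E:
  assumes "x \<in> CC"
  obtains j k :: nat and z where "z \<in> center G" "z \<in> carrier G" "x = b [^] j \<otimes> (c [^] k \<otimes> z)"
  using assms center_carrier unfolding CC_def by blast

lemma CC_mult: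
  fixes j k j' k' :: nat
  assumes "z \<in> center G" "z' \<in> center G"
  shows "(b [^] j \<otimes> (c [^] k \<otimes> z)) \<otimes> (b [^] j' \<otimes> (c [^] k' \<otimes> z'))
    = b [^] (j + j') \<otimes> (c [^] (k + k') \<otimes> (z \<otimes> z'))"
proof -
  have z: "z \<in> carrier G" "z' \<in> carrier G" using assms center_carrier by auto
  have "(b [^] j \<otimes> (c [^] k \<otimes> z)) \<otimes> (b [^] j' \<otimes> (c [^] k' \<otimes> z'))
      = b [^] j \<otimes> (c [^] k \<otimes> (z \<otimes> (b [^] j' \<otimes> (c [^] k' \<otimes> z'))))" using z by (simp add: m_assoc)
  also have "z \<otimes> (b [^] j' \<otimes> (c [^] k' \<otimes> z')) = b [^] j' \<otimes> (z \<otimes> (c [^] k' \<otimes> z'))"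
    using z by (intro center_left[OF assms(1)]) auto
  also have "z \<otimes> (c [^] k' \<otimes> z') = c [^] k' \<otimes> (z \<otimes> z')"
    using z by (intro center_left[OF assms(1)]) auto
  also have "c [^] k \<otimes> (b [^] j' \<otimes> (c [^] k' \<otimes> (z \<otimes> z'))) = (c [^] k \<otimes> b [^] j') \<otimes> (c [^] k' \<otimes> (z \<otimes> z'))"
    using z by (simp add: m_assoc)
  also have "\<dots> = b [^] j' \<otimes> (c [^] k \<otimes> (c [^] k' \<otimes> (z \<otimes> z')))"
    unfolding bc_pow using z by (simp add: m_assoc)
  finally show ?thesis using z by (simp add: pow_mult_left)
qed

lemma CC_comm:
  assumes "x \<in> CC" "y \<in> CC"
  shows "x \<otimes> y = y \<otimes> x"
proof -
  obtain j k :: nat and z where x: "z \<in> center G" "z \<in> carrier G" "x = b [^] j \<otimes> (c [^] k \<otimes> z)" using CC_E[OF assms(1)] .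
  obtain j' k' :: nat and z' where y: "z' \<in> center G" "z' \<in> carrier G" "y = b [^] j' \<otimes> (c [^] k' \<otimes> z')" using CC_E[OF assms(2)] .
  show ?thesis unfolding x y CC_mult[OF x(1) y(1)] CC_mult[OF y(1) x(1)] center_comm[OF x(1) y(2)]
    by (simp only: add.commute)
qed

lemma center_CC: "z \<in> center G \<Longrightarrow> z \<in> CC"
  using CC_I[of z 0 0] center_carrier by simp

lemma b_CC: "b \<in> CC" and c_CC: "c \<in> CC"
  using CC_I[OF subgroup.one_closed[OF subgroup_center], of 1 0]
    CC_I[OF subgroup.one_closed[OF subgroup_center], of 0 1] by simp_all

lemma subCC: "subgroup CC G"
proof (rule finite_subgroupI[OF finite_G])
  show "CC \<subseteq> carrier G" by (auto elim!: CC_E)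
  show "\<one> \<in> CC" using center_CC subgroup.one_closed[OF subgroup_center] by blast
  fix x y assume "x \<in> CC" "y \<in> CC"
  then show "x \<otimes> y \<in> CC"
    by (elim CC_E) (simp only: CC_mult, intro CC_I subgroup.m_closed[OF subgroup_center])
qed

lemma CC_carrier: "x \<in> CC \<Longrightarrow> x \<in> carrier G"
  using subCC subgroup.mem_carrier by metis

lemma CC_a:
  fixes j k :: nat
  assumes z: "z \<in> center G"
  shows "(b [^] j \<otimes> (c [^] k \<otimes> z)) \<otimes> a = a \<otimes> (b [^] j \<otimes> (c [^] (j + k) \<otimes> (e [^] k \<otimes> z)))"
proof -
  have zG: "z \<in> carrier G" using z center_carrier by blast
  have "(b [^] j \<otimes> (c [^] k \<otimes> z)) \<otimes> a = b [^] j \<otimes> (c [^] k \<otimes> (z \<otimes> a))" using zG by (simp add: m_assoc)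
  also have "z \<otimes> a = a \<otimes> z" by (rule center_comm[OF z a])
  also have "c [^] k \<otimes> (a \<otimes> z) = (c [^] k \<otimes> a) \<otimes> z" using zG by (simp add: m_assoc)
  also have "\<dots> = a \<otimes> (c [^] k \<otimes> (e [^] k \<otimes> z))" unfolding ck_a using zG by (simp add: m_assoc)
  also have "b [^] j \<otimes> (a \<otimes> (c [^] k \<otimes> (e [^] k \<otimes> z))) = (b [^] j \<otimes> a) \<otimes> (c [^] k \<otimes> (e [^] k \<otimes> z))"
    using zG by (simp add: m_assoc)
  also have "\<dots> = a \<otimes> (b [^] j \<otimes> (c [^] j \<otimes> (c [^] k \<otimes> (e [^] k \<otimes> z))))"
    unfolding bj_a using zG by (simp add: m_assoc)
  finally show ?thesis using zG by (simp add: pow_mult_left)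
qed

lemma CC_conj_a: "x \<in> CC \<Longrightarrow> inv a \<otimes> x \<otimes> a \<in> CC"
proof -
  assume x: "x \<in> CC"
  obtain j k :: nat and z where xz: "z \<in> center G" "z \<in> carrier G" "x = b [^] j \<otimes> (c [^] k \<otimes> z)" using CC_E[OF x] .
  have "inv a \<otimes> x \<otimes> a = inv a \<otimes> (x \<otimes> a)" using CC_carrier[OF x] by (simp add: m_assoc)
  also have "\<dots> = b [^] j \<otimes> (c [^] (j + k) \<otimes> (e [^] k \<otimes> z))"
    unfolding xz(3) CC_a[OF xz(1)] using xz(2) by (simp add: mult_inv_cancel_left)
  finally show ?thesis using CC_I subgroup.m_closed[OF subgroup_center epow_center xz(1)] by simp
qed

lemma gen_CC:
  assumes "g \<in> carrier G"
  obtains i :: nat and x where "x \<in> CC" "x \<in> carrier G" "g = a [^] i \<otimes> x"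
  using gen[OF assms] CC_I CC_carrier by blast

lemma conj_apow:
  assumes "x \<in> S" "\<And>x. x \<in> S \<Longrightarrow> inv a \<otimes> x \<otimes> a \<in> S" "S \<subseteq> carrier G"
  shows "inv (a [^] (i::nat)) \<otimes> x \<otimes> a [^] i \<in> S"
proof (induction i)
  case (Suc i)
  have "inv (a [^] Suc i) \<otimes> x \<otimes> a [^] Suc i = inv a \<otimes> (inv (a [^] i) \<otimes> x \<otimes> a [^] i) \<otimes> a"
    using assms by (simp add: inv_mult_group m_assoc subset_iff)
  then show ?case using assms(2)[OF Suc] by simp
qed (use assms in auto)

text \<open>Every element is a power of \<open>a\<close> times an element of the abelian group
  \<open>CC\<close>, which acts trivially, so normality needs to be checked for conjugation by
  \<open>a\<close> only.\<close>

lemma norm_in_CC: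
  assumes S: "S \<subseteq> CC" "\<And>x. x \<in> S \<Longrightarrow> inv a \<otimes> x \<otimes> a \<in> S" and g: "g \<in> carrier G" and x: "x \<in> S"
  shows "inv g \<otimes> x \<otimes> g \<in> S"
proof -
  obtain i y where y: "y \<in> CC" "y \<in> carrier G" "g = a [^] (i::nat) \<otimes> y" using gen_CC[OF g] .
  let ?w = "inv (a [^] i) \<otimes> x \<otimes> a [^] i"
  have w: "?w \<in> S" using conj_apow[of x S i] S x CC_carrier by blast
  have xG: "x \<in> carrier G" using S x CC_carrier by blast
  have "inv g \<otimes> x \<otimes> g = inv y \<otimes> (?w \<otimes> y)" unfolding y(3) using y(2) xG by (simp add: inv_mult_group m_assoc)
  also have "?w \<otimes> y = y \<otimes> ?w" using CC_comm w S(1) y(1) by blast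
  also have "inv y \<otimes> (y \<otimes> ?w) = ?w" using y(2) xG by (simp add: mult_inv_cancel_left)
  finally show ?thesis using w by simp
qed

lemma norm_CC: "g \<in> carrier G \<Longrightarrow> x \<in> CC \<Longrightarrow> inv g \<otimes> x \<otimes> g \<in> CC"
  by (rule norm_in_CC[OF order_refl CC_conj_a])

lemma c_ai: "c \<otimes> a [^] (i::nat) = a [^] i \<otimes> (c \<otimes> e [^] i)"
proof (induction i)
  case (Suc i)
  have "c \<otimes> a [^] Suc i = (c \<otimes> a [^] i) \<otimes> a" by (simp add: m_assoc)
  also have "\<dots> = a [^] i \<otimes> (c \<otimes> (e [^] i \<otimes> a))" unfolding Suc.IH by (simp add: m_assoc)
  also have "e [^] i \<otimes> a = a \<otimes> e [^] i" by (rule center_comm[OF epow_center a])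
  also have "c \<otimes> (a \<otimes> e [^] i) = (c \<otimes> a) \<otimes> e [^] i" by (simp add: m_assoc)
  also have "\<dots> = a \<otimes> (c \<otimes> (e \<otimes> e [^] i))" unfolding ca by (simp add: m_assoc)
  also have "e \<otimes> e [^] i = e [^] i \<otimes> e" by (rule center_comm[OF e_center]) simp
  finally show ?case by (simp add: m_assoc)
qed simp

lemma b_ai: "\<exists>m::nat. b \<otimes> a [^] (i::nat) = a [^] i \<otimes> (b \<otimes> (c [^] i \<otimes> e [^] m))"
proof (induction i)
  case 0
  show ?case by (rule exI[of _ 0]) simp
next
  case (Suc i)
  then obtain m :: nat where m: "b \<otimes> a [^] i = a [^] i \<otimes> (b \<otimes> (c [^] i \<otimes> e [^] m))" by blast
  have "b \<otimes> a [^] Suc i = (b \<otimes> a [^] i) \<otimes> a" by (simp add: m_assoc)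
  also have "\<dots> = a [^] i \<otimes> ((b [^] (1::nat) \<otimes> (c [^] i \<otimes> e [^] m)) \<otimes> a)" unfolding m by (simp add: m_assoc)
  also have "(b [^] (1::nat) \<otimes> (c [^] i \<otimes> e [^] m)) \<otimes> a = a \<otimes> (b [^] (1::nat) \<otimes> (c [^] (1 + i) \<otimes> (e [^] i \<otimes> e [^] m)))"
    by (rule CC_a[OF epow_center])
  finally have "b \<otimes> a [^] Suc i = a [^] Suc i \<otimes> (b \<otimes> (c [^] Suc i \<otimes> e [^] (i + m)))"
    by (simp add: m_assoc nat_pow_mult)
  then show ?case by blast
qed

lemma epow_eq_1: "e [^] (i::nat) = \<one> \<Longrightarrow> p dvd i"
  using pow_eq_one_coprime[OF e ep p _ e_ne] .

lemma a_power_CC: "p dvd i \<Longrightarrow> a [^] (i::nat) \<in> CC"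
  using center_CC subgroup_pow[OF subgroup_center ap_center] by (auto elim!: dvdE simp: nat_pow_pow[symmetric])

text \<open>For g = a^i x with x in \<open>CC\<close>, moving c across g produces the central factor
  e^i. If g commutes with c then p divides i, and a^i is central.\<close>

lemma commute_c_CC:
  assumes "g \<in> carrier G" "g \<otimes> c = c \<otimes> g"
  shows "g \<in> CC"
proof -
  obtain i x where x: "x \<in> CC" "x \<in> carrier G" "g = a [^] (i::nat) \<otimes> x" using gen_CC[OF assms(1)] .
  have "a [^] i \<otimes> (c \<otimes> x) = g \<otimes> c"
    unfolding x(3) CC_comm[OF c_CC x(1)] using x(2) by (simp add: m_assoc)
  also have "\<dots> = c \<otimes> g" by (rule assms(2))
  also have "\<dots> = (c \<otimes> a [^] i) \<otimes> x" unfolding x(3) using x(2) by (simp add: m_assoc)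
  also have "\<dots> = a [^] i \<otimes> (c \<otimes> (e [^] i \<otimes> x))" unfolding c_ai using x(2) by (simp add: m_assoc)
  finally have "e [^] i \<otimes> x = \<one> \<otimes> x" using x(2) by simp
  then have "e [^] i = \<one>" using x(2) by (meson e nat_pow_closed one_closed right_cancel)
  then have "p dvd i" using epow_eq_1 by metis
  then show ?thesis unfolding x(3) using a_power_CC x(1) subgroup.m_closed[OF subCC] by blast
qed

lemma transversal_a: "g \<in> carrier G \<Longrightarrow> \<exists>!i. i < p \<and> inv (a [^] i) \<otimes> g \<in> CC"
proof (rule cyclic_transversal[OF subCC a _ _ p])
  show "a [^] p \<in> CC" by (rule center_CC[OF ap_center])
  show "a \<notin> CC"
  proof
    assume "a \<in> CC"
    then have "a \<otimes> (c \<otimes> e) = a \<otimes> (c \<otimes> \<one>)" using CC_comm[OF c_CC] ca by simp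
    then show False using e_ne by simp
  qed
  fix g assume "g \<in> carrier G"
  then show "\<exists>(i::nat) x. x \<in> CC \<and> g = a [^] i \<otimes> x" using gen_CC by metis
qed

lemma card_CC: "card CC = p ^ 4"
proof -
  have "card (carrier G) = p * card CC" by (rule card_transversal[OF subCC _ transversal_a]) auto
  then have "p * card CC = p * p ^ 4" using card_G by (simp add: power_Suc[symmetric] del: power_Suc)
  then show ?thesis using p0 by simp
qed

lemma CC_abelian: "finite_abelian_subgroup G CC"
  using subCC finite_subset[OF subgroup.subset[OF subCC] finite_G] CC_comm
  by (intro finite_abelian_subgroup.intro finite_abelian_subgroup_axioms.intro is_group)

text \<open>\<open>Gp\<close> is the commutator subgroup, as shown in \<open>derived_eq\<close>, and
  \<open>E\<close> below is the last nontrivial term of the lower central series.\<close>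

definition Gp where "Gp = {c [^] (i::nat) \<otimes> e [^] (j::nat) | i j. True}"
definition E where "E = range (\<lambda>k::nat. e [^] k)"

lemma Gp_I: "c [^] (i::nat) \<otimes> e [^] (j::nat) \<in> Gp"
  unfolding Gp_def by blast

lemma Gp_CC: "Gp \<subseteq> CC"
  unfolding Gp_def using subgroup.m_closed[OF subCC subgroup_pow[OF subCC c_CC] center_CC[OF epow_center]] by blast

lemma E_center: "E \<subseteq> center G"
  unfolding E_def using epow_center by blast

lemma card_E: "card E = p"
  unfolding E_def by (rule card_powers[OF e ep e_ne p])

lemma subE: "subgroup E G"
  unfolding E_def by (rule subgroup_powers[OF finite_G e])

lemma Gp_mult: "(c [^] i \<otimes> e [^] j) \<otimes> (c [^] i' \<otimes> e [^] j') = c [^] (i + i') \<otimes> e [^] (j + j')" for i j i' j' :: nat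
proof -
  have "e [^] j \<otimes> (c [^] i' \<otimes> e [^] j') = c [^] i' \<otimes> (e [^] j \<otimes> e [^] j')"
    by (rule center_left[OF epow_center]) auto
  then show ?thesis by (simp add: m_assoc nat_pow_mult) (simp add: pow_mult_left nat_pow_mult)
qed

lemma subGp: "subgroup Gp G"
proof (rule finite_subgroupI[OF finite_G])
  show "Gp \<subseteq> carrier G" using Gp_CC CC_carrier by blast
  show "\<one> \<in> Gp" using Gp_I[of 0 0] by simp
  fix x y assume "x \<in> Gp" "y \<in> Gp"
  then show "x \<otimes> y \<in> Gp" unfolding Gp_def using Gp_mult by blast
qed

lemma norm_Gp:
  assumes "g \<in> carrier G" "x \<in> Gp"
  shows "inv g \<otimes> x \<otimes> g \<in> Gp"
proof (rule norm_in_CC[OF Gp_CC _ assms])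
  fix x assume "x \<in> Gp"
  then obtain i j :: nat where x: "x = c [^] i \<otimes> e [^] j" unfolding Gp_def by blast
  have "x \<otimes> a = a \<otimes> (c [^] i \<otimes> (e [^] i \<otimes> e [^] j))"
    using CC_a[OF epow_center, of 0 i j] unfolding x by simp
  then have "inv a \<otimes> x \<otimes> a = c [^] i \<otimes> e [^] (i + j)"
    unfolding x by (simp add: m_assoc mult_inv_cancel_left nat_pow_mult)
  then show "inv a \<otimes> x \<otimes> a \<in> Gp" using Gp_I by simp
qed

end

lemma (in group) commutator_derived:
  assumes "x \<in> carrier G" "y \<in> carrier G"
  shows "inv x \<otimes> inv y \<otimes> x \<otimes> y \<in> derived G (carrier G)"
proof -
  have "inv x \<otimes> inv y \<otimes> inv (inv x) \<otimes> inv (inv y) \<in> derived G (carrier G)"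
    unfolding derived_def using assms by (intro generate.incl UN_I[of "inv x"] UN_I[of "inv y"]) auto
  then show ?thesis using assms by simp
qed

section \<open>Commutator subgroup, its centralizer and the centre\<close>

context phi3
begin

lemma CC_a_pow:
  assumes x: "x \<in> CC"
  shows "\<exists>y\<in>Gp. x \<otimes> a [^] (i::nat) = a [^] i \<otimes> (x \<otimes> y)"
proof (induction i)
  case 0
  show ?case using CC_carrier[OF x] by (intro bexI[OF _ subgroup.one_closed[OF subGp]]) simp
next
  case (Suc i)
  then obtain y where y: "y \<in> Gp" "x \<otimes> a [^] i = a [^] i \<otimes> (x \<otimes> y)" by blast
  have w: "x \<otimes> y \<in> CC" using x y Gp_CC subgroup.m_closed[OF subCC] by blast
  obtain j k :: nat and z where xz: "z \<in> center G" "z \<in> carrier G" "x \<otimes> y = b [^] j \<otimes> (c [^] k \<otimes> z)" using CC_E[OF w] .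
  let ?y = "c [^] j \<otimes> e [^] k"
  have G: "x \<in> carrier G" "y \<in> carrier G" "?y \<in> carrier G" using x y(1) Gp_CC CC_carrier by auto
  have "(x \<otimes> y) \<otimes> (b [^] (0::nat) \<otimes> ?y) = b [^] (j + 0) \<otimes> (c [^] (k + j) \<otimes> (z \<otimes> e [^] k))"
    unfolding xz(3) by (rule CC_mult[OF xz(1) epow_center])
  moreover have "z \<otimes> e [^] k = e [^] k \<otimes> z" by (rule center_comm[OF xz(1)]) simp
  ultimately have a: "(x \<otimes> y) \<otimes> a = a \<otimes> ((x \<otimes> y) \<otimes> ?y)"
    unfolding xz(3) CC_a[OF xz(1)] by (simp add: add.commute)
  have "x \<otimes> a [^] Suc i = (x \<otimes> a [^] i) \<otimes> a" using G by (simp add: m_assoc)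
  also have "\<dots> = a [^] i \<otimes> ((x \<otimes> y) \<otimes> a)" unfolding y(2) using G by (simp add: m_assoc)
  also have "\<dots> = a [^] Suc i \<otimes> (x \<otimes> (y \<otimes> ?y))" unfolding a using G by (simp add: m_assoc)
  finally show ?case using subgroup.m_closed[OF subGp y(1) Gp_I] by blast
qed

lemma commutator_Gp:
  assumes "g \<in> carrier G" "h \<in> carrier G"
  shows "g \<otimes> h \<otimes> inv g \<otimes> inv h \<in> Gp"
proof -
  obtain i x where x: "x \<in> CC" "x \<in> carrier G" "g = a [^] (i::nat) \<otimes> x" using gen_CC[OF assms(1)] .
  obtain j y where y: "y \<in> CC" "y \<in> carrier G" "h = a [^] (j::nat) \<otimes> y" using gen_CC[OF assms(2)] .
  obtain u where u: "u \<in> Gp" "x \<otimes> a [^] j = a [^] j \<otimes> (x \<otimes> u)" using CC_a_pow[OF x(1)] by blast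
  obtain v where v: "v \<in> Gp" "y \<otimes> a [^] i = a [^] i \<otimes> (y \<otimes> v)" using CC_a_pow[OF y(1)] by blast
  \<comment> \<open>Both products g h and h g are this common element times an element of
    \<open>Gp\<close>; their quotient is then a conjugate of an element of
    \<open>Gp\<close>.\<close>
  let ?W = "a [^] (i + j) \<otimes> (x \<otimes> y)"
  have C: "u \<in> CC" "v \<in> CC" "u \<in> carrier G" "v \<in> carrier G" using u(1) v(1) Gp_CC CC_carrier by auto
  have "g \<otimes> h = a [^] i \<otimes> ((x \<otimes> a [^] j) \<otimes> y)" unfolding x(3) y(3) using x(2) y(2) by (simp add: m_assoc)
  also have "\<dots> = a [^] (i + j) \<otimes> (x \<otimes> (u \<otimes> y))" unfolding u(2) using x(2) y(2) C by (simp add: m_assoc pow_mult_left)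
  also have "u \<otimes> y = y \<otimes> u" using CC_comm C y by blast
  finally have gh: "g \<otimes> h = ?W \<otimes> u" using x(2) y(2) C by (simp add: m_assoc)
  have "h \<otimes> g = a [^] j \<otimes> ((y \<otimes> a [^] i) \<otimes> x)" unfolding x(3) y(3) using x(2) y(2) by (simp add: m_assoc)
  also have "\<dots> = a [^] (j + i) \<otimes> (y \<otimes> (v \<otimes> x))" unfolding v(2) using x(2) y(2) C by (simp add: m_assoc pow_mult_left)
  also have "v \<otimes> x = x \<otimes> v" using CC_comm C x by blast
  also have "y \<otimes> (x \<otimes> v) = (x \<otimes> y) \<otimes> v" unfolding CC_comm[OF x(1) y(1)] using x(2) y(2) C by (simp add: m_assoc)
  finally have hg: "h \<otimes> g = ?W \<otimes> v" using x(2) y(2) C by (simp add: m_assoc add.commute)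
  have "g \<otimes> h \<otimes> inv g \<otimes> inv h = (g \<otimes> h) \<otimes> inv (h \<otimes> g)" using assms by (simp add: inv_mult_group m_assoc)
  also have "\<dots> = inv (inv ?W) \<otimes> (u \<otimes> inv v) \<otimes> inv ?W"
    unfolding gh hg using C x(2) y(2) by (simp add: inv_mult_group m_assoc)
  also have "\<dots> \<in> Gp"
    using u(1) v(1) x(2) y(2) by (intro norm_Gp subgroup.m_closed[OF subGp] subgroup.m_inv_closed[OF subGp]) auto
  finally show ?thesis .
qed

lemma c_eq: "c = inv b \<otimes> inv a \<otimes> b \<otimes> a"
proof -
  have "inv b \<otimes> inv a \<otimes> b \<otimes> a = inv b \<otimes> (inv a \<otimes> (b \<otimes> a))" by (simp add: m_assoc)
  then show ?thesis unfolding ba by (simp add: mult_inv_cancel_left)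
qed

lemma e_eq: "e = inv c \<otimes> inv a \<otimes> c \<otimes> a"
proof -
  have "inv c \<otimes> inv a \<otimes> c \<otimes> a = inv c \<otimes> (inv a \<otimes> (c \<otimes> a))" by (simp add: m_assoc)
  then show ?thesis unfolding ca by (simp add: mult_inv_cancel_left)
qed

lemma derived_eq: "derived G (carrier G) = Gp"
proof
  show "derived G (carrier G) \<subseteq> Gp"
    unfolding derived_def using commutator_Gp by (intro generate_subgroup_incl subGp) auto
  have S: "subgroup (derived G (carrier G)) G" by (rule derived_is_subgroup) simp
  have "c \<in> derived G (carrier G)" "e \<in> derived G (carrier G)"
    using commutator_derived[of b a] commutator_derived[of c a] unfolding c_eq[symmetric] e_eq[symmetric] by simp_all
  then show "Gp \<subseteq> derived G (carrier G)"
    unfolding Gp_def using subgroup.m_closed[OF S] subgroup_pow[OF S] by blast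
qed

lemma centralizer_Gp: "centralizer G Gp = CC"
proof
  have "c \<in> Gp" using Gp_I[of 1 0] by simp
  then show "centralizer G Gp \<subseteq> CC" using commute_c_CC by (auto simp: centralizer_def)
  show "CC \<subseteq> centralizer G Gp" using CC_comm Gp_CC CC_carrier by (auto simp: centralizer_def)
qed

text \<open>Moving c^i e^j past \<open>a\<close> appends the factor e^i, so equal elements have
  equal e^i. As \<open>e\<close> has order p, this fixes first i and then j.\<close>

lemma Gp_inj: "c [^] (i::nat) \<otimes> e [^] (j::nat) = c [^] i' \<otimes> e [^] j' \<Longrightarrow> i < p \<Longrightarrow> i' < p \<Longrightarrow> j < p \<Longrightarrow> j' < p
  \<Longrightarrow> i = i' \<and> j = j'" for i' j' :: nat
proof -
  have epow: "i = j" if "e [^] i = e [^] j" "i < p" "j < p" for i j :: nat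
    using that
  proof (induction i j rule: linorder_wlog)
    case (le i j)
    have "e [^] i \<otimes> e [^] (j - i) = e [^] j" using nat_pow_mult[OF e, of i "j - i"] le(1) by simp
    also have "\<dots> = e [^] i \<otimes> \<one>" using le(2) by simp
    finally have "e [^] (j - i) = \<one>" by simp
    then have "p dvd j - i" by (rule epow_eq_1)
    then show ?case using le dvd_imp_le[of p "j - i"] by fastforce
  qed auto
  assume eq: "c [^] i \<otimes> e [^] j = c [^] i' \<otimes> e [^] j'" and b: "i < p" "i' < p" "j < p" "j' < p"
  have "a \<otimes> ((c [^] i \<otimes> e [^] j) \<otimes> e [^] i) = a \<otimes> ((c [^] i' \<otimes> e [^] j') \<otimes> e [^] i')"
  proof -
    have *: "(c [^] i \<otimes> e [^] j) \<otimes> a = a \<otimes> ((c [^] i \<otimes> e [^] j) \<otimes> e [^] i)" for i j :: nat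
      using CC_a[OF epow_center, of 0 i j] by (simp add: m_assoc nat_pow_mult add.commute)
    show ?thesis using *[of i j] *[of i' j'] unfolding eq by metis
  qed
  then have "e [^] i = e [^] i'" unfolding eq by simp
  then have i: "i = i'" using epow b by blast
  then have "e [^] j = e [^] j'" using eq by simp
  then show ?thesis using epow b i by blast
qed

text \<open>The commutator of b^j c^k z with \<open>a\<close> is c^j e^k, independent of the central
  factor; by \<open>Gp_inj\<close> it determines j and k below p, and cancelling leaves z. Counting
  then shows that the centre has order p^2.\<close>

lemma CC_normal_form:
  "bij_betw (\<lambda>((j::nat, k::nat), z). b [^] j \<otimes> (c [^] k \<otimes> z)) (({..<p} \<times> {..<p}) \<times> center G) CC"
proof -
  let ?S = "({..<p} \<times> {..<p}) \<times> center G" and ?f = "\<lambda>((j::nat, k::nat), z). b [^] j \<otimes> (c [^] k \<otimes> z)"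
  have "inj_on ?f ?S"
  proof (rule inj_onI, clarify)
    fix j k z j' k' z'
    assume z: "z \<in> center G" "z' \<in> center G" and lt: "j < p" "k < p" "j' < p" "k' < p"
      and eq: "b [^] j \<otimes> (c [^] k \<otimes> z) = b [^] j' \<otimes> (c [^] k' \<otimes> z')"
    have zG: "z \<in> carrier G" "z' \<in> carrier G" using z center_carrier by auto
    have a: "(b [^] j \<otimes> (c [^] k \<otimes> z)) \<otimes> a = a \<otimes> ((b [^] j \<otimes> (c [^] k \<otimes> z)) \<otimes> (c [^] j \<otimes> e [^] k))"
      if "z \<in> center G" for j k :: nat and z
    proof -
      have "(b [^] j \<otimes> (c [^] k \<otimes> z)) \<otimes> (b [^] (0::nat) \<otimes> (c [^] j \<otimes> e [^] k))
          = b [^] (j + 0) \<otimes> (c [^] (k + j) \<otimes> (z \<otimes> e [^] k))"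
        by (rule CC_mult[OF that epow_center])
      moreover have "z \<otimes> e [^] k = e [^] k \<otimes> z" by (rule center_comm[OF that]) simp
      ultimately show ?thesis using CC_a[OF that, of j k] by (simp add: add.commute)
    qed
    have "a \<otimes> ((b [^] j \<otimes> (c [^] k \<otimes> z)) \<otimes> (c [^] j \<otimes> e [^] k))
        = a \<otimes> ((b [^] j \<otimes> (c [^] k \<otimes> z)) \<otimes> (c [^] j' \<otimes> e [^] k'))"
      using a[OF z(1), of j k] a[OF z(2), of j' k'] unfolding eq by simp
    then have "c [^] j \<otimes> e [^] k = c [^] j' \<otimes> e [^] k'" using zG by simp
    then have jk: "j = j'" "k = k'" using Gp_inj lt by auto
    then have "z = z'" using eq zG by simp
    then show "(j, k) = (j', k') \<and> z = z'" using jk by simp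
  qed
  moreover have "?f ` ?S = CC"
  proof
    show "?f ` ?S \<subseteq> CC" using CC_I by auto
    show "CC \<subseteq> ?f ` ?S"
    proof
      fix x assume "x \<in> CC"
      then obtain j k z where x: "z \<in> center G" "z \<in> carrier G" "x = b [^] (j::nat) \<otimes> (c [^] (k::nat) \<otimes> z)" using CC_E by blast
      let ?z = "(b [^] p) [^] (j div p)"
      have zz: "?z \<in> center G" by (rule subgroup_pow[OF subgroup_center bp_center])
      have "x = b [^] (j mod p) \<otimes> (?z \<otimes> (c [^] (k mod p) \<otimes> z))"
        unfolding x using x(2) pow_mod_split[OF b, of j p] pow_mod_split[OF c, of k p] cp by (simp add: m_assoc)
      also have "?z \<otimes> (c [^] (k mod p) \<otimes> z) = c [^] (k mod p) \<otimes> (?z \<otimes> z)"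
        by (rule center_left[OF zz]) (use x in auto)
      finally show "x \<in> ?f ` ?S"
        using p0 subgroup.m_closed[OF subgroup_center zz x(1)]
        by (intro image_eqI[of _ _ "((j mod p, k mod p), ?z \<otimes> z)"]) auto
    qed
  qed
  ultimately show ?thesis by (simp add: bij_betw_def)
qed

lemma card_center: "card (center G) = p\<^sup>2"
proof -
  have "card (({..<p} \<times> {..<p}) \<times> center G) = p ^ 4"
    using bij_betw_same_card[OF CC_normal_form] card_CC by simp
  then have "(p * p) * card (center G) = (p * p) * p\<^sup>2"
    by (auto simp: card_cartesian_product numeral_eq_Suc)
  then show ?thesis by (simp only: nat_mult_eq_cancel1 nat_0_less_mult_iff p0 simp_thms)
qed

text \<open>The centre has order p^2 and \<open>E\<close> has order p, so the quotient has order p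
  and every p-th power of a central element falls into \<open>E\<close>.\<close>

lemma center_pow_E: "z \<in> center G \<Longrightarrow> z [^] p \<in> E"
proof -
  assume z: "z \<in> center G"
  let ?Z = "G\<lparr>carrier := center G\<rparr>"
  interpret Z: comm_group ?Z
    using subgroup_imp_group[OF subgroup_center] center_comm center_carrier
    by (intro group.group_comm_groupI) auto
  have EZ: "subgroup E ?Z" using subgroup_incl[OF subE subgroup_center E_center] .
  then interpret N: normal E ?Z by (rule Z.subgroup_imp_normal)
  interpret Q: group "?Z Mod E" by (rule N.factorgroup_is_group)
  interpret h: group_hom ?Z "?Z Mod E" "\<lambda>x. E #>\<^bsub>?Z\<^esub> x"
    using N.r_coset_hom_Mod by (intro group_hom.intro group_hom_axioms.intro) (auto intro: Z.is_group Q.is_group)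
  have fZ: "finite (center G)" using finite_subset[OF _ finite_G] center_carrier by blast
  have "card (rcosets\<^bsub>?Z\<^esub> E) * card E = Coset.order ?Z" by (rule Z.lagrange[OF EZ])
  then have "card (rcosets\<^bsub>?Z\<^esub> E) * p = p * p"
    by (simp add: card_E Coset.order_def card_center power2_eq_square)
  then have o: "Coset.order (?Z Mod E) = p"
    using p0 by (simp add: Coset.order_def FactGroup_def)
  have cz: "E #>\<^bsub>?Z\<^esub> z \<in> carrier (?Z Mod E)" by (rule h.hom_closed) (simp add: z)
  have "E #>\<^bsub>?Z\<^esub> (z [^]\<^bsub>?Z\<^esub> p) = (E #>\<^bsub>?Z\<^esub> z) [^]\<^bsub>?Z Mod E\<^esub> p"
    using z by (intro h.hom_nat_pow) simp
  also have "\<dots> = \<one>\<^bsub>?Z Mod E\<^esub>" using Q.pow_order_eq_1[OF cz] unfolding o .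
  finally have "E #>\<^bsub>?Z\<^esub> (z [^]\<^bsub>?Z\<^esub> p) = E" by (simp add: FactGroup_def)
  moreover have "z [^]\<^bsub>?Z\<^esub> p \<in> carrier ?Z" using z by (intro Z.nat_pow_closed) simp
  ultimately have "z [^]\<^bsub>?Z\<^esub> p \<in> E" using Z.rcos_self[OF _ EZ, of "z [^]\<^bsub>?Z\<^esub> p"] by simp
  then show ?thesis by (simp add: nat_pow_consistent[symmetric])
qed

text \<open>The degree \<open>p\<close> characters of \<open>G\<close> come from the characters of \<open>C\<^sub>G(G')\<close> that are nontrivial on \<open>N\<close>;
  the congruence \<open>l (x\<^sup>g)\<^sup>k = l x\<close> forces \<open>g \<in> C\<^sub>G(G')\<close> either through \<open>e\<close> and \<open>c\<close> or through \<open>b\<close>.\<close>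

lemma free_e:
  assumes l: "l \<in> chars G CC" and le: "l e \<noteq> 1" and g: "g \<in> carrier G" and k: "coprime k p"
    and inv: "\<And>x. x \<in> CC \<Longrightarrow> l (inv g \<otimes> x \<otimes> g) ^ k = l x"
  shows "g \<in> CC"
proof -
  interpret CC: finite_abelian_subgroup G CC by (rule CC_abelian)
  note ch = chars_mult[OF l] CC.chars_pow[OF l] CC.chars_nonzero[OF l] c_CC b_CC center_CC[OF e_center] center_CC[OF epow_center]
  obtain i x where x: "x \<in> CC" "x \<in> carrier G" "g = a [^] (i::nat) \<otimes> x" using gen_CC[OF g] .
  have "inv g \<otimes> e \<otimes> g = inv g \<otimes> (e \<otimes> g)" using g by (simp add: m_assoc)
  also have "e \<otimes> g = g \<otimes> e" by (rule center_comm[OF e_center g])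
  finally have "inv g \<otimes> e \<otimes> g = e" using g by (simp add: mult_inv_cancel_left)
  then have lek: "l e ^ k = l e" using inv[OF center_CC[OF e_center]] by simp
  have lep: "l e ^ p = 1" using ch(2)[OF ch(6), of p] ep by (simp add: chars_one[OF l])
  have lcp: "l c ^ p = 1" using ch(2)[OF ch(4), of p] cp by (simp add: chars_one[OF l])
  \<comment> \<open>\<open>e\<close> is central, so conjugation does not move l e and
    \<open>k\<close> must fix this nontrivial p-th root of unity. By \<open>fx\<close> it then fixes
    l c and all powers of l e.\<close>
  note fx = prime_root_exponent[OF p lep le lek k]
  have "c \<otimes> g = (c \<otimes> a [^] i) \<otimes> x" unfolding x(3) using x(2) by (simp add: m_assoc)
  also have "\<dots> = a [^] i \<otimes> (c \<otimes> (e [^] i \<otimes> x))" unfolding c_ai using x(2) by (simp add: m_assoc)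
  also have "e [^] i \<otimes> x = x \<otimes> e [^] i" by (rule center_comm[OF epow_center x(2)])
  also have "c \<otimes> (x \<otimes> e [^] i) = (c \<otimes> x) \<otimes> e [^] i" using x(2) by (simp add: m_assoc)
  also have "c \<otimes> x = x \<otimes> c" by (rule CC_comm[OF c_CC x(1)])
  finally have "c \<otimes> g = g \<otimes> (c \<otimes> e [^] i)" unfolding x(3) using x(2) by (simp add: m_assoc)
  then have "inv g \<otimes> c \<otimes> g = c \<otimes> e [^] i" using g by (simp add: m_assoc mult_inv_cancel_left)
  then have "(l c * l e ^ i) ^ k = l c" using inv[OF c_CC] ch by simp
  moreover have "(l c * l e ^ i) ^ k = l c * l e ^ i"
    using fx[OF lcp] lek by (simp add: power_mult_distrib power_mult[symmetric] mult.commute[of i k] power_mult)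
  ultimately have "l e ^ i = 1" using ch by simp
  then have "\<not> coprime i p" using coprime_root_of_unity[of i p "l e"] lep le by blast
  then have "p dvd i" using p by (metis coprime_commute prime_imp_coprime)
  then show ?thesis unfolding x(3) using a_power_CC x(1) subgroup.m_closed[OF subCC] by blast
qed

text \<open>When l e = 1, the character must be nontrivial at c, and c plays the part that e played
  in \<open>free_e\<close>: c is fixed by conjugation up to the kernel of l, so \<open>k\<close>
  fixes all p-th roots of unity, and the conjugate of b compares l b with l b times l(c)^i.\<close>

lemma free_Gp:
  assumes bp: "b [^] p \<in> E"
    and l: "l \<in> chars G CC" and lG: "\<exists>x\<in>Gp. l x \<noteq> 1" and g: "g \<in> carrier G" and k: "coprime k p"
    and inv: "\<And>x. x \<in> CC \<Longrightarrow> l (inv g \<otimes> x \<otimes> g) ^ k = l x"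
  shows "g \<in> CC"
proof (cases "l e = 1")
  case False
  then show ?thesis using free_e[OF l _ g k inv] by blast
next
  case le: True
  interpret CC: finite_abelian_subgroup G CC by (rule CC_abelian)
  note ch = chars_mult[OF l] CC.chars_pow[OF l] CC.chars_nonzero[OF l] c_CC b_CC center_CC[OF e_center] center_CC[OF epow_center]
  have cpow: "c [^] (i::nat) \<in> CC" for i by (rule subgroup_pow[OF subCC c_CC])
  have lepow: "l (e [^] (i::nat)) = 1" for i using ch le by simp
  obtain m n :: nat where mn: "l (c [^] m \<otimes> e [^] n) \<noteq> 1" using lG unfolding Gp_def by blast
  have lc: "l c \<noteq> 1"
  proof
    assume "l c = 1"
    then have "l (c [^] m \<otimes> e [^] n) = 1" using ch cpow lepow by simp
    then show False using mn by simp
  qed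
  obtain s :: nat where s: "b [^] p = e [^] s" using bp unfolding E_def by blast
  \<comment> \<open>Here b^p in \<open>E\<close> enters: l b becomes a p-th root of unity and cannot
    be altered by the exponent \<open>k\<close>.\<close>
  have lbp: "l b ^ p = 1" using ch(2)[OF b_CC, of p] lepow unfolding s by simp
  have lcp: "l c ^ p = 1" using ch(2)[OF ch(4), of p] cp by (simp add: chars_one[OF l])
  obtain i x where x: "x \<in> CC" "x \<in> carrier G" "g = a [^] (i::nat) \<otimes> x" using gen_CC[OF g] .
  obtain m :: nat where m: "b \<otimes> a [^] i = a [^] i \<otimes> (b \<otimes> (c [^] i \<otimes> e [^] m))" using b_ai by blast
  have conj: "inv g \<otimes> y \<otimes> g = w" if y: "y \<in> CC" "w \<in> CC" "y \<otimes> a [^] i = a [^] i \<otimes> w" for y w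
  proof -
    have G: "y \<in> carrier G" "w \<in> carrier G" using y CC_carrier by auto
    have "y \<otimes> g = (y \<otimes> a [^] i) \<otimes> x" unfolding x(3) using x(2) G by (simp add: m_assoc)
    also have "\<dots> = a [^] i \<otimes> (w \<otimes> x)" unfolding y(3) using x(2) G by (simp add: m_assoc)
    also have "w \<otimes> x = x \<otimes> w" by (rule CC_comm[OF y(2) x(1)])
    finally have "y \<otimes> g = g \<otimes> w" unfolding x(3) using x(2) G by (simp add: m_assoc)
    then show ?thesis using g G by (simp add: m_assoc mult_inv_cancel_left)
  qed
  have ce: "c [^] (j::nat) \<otimes> e [^] (n::nat) \<in> CC" for j n using Gp_I Gp_CC by blast
  have "inv g \<otimes> c \<otimes> g = c \<otimes> e [^] i" by (rule conj[OF c_CC _ c_ai]) (use ce[of 1 i] in simp)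
  then have lck: "l c ^ k = l c" using inv[OF c_CC] ch lepow le by simp
  note fx = prime_root_exponent[OF p lcp lc lck k]
  have bce: "b \<otimes> (c [^] i \<otimes> e [^] m) \<in> CC" using subgroup.m_closed[OF subCC b_CC ce] .
  have "inv g \<otimes> b \<otimes> g = b \<otimes> (c [^] i \<otimes> e [^] m)" by (rule conj[OF b_CC bce m])
  then have "(l b * l c ^ i) ^ k = l b" using inv[OF b_CC] ch lepow cpow ce le by simp
  moreover have "(l b * l c ^ i) ^ k = l b * l c ^ i"
    using fx[OF lbp] lck by (simp add: power_mult_distrib power_mult[symmetric] mult.commute[of i k] power_mult)
  ultimately have "l c ^ i = 1" using ch by simp
  then have "\<not> coprime i p" using coprime_root_of_unity[of i p "l c"] lcp lc by blast
  then have "p dvd i" using p by (metis coprime_commute prime_imp_coprime)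
  then show ?thesis unfolding x(3) using a_power_CC x(1) subgroup.m_closed[OF subCC] by blast
qed

lemma induced_Gp:
  assumes "b [^] p \<in> E"
  shows "induced_characters G CC Gp p 4 p (\<lambda>i. a [^] i)"
  using free_Gp[OF assms] finite_G norm_CC subGp Gp_CC norm_Gp p card_CC transversal_a
  by (intro induced_characters.intro induced_characters_axioms.intro CC_abelian) auto

lemma induced_E: "induced_characters G CC E p 4 p (\<lambda>i. a [^] i)"
proof (intro induced_characters.intro induced_characters_axioms.intro CC_abelian finite_G norm_CC subE p card_CC transversal_a)
  show "E \<subseteq> CC" using E_center center_CC by blast
  show "inv g \<otimes> x \<otimes> g \<in> E" if "g \<in> carrier G" "x \<in> E" for g x
  proof -
    have x: "x \<in> center G" "x \<in> carrier G" using that E_center center_carrier by blast+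
    have "inv g \<otimes> x \<otimes> g = inv g \<otimes> (x \<otimes> g)" using that x by (simp add: m_assoc)
    also have "x \<otimes> g = g \<otimes> x" by (rule center_comm[OF x(1) that(1)])
    finally show ?thesis using that x by (simp add: mult_inv_cancel_left)
  qed
  show "g \<in> CC" if l: "l \<in> chars G CC" and ne: "\<exists>x\<in>E. l x \<noteq> 1" and g: "g \<in> carrier G" and k: "coprime k p"
    and inv: "\<And>x. x \<in> CC \<Longrightarrow> l (inv g \<otimes> x \<otimes> g) ^ k = l x" for l g k
  proof (rule free_e[OF l _ g k inv])
    interpret CC: finite_abelian_subgroup G CC by (rule CC_abelian)
    show "l e \<noteq> 1" using ne CC.chars_pow[OF l center_CC[OF e_center]] unfolding E_def by auto
  qed
qed auto

end

lemma alg_prod_assoc_sym: "A \<oplus>\<^sub>\<rat> B \<oplus>\<^sub>\<rat> C \<cong>\<^sub>\<rat> (A \<oplus>\<^sub>\<rat> B) \<oplus>\<^sub>\<rat> C"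
  by (rule alg_isoI[where g = "\<lambda>((a, b), c). (a, b, c)" and h = "\<lambda>(a, b, c). ((a, b), c)"])
    (auto simp: alg_prod_simps)

locale phi3_bp = phi3 +
  assumes bp_E: "b [^] p \<notin> E"
begin

lemma epow_inj:
  assumes "e [^] (i::nat) = e [^] (j::nat)" "i < p" "j < p"
  shows "i = j"
proof -
  have "c [^] (0::nat) \<otimes> e [^] i = c [^] (0::nat) \<otimes> e [^] j" using assms(1) by simp
  from Gp_inj[OF this] show ?thesis using assms p0 by blast
qed

lemma bpow_E: "b [^] (p * i) \<in> E \<Longrightarrow> p dvd i"
  using pow_mem_coprime[OF subE _ center_pow_E[OF bp_center] p, of i] bp_E by (auto simp: nat_pow_pow)

text \<open>With b^p outside \<open>E\<close>, the products of p * i-th powers of b and j-th powers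
  of e, for i and j below p, are p^2 distinct central elements, and the centre has no
  others.\<close>

lemma center_form:
  assumes "z \<in> center G"
  obtains i j :: nat where "z = b [^] (p * i) \<otimes> e [^] j"
proof -
  let ?f = "\<lambda>(i::nat, j::nat). b [^] (p * i) \<otimes> e [^] j" and ?S = "{..<p} \<times> {..<p}"
  have bpi: "b [^] (p * i) \<in> center G" for i :: nat
    using subgroup_pow[OF subgroup_center bp_center, of i] by (simp add: nat_pow_pow)
  have *: "i = i'" if "b [^] (p * i) \<otimes> e [^] j = b [^] (p * i') \<otimes> e [^] j'" "i < p" "i' < p" "i \<le> i'" for i j i' j' :: nat
  proof -
    have "b [^] (p * i) \<otimes> (b [^] (p * (i' - i)) \<otimes> e [^] j') = b [^] (p * i) \<otimes> e [^] j"
      using that by (simp add: pow_mult_left diff_mult_distrib2)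
    then have "b [^] (p * (i' - i)) \<otimes> e [^] j' = e [^] j" by simp
    then have "b [^] (p * (i' - i)) = e [^] j \<otimes> inv (e [^] j')"
      by (metis b e inv_solve_right nat_pow_closed)
    also have "\<dots> \<in> E" unfolding E_def[symmetric]
      using subgroup.m_closed[OF subE] subgroup.m_inv_closed[OF subE] by (auto simp: E_def)
    finally have "p dvd i' - i" by (rule bpow_E)
    then show ?thesis using that by (auto dest: dvd_imp_le)
  qed
  have inj: "inj_on ?f ?S"
  proof (rule inj_onI, clarify)
    fix i j i' j' :: nat
    assume eq: "b [^] (p * i) \<otimes> e [^] j = b [^] (p * i') \<otimes> e [^] j'" and lt: "i < p" "j < p" "i' < p" "j' < p"
    have i: "i = i'" using *[OF eq lt(1,3)] *[OF eq[symmetric] lt(3,1)] nat_le_linear[of i i'] by blast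
    then have "e [^] j = e [^] j'" using eq by simp
    then show "i = i' \<and> j = j'" using i epow_inj lt by blast
  qed
  have "?f ` ?S \<subseteq> center G" using subgroup.m_closed[OF subgroup_center bpi epow_center] by auto
  moreover have "card (?f ` ?S) = card (center G)"
    using card_image[OF inj] card_center by (simp add: card_cartesian_product power2_eq_square)
  moreover have "finite (center G)" using finite_subset[OF _ finite_G] center_carrier by blast
  ultimately have "?f ` ?S = center G" by (metis card_subset_eq)
  then have "z \<in> ?f ` ?S" using assms by simp
  then show thesis using that by auto
qed

lemma gen4:
  assumes "g \<in> carrier G"
  shows "\<exists>(i::nat) (j::nat) (k::nat) (l::nat). g = a [^] i \<otimes> (b [^] j \<otimes> (c [^] k \<otimes> e [^] l))"
proof -
  obtain i j k z where g: "z \<in> center G" "g = a [^] (i::nat) \<otimes> (b [^] (j::nat) \<otimes> (c [^] (k::nat) \<otimes> z))" using gen[OF assms] by blast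
  obtain m l where z: "z = b [^] (p * m) \<otimes> e [^] (l::nat)" by (rule center_form[OF g(1)])
  have "c [^] k \<otimes> (b [^] (p * m) \<otimes> e [^] l) = b [^] (p * m) \<otimes> (c [^] k \<otimes> e [^] l)"
    using bc_pow[of k "p * m"] by (simp add: m_assoc[symmetric])
  then have "g = a [^] i \<otimes> (b [^] (j + p * m) \<otimes> (c [^] k \<otimes> e [^] l))"
    unfolding g(2) z by (simp add: pow_mult_left)
  then show ?thesis by blast
qed

end

text \<open>Normalises \<open>a\<close> so that its p-th power becomes trivial modulo
  \<open>E\<close>, as required of the generator in the quotient of order p^4.\<close>

locale phi3_exc = phi3_bp +
  assumes ap_E: "a [^] p \<in> E"
begin

lemma quotient_heisenberg: "heisenberg_p4 (G Mod E) p (E #> a) (E #> b) (E #> c)"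
proof -
  interpret ind: induced_characters G CC E p 4 p "\<lambda>i. a [^] i" by (rule induced_E)
  interpret N: normal E G by (rule ind.normalN)
  interpret Q: group "G Mod E" by (rule N.factorgroup_is_group)
  interpret h: group_hom G "G Mod E" "\<lambda>x. E #> x"
    using N.r_coset_hom_Mod by (simp add: group_hom_def group_hom_axioms_def is_group Q.is_group)
  have carr: "carrier (G Mod E) = (\<lambda>x. E #> x) ` carrier G" by (auto simp: FactGroup_def RCOSETS_def)
  have one: "E #> x = \<one>\<^bsub>G Mod E\<^esub>" if "x \<in> E" for x
    using coset_join2[OF _ N.subgroup_axioms, of x] that E_center center_carrier by (auto simp: FactGroup_def)
  have he: "E #> e [^] k = \<one>\<^bsub>G Mod E\<^esub>" for k :: nat by (rule one) (simp add: E_def)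
  have oneE: "\<one> \<in> E" by (rule subgroup.one_closed[OF subE])
  show ?thesis
  proof unfold_locales
    have "card (rcosets E) * card E = Coset.order G" by (rule lagrange[OF N.subgroup_axioms])
    then have "card (carrier (G Mod E)) * p = p ^ 5"
      using card_E card_G by (simp add: FactGroup_def Coset.order_def)
    then have "card (carrier (G Mod E)) * p = p ^ 4 * p" by (simp add: power_Suc2[symmetric] del: power_Suc)
    then show "card (carrier (G Mod E)) = p ^ 4" using p0 by simp
    show "(E #> a) [^]\<^bsub>G Mod E\<^esub> p = \<one>\<^bsub>G Mod E\<^esub>" using h.hom_nat_pow[of a p] one[OF ap_E] by simp
    show "(E #> b) [^]\<^bsub>G Mod E\<^esub> p\<^sup>2 = \<one>\<^bsub>G Mod E\<^esub>"
      using h.hom_nat_pow[of b "p\<^sup>2"] one[OF center_pow_E[OF bp_center]] by (simp add: nat_pow_pow power2_eq_square)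
    show "(E #> c) [^]\<^bsub>G Mod E\<^esub> p = \<one>\<^bsub>G Mod E\<^esub>" using h.hom_nat_pow[of c p] cp one[OF oneE] by simp
    show "(E #> b) \<otimes>\<^bsub>G Mod E\<^esub> (E #> a) = (E #> a) \<otimes>\<^bsub>G Mod E\<^esub> ((E #> b) \<otimes>\<^bsub>G Mod E\<^esub> (E #> c))"
      by (simp only: h.hom_mult[symmetric] a b c ba m_closed)
    show "(E #> c) \<otimes>\<^bsub>G Mod E\<^esub> (E #> b) = (E #> b) \<otimes>\<^bsub>G Mod E\<^esub> (E #> c)"
      by (simp only: h.hom_mult[symmetric] a b c cb m_closed)
    have "(E #> c) \<otimes>\<^bsub>G Mod E\<^esub> (E #> a) = E #> (a \<otimes> (c \<otimes> e))" by (simp only: h.hom_mult[symmetric] a c ca)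
    also have "\<dots> = (E #> a) \<otimes>\<^bsub>G Mod E\<^esub> ((E #> c) \<otimes>\<^bsub>G Mod E\<^esub> (E #> e [^] (1::nat)))"
      by (simp only: h.hom_mult a e c m_closed nat_pow_eone)
    finally show "(E #> c) \<otimes>\<^bsub>G Mod E\<^esub> (E #> a) = (E #> a) \<otimes>\<^bsub>G Mod E\<^esub> (E #> c)"
      unfolding he by (simp only: Q.r_one h.hom_closed a c)
    fix U assume "U \<in> carrier (G Mod E)"
    then obtain g where g: "g \<in> carrier G" "U = E #> g" using carr by blast
    obtain i j k l where gg: "g = a [^] (i::nat) \<otimes> (b [^] (j::nat) \<otimes> (c [^] (k::nat) \<otimes> e [^] (l::nat)))" using gen4[OF g(1)] by blast
    have "U = (E #> a [^] i) \<otimes>\<^bsub>G Mod E\<^esub> ((E #> b [^] j) \<otimes>\<^bsub>G Mod E\<^esub> ((E #> c [^] k) \<otimes>\<^bsub>G Mod E\<^esub> (E #> e [^] l)))"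
      unfolding g(2) gg by (simp only: h.hom_mult a b c e nat_pow_closed m_closed)
    then have "U = (E #> a) [^]\<^bsub>G Mod E\<^esub> i \<otimes>\<^bsub>G Mod E\<^esub> ((E #> b) [^]\<^bsub>G Mod E\<^esub> j \<otimes>\<^bsub>G Mod E\<^esub> (E #> c) [^]\<^bsub>G Mod E\<^esub> k)"
      unfolding he by (simp only: h.hom_nat_pow h.hom_closed Q.r_one Q.nat_pow_closed a b c)
    then show "\<exists>(i::nat) (j::nat) (k::nat). U = (E #> a) [^]\<^bsub>G Mod E\<^esub> i \<otimes>\<^bsub>G Mod E\<^esub> ((E #> b) [^]\<^bsub>G Mod E\<^esub> j \<otimes>\<^bsub>G Mod E\<^esub> (E #> c) [^]\<^bsub>G Mod E\<^esub> k)"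
      by blast
  qed (use p in auto)
qed

sublocale ind: induced_characters G CC E p 4 p "\<lambda>i. a [^] i"
  by (rule induced_E)

text \<open>The p-th power removes the factor from c and sends the central factor into
  \<open>E\<close>. What remains is the j-th power of b^p, whose class modulo \<open>E\<close> has
  order p.\<close>

lemma pow_p_E: "(b [^] (j::nat) \<otimes> (c [^] (k::nat) \<otimes> z)) [^] p \<in> E \<longleftrightarrow> p dvd j" if z: "z \<in> center G"
proof -
  have C: "b [^] j \<in> CC" "c [^] k \<in> CC" "z \<in> CC" "c [^] k \<otimes> z \<in> CC"
    using subgroup_pow[OF subCC] b_CC c_CC center_CC[OF z] subgroup.m_closed[OF subCC] by auto
  have zG: "z \<in> carrier G" using z center_carrier by blast
  have "(c [^] k) [^] p = (c [^] p) [^] k" by (simp add: nat_pow_pow mult.commute)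
  then have eq: "(b [^] j \<otimes> (c [^] k \<otimes> z)) [^] p = b [^] (j * p) \<otimes> z [^] p"
    using zG C by (simp add: ind.A_pow_mult nat_pow_pow cp)
  have zp: "z [^] p \<in> E" "z [^] p \<in> carrier G" using center_pow_E[OF z] zG by auto
  have "b [^] (j * p) \<otimes> z [^] p \<in> E \<longleftrightarrow> b [^] (j * p) \<in> E"
  proof
    assume "b [^] (j * p) \<otimes> z [^] p \<in> E"
    then have "(b [^] (j * p) \<otimes> z [^] p) \<otimes> inv (z [^] p) \<in> E"
      using subgroup.m_closed[OF subE _ subgroup.m_inv_closed[OF subE zp(1)]] by blast
    then show "b [^] (j * p) \<in> E" using zp by (simp add: m_assoc)
  qed (use subgroup.m_closed[OF subE _ zp(1)] in blast)
  also have "\<dots> \<longleftrightarrow> p dvd j"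
  proof
    show "b [^] (j * p) \<in> E \<Longrightarrow> p dvd j" using bpow_E[of j] by (simp add: mult.commute)
    assume "p dvd j"
    then obtain i where "j = p * i" by (rule dvdE)
    then have "b [^] (j * p) = ((b [^] p) [^] p) [^] i" by (simp add: nat_pow_pow mult_ac)
    then show "b [^] (j * p) \<in> E" using subgroup_pow[OF subE center_pow_E[OF bp_center]] by simp
  qed
  finally show ?thesis unfolding eq .
qed

lemma pow_p_E_form:
  assumes "x \<in> CC" "x [^] p \<in> E"
  obtains k :: nat and z where "z \<in> center G" "x = c [^] k \<otimes> z" "x [^] p = z [^] p"
proof -
  let ?f = "\<lambda>((j::nat, k::nat), z). b [^] j \<otimes> (c [^] k \<otimes> z)"
  have "x \<in> ?f ` (({..<p} \<times> {..<p}) \<times> center G)"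
    using assms(1) bij_betw_imp_surj_on[OF CC_normal_form] by simp
  then obtain j k z where jkz: "j < p" "z \<in> center G" "x = b [^] (j::nat) \<otimes> (c [^] (k::nat) \<otimes> z)" by auto
  have "j = 0" using assms(2) jkz pow_p_E[OF jkz(2)] by (auto dest: dvd_imp_le)
  then have x: "x = c [^] k \<otimes> z" using jkz(3) center_carrier[OF jkz(2)] by simp
  have "(c [^] k) [^] p = (c [^] p) [^] k" by (simp add: nat_pow_pow mult.commute)
  then have "x [^] p = z [^] p"
    unfolding x using subgroup_pow[OF subCC c_CC] center_CC[OF jkz(2)] center_carrier[OF jkz(2)]
    by (simp add: ind.A_pow_mult cp)
  then show thesis using that x jkz(2) by blast
qed

lemma card_pow_p_E: "card {x \<in> CC. x [^] p \<in> E} = p ^ 3"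
proof -
  let ?f = "\<lambda>((j::nat, k::nat), z). b [^] j \<otimes> (c [^] k \<otimes> z)" and ?S = "({..<p} \<times> {..<p}) \<times> center G"
  let ?T = "({0::nat} \<times> {..<p}) \<times> center G"
  have bij: "inj_on ?f ?S" "?f ` ?S = CC" using CC_normal_form by (auto simp: bij_betw_def)
  have eq: "{x \<in> CC. x [^] p \<in> E} = ?f ` ?T"
  proof
    show "?f ` ?T \<subseteq> {x \<in> CC. x [^] p \<in> E}"
      using pow_p_E[of _ 0] CC_I[of _ 0] by auto
    show "{x \<in> CC. x [^] p \<in> E} \<subseteq> ?f ` ?T"
    proof
      fix x assume x: "x \<in> {x \<in> CC. x [^] p \<in> E}"
      then have "x \<in> ?f ` ?S" unfolding bij(2) by simp
      then obtain j k z where jkz: "j < p" "k < p" "z \<in> center G" "x = b [^] (j::nat) \<otimes> (c [^] (k::nat) \<otimes> z)" by auto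
      then have "j = 0" using x pow_p_E[OF jkz(3)] by (auto dest: dvd_imp_le)
      then show "x \<in> ?f ` ?T" using jkz by (intro image_eqI[of _ _ "((0, k), z)"]) auto
    qed
  qed
  have inj: "inj_on ?f ?T" by (rule inj_on_subset[OF bij(1)]) (use p0 in auto)
  have "card {x \<in> CC. x [^] p \<in> E} = card ?T" unfolding eq by (rule card_image[OF inj])
  then show ?thesis by (simp add: card_cartesian_product card_center power2_eq_square power3_eq_cube)
qed

lemma pow_p2_E: "x \<in> CC \<Longrightarrow> x [^] (p\<^sup>2) = \<one> \<or> x [^] (p\<^sup>2) \<in> E"
proof -
  assume "x \<in> CC"
  then obtain j k z where x: "z \<in> center G" "x = b [^] (j::nat) \<otimes> (c [^] (k::nat) \<otimes> z)" by (elim CC_E) blast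
  have xG: "x \<in> carrier G" using CC_carrier[OF \<open>x \<in> CC\<close>] .
  have C: "b [^] j \<in> CC" "c [^] k \<in> CC" "z \<in> CC" "c [^] k \<otimes> z \<in> CC"
    using subgroup_pow[OF subCC] b_CC c_CC center_CC[OF x(1)] subgroup.m_closed[OF subCC] by auto
  have "(c [^] k) [^] p = (c [^] p) [^] k" by (simp add: nat_pow_pow mult.commute)
  then have "x [^] p = (b [^] p) [^] j \<otimes> z [^] p"
    unfolding x(2) using C center_carrier[OF x(1)] by (simp add: ind.A_pow_mult nat_pow_pow cp mult.commute)
  also have "\<dots> \<in> center G"
    using subgroup.m_closed[OF subgroup_center] subgroup_pow[OF subgroup_center] bp_center x(1) by blast
  finally have "(x [^] p) [^] p \<in> E" by (rule center_pow_E)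
  then show ?thesis using xG by (simp add: nat_pow_pow power2_eq_square)
qed

lemma card_trivial_E:
  "card (ind.trivial_chars E 1) = 1" "card (ind.trivial_chars E p) = p\<^sup>2"
  "card (ind.trivial_chars E (p\<^sup>2)) = p ^ 3" "card (ind.trivial_chars E (p ^ 3)) = p ^ 3"
proof -
  have E1: "\<one> \<in> E" by (rule subgroup.one_closed[OF subE])
  have T: "card (ind.trivial_chars E d) * p = card {x \<in> CC. x [^] d \<in> E}" for d
    using ind.card_trivial_chars[OF ind.N, of d] card_E by simp
  have "{x \<in> CC. x [^] (1::nat) \<in> E} = E" using ind.N CC_carrier by auto
  then show "card (ind.trivial_chars E 1) = 1" using T[of 1] card_E p0 by simp
  show "card (ind.trivial_chars E p) = p\<^sup>2"
    using T[of p] card_pow_p_E p0 by (simp add: power2_eq_square power3_eq_cube)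
  have p2: "x [^] (p\<^sup>2) \<in> E" if "x \<in> CC" for x using pow_p2_E[OF that] E1 by auto
  then have "{x \<in> CC. x [^] (p\<^sup>2) \<in> E} = CC" by blast
  then have "card (ind.trivial_chars E (p\<^sup>2)) * p = p ^ 3 * p" using T[of "p\<^sup>2"] card_CC by (auto simp: numeral_eq_Suc)
  then show "card (ind.trivial_chars E (p\<^sup>2)) = p ^ 3" using p0 by simp
  have "x [^] (p ^ 3) \<in> E" if "x \<in> CC" for x
  proof -
    have "x [^] (p ^ 3) = (x [^] (p\<^sup>2)) [^] p" using CC_carrier[OF that] by (simp add: nat_pow_pow power2_eq_square power3_eq_cube)
    then show ?thesis using subgroup_pow[OF subE p2[OF that]] by simp
  qed
  then have "{x \<in> CC. x [^] (p ^ 3) \<in> E} = CC" by blast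
  then have "card (ind.trivial_chars E (p ^ 3)) * p = p ^ 3 * p" using T[of "p ^ 3"] card_CC by (auto simp: numeral_eq_Suc)
  then show "card (ind.trivial_chars E (p ^ 3)) = p ^ 3" using p0 by simp
qed

lemma pow_p3: "x \<in> CC \<Longrightarrow> x [^] (p ^ 3) = \<one>"
proof -
  assume x: "x \<in> CC"
  have "x [^] (p ^ 3) = (x [^] (p\<^sup>2)) [^] p" using CC_carrier[OF x] by (simp add: nat_pow_pow power2_eq_square power3_eq_cube)
  moreover have "y [^] p = \<one>" if y: "y \<in> E" for y
  proof -
    obtain k :: nat where "y = e [^] k" using y unfolding E_def by blast
    then have "y [^] p = (e [^] p) [^] k" by (simp add: nat_pow_pow mult.commute)
    then show ?thesis using ep by simp
  qed
  ultimately show ?thesis using pow_p2_E[OF x] by auto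
qed

lemma cord_dvd:
  assumes l: "l \<in> ind.X" and d: "\<And>x. x \<in> CC \<Longrightarrow> x [^] (p ^ m) = \<one>"
  obtains j where "ind.cord l = p ^ Suc j" "Suc j \<le> m"
proof -
  obtain j where j: "ind.cord l = p ^ Suc j" using ind.ord_p_power[OF l] by metis
  have lc: "l \<in> chars G CC" using ind.X_chars[OF l] .
  have "l x ^ p ^ m = 1" if "x \<in> CC" for x
    using ind.chars_pow[OF lc that, of "p ^ m"] d[OF that] chars_one[OF lc] by simp
  then have "p ^ Suc j dvd p ^ m" using ind.char_order(3)[OF lc] j by metis
  then have "Suc j \<le> m" by (rule power_dvd_imp_le) (rule p0(2))
  then show thesis using that j by blast
qed

text \<open>The first four summands come from the quotient by \<open>E\<close>; only the characters
  nontrivial on \<open>E\<close> remain to be counted.\<close>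

lemma decomposition_E:
  assumes "\<And>l. l \<in> ind.X \<Longrightarrow> ind.cord l \<in> D" and "\<And>d. d \<in> D \<Longrightarrow> k d = card {l \<in> ind.R. ind.cord l = d}"
  shows "group_algebra G \<cong>\<^sub>\<rat> rat_alg
    \<oplus>\<^sub>\<rat> copies (p + 1) (field_alg (cyclotomic_field p))
    \<oplus>\<^sub>\<rat> copies p (field_alg (cyclotomic_field (p\<^sup>2)))
    \<oplus>\<^sub>\<rat> copies p (mat_alg p (cyclotomic_field p))
    \<oplus>\<^sub>\<rat> alg_sum D (\<lambda>d. copies (k d) (mat_alg p (cyclotomic_field d)))"
proof -
  interpret q: heisenberg_p4 "G Mod E" p "E #> a" "E #> b" "E #> c" by (rule quotient_heisenberg)
  note 1 = alg_iso_trans[OF ind.decomposition_counted[OF assms] alg_prod_cong[OF q.heisenberg_decomposition alg_iso_refl]]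
  note 2 = alg_prod_cong[OF alg_iso_refl alg_prod_assoc]
  note 3 = alg_prod_cong[OF alg_iso_refl alg_iso_trans[OF alg_prod_assoc 2]]
  show ?thesis by (rule alg_iso_trans[OF 1 alg_iso_trans[OF alg_prod_assoc 3]])
qed

text \<open>If \<open>b\<close> has order \<open>p\<^sup>3\<close>, then \<open>E\<close> consists of \<open>p\<^sup>2\<close>-th powers, so a character that is nontrivial
  on \<open>E\<close> has order \<open>p\<^sup>3\<close>.\<close>

theorem decomposition_order_p3:
  assumes "b [^] (p\<^sup>2) \<noteq> \<one>"
  shows "group_algebra G \<cong>\<^sub>\<rat> rat_alg
    \<oplus>\<^sub>\<rat> copies (p + 1) (field_alg (cyclotomic_field p))
    \<oplus>\<^sub>\<rat> copies p (field_alg (cyclotomic_field (p\<^sup>2)))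
    \<oplus>\<^sub>\<rat> copies p (mat_alg p (cyclotomic_field p))
    \<oplus>\<^sub>\<rat> mat_alg p (cyclotomic_field (p ^ 3))"
proof -
  obtain s :: nat where s: "b [^] (p\<^sup>2) = e [^] s" using pow_p2_E[OF b_CC] assms unfolding E_def by auto
  have ps: "\<not> p dvd s"
  proof
    assume "p dvd s"
    then obtain i where "s = p * i" by (rule dvdE)
    then show False using s assms ep by (simp add: nat_pow_pow[symmetric])
  qed
  have trivial: "l e = 1" if l: "l \<in> chars G CC" and d: "\<And>x. x \<in> CC \<Longrightarrow> l x ^ p\<^sup>2 = 1" for l
  proof -
    have "l e ^ s = 1" using ind.chars_pow[OF l b_CC, of "p\<^sup>2"] ind.chars_pow[OF l center_CC[OF e_center], of s] d[OF b_CC] s by simp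
    moreover have "l e ^ p = 1" using ind.chars_pow[OF l center_CC[OF e_center], of p] ep chars_one[OF l] by simp
    moreover have "coprime s p" using p ps by (metis coprime_commute prime_imp_coprime)
    ultimately show ?thesis using coprime_root_of_unity by blast
  qed
  have trivE: "l x = 1" if l: "l \<in> chars G CC" and d: "\<And>x. x \<in> CC \<Longrightarrow> l x ^ p\<^sup>2 = 1" and "x \<in> E" for l x
    using trivial[OF l d] ind.chars_pow[OF l center_CC[OF e_center]] that(3) unfolding E_def by auto
  have T2: "ind.trivial_chars {\<one>} (p\<^sup>2) = ind.trivial_chars E (p\<^sup>2)"
  proof
    show "ind.trivial_chars E (p\<^sup>2) \<subseteq> ind.trivial_chars {\<one>} (p\<^sup>2)"
      unfolding ind.trivial_chars_def using chars_one by auto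
    show "ind.trivial_chars {\<one>} (p\<^sup>2) \<subseteq> ind.trivial_chars E (p\<^sup>2)"
      unfolding ind.trivial_chars_def using trivE by blast
  qed
  have "{x \<in> CC. x [^] (p ^ 3) = \<one>} = CC" using pow_p3 by blast
  then have T3: "card (ind.trivial_chars {\<one>} (p ^ 3)) = p ^ 4" using ind.card_trivial_chars_1[of "p ^ 3"] card_CC by simp
  \<comment> \<open>Exactly p^3 characters have order dividing p^2. The other p^4 - p^3 form a
    single orbit, since an orbit has p * p^2(p-1) elements.\<close>
  have R: "card {l \<in> ind.R. ind.cord l = p ^ Suc 2} = 1"
  proof (rule ind.card_R_eqI)
    have "p * (p\<^sup>2 * (p - 1)) * 1 = p ^ 4 - p ^ 3" by (simp add: numeral_eq_Suc algebra_simps)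
    also have "\<dots> = card {l \<in> ind.X. ind.cord l = p ^ Suc 2}"
      unfolding ind.card_X_order using card_trivial_E T2 T3 by simp
    finally show "p * (p\<^sup>2 * (p - 1)) * 1 = card {l \<in> ind.X. ind.cord l = p ^ Suc 2}" .
  qed (rule p0(1))
  have D: "ind.cord l \<in> {p ^ 3}" if lX: "l \<in> ind.X" for l
  proof -
    obtain j where j: "ind.cord l = p ^ Suc j" "Suc j \<le> 3" using cord_dvd[OF lX pow_p3] by metis
    have lc: "l \<in> chars G CC" using ind.X_chars[OF lX] .
    have "\<not> Suc j \<le> 2"
    proof
      assume "Suc j \<le> 2"
      then have "ind.cord l dvd p\<^sup>2" unfolding j by (rule le_imp_power_dvd)
      then have "\<And>x. x \<in> CC \<Longrightarrow> l x ^ p\<^sup>2 = 1" using ind.char_order(3)[OF lc] by blast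
      moreover obtain x where "x \<in> E" "l x \<noteq> 1" using lX unfolding ind.X_def by blast
      ultimately show False using trivE[OF lc] by blast
    qed
    then have "Suc j = 3" using j(2) by simp
    then show ?thesis using j(1) by simp
  qed
  have R': "1 = card {l \<in> ind.R. ind.cord l = d}" if "d \<in> {p ^ 3}" for d
  proof -
    have "d = p ^ Suc 2" using that by (simp add: numeral_eq_Suc)
    then show ?thesis using R by simp
  qed
  note 1 = decomposition_E[of "{p ^ 3}" "\<lambda>_. 1", OF D R']
  note 2 = alg_iso_trans[OF alg_sum_singleton[of "p ^ 3" "\<lambda>d. copies 1 (mat_alg p (cyclotomic_field d))"] copies_1]
  show ?thesis
    by (rule alg_iso_trans[OF 1 alg_prod_cong[OF alg_iso_refl alg_prod_cong[OF alg_iso_refl alg_prod_cong[OF alg_iso_refl alg_prod_cong[OF alg_iso_refl 2]]]]])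
qed

text \<open>Now the centre has exponent p, so in \<open>CC\<close> a p-th power in \<open>E\<close>
  is already 1. Among the characters nontrivial on \<open>E\<close>, p^3 - p^2 have order p and
  p^2(p-1)^2 have order p^2; with orbits of sizes p(p-1) and p^2(p-1) this yields p and p - 1
  summands. The first p join those coming from the quotient by \<open>E\<close>, which makes
  2p.\<close>

theorem decomposition_order_p2:
  assumes b1: "b [^] (p\<^sup>2) = \<one>"
  shows "group_algebra G \<cong>\<^sub>\<rat> rat_alg
    \<oplus>\<^sub>\<rat> copies (p + 1) (field_alg (cyclotomic_field p))
    \<oplus>\<^sub>\<rat> copies p (field_alg (cyclotomic_field (p\<^sup>2)))
    \<oplus>\<^sub>\<rat> copies (2 * p) (mat_alg p (cyclotomic_field p))
    \<oplus>\<^sub>\<rat> copies (p - 1) (mat_alg p (cyclotomic_field (p\<^sup>2)))"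
proof -
  have zp: "z [^] p = \<one>" if zZ: "z \<in> center G" for z
  proof -
    obtain i j where z: "z = b [^] (p * i) \<otimes> e [^] (j::nat)" by (rule center_form[OF zZ])
    have "b [^] (p * i) \<otimes> e [^] j = e [^] j \<otimes> b [^] (p * i)" by (rule center_comm[OF epow_center, symmetric]) simp
    then have "z [^] p = (b [^] (p * i)) [^] p \<otimes> (e [^] j) [^] p" unfolding z by (intro pow_mult_distrib) auto
    also have "(b [^] (p * i)) [^] p = (b [^] (p\<^sup>2)) [^] i" by (simp add: nat_pow_pow power2_eq_square mult_ac)
    also have "(e [^] j) [^] p = (e [^] p) [^] j" by (simp add: nat_pow_pow mult.commute)
    finally show ?thesis using ep b1 by simp
  qed
  have "x [^] p = \<one>" if "x \<in> CC" "x [^] p \<in> E" for x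
    using pow_p_E_form[OF that] zp by metis
  then have "x \<in> CC \<and> x [^] p = \<one> \<longleftrightarrow> x \<in> CC \<and> x [^] p \<in> E" for x
    using subgroup.one_closed[OF subE] by metis
  then have pE: "{x \<in> CC. x [^] p = \<one>} = {x \<in> CC. x [^] p \<in> E}" by (rule Collect_cong)
  have Tp: "card (ind.trivial_chars {\<one>} p) = p ^ 3" using ind.card_trivial_chars_1[of p] card_pow_p_E pE by simp
  have p2: "x [^] (p\<^sup>2) = \<one>" if xC: "x \<in> CC" for x
  proof -
    obtain j k z where x: "z \<in> center G" "x = b [^] (j::nat) \<otimes> (c [^] (k::nat) \<otimes> z)" using CC_E[OF xC] by metis
    have C: "b [^] j \<in> CC" "c [^] k \<in> CC" "z \<in> CC" "c [^] k \<otimes> z \<in> CC"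
      using subgroup_pow[OF subCC] b_CC c_CC center_CC[OF x(1)] subgroup.m_closed[OF subCC] by auto
    have zG: "z \<in> carrier G" using center_carrier[OF x(1)] .
    have "z [^] (p\<^sup>2) = (z [^] p) [^] p" using zG by (simp add: nat_pow_pow power2_eq_square)
    moreover have "(c [^] k) [^] (p\<^sup>2) = (c [^] p) [^] (p * k)" by (simp add: nat_pow_pow power2_eq_square mult_ac)
    moreover have "(b [^] j) [^] (p\<^sup>2) = (b [^] (p\<^sup>2)) [^] j" by (simp add: nat_pow_pow mult_ac)
    moreover have "x [^] (p\<^sup>2) = (b [^] j) [^] (p\<^sup>2) \<otimes> ((c [^] k) [^] (p\<^sup>2) \<otimes> z [^] (p\<^sup>2))"
      unfolding x(2) using C by (simp only: ind.A_pow_mult)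
    ultimately show ?thesis using b1 cp zp[OF x(1)] by simp
  qed
  then have "{x \<in> CC. x [^] (p\<^sup>2) = \<one>} = CC" by blast
  then have Tp2: "card (ind.trivial_chars {\<one>} (p\<^sup>2)) = p ^ 4" using ind.card_trivial_chars_1[of "p\<^sup>2"] card_CC by simp
  have "{x \<in> CC. x [^] (1::nat) = \<one>} = {\<one>}" using subgroup.one_closed[OF subCC] CC_carrier by auto
  then have T1: "card (ind.trivial_chars {\<one>} 1) = 1" using ind.card_trivial_chars_1[of 1] by simp
  have R1: "card {l \<in> ind.R. ind.cord l = p ^ Suc 0} = p"
  proof (rule ind.card_R_eqI)
    have "p * (p - 1) * p = p ^ 3 - p\<^sup>2" by (simp add: power3_eq_cube power2_eq_square algebra_simps)
    also have "\<dots> = (p ^ 3 - 1) - (p\<^sup>2 - 1)" using p0 by simp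
    finally show "p * (p ^ 0 * (p - 1)) * p = card {l \<in> ind.X. ind.cord l = p ^ Suc 0}"
      unfolding ind.card_X_order using T1 Tp card_trivial_E by simp
  qed (rule p0(1))
  have R2: "card {l \<in> ind.R. ind.cord l = p ^ Suc 1} = p - 1"
  proof (rule ind.card_R_eqI)
    obtain q where q: "p = Suc q" using p0(1) by (metis gr0_implies_Suc)
    have "p * (p ^ 1 * (p - 1)) * (p - 1) = (p ^ 4 - p ^ 3) - (p ^ 3 - p\<^sup>2)"
      unfolding q by (simp add: numeral_eq_Suc algebra_simps)
    then show "p * (p ^ 1 * (p - 1)) * (p - 1) = card {l \<in> ind.X. ind.cord l = p ^ Suc 1}"
      unfolding ind.card_X_order using Tp Tp2 card_trivial_E by (simp add: power2_eq_square)
  qed (rule p0(1))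
  have D: "ind.cord l \<in> {p} \<union> {p\<^sup>2}" if lX: "l \<in> ind.X" for l
  proof -
    obtain j where j: "ind.cord l = p ^ Suc j" "Suc j \<le> 2" using cord_dvd[OF lX p2] by metis
    then have "j = 0 \<or> j = 1" by auto
    then show ?thesis using j(1) by (auto simp: power2_eq_square)
  qed
  define k where "k d = (if d = p then p else p - 1)" for d
  let ?M = "\<lambda>d. copies (k d) (mat_alg p (cyclotomic_field d))"
  have ne: "p\<^sup>2 \<noteq> p" using p0 by (simp add: power2_eq_square)
  then have kk: "k d = card {l \<in> ind.R. ind.cord l = d}" if "d \<in> {p} \<union> {p\<^sup>2}" for d
    using R1 R2 that by (auto simp: k_def power2_eq_square)
  note 1 = decomposition_E[OF D kk]
  have 2: "alg_sum ({p} \<union> {p\<^sup>2}) ?M \<cong>\<^sub>\<rat> copies p (mat_alg p (cyclotomic_field p)) \<oplus>\<^sub>\<rat> copies (p - 1) (mat_alg p (cyclotomic_field (p\<^sup>2)))"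
  proof -
    have "{p} \<inter> {p\<^sup>2} = {}" using ne by auto
    from alg_iso_trans[OF alg_sum_Un[OF this, of ?M] alg_prod_cong[OF alg_sum_singleton alg_sum_singleton]]
    show ?thesis using ne by (simp add: k_def)
  qed
  have 3: "copies p (mat_alg p (cyclotomic_field p)) \<oplus>\<^sub>\<rat> alg_sum ({p} \<union> {p\<^sup>2}) ?M
    \<cong>\<^sub>\<rat> copies (2 * p) (mat_alg p (cyclotomic_field p)) \<oplus>\<^sub>\<rat> copies (p - 1) (mat_alg p (cyclotomic_field (p\<^sup>2)))"
    unfolding mult_2
    by (rule alg_iso_trans[OF alg_prod_cong[OF alg_iso_refl 2] alg_iso_trans[OF alg_prod_assoc_sym alg_prod_cong[OF copies_add alg_iso_refl]]])
  show ?thesis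
    by (rule alg_iso_trans[OF 1 alg_prod_cong[OF alg_iso_refl alg_prod_cong[OF alg_iso_refl alg_prod_cong[OF alg_iso_refl 3]]]])
qed

end

section \<open>Presentations\<close>

context phi3_base
begin

lemma mult_a:
  "(a [^] (i::nat) \<otimes> (b [^] (j::nat) \<otimes> (c [^] (k::nat) \<otimes> e [^] (l::nat)))) \<otimes> a
    = a [^] Suc i \<otimes> (b [^] j \<otimes> (c [^] (j + k) \<otimes> e [^] (k + l)))"
proof -
  have "e [^] l \<otimes> a = a \<otimes> e [^] l" by (rule center_comm[OF epow_center a])
  then have "(a [^] i \<otimes> (b [^] j \<otimes> (c [^] k \<otimes> e [^] l))) \<otimes> a = a [^] i \<otimes> (b [^] j \<otimes> ((c [^] k \<otimes> a) \<otimes> e [^] l))"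
    by (simp add: m_assoc)
  also have "\<dots> = a [^] i \<otimes> ((b [^] j \<otimes> a) \<otimes> (c [^] k \<otimes> (e [^] k \<otimes> e [^] l)))"
    unfolding ck_a by (simp add: m_assoc)
  finally show ?thesis unfolding bj_a by (simp add: m_assoc nat_pow_mult pow_mult_left)
qed

lemma mult_b:
  "(a [^] (i::nat) \<otimes> (b [^] (j::nat) \<otimes> (c [^] (k::nat) \<otimes> e [^] (l::nat)))) \<otimes> b [^] (m::nat)
    = a [^] i \<otimes> (b [^] (j + m) \<otimes> (c [^] k \<otimes> e [^] l))"
proof -
  have "e [^] l \<otimes> b [^] m = b [^] m \<otimes> e [^] l" by (rule center_comm[OF epow_center]) simp
  then have "(a [^] i \<otimes> (b [^] j \<otimes> (c [^] k \<otimes> e [^] l))) \<otimes> b [^] m = a [^] i \<otimes> (b [^] j \<otimes> ((c [^] k \<otimes> b [^] m) \<otimes> e [^] l))"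
    by (simp add: m_assoc)
  then show ?thesis unfolding bc_pow by (simp add: m_assoc pow_mult_left)
qed

lemma mult_c:
  "(a [^] (i::nat) \<otimes> (b [^] (j::nat) \<otimes> (c [^] (k::nat) \<otimes> e [^] (l::nat)))) \<otimes> c
    = a [^] i \<otimes> (b [^] j \<otimes> (c [^] Suc k \<otimes> e [^] l))"
proof -
  have "e [^] l \<otimes> c = c \<otimes> e [^] l" by (rule center_comm[OF epow_center]) simp
  then show ?thesis by (simp add: m_assoc)
qed

text \<open>Collecting \<open>a\<close> to the left: the i-th factor \<open>a\<close> crosses b^(im)
  and leaves c^(im), which explains the sum in the exponent of c. The exponent of \<open>e\<close>
  stays existential, since it matters only that the correction is a power of
  \<open>e\<close>.\<close>

lemma power_ab: "\<exists>s::nat. (a \<otimes> b [^] (m::nat)) [^] n = a [^] n \<otimes> (b [^] (n * m) \<otimes> (c [^] (m * (\<Sum>i<n. i)) \<otimes> e [^] s))"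
proof (induction n)
  case 0
  show ?case by (rule exI[of _ 0]) simp
next
  case (Suc n)
  then obtain s :: nat where s: "(a \<otimes> b [^] m) [^] n = a [^] n \<otimes> (b [^] (n * m) \<otimes> (c [^] (m * (\<Sum>i<n. i)) \<otimes> e [^] s))" by blast
  let ?t = "m * (\<Sum>i<n. i)"
  have "(a \<otimes> b [^] m) [^] Suc n = ((a [^] n \<otimes> (b [^] (n * m) \<otimes> (c [^] ?t \<otimes> e [^] s))) \<otimes> a) \<otimes> b [^] m"
    unfolding nat_pow_Suc s by (simp add: m_assoc)
  also have "\<dots> = a [^] Suc n \<otimes> (b [^] (n * m + m) \<otimes> (c [^] (n * m + ?t) \<otimes> e [^] (?t + s)))"
    unfolding mult_a mult_b ..
  finally show ?case by (intro exI[of _ "?t + s"]) (simp add: algebra_simps)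
qed

end

text \<open>A finite group generated by elements with these relations, of unspecified order. It is
  used for upper bounds on the order and for replacing one generating system by another.\<close>

locale phi3_gen = phi3_base +
  assumes fin: "finite (carrier G)" and generate: "generate G {a, b, c, e} = carrier G"
begin

text \<open>The set of normal forms is stable under right multiplication by each generator; by
  finiteness inverses are positive powers, so it is stable under the whole group.\<close>

lemma normal_form:
  assumes "g \<in> carrier G"
  shows "\<exists>(i::nat) (j::nat) (k::nat) (l::nat). g = a [^] i \<otimes> (b [^] j \<otimes> (c [^] k \<otimes> e [^] l))"
proof -
  define S where "S = {a [^] (i::nat) \<otimes> (b [^] (j::nat) \<otimes> (c [^] (k::nat) \<otimes> e [^] (l::nat))) | i j k l. True}"
  have SI: "a [^] i \<otimes> (b [^] j \<otimes> (c [^] k \<otimes> e [^] l)) \<in> S" for i j k l :: nat unfolding S_def by blast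
  have SG: "x \<in> carrier G" if "x \<in> S" for x using that unfolding S_def by auto
  have step: "x \<otimes> h \<in> S" if x: "x \<in> S" and h: "h \<in> {a, b, c, e}" for x h
  proof -
    obtain i j k l where ijkl: "x = a [^] (i::nat) \<otimes> (b [^] (j::nat) \<otimes> (c [^] (k::nat) \<otimes> e [^] (l::nat)))"
      using x unfolding S_def by blast
    have 1: "x \<otimes> a \<in> S" unfolding ijkl mult_a by (rule SI)
    have 2: "x \<otimes> b \<in> S" using SI[of i "j + 1" k l] mult_b[of i j k l 1] unfolding ijkl by (simp only: nat_pow_eone b)
    have 3: "x \<otimes> c \<in> S" unfolding ijkl mult_c by (rule SI)
    have 4: "x \<otimes> e = a [^] i \<otimes> (b [^] j \<otimes> (c [^] k \<otimes> e [^] Suc l))" unfolding ijkl by (simp add: m_assoc)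
    have 4: "x \<otimes> e \<in> S" unfolding 4 by (rule SI)
    show ?thesis using 1 2 3 4 h by blast
  qed
  have pow: "x \<otimes> h [^] n \<in> S" if x: "x \<in> S" and h: "h \<in> {a, b, c, e}" for x h and n :: nat
  proof (induction n)
    case (Suc n)
    have "h \<in> carrier G" using h by auto
    then have "x \<otimes> h [^] Suc n = (x \<otimes> h [^] n) \<otimes> h" using SG[OF x] by (simp add: m_assoc)
    then show ?case using step[OF Suc h] by simp
  qed (use x SG in simp)
  have "\<forall>x\<in>S. x \<otimes> g \<in> S" if "g \<in> generate G {a, b, c, e}"
    using that
  proof induction
    case one
    show ?case using SG by simp
  next
    case (incl h)
    then show ?case using step by blast
  next
    case (inv h)
    then have "h \<in> carrier G" by auto
    then show ?case using pow inv inv_eq_pow[OF fin] by auto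
  next
    case (eng h1 h2)
    have "h1 \<in> carrier G" "h2 \<in> carrier G" using eng.hyps generate by auto
    then have "x \<otimes> (h1 \<otimes> h2) = (x \<otimes> h1) \<otimes> h2" if "x \<in> S" for x using SG[OF that] by (simp add: m_assoc)
    then show ?case using eng.IH by auto
  qed
  moreover have "\<one> \<in> S" using SI[of 0 0 0 0] by simp
  ultimately have "\<one> \<otimes> g \<in> S" using assms generate by blast
  then show ?thesis using assms unfolding S_def by auto
qed

text \<open>Exponents of \<open>a\<close> and \<open>b\<close> are reduced by moving the surplus
  into powers of \<open>e\<close>. The moduli \<open>q\<close> and \<open>r\<close> are parameters
  so that the same bound can also refute collapsed relations, by taking r = 1 or q = p.\<close>

lemma card_le:
  fixes p q r :: nat
  assumes ap: "a [^] p \<in> range (\<lambda>k::nat. e [^] k)" and bq: "b [^] q \<in> range (\<lambda>k::nat. e [^] k)"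
    and cp: "c [^] p = \<one>" and er: "e [^] r = \<one>" and pos: "p > 0" "q > 0" "r > 0"
  shows "card (carrier G) \<le> p * q * p * r"
proof -
  let ?f = "\<lambda>(i::nat, j::nat, k::nat, l::nat). a [^] i \<otimes> (b [^] j \<otimes> (c [^] k \<otimes> e [^] l))"
  let ?S = "{..<p} \<times> {..<q} \<times> {..<p} \<times> {..<r}"
  obtain s t :: nat where st: "a [^] p = e [^] s" "b [^] q = e [^] t" using ap bq by blast
  have "carrier G \<subseteq> ?f ` ?S"
  proof
    fix g assume "g \<in> carrier G"
    then obtain i j k l where g: "g = a [^] (i::nat) \<otimes> (b [^] (j::nat) \<otimes> (c [^] (k::nat) \<otimes> e [^] (l::nat)))" using normal_form by blast
    let ?m = "s * (i div p) + t * (j div q) + l"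
    have a: "a [^] i = a [^] (i mod p) \<otimes> e [^] (s * (i div p))"
      using pow_mod_split[OF a, of i p] st by (simp add: nat_pow_pow)
    have b: "b [^] j = b [^] (j mod q) \<otimes> e [^] (t * (j div q))"
      using pow_mod_split[OF b, of j q] st by (simp add: nat_pow_pow)
    have c: "c [^] k = c [^] (k mod p)" using pow_mod_split[OF c, of k p] cp by simp
    have e: "e [^] ?m = e [^] (?m mod r)" using pow_mod_split[OF e, of ?m r] er by simp
    have 1: "e [^] m \<otimes> (x \<otimes> w) = x \<otimes> (e [^] m \<otimes> w)" if "x \<in> carrier G" "w \<in> carrier G" for x w and m :: nat
      by (rule center_left[OF epow_center that])
    have "g = a [^] (i mod p) \<otimes> (b [^] (j mod q) \<otimes> (c [^] (k mod p) \<otimes> e [^] ?m))"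
      unfolding g a b c by (simp add: m_assoc 1 nat_pow_mult add.assoc)
    then show "g \<in> ?f ` ?S"
      unfolding e using pos by (intro image_eqI[of _ _ "(i mod p, j mod q, k mod p, ?m mod r)"]) auto
  qed
  then have "card (carrier G) \<le> card (?f ` ?S)" by (intro card_mono) auto
  also have "\<dots> \<le> card ?S" by (rule card_image_le) simp
  finally show ?thesis by (simp add: card_cartesian_product mult_ac)
qed

text \<open>Nontriviality is extracted from the order: if e were 1 or b^p a power of e,
  \<open>card_le\<close> would leave at most p^4 elements.\<close>

lemma phi3_excI:
  assumes p: "prime p" "p > 2" and card: "card (carrier G) = p ^ 5"
    and ap: "a [^] p \<in> range (\<lambda>k::nat. e [^] k)" and bp: "b [^] (p\<^sup>2) \<in> range (\<lambda>k::nat. e [^] k)"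
    and cp: "c [^] p = \<one>" and ep: "e [^] p = \<one>"
  shows "phi3_exc G p a b c e"
proof -
  have p0: "p > 0" "p\<^sup>2 > 0" using p by auto
  have ne: "\<not> p ^ 5 \<le> p ^ 4" using p by (auto dest: power_le_imp_le_exp[rotated])
  have e_ne: "e \<noteq> \<one>"
  proof
    assume "e = \<one>"
    then show False using card_le[OF ap bp cp, of 1] p0 card ne by (auto simp: numeral_eq_Suc mult_ac)
  qed
  have bp_E: "b [^] p \<notin> range (\<lambda>k::nat. e [^] k)"
  proof
    assume "b [^] p \<in> range (\<lambda>k::nat. e [^] k)"
    then show False using card_le[OF ap _ cp ep, of p] p0 card ne by (auto simp: numeral_eq_Suc mult_ac)
  qed
  have bpc: "b [^] p \<in> center G"
  proof (rule centerI)
    fix g assume "g \<in> carrier G"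
    then obtain i j k l where g: "g = a [^] (i::nat) \<otimes> (b [^] (j::nat) \<otimes> (c [^] (k::nat) \<otimes> e [^] (l::nat)))" using normal_form by blast
    have S: "subgroup (centralizer G {b [^] p}) G" by (rule subgroup_centralizer) simp
    have "b [^] p \<otimes> a = a \<otimes> b [^] p" using bj_a[of p] cp by simp
    then have "{a, b, c, e} \<subseteq> centralizer G {b [^] p}"
      using group_commutes_pow[of b b p] bc_pow[of 1 p] center_comm[OF e_center, of "b [^] p"]
      by (simp add: centralizer_def)
    then have "g \<in> centralizer G {b [^] p}"
      unfolding g using subgroup.m_closed[OF S] subgroup_pow[OF S] by simp
    then show "b [^] p \<otimes> g = g \<otimes> b [^] p" by (simp add: centralizer_def)
  qed simp
  interpret phi3 G p a b c e
  proof unfold_locales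
    show "a [^] p \<in> center G" using ap epow_center by auto
    show "\<exists>(i::nat) (j::nat) (k::nat) z. z \<in> center G \<and> g = a [^] i \<otimes> (b [^] j \<otimes> (c [^] k \<otimes> z))"
      if "g \<in> carrier G" for g using normal_form[OF that] epow_center by blast
  qed (use p card e_ne cp ep bpc in auto)
  show ?thesis by unfold_locales (use ap bp_E E_def in auto)
qed

end

section \<open>Reading the presentations in a concrete group\<close>

context group
begin

lemma gcomm_eq_iff:
  assumes "x \<in> carrier G" "y \<in> carrier G" "z \<in> carrier G"
  shows "inv x \<otimes> inv y \<otimes> x \<otimes> y = z \<longleftrightarrow> x \<otimes> y = y \<otimes> (x \<otimes> z)"
proof
  assume "inv x \<otimes> inv y \<otimes> x \<otimes> y = z"
  then show "x \<otimes> y = y \<otimes> (x \<otimes> z)" using assms(1,2) by (auto simp: m_assoc mult_inv_cancel_left)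
next
  assume "x \<otimes> y = y \<otimes> (x \<otimes> z)"
  then show "inv x \<otimes> inv y \<otimes> x \<otimes> y = z" using assms by (simp add: m_assoc mult_inv_cancel_left)
qed

lemma phi3_genI:
  assumes fin: "finite (carrier G)" and G: "a \<in> carrier G" "b \<in> carrier G" "c \<in> carrier G" "e \<in> carrier G"
    and rel: "b \<otimes> a = a \<otimes> (b \<otimes> c)" "c \<otimes> a = a \<otimes> (c \<otimes> e)" "c \<otimes> b = b \<otimes> c"
    and e: "e \<otimes> a = a \<otimes> e" "e \<otimes> b = b \<otimes> e" "e \<otimes> c = c \<otimes> e"
    and gen: "carrier G \<subseteq> generate G {a, b, c, e}"
  shows "phi3_gen G a b c e"
proof -
  have gen': "generate G {a, b, c, e} = carrier G" using gen generate_incl[of "{a, b, c, e}"] G by auto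
  have "{a, b, c, e} \<subseteq> centralizer G {e}" using G e by (simp add: centralizer_def)
  then have "generate G {a, b, c, e} \<subseteq> centralizer G {e}"
    using subgroup_centralizer[of "{e}"] G by (intro generate_subgroup_incl) auto
  then have all: "g \<in> centralizer G {e}" if "g \<in> carrier G" for g using that unfolding gen' by blast
  have "e \<in> center G"
  proof (rule centerI)
    fix g assume "g \<in> carrier G"
    from all[OF this] show "e \<otimes> g = g \<otimes> e" by (simp add: centralizer_def)
  qed (rule G(4))
  then show ?thesis
    by (intro phi3_gen.intro phi3_base.intro phi3_base_axioms.intro phi3_gen_axioms.intro is_group G(1-3) rel fin gen')
qed

lemma satisfies_common_iff:
  "satisfies G x (Phi3_common \<union> R) \<longleftrightarrow> range x \<subseteq> carrier G
    \<and> x Al1 \<otimes> x Al = x Al \<otimes> (x Al1 \<otimes> x Al2) \<and> x Al3 \<otimes> x Al = x Al \<otimes> x Al3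
    \<and> x Al1 \<otimes> x Al2 = x Al2 \<otimes> x Al1 \<and> x Al1 \<otimes> x Al3 = x Al3 \<otimes> x Al1 \<and> x Al2 \<otimes> x Al3 = x Al3 \<otimes> x Al2
    \<and> (\<forall>(s, t) \<in> R. geval G x s = geval G x t)"
proof (cases "range x \<subseteq> carrier G")
  case True
  then have G: "x v \<in> carrier G" for v by auto
  have 1: "inv x u \<otimes> inv x v \<otimes> x u \<otimes> x v = x w \<longleftrightarrow> x u \<otimes> x v = x v \<otimes> (x u \<otimes> x w)" for u v w
    by (rule gcomm_eq_iff[OF G G G])
  have 2: "inv x u \<otimes> inv x v \<otimes> x u \<otimes> x v = \<one> \<longleftrightarrow> x u \<otimes> x v = x v \<otimes> x u" for u v
    using gcomm_eq_iff[OF G[of u] G[of v] one_closed] G by simp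
  show ?thesis
    by (simp only: satisfies_def Phi3_common_def Comm_def ball_Un ball_simps prod.case geval.simps 1 2 simp_thms conj_assoc)
qed (simp add: satisfies_def)

lemma range_gen4: "range x = {x Al, x Al1, x Al2, x Al3}"
proof -
  have "v \<in> {Al, Al1, Al2, Al3}" for v by (cases v) auto
  then have U: "UNIV = {Al, Al1, Al2, Al3}" by blast
  have "x ` {Al, Al1, Al2, Al3} = {x Al, x Al1, x Al2, x Al3}" by (simp only: image_insert image_empty)
  then show ?thesis unfolding U .
qed

text \<open>The commutator \<open>e\<close> and the generator alpha_3 need not coincide, as alpha_3
  = e^r in one family. It suffices that each is a power of the other: then \<open>e\<close> inherits
  centrality from alpha_3 and can replace it as a generator.\<close>

lemma satisfies_phi3_gen:
  assumes fin: "finite (carrier G)" and sat: "satisfies G x (Phi3_common \<union> R)"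
    and e: "e = inv x Al2 \<otimes> inv x Al \<otimes> x Al2 \<otimes> x Al" "e \<in> range (\<lambda>k::nat. x Al3 [^] k)" "x Al3 \<in> range (\<lambda>k::nat. e [^] k)"
    and gen: "generate G (range x) = carrier G"
  shows "phi3_gen G (x Al) (x Al1) (x Al2) e"
proof (rule phi3_genI[OF fin])
  note S = sat[unfolded satisfies_common_iff]
  have G: "x v \<in> carrier G" for v using S by auto
  then show eG: "e \<in> carrier G" unfolding e(1) by simp
  obtain k :: nat where k: "e = x Al3 [^] k" using e(2) by blast
  show "x Al2 \<otimes> x Al = x Al \<otimes> (x Al2 \<otimes> e)" using gcomm_eq_iff[of "x Al2" "x Al" e] e(1) G eG by simp
  have comm: "x Al3 \<otimes> x Al = x Al \<otimes> x Al3" "x Al3 \<otimes> x Al1 = x Al1 \<otimes> x Al3" "x Al3 \<otimes> x Al2 = x Al2 \<otimes> x Al3"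
    using S by metis+
  show "e \<otimes> x Al = x Al \<otimes> e" "e \<otimes> x Al1 = x Al1 \<otimes> e" "e \<otimes> x Al2 = x Al2 \<otimes> e"
    unfolding k by (intro group_commutes_pow comm G)+
  have Sg: "subgroup (generate G {x Al, x Al1, x Al2, e}) G"
    using G eG by (intro generate_is_subgroup) auto
  have "e \<in> generate G {x Al, x Al1, x Al2, e}" by (rule generate.incl) simp
  then have "x Al3 \<in> generate G {x Al, x Al1, x Al2, e}" using e(3) subgroup_pow[OF Sg] by auto
  then have "range x \<subseteq> generate G {x Al, x Al1, x Al2, e}" unfolding range_gen4 by (auto intro: generate.incl)
  then show "carrier G \<subseteq> generate G {x Al, x Al1, x Al2, e}"
    using generate_subgroup_incl[OF _ Sg] gen by blast
qed (use sat[unfolded satisfies_common_iff] in auto)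

lemma satisfies_phi3_gen_Al3:
  assumes fin: "finite (carrier G)" and sat: "satisfies G x (Phi3_common \<union> R)"
    and R: "(Comm (Gen Al2) (Gen Al), Gen Al3) \<in> R" and gen: "generate G (range x) = carrier G"
  shows "phi3_gen G (x Al) (x Al1) (x Al2) (x Al3)"
proof (rule satisfies_phi3_gen[OF fin sat _ _ _ gen])
  have "x Al3 \<in> carrier G" using sat[unfolded satisfies_common_iff] by auto
  then show "x Al3 \<in> range (\<lambda>k::nat. x Al3 [^] k)" "x Al3 \<in> range (\<lambda>k::nat. x Al3 [^] k)"
    by (auto intro: range_eqI[of _ _ 1])
  have "\<forall>(s, t)\<in>R. geval G x s = geval G x t" using sat[unfolded satisfies_common_iff] by blast
  then show "x Al3 = inv x Al2 \<otimes> inv x Al \<otimes> x Al2 \<otimes> x Al" using R by (fastforce simp: Comm_def)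
qed

text \<open>The exponent r is invertible modulo p^n, so taking r-th powers loses nothing.\<close>

lemma mem_powers_coprime:
  assumes "x \<in> carrier G" "x [^] (p ^ n) = \<one>" "coprime r p"
  shows "x \<in> range (\<lambda>k::nat. (x [^] (r::nat)) [^] k)"
proof (cases "p ^ n = 1")
  case True
  then show ?thesis using assms by (auto intro: range_eqI[of _ _ 0])
next
  case False
  have cop: "coprime r (p ^ n)" using assms(3) by simp
  have r0: "r \<noteq> 0"
  proof
    assume "r = 0"
    then show False using cop False by simp
  qed
  obtain u v where uv: "r * u = p ^ n * v + 1" using bezout_nat[OF r0, of "p ^ n"] cop by (metis coprime_imp_gcd_eq_1)
  have "(x [^] r) [^] u = (x [^] (p ^ n)) [^] v \<otimes> x" using assms(1) uv by (simp add: nat_pow_pow)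
  then have "x = (x [^] r) [^] u" using assms by simp
  then show ?thesis by blast
qed

end

text \<open>If every residue were a square, squaring would be a bijection on the residues modulo p,
  yet p - 1 and 1 have the same square.\<close>

lemma nonresidue_exists:
  assumes p: "prime p" "p > 2"
  shows "\<exists>n. 0 < n \<and> \<not> QuadRes (int p) (int n)"
proof (rule ccontr)
  assume "\<not> ?thesis"
  then have all: "QuadRes (int p) (int n)" if "n > 0" for n using that by blast
  let ?f = "\<lambda>y::nat. y\<^sup>2 mod p"
  have "{..<p} \<subseteq> ?f ` {..<p}"
  proof
    fix n assume n: "n \<in> {..<p}"
    \<comment> \<open>\<open>all\<close> speaks of positive numbers only; passing to n + p includes
      the residue 0.\<close>
    obtain y where y: "[y\<^sup>2 = int (n + p)] (mod int p)" using all[of "n + p"] p unfolding QuadRes_def by auto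
    define z where "z = nat (y mod int p)"
    have z: "int z = y mod int p" "z < p" using p unfolding z_def by (auto simp: nat_less_iff)
    have "int (z\<^sup>2 mod p) = y\<^sup>2 mod int p" using z by (simp add: of_nat_mod power_mod)
    also have "\<dots> = int n mod int p" using y by (simp add: cong_def)
    finally have "z\<^sup>2 mod p = n" using n by (metis lessThan_iff mod_less of_nat_eq_iff of_nat_mod)
    then show "n \<in> ?f ` {..<p}" using z by blast
  qed
  then have "card {..<p} \<le> card (?f ` {..<p})" by (intro card_mono) auto
  then have "card (?f ` {..<p}) = card {..<p}" using card_image_le[of "{..<p}" ?f] by simp
  then have inj: "inj_on ?f {..<p}" by (intro eq_card_imp_inj_on) auto
  have eq: "?f (p - 1) = ?f 1"
  proof -
    obtain q where q: "p = q + 2" using p le_Suc_ex[of 2 p] by (metis add.commute less_imp_le)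
    have "(p - 1)\<^sup>2 = q * p + 1" unfolding q by (simp add: power2_eq_square)
    then show ?thesis by (simp only: mod_mult_self3 one_power2)
  qed
  have "p - 1 = 1" by (rule inj_onD[OF inj eq]) (use p in auto)
  then show False using p by simp
qed

lemma least_nonresidue:
  assumes p: "prime p" "p > 2"
  shows "\<not> QuadRes (int p) (int (least_nonresidue p))" "coprime (least_nonresidue p) p"
proof -
  show 1: "\<not> QuadRes (int p) (int (least_nonresidue p))"
    unfolding least_nonresidue_def using LeastI_ex[OF nonresidue_exists[OF p]] by blast
  have "\<not> p dvd least_nonresidue p"
  proof
    assume "p dvd least_nonresidue p"
    then have "[int (least_nonresidue p) = 0] (mod int p)" by (simp add: cong_0_iff)
    then have "[0 = int (least_nonresidue p)] (mod int p)" by (rule cong_sym)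
    then have "[0\<^sup>2 = int (least_nonresidue p)] (mod int p)" by simp
    then show False using 1 unfolding QuadRes_def by blast
  qed
  then show "coprime (least_nonresidue p) p" using p by (metis coprime_commute prime_imp_coprime)
qed

context group
begin

text \<open>The relations mention only e^r. Because the group is a finite p-group and r is prime to
  p, \<open>e\<close> is a power of e^r = alpha_3, and therefore e^p = 1 follows from the relation
  for alpha_3.\<close>

lemma satisfies_311b:
  assumes fin: "finite_p_group p G" and sat: "satisfies G x (Phi3_311b_rels p r)" and r: "coprime r p"
    and gen: "generate G (range x) = carrier G"
  obtains e where "phi3_gen G (x Al) (x Al1) (x Al2) e" "x Al [^] p = \<one>" "x Al2 [^] p = \<one>" "e [^] p = \<one>"
    "x Al3 = e [^] r" "x Al1 [^] (p\<^sup>2) = e [^] r"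
proof -
  define e where "e = inv x Al2 \<otimes> inv x Al \<otimes> x Al2 \<otimes> x Al"
  note S = sat[unfolded Phi3_311b_rels_def satisfies_common_iff]
  have G: "x v \<in> carrier G" for v using S by auto
  have eG: "e \<in> carrier G" unfolding e_def using G by simp
  have rel: "e [^] r = x Al3" "x Al1 [^] (p\<^sup>2) = x Al3" "x Al [^] p = \<one>" "x Al2 [^] p = \<one>" "x Al3 [^] p = \<one>"
    using S by (simp_all add: Comm_def e_def)
  obtain n where n: "Coset.order G = p ^ n" "finite (carrier G)" using fin unfolding finite_p_group_def by blast
  have "e [^] (p ^ n) = \<one>" using pow_order_eq_1[OF eG] n by simp
  then have eR: "e \<in> range (\<lambda>k::nat. x Al3 [^] k)" using mem_powers_coprime[OF eG _ r] rel(1) by simp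
  then obtain k :: nat where "e = x Al3 [^] k" by blast
  then have "e [^] p = (x Al3 [^] p) [^] k" using G by (simp add: nat_pow_pow mult.commute)
  then have "e [^] p = \<one>" using rel by simp
  moreover have "phi3_gen G (x Al) (x Al1) (x Al2) e"
    using rel(1)[symmetric] by (intro satisfies_phi3_gen[OF n(2) sat[unfolded Phi3_311b_rels_def] e_def eR _ gen]) blast
  ultimately show thesis using that rel by simp
qed

lemma satisfies_2:
  assumes fin: "finite (carrier G)" and sat: "satisfies G x (Phi3_221a_rels p) \<or> satisfies G x (Phi3_2111e_rels p)"
    and gen: "generate G (range x) = carrier G"
  shows "phi3_gen G (x Al) (x Al1) (x Al2) (x Al3)" "x Al [^] p \<in> {\<one>, x Al3}" "x Al2 [^] p = \<one>" "x Al3 [^] p = \<one>"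
    "x Al1 [^] (p\<^sup>2) = \<one>"
proof -
  show "phi3_gen G (x Al) (x Al1) (x Al2) (x Al3)"
    using sat satisfies_phi3_gen_Al3[OF fin _ _ gen, of "Phi3_221a_rels p - Phi3_common"]
      satisfies_phi3_gen_Al3[OF fin _ _ gen] unfolding Phi3_221a_rels_def Phi3_2111e_rels_def by blast
  show "x Al [^] p \<in> {\<one>, x Al3}" "x Al2 [^] p = \<one>" "x Al3 [^] p = \<one>" "x Al1 [^] (p\<^sup>2) = \<one>"
    using sat unfolding Phi3_221a_rels_def Phi3_2111e_rels_def satisfies_common_iff by auto
qed

lemma powers_one_self: "x \<in> carrier G \<Longrightarrow> x \<in> range (\<lambda>k::nat. x [^] k)" "\<one> \<in> range (\<lambda>k::nat. x [^] k)"
  by (auto intro: range_eqI[of _ _ 1] range_eqI[of _ _ 0])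

lemma is_Phi3_311b_exc:
  assumes p: "prime p" "p > 2" and r: "coprime r p" and G: "is_Phi3_311b p r G"
  obtains a b c e where "phi3_exc G p a b c e" "b [^] (p\<^sup>2) \<noteq> \<one>"
proof -
  obtain x where x: "presented_among_p_groups p (Phi3_311b_rels p r) G x" "Coset.order G = p ^ 5"
    using G unfolding is_Phi3_311b_def has_presentation_def by blast
  then obtain e where xe: "phi3_gen G (x Al) (x Al1) (x Al2) e" "x Al [^] p = \<one>" "x Al2 [^] p = \<one>" "e [^] p = \<one>"
    "x Al1 [^] (p\<^sup>2) = e [^] r"
    unfolding presented_among_p_groups_def using satisfies_311b[OF _ _ r] by metis
  interpret phi3_gen G "x Al" "x Al1" "x Al2" e by (rule xe(1))
  have exc: "phi3_exc G p (x Al) (x Al1) (x Al2) e"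
  proof (rule phi3_excI[OF p _ _ _ xe(3,4)])
    show "card (carrier G) = p ^ 5" using x(2) by (simp add: Coset.order_def)
    show "x Al [^] p \<in> range (\<lambda>k::nat. e [^] k)" unfolding xe(2) by (rule powers_one_self(2))
    show "x Al1 [^] (p\<^sup>2) \<in> range (\<lambda>k::nat. e [^] k)" unfolding xe(5) by (rule rangeI)
  qed
  interpret phi3_exc G p "x Al" "x Al1" "x Al2" e by (rule exc)
  have "\<not> p dvd r" using r p by (metis coprime_absorb_right not_prime_unit coprime_commute)
  then have "e [^] r \<noteq> \<one>" using epow_eq_1 by blast
  then show thesis using that[OF exc] xe(5) by simp
qed

lemma is_Phi3_2_exc:
  assumes p: "prime p" "p > 2" and G: "is_Phi3_221a p G \<or> is_Phi3_2111e p G"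
  obtains a b c e where "phi3_exc G p a b c e" "b [^] (p\<^sup>2) = \<one>"
proof -
  obtain x where x: "satisfies G x (Phi3_221a_rels p) \<or> satisfies G x (Phi3_2111e_rels p)" "Coset.order G = p ^ 5"
    "finite (carrier G)" "generate G (range x) = carrier G"
    using G unfolding is_Phi3_221a_def is_Phi3_2111e_def has_presentation_def presented_among_p_groups_def finite_p_group_def
    by (elim disjE conjE exE) blast+
  note S = satisfies_2[OF x(3,1,4)]
  interpret phi3_gen G "x Al" "x Al1" "x Al2" "x Al3" by (rule S(1))
  have "phi3_exc G p (x Al) (x Al1) (x Al2) (x Al3)"
  proof (rule phi3_excI[OF p _ _ _ S(3,4)])
    show "card (carrier G) = p ^ 5" using x(2) by (simp add: Coset.order_def)
    show "x Al [^] p \<in> range (\<lambda>k::nat. x Al3 [^] k)" using S(2) powers_one_self[of "x Al3"] by auto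
    show "x Al1 [^] (p\<^sup>2) \<in> range (\<lambda>k::nat. x Al3 [^] k)" unfolding S(5) by (rule powers_one_self(2))
  qed
  then show thesis using that S by simp
qed

end

section \<open>Recognising a group by its presentation\<close>

context group
begin

lemma geval_closed: "range z \<subseteq> carrier G \<Longrightarrow> geval G z t \<in> carrier G"
  by (induction t) auto

lemma geval_subgroup:
  assumes S: "subgroup S G" and z: "range z \<subseteq> S"
  shows "geval (G\<lparr>carrier := S\<rparr>) z t = geval G z t \<and> geval G z t \<in> S"
proof (induction t)
  case (Gen v)
  then show ?case using z by auto
next
  case One
  then show ?case using subgroup.one_closed[OF S] by simp
next
  case (Mul s t)
  then show ?case using subgroup.m_closed[OF S] by simp
next
  case (Inv s)
  then show ?case using subgroup.m_inv_closed[OF S] m_inv_consistent[OF S] by simp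
next
  case (Pow s n)
  then show ?case using subgroup_pow[OF S] by (simp add: nat_pow_consistent[symmetric])
qed

lemma mem_subgroup_coprime:
  assumes S: "subgroup S G" "x [^] (k::nat) \<in> S" and x: "x \<in> carrier G" "x [^] (p ^ n) = \<one>" "coprime k p"
  shows "x \<in> S"
proof -
  obtain j :: nat where j: "(x [^] k) [^] j = x" using mem_powers_coprime[OF x] by (metis rangeE)
  show ?thesis using subgroup_pow[OF S, of j] unfolding j .
qed

lemma generate_supset:
  assumes "T \<subseteq> carrier G" "S \<subseteq> generate G T" "generate G S = carrier G"
  shows "generate G T = carrier G"
  using generate_subgroup_incl[OF assms(2) generate_is_subgroup[OF assms(1)]] assms(3) generate_incl[OF assms(1)]
  by blast

end

lemma geval_DirProd:
  assumes "group G" "group H" and z: "range z \<subseteq> carrier (G \<times>\<times> H)"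
  shows "geval (G \<times>\<times> H) z t = (geval G (\<lambda>v. fst (z v)) t, geval H (\<lambda>v. snd (z v)) t)"
proof -
  interpret G: group G by fact
  interpret H: group H by fact
  have c: "range (\<lambda>v. fst (z v)) \<subseteq> carrier G" "range (\<lambda>v. snd (z v)) \<subseteq> carrier H"
    using z by (auto simp: DirProd_def)
  have pow: "(x, y) [^]\<^bsub>G \<times>\<times> H\<^esub> n = (x [^]\<^bsub>G\<^esub> n, y [^]\<^bsub>H\<^esub> n)" for x y and n :: nat
    by (induction n) (auto simp: DirProd_def nat_pow_def)
  show ?thesis
  proof (induction t)
    case (Inv t)
    then show ?case using inv_DirProd[OF assms(1,2)] G.geval_closed[OF c(1)] H.geval_closed[OF c(2)] by simp
  qed (simp_all add: pow)
qed

text \<open>A pair of assignments generates a subgroup of \<open>G \<times> H\<close>; if no group with these relations is larger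
  than \<open>G\<close>, this subgroup is the graph of a homomorphism.\<close>

lemma presented_if_card_le:
  fixes G :: "('a, 'b) monoid_scheme"
  assumes p: "prime p" and G: "finite_p_group p G" and sat: "satisfies G x R" and gen: "generate G (range x) = carrier G"
    and bound: "\<And>(K :: ('a \<times> nat) monoid) z. finite_p_group p K \<Longrightarrow> satisfies K z R \<Longrightarrow> generate K (range z) = carrier K
      \<Longrightarrow> card (carrier K) \<le> card (carrier G)"
  shows "presented_among_p_groups p R G x"
  unfolding presented_among_p_groups_def
proof (intro conjI allI impI G sat gen)
  fix H :: "nat monoid" and y
  assume H: "finite_p_group p H" and satH: "satisfies H y R"
  obtain n m where nm: "Coset.order G = p ^ n" "Coset.order H = p ^ m" and fin: "finite (carrier G)" "finite (carrier H)"
    and gr: "group G" "group H"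
    using G H unfolding finite_p_group_def by blast
  interpret G: group G by fact
  interpret H: group H by fact
  let ?P = "G \<times>\<times> H" and ?z = "\<lambda>v. (x v, y v)"
  interpret P: group ?P by (rule DirProd_group[OF gr])
  define S where "S = generate ?P (range ?z)"
  let ?K = "?P\<lparr>carrier := S\<rparr>"
  have zc: "range ?z \<subseteq> carrier ?P" using sat satH by (auto simp: satisfies_def DirProd_def)
  have sub: "subgroup S ?P" unfolding S_def by (rule P.generate_is_subgroup[OF zc])
  interpret K: group ?K by (rule P.subgroup_imp_group[OF sub])
  have zS: "range ?z \<subseteq> S" unfolding S_def by (auto intro: generate.incl)
  have SP: "S \<subseteq> carrier ?P" by (rule subgroup.subset[OF sub])
  have finP: "finite (carrier ?P)" using fin by (simp add: DirProd_def)
  have finS: "finite S" by (rule finite_subset[OF SP finP])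
  have "card (rcosets\<^bsub>?P\<^esub> S) * card S = Coset.order ?P" by (rule P.lagrange[OF sub])
  also have "\<dots> = p ^ (n + m)" using nm by (simp add: Coset.order_def DirProd_def card_cartesian_product power_add)
  finally have "card S dvd p ^ (n + m)" by (metis dvd_triv_right)
  then obtain j where "card S = p ^ j" using divides_primepow_nat[OF p] by blast
  then have Kp: "finite_p_group p ?K" using K.is_group finS unfolding finite_p_group_def by (auto simp: Coset.order_def)
  have satK: "satisfies ?K ?z R"
    unfolding satisfies_def
  proof (intro conjI ballI)
    show "range ?z \<subseteq> carrier ?K" using zS by simp
    fix st assume st: "st \<in> R"
    obtain s t where [simp]: "st = (s, t)" by fastforce
    have "geval G x s = geval G x t" "geval H y s = geval H y t" using sat satH st unfolding satisfies_def by auto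
    then have "geval ?P ?z s = geval ?P ?z t" unfolding geval_DirProd[OF gr zc] by simp
    then show "case st of (s, t) \<Rightarrow> geval ?K ?z s = geval ?K ?z t" using P.geval_subgroup[OF sub zS] by simp
  qed
  have genK: "generate ?K (range ?z) = carrier ?K"
    using P.generate_consistent[OF zS sub] by (simp add: S_def)
  \<comment> \<open>The first projection from the generated subgroup is onto \<open>G\<close>, so
    this bound makes it injective; inverting it and projecting to \<open>H\<close> gives the
    required homomorphism.\<close>
  have le: "card S \<le> card (carrier G)" using bound[OF Kp satK genK] by simp
  interpret f: group_hom ?K G fst
  proof (intro group_hom.intro group_hom_axioms.intro K.is_group gr homI)
    show "fst u \<in> carrier G" if "u \<in> carrier ?K" for u using that SP by (auto simp: DirProd_def)
  qed (auto simp: DirProd_def split: prod.splits)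
  have "subgroup (fst ` S) G" using f.img_is_subgroup by simp
  moreover have "range x \<subseteq> fst ` S" using zS by (force simp: image_iff)
  ultimately have "carrier G \<subseteq> fst ` S" using G.generate_subgroup_incl gen by metis
  moreover have "fst ` S \<subseteq> carrier G" using SP by (auto simp: DirProd_def)
  ultimately have im: "fst ` S = carrier G" by blast
  then have "card (fst ` S) = card S" using le card_image_le[OF finS, of fst] by simp
  then have inj: "inj_on fst S" by (rule eq_card_imp_inj_on[OF finS])
  define h where "h g = snd (inv_into S fst g)" for g
  have h: "h (fst u) = snd u" if "u \<in> S" for u using inj that by (simp add: h_def)
  have "h \<in> hom G H"
  proof (rule homI)
    fix g g' assume "g \<in> carrier G" "g' \<in> carrier G"
    then obtain u u' where u: "u \<in> S" "u' \<in> S" "g = fst u" "g' = fst u'" using im by blast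
    have uu: "u \<otimes>\<^bsub>?P\<^esub> u' \<in> S" using subgroup.m_closed[OF sub] u by blast
    show "h g \<in> carrier H" using h[OF u(1)] u SP by (auto simp: DirProd_def)
    have "fst (u \<otimes>\<^bsub>?P\<^esub> u') = g \<otimes>\<^bsub>G\<^esub> g'" "snd (u \<otimes>\<^bsub>?P\<^esub> u') = snd u \<otimes>\<^bsub>H\<^esub> snd u'"
      using u by (auto simp: DirProd_def split: prod.splits)
    then show "h (g \<otimes>\<^bsub>G\<^esub> g') = h g \<otimes>\<^bsub>H\<^esub> h g'" using h[OF uu] h u by simp
  qed
  moreover have "h (x v) = y v" for v using h[of "?z v"] zS by auto
  ultimately show "\<exists>h\<in>hom G H. \<forall>v. h (x v) = y v" by blast
qed

lemma (in group) card_le_311b: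
  assumes p: "prime p" and r: "coprime r p" and fin: "finite_p_group p G" and sat: "satisfies G x (Phi3_311b_rels p r)"
    and gen: "generate G (range x) = carrier G"
  shows "card (carrier G) \<le> p ^ 5"
proof -
  obtain e where xe: "phi3_gen G (x Al) (x Al1) (x Al2) e" "x Al [^] p = \<one>" "x Al2 [^] p = \<one>" "e [^] p = \<one>"
    "x Al1 [^] (p\<^sup>2) = e [^] r"
    using satisfies_311b[OF fin sat r gen] by metis
  interpret phi3_gen G "x Al" "x Al1" "x Al2" e by (rule xe(1))
  have "card (carrier G) \<le> p * p\<^sup>2 * p * p"
  proof (rule card_le[OF _ _ xe(3,4)])
    show "x Al [^] p \<in> range (\<lambda>k::nat. e [^] k)" unfolding xe(2) by (rule powers_one_self(2))
    show "x Al1 [^] (p\<^sup>2) \<in> range (\<lambda>k::nat. e [^] k)" unfolding xe(5) by (rule rangeI)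
  qed (use prime_gt_0_nat[OF p] in auto)
  then show ?thesis by (simp add: numeral_eq_Suc mult_ac)
qed

lemma (in group) card_le_2:
  assumes p: "prime p" and fin: "finite_p_group p G"
    and sat: "satisfies G x (Phi3_221a_rels p) \<or> satisfies G x (Phi3_2111e_rels p)"
    and gen: "generate G (range x) = carrier G"
  shows "card (carrier G) \<le> p ^ 5"
proof -
  have f: "finite (carrier G)" using fin unfolding finite_p_group_def by blast
  note S = satisfies_2[OF f sat gen]
  interpret phi3_gen G "x Al" "x Al1" "x Al2" "x Al3" by (rule S(1))
  have "card (carrier G) \<le> p * p\<^sup>2 * p * p"
  proof (rule card_le[OF _ _ S(3,4)])
    show "x Al [^] p \<in> range (\<lambda>k::nat. x Al3 [^] k)" using S(2) powers_one_self[of "x Al3"] by auto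
    show "x Al1 [^] (p\<^sup>2) \<in> range (\<lambda>k::nat. x Al3 [^] k)" unfolding S(5) by (rule powers_one_self(2))
  qed (use prime_gt_0_nat[OF p] in auto)
  then show ?thesis by (simp add: numeral_eq_Suc mult_ac)
qed

context phi3_gen
begin

text \<open>The value at alpha_3 is kept free because it is \<open>e\<close> in two of the
  presentations and e^r in the third.\<close>

definition assign :: "'a \<Rightarrow> gen4 \<Rightarrow> 'a" where
  "assign w v = (case v of Al \<Rightarrow> a | Al1 \<Rightarrow> b | Al2 \<Rightarrow> c | Al3 \<Rightarrow> w)"

lemma assign_simps [simp]: "assign w Al = a" "assign w Al1 = b" "assign w Al2 = c" "assign w Al3 = w"
  by (simp_all add: assign_def)

lemma generate_assign: "w \<in> carrier G \<Longrightarrow> generate G (range (assign w)) = carrier G"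
proof (rule generate_supset[OF _ _ generate])
  assume w: "w \<in> carrier G"
  show sub: "range (assign w) \<subseteq> carrier G" unfolding range_gen4 using w by simp
  have S: "subgroup (generate G (range (assign w))) G" by (rule generate_is_subgroup[OF sub])
  have i: "a \<in> generate G (range (assign w))" "b \<in> generate G (range (assign w))" "c \<in> generate G (range (assign w))"
    unfolding range_gen4 by (auto intro: generate.incl)
  have "e = inv c \<otimes> inv a \<otimes> c \<otimes> a" using gcomm_eq_iff[of c a e] ca by simp
  then have "e \<in> generate G (range (assign w))"
    using subgroup.m_closed[OF S] subgroup.m_inv_closed[OF S] i by simp
  then show "{a, b, c, e} \<subseteq> generate G (range (assign w))" using i by blast
qed

lemma assign_common:
  assumes w: "w \<in> center G"
  shows "satisfies G (assign w) (Phi3_common \<union> R) \<longleftrightarrow> (\<forall>(s, t) \<in> R. geval G (assign w) s = geval G (assign w) t)"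
proof -
  have "range (assign w) \<subseteq> carrier G" unfolding range_gen4 using center_carrier[OF w] by simp
  moreover have "w \<otimes> a = a \<otimes> w" "b \<otimes> w = w \<otimes> b" "c \<otimes> w = w \<otimes> c" using center_comm[OF w] by simp_all
  ultimately show ?thesis unfolding satisfies_common_iff assign_simps by (simp add: ba cb)
qed

lemma e_comm: "inv c \<otimes> inv a \<otimes> c \<otimes> a = e"
  using gcomm_eq_iff[of c a e] ca by simp

context
  fixes p :: nat
  assumes p: "prime p" and card_p5: "card (carrier G) = p ^ 5" and cp: "c [^] p = \<one>" and ep: "e [^] p = \<one>"
begin

lemma p_group: "finite_p_group p G" "Coset.order G = p ^ 5"
  using fin card_p5 is_group by (auto simp: finite_p_group_def Coset.order_def)

lemma is_311bI:
  assumes "a [^] p = \<one>" "b [^] (p\<^sup>2) = e [^] r" "coprime r p"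
  shows "is_Phi3_311b p r G"
proof -
  have "(e [^] r) [^] p = (e [^] p) [^] r" by (simp add: nat_pow_pow mult.commute)
  then have "satisfies G (assign (e [^] r)) (Phi3_311b_rels p r)"
    unfolding Phi3_311b_rels_def assign_common[OF epow_center] using assms cp ep by (simp add: Comm_def e_comm)
  moreover have "e [^] r \<in> carrier G" by simp
  ultimately have "presented_among_p_groups p (Phi3_311b_rels p r) G (assign (e [^] r))"
    using group.card_le_311b[OF _ p assms(3)] card_p5
    by (intro presented_if_card_le p p_group generate_assign) (auto simp: finite_p_group_def)
  then show ?thesis unfolding is_Phi3_311b_def has_presentation_def using p_group by blast
qed

lemma is_221aI:
  assumes "a [^] p = e" "b [^] (p\<^sup>2) = \<one>"
  shows "is_Phi3_221a p G"
proof -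
  have "satisfies G (assign e) (Phi3_221a_rels p)"
    unfolding Phi3_221a_rels_def assign_common[OF e_center] using assms cp ep by (simp add: Comm_def e_comm)
  then have "presented_among_p_groups p (Phi3_221a_rels p) G (assign e)"
    using group.card_le_2[OF _ p] card_p5
    by (intro presented_if_card_le p p_group generate_assign) (auto simp: finite_p_group_def)
  then show ?thesis unfolding is_Phi3_221a_def has_presentation_def using p_group by blast
qed

lemma is_2111eI:
  assumes "a [^] p = \<one>" "b [^] (p\<^sup>2) = \<one>"
  shows "is_Phi3_2111e p G"
proof -
  have "satisfies G (assign e) (Phi3_2111e_rels p)"
    unfolding Phi3_2111e_rels_def assign_common[OF e_center] using assms cp ep by (simp add: Comm_def e_comm)
  then have "presented_among_p_groups p (Phi3_2111e_rels p) G (assign e)"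
    using group.card_le_2[OF _ p] card_p5
    by (intro presented_if_card_le p p_group generate_assign) (auto simp: finite_p_group_def)
  then show ?thesis unfolding is_Phi3_2111e_def has_presentation_def using p_group by blast
qed

end

end

text \<open>For a nonresidue s, Euler's criterion makes s times the least nonresidue v a square y^2.
  With w an inverse of v modulo p, this rewrites s as v (y w)^2.\<close>

lemma square_class:
  fixes s :: nat
  assumes p: "prime p" "p > 2" and s: "\<not> p dvd s"
  shows "\<exists>r\<in>{1, least_nonresidue p}. \<exists>t::nat. [r * t\<^sup>2 = s] (mod p)"
proof -
  have root: "\<exists>t::nat. [t\<^sup>2 = n] (mod p)" if "QuadRes (int p) (int n)" for n
  proof -
    obtain y where y: "[y\<^sup>2 = int n] (mod int p)" using \<open>QuadRes (int p) (int n)\<close> unfolding QuadRes_def by blast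
    have "[(\<bar>y\<bar>)\<^sup>2 = int n] (mod int p)" using y by simp
    then have "[int ((nat \<bar>y\<bar>)\<^sup>2) = int n] (mod int p)" by simp
    then show ?thesis by (metis cong_int_iff)
  qed
  show ?thesis
  proof (cases "QuadRes (int p) (int s)")
    case True
    then show ?thesis using root by auto
  next
    case False
    let ?v = "least_nonresidue p" and ?k = "(p - 1) div 2"
    note v = least_nonresidue[OF p]
    have nd: "\<not> p dvd ?v" using v(2) p by (metis coprime_absorb_right not_prime_unit coprime_commute)
    have L: "Legendre (int n) (int p) = -1" if "\<not> QuadRes (int p) (int n)" "\<not> p dvd n" for n
      using that by (simp add: Legendre_def cong_0_iff)
    have E: "[Legendre (int n) (int p) = int n ^ ?k] (mod int p)" for n
      using euler_criterion[of p "int n"] p by simp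
    have "[int s ^ ?k * int ?v ^ ?k = (-1) * (-1)] (mod int p)"
      using cong_mult[OF cong_sym[OF E[of s]] cong_sym[OF E[of ?v]]] unfolding L[OF False s] L[OF v(1) nd] .
    moreover have "int (s * ?v) ^ ?k = int s ^ ?k * int ?v ^ ?k" by (simp add: power_mult_distrib)
    ultimately have "[Legendre (int (s * ?v)) (int p) = 1] (mod int p)"
      using cong_trans[OF E[of "s * ?v"]] by simp
    moreover have "\<not> [0 = 1] (mod int p)" "\<not> [-1 = 1] (mod int p)"
      using p by (auto simp: cong_iff_dvd_diff zdvd_not_zless dest: zdvd_imp_le)
    ultimately have "QuadRes (int p) (int (s * ?v))"
      unfolding Legendre_def by (metis (full_types))
    then obtain y :: nat where y: "[y\<^sup>2 = s * ?v] (mod p)" using root by blast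
    obtain w where w: "[?v * w = 1] (mod p)" using cong_solve_coprime_nat[of ?v p] v(2) by auto
    have "[?v * (y * w)\<^sup>2 = ?v * (s * ?v * w\<^sup>2)] (mod p)"
      unfolding power_mult_distrib using y by (intro cong_mult cong_refl) auto
    also have "?v * (s * ?v * w\<^sup>2) = s * ((?v * w) * (?v * w))" by (simp add: power2_eq_square mult_ac)
    also have "[\<dots> = s * (1 * 1)] (mod p)" using w by (intro cong_mult cong_refl) auto
    finally have "[?v * (y * w)\<^sup>2 = s] (mod p)" by simp
    then show ?thesis by blast
  qed
qed

section \<open>Change of generators in the exceptional case\<close>

context phi3_bp
begin

lemma phi3_gen: "phi3_gen G a b c e"
proof (intro phi3_gen.intro phi3_gen_axioms.intro phi3_base_axioms finite_G)
  have abce: "{a, b, c, e} \<subseteq> carrier G" by simp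
  have S: "subgroup (generate G {a, b, c, e}) G" by (rule generate_is_subgroup[OF abce])
  have i: "a \<in> generate G {a, b, c, e}" "b \<in> generate G {a, b, c, e}" "c \<in> generate G {a, b, c, e}" "e \<in> generate G {a, b, c, e}"
    by (auto intro: generate.incl)
  have "g \<in> generate G {a, b, c, e}" if "g \<in> carrier G" for g
    using gen4[OF that] subgroup.m_closed[OF S] subgroup_pow[OF S] i by auto
  then show "generate G {a, b, c, e} = carrier G" using generate_incl[OF abce] by blast
qed

text \<open>Multiplying \<open>a\<close> by a power of \<open>b\<close> moves \<open>a\<^sup>p\<close> into \<open>E\<close>.\<close>

lemma phi3_exc: "\<exists>a'. phi3_exc G p a' b c e"
proof -
  interpret phi3_gen G a b c e by (rule phi3_gen)
  obtain i j where ij: "a [^] p = b [^] (p * i) \<otimes> e [^] (j::nat)" by (rule center_form[OF ap_center])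
  \<comment> \<open>Congruent to -i modulo p: the total exponent p * i + p * m is p * p * i, and
    b^(p * p) is the p-th power of a central element, hence in \<open>E\<close>.\<close>
  define m where "m = (p - 1) * i"
  let ?a = "a \<otimes> b [^] m"
  obtain s :: nat where s: "?a [^] p = a [^] p \<otimes> (b [^] (p * m) \<otimes> (c [^] (m * (\<Sum>i<p. i)) \<otimes> e [^] s))"
    using power_ab by blast
  have double: "2 * (\<Sum>i<n. i) = n * (n - 1)" for n :: nat
  proof (induction n)
    case (Suc n)
    then show ?case by (cases n) auto
  qed simp
  \<comment> \<open>Oddness makes the sum 0 + ... + (p-1) divisible by p, so the power of c produced
    by \<open>power_ab\<close> vanishes.\<close>
  have "odd p" using p p2 prime_odd_nat by auto
  then have "coprime p 2" by simp
  moreover have "p dvd 2 * (\<Sum>i<p. i)" unfolding double by simp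
  ultimately have "p dvd (\<Sum>i<p. i)" by (simp only: coprime_dvd_mult_right_iff)
  then obtain l where l: "(\<Sum>i<p. i) = p * l" by (rule dvdE)
  have c1: "c [^] (m * (\<Sum>i<p. i)) = \<one>"
    unfolding l using cp by (simp add: nat_pow_pow[symmetric] mult.left_commute[of m p])
  have "p * i + p * m = p * p * i" unfolding m_def using p0 by (cases p) (auto simp: algebra_simps)
  then have bb: "b [^] (p * i) \<otimes> b [^] (p * m) = ((b [^] p) [^] p) [^] i" by (simp add: nat_pow_mult nat_pow_pow)
  have "e [^] j \<otimes> (b [^] (p * m) \<otimes> e [^] s) = b [^] (p * m) \<otimes> (e [^] j \<otimes> e [^] s)"
    by (rule center_left[OF epow_center]) auto
  then have "?a [^] p = (b [^] (p * i) \<otimes> b [^] (p * m)) \<otimes> (e [^] j \<otimes> e [^] s)"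
    unfolding s c1 ij by (simp add: m_assoc)
  also have "\<dots> \<in> E"
    unfolding bb using subgroup.m_closed[OF subE] subgroup_pow[OF subE] center_pow_E[OF bp_center] by (simp add: E_def nat_pow_mult)
  finally have aE: "?a [^] p \<in> E" .
  have gen: "phi3_gen G ?a b c e"
  proof (rule phi3_genI[OF finite_G])
    have "b \<otimes> ?a = a \<otimes> ((b \<otimes> c) \<otimes> b [^] m)" by (simp add: m_assoc[symmetric] ba)
    also have "(b \<otimes> c) \<otimes> b [^] m = b [^] m \<otimes> (b \<otimes> c)"
      using CC_comm[OF subgroup.m_closed[OF subCC b_CC c_CC] subgroup_pow[OF subCC b_CC]] .
    finally show "b \<otimes> ?a = ?a \<otimes> (b \<otimes> c)" by (simp add: m_assoc)
    have "c \<otimes> ?a = a \<otimes> ((c \<otimes> e) \<otimes> b [^] m)" by (simp add: m_assoc[symmetric] ca)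
    also have "(c \<otimes> e) \<otimes> b [^] m = b [^] m \<otimes> (c \<otimes> e)"
      using CC_comm[OF subgroup.m_closed[OF subCC c_CC center_CC[OF e_center]] subgroup_pow[OF subCC b_CC]] .
    finally show "c \<otimes> ?a = ?a \<otimes> (c \<otimes> e)" by (simp add: m_assoc)
    have sub: "{?a, b, c, e} \<subseteq> carrier G" by simp
    have S: "subgroup (generate G {?a, b, c, e}) G" by (rule generate_is_subgroup[OF sub])
    have i: "?a \<in> generate G {?a, b, c, e}" "b \<in> generate G {?a, b, c, e}" "c \<in> generate G {?a, b, c, e}" "e \<in> generate G {?a, b, c, e}"
      by (auto intro: generate.incl)
    have eq: "?a \<otimes> inv (b [^] m) = a" by (simp add: m_assoc)
    have "a \<in> generate G {?a, b, c, e}"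
      using subgroup.m_closed[OF S i(1) subgroup.m_inv_closed[OF S subgroup_pow[OF S i(2), of m]]] unfolding eq .
    then show "carrier G \<subseteq> generate G {?a, b, c, e}" using generate_supset[OF sub _ generate] i by blast
  qed (use cb center_comm[OF e_center] in auto)
  have "b [^] (p\<^sup>2) \<in> E" using center_pow_E[OF bp_center] by (simp add: nat_pow_pow power2_eq_square)
  then have "phi3_exc G p ?a b c e"
    using aE phi3_gen.phi3_excI[OF gen p p2 card_G _ _ cp ep] unfolding E_def by blast
  then show ?thesis by blast
qed

end

context phi3_exc
begin

text \<open>Write a^p = e^u. If p divides u then a^p = 1, which is the second form. Otherwise
  replacing b, c, e by their u-th powers keeps all relations and turns a^p into the new
  \<open>e\<close>, which is the first form.\<close>

lemma is_special_order_p2: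
  assumes b1: "b [^] (p\<^sup>2) = \<one>"
  shows "is_Phi3_221a p G \<or> is_Phi3_2111e p G"
proof -
  interpret phi3_gen G a b c e by (rule phi3_gen)
  obtain u :: nat where u: "a [^] p = e [^] u" using ap_E unfolding E_def by blast
  show ?thesis
  proof (cases "p dvd u")
    case True
    then have "a [^] p = \<one>" unfolding u using ep by (auto elim!: dvdE simp: nat_pow_pow[symmetric])
    then show ?thesis using is_2111eI[OF p card_G cp ep _ b1] by blast
  next
    case False
    then have cop: "coprime u p" using p by (metis coprime_commute prime_imp_coprime)
    have gen: "phi3_gen G a (b [^] u) (c [^] u) (e [^] u)"
    proof (rule phi3_genI[OF finite_G])
      let ?T = "{a, b [^] u, c [^] u, e [^] u}"
      have sub: "?T \<subseteq> carrier G" by simp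
      have S: "subgroup (generate G ?T) G" by (rule generate_is_subgroup[OF sub])
      have i: "a \<in> generate G ?T" "b [^] u \<in> generate G ?T" "c [^] u \<in> generate G ?T" "e [^] u \<in> generate G ?T"
        by (auto intro: generate.incl)
      from mem_subgroup_coprime[OF S i(2), of p 2] mem_subgroup_coprime[OF S i(3), of p 1] mem_subgroup_coprime[OF S i(4), of p 1]
      have "{a, b, c, e} \<subseteq> generate G ?T" using i(1) b1 cp ep cop by simp
      then show "carrier G \<subseteq> generate G ?T" using generate_supset[OF sub _ generate] by blast
      show "b [^] u \<otimes> a = a \<otimes> (b [^] u \<otimes> c [^] u)" by (rule bj_a)
      show "c [^] u \<otimes> a = a \<otimes> (c [^] u \<otimes> e [^] u)" by (rule ck_a)
      show "c [^] u \<otimes> b [^] u = b [^] u \<otimes> c [^] u" by (rule bc_pow)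
    qed (use center_comm[OF epow_center] in auto)
    have pw: "(x [^] u) [^] n = \<one>" if "x \<in> carrier G" "x [^] n = \<one>" for x and n :: nat
    proof -
      have "(x [^] u) [^] n = (x [^] n) [^] u" using that(1) by (simp add: nat_pow_pow mult.commute)
      then show ?thesis using that(2) by simp
    qed
    have "is_Phi3_221a p G"
      by (rule phi3_gen.is_221aI[OF gen p card_G pw[OF c cp] pw[OF e ep] u pw[OF b b1]])
    then show ?thesis by blast
  qed
qed

text \<open>Two changes are made. Multiplying \<open>a\<close> by a central power of b^p removes
  a^p, since the p-th powers of these central elements now fill \<open>E\<close>. Replacing
  \<open>a\<close> by its t-th power turns \<open>e\<close> into e^(t*t), so the exponent s in
  b^(p^2) = e^s matters only up to squares, which leaves r = 1 and the least nonresidue.\<close>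

lemma is_special_order_p3:
  assumes b1: "b [^] (p\<^sup>2) \<noteq> \<one>"
  shows "\<exists>r\<in>{1, least_nonresidue p}. is_Phi3_311b p r G"
proof -
  interpret phi3_gen G a b c e by (rule phi3_gen)
  have epm: "e [^] (x::nat) = e [^] (y::nat)" if "[x = y] (mod p)" for x y
    using pow_mod_split[OF e, of x p] pow_mod_split[OF e, of y p] ep that by (simp add: cong_def)
  obtain u :: nat where u: "a [^] p = e [^] u" using ap_E unfolding E_def by blast
  have "b [^] (p\<^sup>2) \<in> E" using center_pow_E[OF bp_center] by (simp add: nat_pow_pow power2_eq_square)
  then obtain s :: nat where s: "b [^] (p\<^sup>2) = e [^] s" unfolding E_def by blast
  have ps: "\<not> p dvd s"
  proof
    assume "p dvd s"
    then show False using b1 ep unfolding s by (auto elim!: dvdE simp: nat_pow_pow[symmetric])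
  qed
  then have "coprime s p" using p by (metis coprime_commute prime_imp_coprime)
  then obtain w where w: "[s * w = 1] (mod p)" using cong_solve_coprime_nat[of s p] by auto
  \<comment> \<open>This solves u + s m = 0 modulo p, with w the inverse of s, and makes the p-th
    power of the new \<open>a\<close> trivial.\<close>
  define m where "m = w * ((p - 1) * u)"
  have "[u + (s * w) * ((p - 1) * u) = u + 1 * ((p - 1) * u)] (mod p)"
    using w by (intro cong_add cong_mult cong_refl)
  moreover have "u + 1 * ((p - 1) * u) = p * u" using p0 by (cases p) auto
  ultimately have um: "[u + s * m = 0] (mod p)" unfolding m_def by (simp add: cong_0_iff cong_dvd_iff mult.assoc)
  obtain r t where r: "r \<in> {1, least_nonresidue p}" and rt: "[r * t\<^sup>2 = s] (mod p)" using square_class[OF p p2 ps] by blast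
  have pt: "\<not> p dvd t"
  proof
    assume "p dvd t"
    then have "p dvd r * t\<^sup>2" by (simp add: power2_eq_square)
    then show False using ps rt cong_dvd_iff by blast
  qed
  then have cop: "coprime t p" using p by (metis coprime_commute prime_imp_coprime)
  have copr: "coprime r p" using r least_nonresidue(2)[OF p p2] by auto
  let ?z = "b [^] (p * m)" and ?a = "a \<otimes> b [^] (p * m)"
  have z: "?z \<in> center G" using subgroup_pow[OF subgroup_center bp_center, of m] by (simp add: nat_pow_pow)
  have ap: "?a [^] p = \<one>"
  proof -
    have "?a [^] p = a [^] p \<otimes> ?z [^] p" using center_comm[OF z, of a] by (intro pow_mult_distrib) auto
    also have "?z [^] p = (b [^] (p\<^sup>2)) [^] m" by (simp add: nat_pow_pow power2_eq_square mult_ac)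
    finally have "?a [^] p = e [^] (u + s * m)" unfolding u s by (simp add: nat_pow_pow nat_pow_mult)
    also have "\<dots> = e [^] (0::nat)" by (rule epm[OF um])
    finally show ?thesis by simp
  qed
  obtain n :: nat where n: "b \<otimes> a [^] t = a [^] t \<otimes> (b \<otimes> (c [^] t \<otimes> e [^] n))" using b_ai by blast
  \<comment> \<open>\<open>?c2\<close> is the commutator of b with the new \<open>a\<close>, where n
    comes from \<open>b_ai\<close>, and \<open>?e2\<close> is the commutator of \<open>?c2\<close>
    with it. The central factor of \<open>?a\<close> does not affect either commutator.\<close>
  let ?a2 = "?a [^] t" and ?c2 = "c [^] t \<otimes> e [^] n" and ?e2 = "e [^] (t * t)"
  have a2: "?a2 = a [^] t \<otimes> ?z [^] t" using center_comm[OF z, of a] by (intro pow_mult_distrib) auto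
  have zt: "?z [^] t \<in> center G" by (rule subgroup_pow[OF subgroup_center z])
  have c2a: "?c2 \<otimes> a [^] t = a [^] t \<otimes> (?c2 \<otimes> ?e2)"
  proof -
    have *: "c [^] k \<otimes> a [^] t = a [^] t \<otimes> (c [^] k \<otimes> e [^] (t * k))" for k :: nat
    proof (induction k)
      case (Suc k)
      have "c [^] Suc k \<otimes> a [^] t = c [^] k \<otimes> (c \<otimes> a [^] t)" by (simp add: m_assoc)
      also have "\<dots> = (c [^] k \<otimes> a [^] t) \<otimes> (c \<otimes> e [^] t)" unfolding c_ai by (simp add: m_assoc)
      also have "\<dots> = a [^] t \<otimes> (c [^] k \<otimes> (e [^] (t * k) \<otimes> (c \<otimes> e [^] t)))" unfolding Suc.IH by (simp add: m_assoc)
      also have "e [^] (t * k) \<otimes> (c \<otimes> e [^] t) = c \<otimes> (e [^] (t * k) \<otimes> e [^] t)"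
        by (rule center_left[OF epow_center]) auto
      finally show ?case by (simp add: m_assoc nat_pow_mult add.commute)
    qed simp
    have "?c2 \<otimes> a [^] t = c [^] t \<otimes> (e [^] n \<otimes> a [^] t)" by (simp add: m_assoc)
    also have "e [^] n \<otimes> a [^] t = a [^] t \<otimes> e [^] n" by (rule center_comm[OF epow_center]) simp
    also have "c [^] t \<otimes> (a [^] t \<otimes> e [^] n) = a [^] t \<otimes> (c [^] t \<otimes> (?e2 \<otimes> e [^] n))"
      by (simp add: m_assoc[symmetric] *)
    also have "?e2 \<otimes> e [^] n = e [^] n \<otimes> ?e2" by (rule center_comm[OF epow_center]) simp
    finally show ?thesis by (simp add: m_assoc)
  qed
  have shift: "x \<otimes> ?a2 = ?a2 \<otimes> (x \<otimes> y)" if "x \<otimes> a [^] t = a [^] t \<otimes> (x \<otimes> y)" "x \<in> carrier G" "y \<in> carrier G" for x y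
  proof -
    have "x \<otimes> ?a2 = (x \<otimes> a [^] t) \<otimes> ?z [^] t" unfolding a2 using that(2) by (simp add: m_assoc)
    also have "\<dots> = a [^] t \<otimes> ((x \<otimes> y) \<otimes> ?z [^] t)" unfolding that(1) using that by (simp add: m_assoc)
    also have "(x \<otimes> y) \<otimes> ?z [^] t = ?z [^] t \<otimes> (x \<otimes> y)" using center_comm[OF zt, of "x \<otimes> y"] that by simp
    finally show ?thesis unfolding a2 using that by (simp add: m_assoc)
  qed
  have gen: "phi3_gen G ?a2 b ?c2 ?e2"
  proof (rule phi3_genI[OF finite_G])
    let ?T = "{?a2, b, ?c2, ?e2}"
    have sub: "?T \<subseteq> carrier G" by simp
    have S: "subgroup (generate G ?T) G" by (rule generate_is_subgroup[OF sub])
    have i: "?a2 \<in> generate G ?T" "b \<in> generate G ?T" "?c2 \<in> generate G ?T" "?e2 \<in> generate G ?T"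
      by (auto intro: generate.incl)
    have root: "x \<in> generate G ?T" if "x [^] k \<in> generate G ?T" "x \<in> carrier G" "x [^] p = \<one>" "coprime k p" for x and k :: nat
      using mem_subgroup_coprime[OF S that(1,2) _ that(4), of 1] that(3) by simp
    have e: "e \<in> generate G ?T" by (rule root[OF i(4)]) (use ep cop in auto)
    have eq: "?c2 \<otimes> inv (e [^] n) = c [^] t" by (simp add: m_assoc)
    have "c [^] t \<in> generate G ?T"
      using subgroup.m_closed[OF S i(3) subgroup.m_inv_closed[OF S subgroup_pow[OF S e, of n]]] unfolding eq .
    then have c: "c \<in> generate G ?T" by (rule root) (use cp cop in auto)
    have a': "?a \<in> generate G ?T" by (rule root[OF i(1)]) (use ap cop in auto)
    have eq': "?a \<otimes> inv ?z = a" by (simp add: m_assoc)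
    have "a \<in> generate G ?T"
      using subgroup.m_closed[OF S a' subgroup.m_inv_closed[OF S subgroup_pow[OF S i(2), of "p * m"]]] unfolding eq' .
    then have "{a, b, c, e} \<subseteq> generate G ?T" using i(2) c e by blast
    then show "carrier G \<subseteq> generate G ?T" using generate_supset[OF sub _ generate] by blast
    show "b \<otimes> ?a2 = ?a2 \<otimes> (b \<otimes> ?c2)" by (rule shift[OF n]) auto
    show "?c2 \<otimes> ?a2 = ?a2 \<otimes> (?c2 \<otimes> ?e2)" by (rule shift[OF c2a]) auto
    show "?c2 \<otimes> b = b \<otimes> ?c2"
      using CC_comm[OF subgroup.m_closed[OF subCC subgroup_pow[OF subCC c_CC] center_CC[OF epow_center]] b_CC] .
  qed (use center_comm[OF epow_center] in auto)
  have "is_Phi3_311b p r G"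
  proof (rule phi3_gen.is_311bI[OF gen p card_G])
    have "(c [^] t) [^] p = (c [^] p) [^] t" "(e [^] n) [^] p = (e [^] p) [^] n" "(e [^] (t * t)) [^] p = (e [^] p) [^] (t * t)"
      by (simp_all add: nat_pow_pow mult.commute)
    moreover have "?c2 [^] p = (c [^] t) [^] p \<otimes> (e [^] n) [^] p"
      using center_comm[OF epow_center, of "c [^] t"] by (intro pow_mult_distrib) auto
    ultimately show "?c2 [^] p = \<one>" "?e2 [^] p = \<one>" using cp ep by simp_all
    have "?a2 [^] p = (?a [^] p) [^] t" by (simp add: nat_pow_pow mult.commute)
    then show "?a2 [^] p = \<one>" using ap by simp
    have "e [^] s = e [^] (r * t\<^sup>2)" by (rule epm[OF rt, symmetric])
    then show "b [^] (p\<^sup>2) = ?e2 [^] r" unfolding s by (simp add: nat_pow_pow power2_eq_square mult_ac)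
  qed (rule copr)
  then show ?thesis using r by blast
qed

end

section \<open>Isoclinism\<close>

lemma (in group) normal_center: "center G \<lhd> G"
proof -
  have "x \<otimes> z \<otimes> inv x \<in> center G" if "x \<in> carrier G" "z \<in> center G" for x z
  proof -
    have "x \<otimes> z \<otimes> inv x = z \<otimes> x \<otimes> inv x" using center_comm[OF that(2,1)] by simp
    then show ?thesis using that center_carrier[OF that(2)] by (simp add: m_assoc)
  qed
  then show ?thesis using subgroup_center by (simp add: normal_inv_iff)
qed

lemma (in group_hom) hom_gcomm:
  assumes "x \<in> carrier G" "y \<in> carrier G"
  shows "h (gcomm G x y) = gcomm H (h x) (h y)"
  using assms by (simp add: gcomm_def)

text \<open>\<open>a\<close> and \<open>b\<close> are arbitrary lifts of the classes of a' and b'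
  modulo the centres. Defining c and e as commutators makes the second isomorphism send them exactly
  to c' and e', so their p-th powers vanish by injectivity. For \<open>a\<close> and
  \<open>b\<close>, by contrast, the p-th powers are controlled only modulo the centre.\<close>

lemma isoclinic_phi3:
  fixes G :: "('a, 'b) monoid_scheme" and H :: "('c, 'd) monoid_scheme"
  assumes p: "prime p" "p > 2" and G: "group G" and card_G: "card (carrier G) = p ^ 5"
    and gen: "phi3_gen H a' b' c' e'" and card_H: "card (carrier H) = p ^ 4"
    and pow: "a' [^]\<^bsub>H\<^esub> p = \<one>\<^bsub>H\<^esub>" "b' [^]\<^bsub>H\<^esub> p = \<one>\<^bsub>H\<^esub>" "c' [^]\<^bsub>H\<^esub> p = \<one>\<^bsub>H\<^esub>" "e' [^]\<^bsub>H\<^esub> p = \<one>\<^bsub>H\<^esub>"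
    and iso: "isoclinic G H"
  shows "\<exists>a b c e. phi3 G p a b c e"
proof -
  interpret G: group G by fact
  interpret H: phi3_gen H a' b' c' e' by fact
  obtain \<phi> \<psi> where \<phi>: "\<phi> \<in> Group.iso (G Mod center G) (H Mod center H)"
    and \<psi>: "\<psi> \<in> Group.iso (G\<lparr>carrier := commutator_subgroup G\<rparr>) (H\<lparr>carrier := commutator_subgroup H\<rparr>)"
    and compat: "\<And>x y x' y'. x \<in> carrier G \<Longrightarrow> y \<in> carrier G \<Longrightarrow> x' \<in> carrier H \<Longrightarrow> y' \<in> carrier H \<Longrightarrow>
      \<phi> (center G #>\<^bsub>G\<^esub> x) = center H #>\<^bsub>H\<^esub> x' \<Longrightarrow> \<phi> (center G #>\<^bsub>G\<^esub> y) = center H #>\<^bsub>H\<^esub> y' \<Longrightarrow>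
      \<psi> (gcomm G x y) = gcomm H x' y'"
    using iso unfolding isoclinic_def by blast
  interpret NG: normal "center G" G by (rule G.normal_center)
  interpret NH: normal "center H" H by (rule H.normal_center)
  interpret QG: group "G Mod center G" by (rule NG.factorgroup_is_group)
  interpret QH: group "H Mod center H" by (rule NH.factorgroup_is_group)
  define q where "q g = \<phi> (center G #>\<^bsub>G\<^esub> g)" for g
  define r where "r h = center H #>\<^bsub>H\<^esub> h" for h
  interpret r: group_hom H "H Mod center H" r
    unfolding r_def using NH.r_coset_hom_Mod by (simp add: group_hom_def group_hom_axioms_def H.is_group QH.is_group)
  have "\<phi> \<in> hom (G Mod center G) (H Mod center H)" using \<phi> by (simp add: Group.iso_def)
  then have qhom: "q \<in> hom G (H Mod center H)"
    unfolding q_def[abs_def] using hom_compose[OF NG.r_coset_hom_Mod, of \<phi>] by (simp add: comp_def)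
  interpret q: group_hom G "H Mod center H" q
    using qhom by (simp add: group_hom_def group_hom_axioms_def G QH.is_group)
  have \<phi>bij: "bij_betw \<phi> (carrier (G Mod center G)) (carrier (H Mod center H))" using \<phi> by (simp add: Group.iso_def)
  have carrG: "carrier (G Mod center G) = (\<lambda>x. center G #>\<^bsub>G\<^esub> x) ` carrier G" by (auto simp: FactGroup_def RCOSETS_def)
  have carrH: "carrier (H Mod center H) = r ` carrier H" by (auto simp: FactGroup_def RCOSETS_def r_def)
  have lift: "\<exists>g\<in>carrier G. q g = r h" if "h \<in> carrier H" for h
  proof -
    have "r h \<in> \<phi> ` carrier (G Mod center G)" using bij_betw_imp_surj_on[OF \<phi>bij] that unfolding carrH by blast
    then obtain U where U: "U \<in> carrier (G Mod center G)" "r h = \<phi> U" by blast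
    then obtain g where "g \<in> carrier G" "U = center G #>\<^bsub>G\<^esub> g" unfolding carrG by blast
    then show ?thesis using U(2) unfolding q_def by metis
  qed
  have lift': "\<exists>h\<in>carrier H. r h = q g" if "g \<in> carrier G" for g
    using q.hom_closed[OF that] unfolding carrH by force
  have q1: "g \<in> center G" if g: "g \<in> carrier G" "q g = \<one>\<^bsub>H Mod center H\<^esub>" for g
  proof -
    have "q g = q \<one>\<^bsub>G\<^esub>" using g by simp
    then have "center G #>\<^bsub>G\<^esub> g = center G #>\<^bsub>G\<^esub> \<one>\<^bsub>G\<^esub>"
      unfolding q_def using bij_betw_imp_inj_on[OF \<phi>bij] g(1) by (auto simp: carrG dest: inj_onD)
    then have "center G #>\<^bsub>G\<^esub> g = center G" using G.coset_mult_one[OF NG.subset] by simp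
    then show ?thesis using G.rcos_self[OF g(1) NG.subgroup_axioms] by simp
  qed
  have comp: "\<psi> (gcomm G x y) = gcomm H x' y'"
    if "x \<in> carrier G" "y \<in> carrier G" "x' \<in> carrier H" "y' \<in> carrier H" "q x = r x'" "q y = r y'" for x y x' y'
    using compat that unfolding q_def r_def by blast
  let ?DG = "G\<lparr>carrier := commutator_subgroup G\<rparr>" and ?DH = "H\<lparr>carrier := commutator_subgroup H\<rparr>"
  have DG: "subgroup (commutator_subgroup G) G" by (rule G.derived_is_subgroup) simp
  have DH: "subgroup (commutator_subgroup H) H" by (rule H.derived_is_subgroup) simp
  interpret psi: group_hom ?DG ?DH \<psi>
    using \<psi> G.subgroup_imp_group[OF DG] H.subgroup_imp_group[OF DH]
    by (simp add: group_hom_def group_hom_axioms_def Group.iso_def)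
  have comG: "gcomm G x y \<in> commutator_subgroup G" if "x \<in> carrier G" "y \<in> carrier G" for x y
    unfolding gcomm_def by (rule G.commutator_derived[OF that])
  have \<psi>1: "x = \<one>\<^bsub>G\<^esub>" if "x \<in> commutator_subgroup G" "\<psi> x = \<one>\<^bsub>H\<^esub>" for x
  proof -
    have "inj_on \<psi> (commutator_subgroup G)" using \<psi> by (simp add: Group.iso_def bij_betw_def)
    moreover have "\<psi> x = \<psi> \<one>\<^bsub>G\<^esub>" using psi.hom_one that by simp
    ultimately show ?thesis using that(1) subgroup.one_closed[OF DG] by (auto dest: inj_onD)
  qed
  have \<psi>pow: "x [^]\<^bsub>G\<^esub> p = \<one>\<^bsub>G\<^esub>" if "x \<in> commutator_subgroup G" "\<psi> x [^]\<^bsub>H\<^esub> p = \<one>\<^bsub>H\<^esub>" for x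
  proof (rule \<psi>1)
    show "x [^]\<^bsub>G\<^esub> p \<in> commutator_subgroup G" by (rule G.subgroup_pow[OF DG that(1)])
    have "\<psi> (x [^]\<^bsub>?DG\<^esub> p) = \<psi> x [^]\<^bsub>?DH\<^esub> p" by (rule psi.hom_nat_pow) (simp add: that)
    then show "\<psi> (x [^]\<^bsub>G\<^esub> p) = \<one>\<^bsub>H\<^esub>" using that(2) by (simp add: G.nat_pow_consistent[symmetric] H.nat_pow_consistent[symmetric])
  qed
  obtain a where a: "a \<in> carrier G" "q a = r a'" using lift[OF H.a] by blast
  obtain b where b: "b \<in> carrier G" "q b = r b'" using lift[OF H.b] by blast
  define c where "c = gcomm G b a"
  define e where "e = gcomm G c a"
  have cG: "c \<in> carrier G" and eG: "e \<in> carrier G" unfolding c_def e_def gcomm_def using a b by simp_all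
  have c': "gcomm H b' a' = c'" and e': "gcomm H c' a' = e'"
    using H.gcomm_eq_iff[of b' a' c'] H.gcomm_eq_iff[of c' a' e'] H.ba H.ca by (simp_all add: gcomm_def)
  have qc: "q c = r c'" unfolding c_def q.hom_gcomm[OF b(1) a(1)] a(2) b(2) c'[symmetric] r.hom_gcomm[OF H.b H.a] ..
  have qe: "q e = r e'" unfolding e_def q.hom_gcomm[OF cG a(1)] a(2) qc e'[symmetric] r.hom_gcomm[OF H.c H.a] ..
  have \<psi>c: "\<psi> c = c'" unfolding c_def using comp[OF b(1) a(1) H.b H.a b(2) a(2)] c' by simp
  have \<psi>e: "\<psi> e = e'" unfolding e_def using comp[OF cG a(1) H.c H.a qc a(2)] e' by simp
  have cD: "c \<in> commutator_subgroup G" and eD: "e \<in> commutator_subgroup G"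
    unfolding c_def e_def using comG a b cG c_def by auto
  \<comment> \<open>If e' were trivial, the normal forms would leave at most p^3 elements in a group
    of order p^4.\<close>
  have e'1: "e' \<noteq> \<one>\<^bsub>H\<^esub>"
  proof
    assume e1: "e' = \<one>\<^bsub>H\<^esub>"
    have one: "\<one>\<^bsub>H\<^esub> \<in> range (\<lambda>k::nat. e' [^]\<^bsub>H\<^esub> k)" by (rule H.powers_one_self(2))
    have "card (carrier H) \<le> p * p * p * 1"
      by (rule H.card_le) (use pow one e1 p in auto)
    then have "p * (p * p * p) \<le> 1 * (p * p * p)" using card_H by (simp add: numeral_eq_Suc)
    then show False using p by simp
  qed
  \<comment> \<open>Elements of \<open>G\<close> commute as soon as representatives of their classes
    commute in \<open>H\<close>: the commutators correspond under an injective map.\<close>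
  have comm: "x \<otimes>\<^bsub>G\<^esub> y = y \<otimes>\<^bsub>G\<^esub> x" if xy: "x \<in> carrier G" "y \<in> carrier G" "x' \<in> carrier H" "y' \<in> carrier H"
    "q x = r x'" "q y = r y'" "x' \<otimes>\<^bsub>H\<^esub> y' = y' \<otimes>\<^bsub>H\<^esub> x'" for x y x' y'
  proof -
    have "gcomm H x' y' = \<one>\<^bsub>H\<^esub>"
      using H.gcomm_eq_iff[of x' y' "\<one>\<^bsub>H\<^esub>"] xy by (simp add: gcomm_def)
    then have "\<psi> (gcomm G x y) = \<one>\<^bsub>H\<^esub>" using comp[OF xy(1-6)] by simp
    then have "gcomm G x y = \<one>\<^bsub>G\<^esub>" using \<psi>1 comG xy by blast
    then show ?thesis using G.gcomm_eq_iff[of x y "\<one>\<^bsub>G\<^esub>"] xy by (simp add: gcomm_def)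
  qed
  have e_center: "e \<in> center G"
  proof (rule G.centerI[OF eG])
    fix g assume g: "g \<in> carrier G"
    obtain h where h: "h \<in> carrier H" "r h = q g" using lift'[OF g] by blast
    show "e \<otimes>\<^bsub>G\<^esub> g = g \<otimes>\<^bsub>G\<^esub> e"
      by (rule comm[OF eG g H.e h(1) qe h(2)[symmetric] H.center_comm[OF H.e_center h(1)]])
  qed
  have pcenter: "x [^]\<^bsub>G\<^esub> p \<in> center G" if "x \<in> carrier G" "y \<in> carrier H" "q x = r y" "y [^]\<^bsub>H\<^esub> p = \<one>\<^bsub>H\<^esub>" for x y
  proof (rule q1)
    have "q (x [^]\<^bsub>G\<^esub> p) = r (y [^]\<^bsub>H\<^esub> p)" using that(1,2) by (simp only: q.hom_nat_pow r.hom_nat_pow that(3))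
    then show "q (x [^]\<^bsub>G\<^esub> p) = \<one>\<^bsub>H Mod center H\<^esub>" using that(4) by (simp only: r.hom_one)
  qed (use that in simp)
  have "phi3 G p a b c e"
  proof (intro phi3.intro phi3_base.intro phi3_base_axioms.intro phi3_axioms.intro)
    show "b \<otimes>\<^bsub>G\<^esub> a = a \<otimes>\<^bsub>G\<^esub> (b \<otimes>\<^bsub>G\<^esub> c)" "c \<otimes>\<^bsub>G\<^esub> a = a \<otimes>\<^bsub>G\<^esub> (c \<otimes>\<^bsub>G\<^esub> e)"
      using G.gcomm_eq_iff[OF b(1) a(1) cG] G.gcomm_eq_iff[OF cG a(1) eG] c_def e_def by (simp_all add: gcomm_def)
    show "c \<otimes>\<^bsub>G\<^esub> b = b \<otimes>\<^bsub>G\<^esub> c" by (rule comm[OF cG b(1) H.c H.b qc b(2) H.cb])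
    show "e \<noteq> \<one>\<^bsub>G\<^esub>" using \<psi>e e'1 psi.hom_one by auto
    show "c [^]\<^bsub>G\<^esub> p = \<one>\<^bsub>G\<^esub>" "e [^]\<^bsub>G\<^esub> p = \<one>\<^bsub>G\<^esub>" using \<psi>pow[OF cD] \<psi>pow[OF eD] \<psi>c \<psi>e pow by simp_all
    show "a [^]\<^bsub>G\<^esub> p \<in> center G" "b [^]\<^bsub>G\<^esub> p \<in> center G"
      using pcenter[OF a(1) H.a a(2) pow(1)] pcenter[OF b(1) H.b b(2) pow(2)] .
    fix g assume g: "g \<in> carrier G"
    obtain h where h: "h \<in> carrier H" "r h = q g" using lift'[OF g] by blast
    obtain i j k l :: nat where ijkl: "h = a' [^]\<^bsub>H\<^esub> i \<otimes>\<^bsub>H\<^esub> (b' [^]\<^bsub>H\<^esub> j \<otimes>\<^bsub>H\<^esub> (c' [^]\<^bsub>H\<^esub> k \<otimes>\<^bsub>H\<^esub> e' [^]\<^bsub>H\<^esub> l))"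
      using H.normal_form[OF h(1)] by blast
    \<comment> \<open>The word for \<open>h\<close>, rewritten in the lifted generators; it agrees
      with \<open>g\<close> modulo the centre, and the difference becomes the central factor
      z.\<close>
    define w where "w = a [^]\<^bsub>G\<^esub> i \<otimes>\<^bsub>G\<^esub> (b [^]\<^bsub>G\<^esub> j \<otimes>\<^bsub>G\<^esub> (c [^]\<^bsub>G\<^esub> k \<otimes>\<^bsub>G\<^esub> e [^]\<^bsub>G\<^esub> l))"
    have wG: "w \<in> carrier G" unfolding w_def using a(1) b(1) cG eG by simp
    have "q w = r h"
      unfolding w_def ijkl using a(1) b(1) cG eG
      by (simp only: q.hom_mult q.hom_nat_pow r.hom_mult r.hom_nat_pow G.nat_pow_closed G.m_closed H.nat_pow_closed H.m_closed
          H.a H.b H.c H.e a(2) b(2) qc qe)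
    then have "q w = q g" using h(2) by simp
    then have "q (inv\<^bsub>G\<^esub> w \<otimes>\<^bsub>G\<^esub> g) = \<one>\<^bsub>H Mod center H\<^esub>"
      using wG g by (simp only: q.hom_mult q.hom_inv G.inv_closed QH.l_inv q.hom_closed)
    then have z: "inv\<^bsub>G\<^esub> w \<otimes>\<^bsub>G\<^esub> g \<in> center G" using q1 wG g by simp
    have "g = w \<otimes>\<^bsub>G\<^esub> (inv\<^bsub>G\<^esub> w \<otimes>\<^bsub>G\<^esub> g)" using wG g by (simp add: G.mult_inv_cancel_left)
    also have "\<dots> = a [^]\<^bsub>G\<^esub> i \<otimes>\<^bsub>G\<^esub> (b [^]\<^bsub>G\<^esub> j \<otimes>\<^bsub>G\<^esub> (c [^]\<^bsub>G\<^esub> k \<otimes>\<^bsub>G\<^esub> (e [^]\<^bsub>G\<^esub> l \<otimes>\<^bsub>G\<^esub> (inv\<^bsub>G\<^esub> w \<otimes>\<^bsub>G\<^esub> g))))"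
      (is "_ = ?rhs")
      unfolding w_def using a(1) b(1) cG eG g by (simp add: G.m_assoc)
    finally have "g = ?rhs" .
    moreover have "e [^]\<^bsub>G\<^esub> l \<otimes>\<^bsub>G\<^esub> (inv\<^bsub>G\<^esub> w \<otimes>\<^bsub>G\<^esub> g) \<in> center G"
      using subgroup.m_closed[OF G.subgroup_center G.subgroup_pow[OF G.subgroup_center e_center] z] .
    ultimately show "\<exists>(i::nat) (j::nat) (k::nat) z. z \<in> center G \<and>
      g = a [^]\<^bsub>G\<^esub> i \<otimes>\<^bsub>G\<^esub> (b [^]\<^bsub>G\<^esub> j \<otimes>\<^bsub>G\<^esub> (c [^]\<^bsub>G\<^esub> k \<otimes>\<^bsub>G\<^esub> z))" by blast
  qed (use G p card_G a(1) b(1) cG e_center in auto)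
  then show ?thesis by blast
qed

lemma in_Phi3_phi3:
  fixes G :: "('a, 'b) monoid_scheme"
  assumes p: "prime p" "p > 2" and G: "group G" and order: "Coset.order G = p ^ 5" and Phi: "in_Phi3 p G"
  shows "\<exists>a b c e. phi3 G p a b c e"
proof -
  obtain H :: "nat monoid" and x where H: "Coset.order H = p ^ 4" "presented_among_p_groups p (Phi3_1111_rels p) H x" "isoclinic G H"
    using Phi unfolding in_Phi3_def has_presentation_def by blast
  then have fin: "group H" "finite (carrier H)" and sat: "satisfies H x (Phi3_1111_rels p)" and gen: "generate H (range x) = carrier H"
    unfolding presented_among_p_groups_def finite_p_group_def by auto
  interpret H: group H by fact
  have x: "phi3_gen H (x Al) (x Al1) (x Al2) (x Al3)"
    by (rule H.satisfies_phi3_gen_Al3[OF fin(2) sat[unfolded Phi3_1111_rels_def] _ gen]) simp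
  have "x Al [^]\<^bsub>H\<^esub> p = \<one>\<^bsub>H\<^esub>" "x Al1 [^]\<^bsub>H\<^esub> p = \<one>\<^bsub>H\<^esub>" "x Al2 [^]\<^bsub>H\<^esub> p = \<one>\<^bsub>H\<^esub>" "x Al3 [^]\<^bsub>H\<^esub> p = \<one>\<^bsub>H\<^esub>"
    using sat[unfolded Phi3_1111_rels_def H.satisfies_common_iff] by simp_all
  then show ?thesis
    using isoclinic_phi3[OF p G _ x _ _ _ _ _ H(3)] order H(1) unfolding Coset.order_def by blast
qed

theorem theorem37:
  fixes G :: "('a, 'b) monoid_scheme" and p :: nat
  assumes "prime p" and "p \<ge> 5"
    and "group G" and "Coset.order G = p ^ 5" and "in_Phi3 p G"
  shows
    "(\<not> (\<exists>r \<in> {1, least_nonresidue p}. is_Phi3_311b p r G) \<and>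
      \<not> is_Phi3_221a p G \<and> \<not> is_Phi3_2111e p G \<longrightarrow>
        (let G' = commutator_subgroup G;
             C = G\<lparr>carrier := centralizer G G'\<rparr>;
             m = group_exponent C;
             m' = group_exponent (C Mod G');
             a = num_cyclic_subgroups C;
             a' = num_cyclic_subgroups (C Mod G')
         in (\<forall>d. d dvd m \<and> \<not> d dvd m' \<longrightarrow> p dvd a d) \<and>
            (\<forall>d. d dvd m \<and> d dvd m' \<longrightarrow> a' d \<le> a d \<and> p dvd (a d - a' d)) \<and>
            group_algebra G \<cong>\<^sub>\<rat>
              group_algebra (G Mod G')
              \<oplus>\<^sub>\<rat> alg_sum {d. d dvd m \<and> \<not> d dvd m'}
                    (\<lambda>d. copies (a d div p) (mat_alg p (cyclotomic_field d)))
              \<oplus>\<^sub>\<rat> alg_sum {d. d dvd m \<and> d dvd m'}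
                    (\<lambda>d. copies ((a d - a' d) div p) (mat_alg p (cyclotomic_field d)))))
     \<and>
     (\<forall>r \<in> {1, least_nonresidue p}. is_Phi3_311b p r G \<longrightarrow>
        group_algebra G \<cong>\<^sub>\<rat>
          rat_alg
          \<oplus>\<^sub>\<rat> copies (p + 1) (field_alg (cyclotomic_field p))
          \<oplus>\<^sub>\<rat> copies p (field_alg (cyclotomic_field (p\<^sup>2)))
          \<oplus>\<^sub>\<rat> copies p (mat_alg p (cyclotomic_field p))
          \<oplus>\<^sub>\<rat> mat_alg p (cyclotomic_field (p ^ 3)))
     \<and>
     (is_Phi3_221a p G \<or> is_Phi3_2111e p G \<longrightarrow>
        group_algebra G \<cong>\<^sub>\<rat>
          rat_alg
          \<oplus>\<^sub>\<rat> copies (p + 1) (field_alg (cyclotomic_field p))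
          \<oplus>\<^sub>\<rat> copies p (field_alg (cyclotomic_field (p\<^sup>2)))
          \<oplus>\<^sub>\<rat> copies (2 * p) (mat_alg p (cyclotomic_field p))
          \<oplus>\<^sub>\<rat> copies (p - 1) (mat_alg p (cyclotomic_field (p\<^sup>2))))"
proof (intro conjI impI ballI)
  interpret group G by fact
  have p: "prime p" "p > 2" using assms by auto
  show "group_algebra G \<cong>\<^sub>\<rat> rat_alg
      \<oplus>\<^sub>\<rat> copies (p + 1) (field_alg (cyclotomic_field p))
      \<oplus>\<^sub>\<rat> copies p (field_alg (cyclotomic_field (p\<^sup>2)))
      \<oplus>\<^sub>\<rat> copies p (mat_alg p (cyclotomic_field p))
      \<oplus>\<^sub>\<rat> mat_alg p (cyclotomic_field (p ^ 3))"
    if r: "r \<in> {1, least_nonresidue p}" and G: "is_Phi3_311b p r G" for r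
  proof -
    have "coprime r p" using r least_nonresidue(2)[OF p] by auto
    from is_Phi3_311b_exc[OF p this G] show ?thesis using phi3_exc.decomposition_order_p3 by metis
  qed
  show "group_algebra G \<cong>\<^sub>\<rat> rat_alg
      \<oplus>\<^sub>\<rat> copies (p + 1) (field_alg (cyclotomic_field p))
      \<oplus>\<^sub>\<rat> copies p (field_alg (cyclotomic_field (p\<^sup>2)))
      \<oplus>\<^sub>\<rat> copies (2 * p) (mat_alg p (cyclotomic_field p))
      \<oplus>\<^sub>\<rat> copies (p - 1) (mat_alg p (cyclotomic_field (p\<^sup>2)))"
    if "is_Phi3_221a p G \<or> is_Phi3_2111e p G"
    using is_Phi3_2_exc[OF p that] phi3_exc.decomposition_order_p2 by metis
next
  assume ne: "\<not> (\<exists>r \<in> {1, least_nonresidue p}. is_Phi3_311b p r G) \<and> \<not> is_Phi3_221a p G \<and> \<not> is_Phi3_2111e p G"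
  obtain a b c e where "phi3 G p a b c e" using in_Phi3_phi3[of p G] assms by auto
  then interpret phi3 G p a b c e .
  have "b [^]\<^bsub>G\<^esub> p \<in> E"
  proof (rule ccontr)
    assume "b [^]\<^bsub>G\<^esub> p \<notin> E"
    then interpret phi3_bp G p a b c e by unfold_locales
    obtain a' where "phi3_exc G p a' b c e" using phi3_exc by blast
    then interpret x: phi3_exc G p a' b c e .
    show False using x.is_special_order_p2 x.is_special_order_p3 ne by blast
  qed
  then interpret ind: induced_characters G CC Gp p 4 p "\<lambda>i. a [^]\<^bsub>G\<^esub> i" by (rule induced_Gp)
  show "let G' = commutator_subgroup G;
             C = G\<lparr>carrier := centralizer G G'\<rparr>;
             m = group_exponent C;
             m' = group_exponent (C Mod G');
             a = num_cyclic_subgroups C;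
             a' = num_cyclic_subgroups (C Mod G')
         in (\<forall>d. d dvd m \<and> \<not> d dvd m' \<longrightarrow> p dvd a d) \<and>
            (\<forall>d. d dvd m \<and> d dvd m' \<longrightarrow> a' d \<le> a d \<and> p dvd (a d - a' d)) \<and>
            group_algebra G \<cong>\<^sub>\<rat>
              group_algebra (G Mod G')
              \<oplus>\<^sub>\<rat> alg_sum {d. d dvd m \<and> \<not> d dvd m'}
                    (\<lambda>d. copies (a d div p) (mat_alg p (cyclotomic_field d)))
              \<oplus>\<^sub>\<rat> alg_sum {d. d dvd m \<and> d dvd m'}
                    (\<lambda>d. copies ((a d - a' d) div p) (mat_alg p (cyclotomic_field d)))"
    using ind.decomposition_cyclic_subgroups[OF p0(1)] unfolding Let_def derived_eq centralizer_Gp .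
qed

end
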